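(* Let $G$ be a compact connected Abelian topological group which is at the same time a topological retract of some space from the class $\mathcal{R}$. Then $G$ is isomorphic, in the category of topological groups, to a product of metrizable compact groups.
   Context: All topological spaces are compact Hausdorff. A topological group is a group with a Hausdorff topology for which the group operations are continuous. A retraction is a continuous map $f\colon X\to Y$ which is right-invertible, i.e. $fj=\mathrm{id}_Y$ for some continuous map $j\colon Y\to X$; in this case $Y$ is called a (topological) retract of $X$. An inverse sequence $\mathbb{S}=\langle K_\alpha, r_\alpha^\beta,\delta\rangle$ (indexed by the ordinals below an ordinal $\delta$, with bonding maps $r_\alpha^\beta\colon K_\beta\to K_\alpha$ for $\alpha\leqslant\beta<\delta$) is continuous if for every limit ordinal $\varrho<\delta$ the space $K_\varrho$ together with the maps $\{r_\alpha^\varrho\}_{\alpha<\varrho}$ is the inverse limit of the restricted sequence $\langle K_\xi,r_\xi^\eta,\varrho\rangle$. A retractive inverse sequence is a continuous inverse sequence all of whose bonding maps are retractions. The class $\mathcal{R}$ is the smallest class of (compact Hausdorff) spaces that contains all metrizable compact spaces and is closed under limits of retractive inverse sequences (classes of spaces are understood up to homeomorphism). *)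

theory Defs
  imports "HOL-Analysis.Analysis" "HOL-Algebra.Product_Groups"
begin

section \<open>Inverse sequences\<close>

text \<open>
  Ordinals are represented by well-orders \<open>s\<close> on subsets of an index type \<open>'i\<close>: the ordinal
  \<open>\<delta>\<close> is the order type of \<open>s\<close>, its elements are \<open>Field s\<close>, and \<open>(a, b) \<in> s\<close> reads
  \<open>a \<le> b\<close>. The set \<open>underS s c\<close> is the initial segment of all elements strictly below \<open>c\<close>.
  The map \<open>p a b\<close> is the bonding map from \<open>K b\<close> to \<open>K a\<close>.
\<close>

definition limit_element :: "'i rel \<Rightarrow> 'i \<Rightarrow> bool" where
  "limit_element s c \<longleftrightarrow>
     c \<in> Field s \<and> underS s c \<noteq> {} \<and> (\<forall>a\<in>underS s c. \<exists>b\<in>underS s c. a \<in> underS s b)"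

definition inverse_sequence ::
    "'i rel \<Rightarrow> ('i \<Rightarrow> 'u topology) \<Rightarrow> ('i \<Rightarrow> 'i \<Rightarrow> 'u \<Rightarrow> 'u) \<Rightarrow> bool" where
  "inverse_sequence s K p \<longleftrightarrow>
     Well_order s \<and>
     (\<forall>a\<in>Field s. compact_space (K a) \<and> Hausdorff_space (K a)) \<and>
     (\<forall>a b. (a, b) \<in> s \<longrightarrow> continuous_map (K b) (K a) (p a b)) \<and>
     (\<forall>a\<in>Field s. \<forall>x\<in>topspace (K a). p a a x = x) \<and>
     (\<forall>a b c. (a, b) \<in> s \<longrightarrow> (b, c) \<in> s \<longrightarrow> (\<forall>x\<in>topspace (K c). p a b (p b c x) = p a c x))"

definition inverse_limit ::
    "'i rel \<Rightarrow> 'i set \<Rightarrow> ('i \<Rightarrow> 'u topology) \<Rightarrow> ('i \<Rightarrow> 'i \<Rightarrow> 'u \<Rightarrow> 'u) \<Rightarrow> ('i \<Rightarrow> 'u) topology" where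
  "inverse_limit s I K p =
     subtopology (product_topology K I)
       {x. \<forall>a\<in>I. \<forall>b\<in>I. (a, b) \<in> s \<longrightarrow> p a b (x b) = x a}"

text \<open>
  The space \<open>X\<close> together with the projections \<open>q a\<close> is the inverse limit of the sequence
  restricted to the index set \<open>I\<close>.
\<close>

definition is_inverse_limit ::
    "'i rel \<Rightarrow> 'i set \<Rightarrow> ('i \<Rightarrow> 'u topology) \<Rightarrow> ('i \<Rightarrow> 'i \<Rightarrow> 'u \<Rightarrow> 'u) \<Rightarrow>
      'x topology \<Rightarrow> ('i \<Rightarrow> 'x \<Rightarrow> 'u) \<Rightarrow> bool" where
  "is_inverse_limit s I K p X q \<longleftrightarrow>
     homeomorphic_map X (inverse_limit s I K p) (\<lambda>x. \<lambda>a\<in>I. q a x)"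

definition continuous_inverse_sequence ::
    "'i rel \<Rightarrow> ('i \<Rightarrow> 'u topology) \<Rightarrow> ('i \<Rightarrow> 'i \<Rightarrow> 'u \<Rightarrow> 'u) \<Rightarrow> bool" where
  "continuous_inverse_sequence s K p \<longleftrightarrow>
     inverse_sequence s K p \<and>
     (\<forall>c. limit_element s c \<longrightarrow> is_inverse_limit s (underS s c) K p (K c) (\<lambda>a. p a c))"

definition retractive_inverse_sequence ::
    "'i rel \<Rightarrow> ('i \<Rightarrow> 'u topology) \<Rightarrow> ('i \<Rightarrow> 'i \<Rightarrow> 'u \<Rightarrow> 'u) \<Rightarrow> bool" where
  "retractive_inverse_sequence s K p \<longleftrightarrow>
     continuous_inverse_sequence s K p \<and>
     (\<forall>a b. (a, b) \<in> s \<longrightarrow> retraction_map (K b) (K a) (p a b))"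

section \<open>The class R\<close>

text \<open>
  HOL has no class of all spaces, so the class is formed inside a type \<open>'u\<close> that carries all the
  spaces of a construction, with ordinals realized in a type \<open>'i\<close>. Both types are arbitrary; every
  space of the class has a set-sized construction, which takes place in sufficiently large \<open>'u\<close>
  and \<open>'i\<close>, so a theorem that is polymorphic in both covers the whole class. In the second rule
  \<open>X\<close> is any space on \<open>'u\<close> homeomorphic to the limit, so the class is closed under homeomorphism.
\<close>

inductive class_R :: "'i itself \<Rightarrow> 'u topology \<Rightarrow> bool" for index_type :: "'i itself" where
  metrizable:
    "compact_space X \<Longrightarrow> metrizable_space X \<Longrightarrow> class_R index_type X"
| limit:
    "retractive_inverse_sequence (s :: 'i rel) K p \<Longrightarrow>
     (\<And>a. a \<in> Field s \<Longrightarrow> class_R index_type (K a)) \<Longrightarrow>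
     is_inverse_limit s (Field s) K p X q \<Longrightarrow>
     class_R index_type X"

section \<open>Topological groups\<close>

locale topological_group = group G for G (structure) +
  fixes T :: "'a topology"
  assumes topspace_eq_carrier: "topspace T = carrier G"
    and Hausdorff: "Hausdorff_space T"
    and continuous_mult: "continuous_map (prod_topology T T) T (\<lambda>(x, y). x \<otimes> y)"
    and continuous_inv: "continuous_map T T (\<lambda>x. inv x)"

definition topological_group_iso ::
    "('a, 'm) monoid_scheme \<Rightarrow> 'a topology \<Rightarrow> ('b, 'n) monoid_scheme \<Rightarrow> 'b topology \<Rightarrow>
      ('a \<Rightarrow> 'b) \<Rightarrow> bool" where
  "topological_group_iso G T H S f \<longleftrightarrow> f \<in> iso G H \<and> homeomorphic_map T S f"

end

theory Submission
  imports Defs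
begin

text \<open>
  For a space \<open>X\<close> let \<open>H(X)\<close> be the group of continuous maps from \<open>X\<close> to the unit circle modulo
  the maps that possess a continuous real logarithm; it is the Bruschlinsky group of \<open>X\<close>, and for
  compact \<open>X\<close> it is the group of homotopy classes of maps to the circle. The proof reads off the
  structure of \<open>G\<close> from \<open>H(X)\<close>.

  First, \<open>H(X)\<close> is a direct sum of countable subgroups for every \<open>X\<close> in the class
  (\<open>class_R_bruschlinsky\<close>). For compact metrizable \<open>X\<close> it is countable. For the limit of a
  retractive sequence, the groups of the stages embed into \<open>H(X)\<close> as a continuous increasing chain
  whose union is \<open>H(X)\<close>, and each retraction between consecutive stages splits the smaller subgroup
  off the larger one. The complements are summands of direct sums of countable groups, hence are
  themselves such direct sums by a theorem of Kaplansky (\<open>countably_decomposable_summand\<close>), and the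
  decompositions of all complements together decompose \<open>H(X)\<close> (\<open>filtration_decomposition\<close>).

  Second, if \<open>G\<close> is compact, connected and abelian, every map from \<open>G\<close> to the circle is homotopic to
  exactly one continuous character (\<open>homotopic_to_character\<close>, \<open>nullhomotopic_character\<close>), so the
  dual group of \<open>G\<close> is \<open>H(G)\<close>. If \<open>G\<close> is a retract of \<open>X\<close>, then \<open>H(G)\<close> is a summand of \<open>H(X)\<close>, and
  Kaplansky's theorem applies once more: the dual is a direct sum of countable groups
  (\<open>dual_countably_decomposable\<close>).

  Third, Pontryagin duality turns this sum into a product. It rests on two facts:
  continuous characters separate points (\<open>characters_separate\<close>), and every homomorphism from the
  dual to the circle is the evaluation at a point (\<open>character_values_attained\<close>). The factor belonging
  to a summand \<open>D\<close> is the annihilator of the sum of all other summands. Its points are determined by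
  the countably many characters in \<open>D\<close>, so it is metrizable.

  Integration enters through the mean of a continuous function, the unique constant which
  is uniformly approximated by finite averages of its translates. It replaces Haar measure in the
  construction of characters, in the duality argument and in the choice of logarithms.
\<close>

section \<open>Direct sums of countable subgroups\<close>


text \<open>
  Independence is stated by comparing a subfamily with the complementary one instead of comparing
  single members with the rest. For subgroups of an abelian group both mean that the sum is direct, but this form
  survives the regrouping of summands that Kaplansky's argument performs.
\<close>

definition independent_family :: "('a, 'b) monoid_scheme \<Rightarrow> 'a set set \<Rightarrow> bool" where
  "independent_family G \<D> \<longleftrightarrow>
     (\<forall>\<B>\<subseteq>\<D>. generate G (\<Union>\<B>) \<inter> generate G (\<Union>(\<D> - \<B>)) \<subseteq> {\<one>\<^bsub>G\<^esub>})"

definition countably_decomposable :: "('a, 'b) monoid_scheme \<Rightarrow> 'a set \<Rightarrow> bool" where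
  "countably_decomposable G A \<longleftrightarrow>
     (\<exists>\<D>. (\<forall>D\<in>\<D>. subgroup D G \<and> countable D) \<and> independent_family G \<D> \<and>
       A = generate G (\<Union>\<D>))"

lemma (in group) generate_countable:
  assumes "H \<subseteq> carrier G" "countable H"
  shows "countable (generate G H)"
proof -
  let ?L = "lists (H \<union> m_inv G ` H)"
  have "x \<in> (\<lambda>l. foldr (\<otimes>) l \<one>) ` ?L" if "x \<in> generate G H" for x
    using that
  proof induction
    case one
    show ?case by (rule image_eqI[of _ _ "[]"]) auto
  next
    case (incl h)
    then show ?case using assms by (intro image_eqI[of _ _ "[h]"]) auto
  next
    case (inv h)
    then show ?case using assms by (intro image_eqI[of _ _ "[inv h]"]) auto
  next
    case (eng h1 h2)
    then obtain l1 l2 where l: "l1 \<in> ?L" "l2 \<in> ?L"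
      "h1 = foldr (\<otimes>) l1 \<one>" "h2 = foldr (\<otimes>) l2 \<one>" by blast
    have fold: "foldr (\<otimes>) l1 x = foldr (\<otimes>) l1 \<one> \<otimes> x" "foldr (\<otimes>) l1 \<one> \<in> carrier G"
      if "x \<in> carrier G" for x
      using l(1) that
    proof (induction l1)
      case Nil
      { case 1 then show ?case by simp next case 2 then show ?case by simp }
    next
      case (Cons a l)
      have a: "a \<in> carrier G" using Cons.hyps(1) assms by auto
      { case 1 with a Cons.IH show ?case by (simp add: m_assoc)
      next case 2 with a Cons.IH show ?case by simp }
    qed
    have "h2 \<in> carrier G" by (rule generate_in_carrier[OF assms(1) eng.hyps(2)])
    from fold(1)[OF this] have "h1 \<otimes> h2 = foldr (\<otimes>) (l1 @ l2) \<one>"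
      unfolding foldr_append comp_apply l(3) l(4) by simp
    with l show ?case by (intro image_eqI[of _ _ "l1 @ l2"]) auto
  qed
  moreover have "countable ?L" using assms by (intro countable_lists) auto
  ultimately show ?thesis by (meson countable_image countable_subset subsetI)
qed

lemma (in comm_group) generate_Un:
  assumes "H \<subseteq> carrier G" "K \<subseteq> carrier G"
  shows "x \<in> generate G (H \<union> K) \<longleftrightarrow> (\<exists>h\<in>generate G H. \<exists>k\<in>generate G K. x = h \<otimes> k)"
proof
  assume "x \<in> generate G (H \<union> K)"
  then show "\<exists>h\<in>generate G H. \<exists>k\<in>generate G K. x = h \<otimes> k"
  proof induction
    case one
    show ?case using generate.one[of G] by force
  next
    case (incl h)
    then have h: "h \<in> carrier G" using assms by blast
    from incl show ?case
    proof
      assume "h \<in> H"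
      then show ?thesis
        using h by (intro bexI[of _ h] bexI[of _ "\<one>"]) (auto intro: generate.intros)
    next
      assume "h \<in> K"
      then show ?thesis
        using h by (intro bexI[of _ "\<one>"] bexI[of _ h]) (auto intro: generate.intros)
    qed
  next
    case (inv h)
    then have h: "h \<in> carrier G" using assms by blast
    from inv show ?case
    proof
      assume "h \<in> H"
      then show ?thesis
        using h by (intro bexI[of _ "inv h"] bexI[of _ "\<one>"]) (auto intro: generate.intros)
    next
      assume "h \<in> K"
      then show ?thesis
        using h by (intro bexI[of _ "\<one>"] bexI[of _ "inv h"]) (auto intro: generate.intros)
    qed
  next
    case (eng h1 h2)
    then obtain a b c d where *: "a \<in> generate G H" "b \<in> generate G K" "h1 = a \<otimes> b"
      "c \<in> generate G H" "d \<in> generate G K" "h2 = c \<otimes> d" by blast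
    then have "h1 \<otimes> h2 = (a \<otimes> c) \<otimes> (b \<otimes> d)"
      using assms generate_in_carrier by (simp add: m_ac)
    with * show ?case by (meson generate.eng)
  qed
next
  assume "\<exists>h\<in>generate G H. \<exists>k\<in>generate G K. x = h \<otimes> k"
  moreover have "generate G H \<subseteq> generate G (H \<union> K)" "generate G K \<subseteq> generate G (H \<union> K)"
    by (simp_all add: mono_generate)
  ultimately show "x \<in> generate G (H \<union> K)" by (auto intro: generate.eng)
qed

lemma (in group) generate_Union_chain:
  assumes "x \<in> generate G (\<Union>a\<in>S. U a)"
    and "\<And>a b. a \<in> S \<Longrightarrow> b \<in> S \<Longrightarrow> U a \<subseteq> U b \<or> U b \<subseteq> U a"
  shows "x = \<one> \<or> (\<exists>a\<in>S. x \<in> generate G (U a))"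
  using assms(1)
proof induction
  case (eng h1 h2)
  show ?case
  proof (cases "\<exists>a\<in>S. h1 \<in> generate G (U a)")
    case True
    then obtain a where a: "a \<in> S" "h1 \<in> generate G (U a)" by blast
    show ?thesis
    proof (cases "\<exists>a\<in>S. h2 \<in> generate G (U a)")
      case True
      then obtain b where b: "b \<in> S" "h2 \<in> generate G (U b)" by blast
      from assms(2)[OF a(1) b(1)] show ?thesis
        using a b mono_generate[of "U a" "U b"] mono_generate[of "U b" "U a"]
        by (meson generate.eng subsetD)
    next
      case False
      then have "h2 = \<one>" using eng by blast
      then show ?thesis using a by (metis generate.eng generate.one)
    qed
  next
    case False
    then have "h1 = \<one>" using eng by blast
    then show ?thesis using eng.IH(2) by (metis generate.eng generate.one l_one one_closed)
  qed
qed (auto intro: generate.intros)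

lemma (in group) generate_Union_finite:
  assumes "x \<in> generate G (\<Union>\<B>)"
  shows "\<exists>\<F>\<subseteq>\<B>. finite \<F> \<and> x \<in> generate G (\<Union>\<F>)"
  using assms
proof induction
  case one
  show ?case using generate.one by (intro exI[of _ "{}"]) auto
next
  case (incl h)
  then obtain B where "B \<in> \<B>" "h \<in> B" by blast
  then show ?case by (intro exI[of _ "{B}"]) (auto intro: generate.intros)
next
  case (inv h)
  then obtain B where "B \<in> \<B>" "h \<in> B" by blast
  then show ?case by (intro exI[of _ "{B}"]) (auto intro: generate.intros)
next
  case (eng h1 h2)
  then obtain F1 F2 where "F1 \<subseteq> \<B>" "finite F1" "h1 \<in> generate G (\<Union>F1)"
     "F2 \<subseteq> \<B>" "finite F2" "h2 \<in> generate G (\<Union>F2)" by blast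
  moreover have "generate G (\<Union>F1) \<subseteq> generate G (\<Union>(F1 \<union> F2))"
    "generate G (\<Union>F2) \<subseteq> generate G (\<Union>(F1 \<union> F2))" by (auto intro!: mono_generate)
  ultimately show ?case by (intro exI[of _ "F1 \<union> F2"]) (auto intro: generate.eng)
qed

lemma (in group) mult_cancel_split:
  assumes "subgroup H G" "subgroup K G" "H \<inter> K \<subseteq> {\<one>}"
    "h \<in> H" "h' \<in> H" "k \<in> K" "k' \<in> K" "h \<otimes> k = h' \<otimes> k'"
  shows "h = h'" "k = k'"
proof -
  have c: "h \<in> carrier G" "h' \<in> carrier G" "k \<in> carrier G" "k' \<in> carrier G"
    using assms subgroup.mem_carrier by metis+
  have e: "inv h' \<otimes> h = k' \<otimes> inv k"
    using assms(8) c by (metis inv_closed inv_solve_left inv_solve_right m_assoc m_closed)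
  have "inv h' \<otimes> h \<in> H" "k' \<otimes> inv k \<in> K"
    using assms by (meson subgroup.m_closed subgroup.m_inv_closed)+
  with e assms(3) have "inv h' \<otimes> h = \<one>" by auto
  then show "h = h'" using c by (metis inv_closed inv_equality inv_inv)
  with assms(8) c show "k = k'" by simp
qed

text \<open>
  A direct sum decomposition can be assembled along a well-ordered chain of subgroups \<open>A c\<close>: it
  suffices that at each \<open>c\<close> the new members \<open>\<D> c\<close> span a complement of what the earlier stages
  generate. Independence is proved by induction on the stage. Writing an element of the stage \<open>c\<close>
  in two ways, once over \<open>\<B>\<close> and once over the complementary members, the components in the
  complement agree and are trivial because \<open>\<D> c\<close> is independent; what remains lies in an
  earlier stage, since an element is generated by finitely many members.
\<close>

lemma (in comm_group) filtration_decomposition: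
  fixes s :: "'i rel" and A :: "'i \<Rightarrow> 'a set" and \<D> :: "'i \<Rightarrow> 'a set set"
  assumes wo: "Well_order s"
    and sub: "\<And>c. c \<in> Field s \<Longrightarrow> subgroup (A c) G"
    and mono: "\<And>a b. (a, b) \<in> s \<Longrightarrow> A a \<subseteq> A b"
    and into: "\<And>c. c \<in> Field s \<Longrightarrow> \<Union>(\<D> c) \<subseteq> A c"
    and indep: "\<And>c. c \<in> Field s \<Longrightarrow> independent_family G (\<D> c)"
    and disj: "\<And>c. c \<in> Field s \<Longrightarrow>
      generate G (\<Union>a\<in>underS s c. A a) \<inter> generate G (\<Union>(\<D> c)) \<subseteq> {\<one>}"
    and gen: "\<And>c. c \<in> Field s \<Longrightarrow> A c \<subseteq> generate G ((\<Union>a\<in>underS s c. A a) \<union> \<Union>(\<D> c))"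
  shows "independent_family G (\<Union>c\<in>Field s. \<D> c)"
    and "generate G (\<Union>(\<Union>c\<in>Field s. \<D> c)) = generate G (\<Union>c\<in>Field s. A c)"
proof -
  have wo': "wo_rel s" by (simp add: wo_rel_def wo)
  note REFL = wo_rel.REFL[OF wo'] and TRANS = wo_rel.TRANS[OF wo'] and TOTALS = wo_rel.TOTALS[OF wo']
    and well_order_induct = wo_rel.well_order_induct[OF wo']
  have car: "A c \<subseteq> carrier G" if "c \<in> Field s" for c
    using sub[OF that] subgroup.subset by blast
  have fld: "a \<in> Field s" "c \<in> Field s" if "a \<in> underS s c" for a c
    using that by (auto simp: underS_def Field_def)
  let ?E = "\<Union>c\<in>Field s. \<D> c"
  let ?U = "\<lambda>J c. \<Union>a\<in>under s c. \<Union>(\<D> a \<inter> J)"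
  have split: "?U J c = (\<Union>a\<in>underS s c. ?U J a) \<union> \<Union>(\<D> c \<inter> J)" (is "?l = ?r")
    if c: "c \<in> Field s" for J c
  proof
    show "?l \<subseteq> ?r"
    proof
      fix x assume "x \<in> ?l"
      then obtain a where a: "(a, c) \<in> s" "x \<in> \<Union>(\<D> a \<inter> J)" by (auto simp: under_def)
      then have "(a, a) \<in> s" using refl_onD[OF REFL, of a] by (auto simp: Field_def)
      with a show "x \<in> ?r" by (cases "a = c") (auto simp: under_def underS_def)
    qed
    show "?r \<subseteq> ?l"
    proof
      fix x assume "x \<in> ?r"
      then consider a b where "(b, c) \<in> s" "(a, b) \<in> s" "x \<in> \<Union>(\<D> a \<inter> J)" | "x \<in> \<Union>(\<D> c \<inter> J)"
        by (auto simp: under_def underS_def)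
      then show "x \<in> ?l"
      proof cases
        case 1
        then have "a \<in> under s c" using 1(1,2) transD[OF TRANS] unfolding under_def by blast
        with 1 show ?thesis by blast
      next
        case 2
        moreover have "c \<in> under s c" using refl_onD[OF REFL c] by (simp add: under_def)
        ultimately show ?thesis by blast
      qed
    qed
  qed
  have under_chain: "under s a \<subseteq> under s b \<or> under s b \<subseteq> under s a"
    if "a \<in> Field s" "b \<in> Field s" for a b
  proof -
    have "(a, b) \<in> s \<or> (b, a) \<in> s" using that TOTALS by blast
    then show ?thesis using transD[OF TRANS] unfolding under_def by blast
  qed
  have Umono: "?U J a \<subseteq> ?U J b" if "under s a \<subseteq> under s b" for a b J
    using that by (rule UN_mono) simp
  have chain: "?U J a \<subseteq> ?U J b \<or> ?U J b \<subseteq> ?U J a" if "a \<in> Field s" "b \<in> Field s" for a b J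
    using under_chain[OF that] Umono by metis
  have UA: "?U J c \<subseteq> A c" if "c \<in> Field s" for J c
  proof
    fix x assume "x \<in> ?U J c"
    then obtain a where a: "(a, c) \<in> s" "x \<in> \<Union>(\<D> a)" by (auto simp: under_def)
    then have "a \<in> Field s" by (auto simp: Field_def)
    then show "x \<in> A c" using into[of a] mono[OF a(1)] a(2) by blast
  qed
  have Ucar: "?U J c \<subseteq> carrier G" if "c \<in> Field s" for J c
    using UA[OF that] car[OF that] by (rule order_trans)
  \<comment> \<open>The two stages at which \<open>x\<close> is reached may differ; the later one serves for both.\<close>
  have both: "x = \<one> \<or> (\<exists>a\<in>S. x \<in> generate G (?U J a) \<inter> generate G (?U J' a))"
    if S: "S \<subseteq> Field s" and x: "x \<in> generate G (\<Union>a\<in>S. ?U J a)" "x \<in> generate G (\<Union>a\<in>S. ?U J' a)"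
    for x S J J'
  proof (cases "x = \<one>")
    case False
    have S': "a \<in> Field s" if "a \<in> S" for a using S that by blast
    have "x = \<one> \<or> (\<exists>a\<in>S. x \<in> generate G (?U J a))"
      by (rule generate_Union_chain[OF x(1)]) (rule chain; erule S')
    with False obtain a where a: "a \<in> S" "x \<in> generate G (?U J a)" by blast
    have "x = \<one> \<or> (\<exists>a\<in>S. x \<in> generate G (?U J' a))"
      by (rule generate_Union_chain[OF x(2)]) (rule chain; erule S')
    with False obtain b where b: "b \<in> S" "x \<in> generate G (?U J' b)" by blast
    note ab = a b
    have "under s a \<subseteq> under s b \<or> under s b \<subseteq> under s a"
      using under_chain[OF S'[OF a(1)] S'[OF b(1)]] .
    then show ?thesis
    proof
      assume "under s a \<subseteq> under s b"
      then have "generate G (?U J a) \<subseteq> generate G (?U J b)" by (intro mono_generate Umono)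
      with ab show ?thesis by blast
    next
      assume "under s b \<subseteq> under s a"
      then have "generate G (?U J' b) \<subseteq> generate G (?U J' a)" by (intro mono_generate Umono)
      with ab show ?thesis by blast
    qed
  qed auto
  show "independent_family G ?E"
    unfolding independent_family_def
  proof (intro allI impI)
    fix \<B> assume B: "\<B> \<subseteq> ?E"
    let ?C = "?E - \<B>"
    have step: "c \<in> Field s \<longrightarrow> generate G (?U \<B> c) \<inter> generate G (?U ?C c) \<subseteq> {\<one>}" for c
    proof (induction c rule: well_order_induct)
      case (1 c)
      show ?case
      proof (intro impI subsetI)
        fix x assume c: "c \<in> Field s" and x: "x \<in> generate G (?U \<B> c) \<inter> generate G (?U ?C c)"
        let ?L = "\<lambda>J. \<Union>a\<in>underS s c. ?U J a"
        have Lcar: "?L J \<subseteq> carrier G" for J using Ucar fld by blast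
        have Dcar: "\<Union>(\<D> c \<inter> J) \<subseteq> carrier G" for J using into[OF c] car[OF c] by blast
        have LA: "?L J \<subseteq> (\<Union>a\<in>underS s c. A a)" for J using UA fld by blast
        obtain y d where yd: "y \<in> generate G (?L \<B>)" "d \<in> generate G (\<Union>(\<D> c \<inter> \<B>))" "x = y \<otimes> d"
          using x generate_Un[OF Lcar Dcar] split[OF c] by (metis IntD1)
        obtain y' d' where yd': "y' \<in> generate G (?L ?C)" "d' \<in> generate G (\<Union>(\<D> c \<inter> ?C))" "x = y' \<otimes> d'"
          using x generate_Un[OF Lcar Dcar] split[OF c] by (metis IntD2)
        let ?A = "\<Union>a\<in>underS s c. A a"
        have sg: "subgroup (generate G ?A) G" "subgroup (generate G (\<Union>(\<D> c))) G"
          using car fld into[OF c] car[OF c] by (auto intro!: generate_is_subgroup)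
        have m: "y \<in> generate G ?A" "y' \<in> generate G ?A"
          using yd yd' mono_generate[OF LA] by blast+
        have "generate G (\<Union>(\<D> c \<inter> J)) \<subseteq> generate G (\<Union>(\<D> c))" for J
          by (intro mono_generate) auto
        then have n: "d \<in> generate G (\<Union>(\<D> c))" "d' \<in> generate G (\<Union>(\<D> c))"
          using yd yd' by blast+
        have eq: "y = y'" "d = d'"
          using mult_cancel_split[OF sg disj[OF c] m n] yd yd' by auto
        have "\<D> c \<inter> ?C = \<D> c - (\<D> c \<inter> \<B>)" using c by blast
        then have "d \<in> generate G (\<Union>(\<D> c \<inter> \<B>)) \<inter> generate G (\<Union>(\<D> c - (\<D> c \<inter> \<B>)))"
          using yd(2) yd'(2) eq(2) by simp
        moreover have "generate G (\<Union>(\<D> c \<inter> \<B>)) \<inter> generate G (\<Union>(\<D> c - (\<D> c \<inter> \<B>))) \<subseteq> {\<one>}"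
          using indep[OF c] unfolding independent_family_def by (meson inf_le1)
        ultimately have "d = \<one>" by blast
        have "underS s c \<subseteq> Field s" using fld by blast
        from both[OF this yd(1)] yd'(1) eq(1) have "y = \<one> \<or>
          (\<exists>a\<in>underS s c. y \<in> generate G (?U \<B> a) \<inter> generate G (?U ?C a))" by metis
        moreover have "y = \<one>" if "a \<in> underS s c" "y \<in> generate G (?U \<B> a) \<inter> generate G (?U ?C a)" for a
        proof -
          have "a \<noteq> c" "(a, c) \<in> s" using that(1) by (auto simp: underS_def)
          with 1 fld(1)[OF that(1)] have "generate G (?U \<B> a) \<inter> generate G (?U ?C a) \<subseteq> {\<one>}"
            by metis
          with that(2) show ?thesis by blast
        qed
        ultimately have "y = \<one>" by blast
        with \<open>d = \<one>\<close> yd show "x \<in> {\<one>}" by simp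
      qed
    qed
    have tot: "\<Union>J \<subseteq> (\<Union>c\<in>Field s. ?U J c)" if "J \<subseteq> ?E" for J
    proof
      fix x assume "x \<in> \<Union>J"
      then obtain D where D: "x \<in> D" "D \<in> J" by blast
      from subsetD[OF that D(2)] obtain c where c: "c \<in> Field s" "D \<in> \<D> c" by (rule UN_E)
      have "c \<in> under s c" using refl_onD[OF REFL c(1)] by (simp add: under_def)
      moreover have "x \<in> \<Union>(\<D> c \<inter> J)" using D c(2) by blast
      ultimately have "x \<in> ?U J c" by (rule UN_I)
      with c(1) show "x \<in> (\<Union>c\<in>Field s. ?U J c)" by (rule UN_I)
    qed
    show "generate G (\<Union>\<B>) \<inter> generate G (\<Union>?C) \<subseteq> {\<one>}"
    proof
      fix x assume "x \<in> generate G (\<Union>\<B>) \<inter> generate G (\<Union>?C)"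
      then have "x \<in> generate G (\<Union>c\<in>Field s. ?U \<B> c)" "x \<in> generate G (\<Union>c\<in>Field s. ?U ?C c)"
        by (auto intro: subsetD[OF mono_generate[OF tot[OF B]]] subsetD[OF mono_generate[OF tot[OF Diff_subset]]])
      from both[OF subset_refl this] consider "x = \<one>"
        | c where "c \<in> Field s" "x \<in> generate G (?U \<B> c) \<inter> generate G (?U ?C c)" by blast
      then show "x \<in> {\<one>}"
      proof cases
        case 2
        with step[of c] show ?thesis by blast
      qed simp
    qed
  qed
  show "generate G (\<Union>?E) = generate G (\<Union>c\<in>Field s. A c)"
  proof
    show "generate G (\<Union>?E) \<subseteq> generate G (\<Union>c\<in>Field s. A c)"
    proof (rule mono_generate, rule Union_least, erule UN_E)
      fix D c assume "c \<in> Field s" "D \<in> \<D> c"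
      then show "D \<subseteq> (\<Union>c\<in>Field s. A c)" using into[of c] by blast
    qed
    have Ecar: "\<Union>?E \<subseteq> carrier G"
    proof (rule Union_least, erule UN_E)
      fix D c assume "c \<in> Field s" "D \<in> \<D> c"
      then show "D \<subseteq> carrier G" using into[of c] car[of c] by blast
    qed
    have sgE: "subgroup (generate G (\<Union>?E)) G" by (rule generate_is_subgroup[OF Ecar])
    have "c \<in> Field s \<longrightarrow> A c \<subseteq> generate G (\<Union>?E)" for c
    proof (induction c rule: well_order_induct)
      case (1 c)
      show ?case
      proof
        assume c: "c \<in> Field s"
        have "(\<Union>a\<in>underS s c. A a) \<subseteq> generate G (\<Union>?E)"
        proof (rule UN_least)
          fix a assume a: "a \<in> underS s c"
          show "A a \<subseteq> generate G (\<Union>?E)"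
            using 1[rule_format, of a] a fld[OF a] by (simp add: underS_def)
        qed
        moreover have "\<Union>(\<D> c) \<subseteq> generate G (\<Union>?E)"
          using c generate.incl[of _ "\<Union>?E" G] by blast
        ultimately show "A c \<subseteq> generate G (\<Union>?E)"
          using gen[OF c] generate_subgroup_incl[OF _ sgE] by (meson Un_least order_trans)
      qed
    qed
    then show "generate G (\<Union>c\<in>Field s. A c) \<subseteq> generate G (\<Union>?E)"
      by (intro generate_subgroup_incl[OF _ sgE]) blast
  qed
qed

lemma (in group) generate_empty_subset: "generate G {} \<subseteq> {\<one>}"
proof
  fix x assume "x \<in> generate G {}"
  then show "x \<in> {\<one>}" by induction auto
qed

lemma (in group) independent_family_singleton: "independent_family G {D}"
  unfolding independent_family_def
proof (intro allI impI)
  fix \<B> assume "\<B> \<subseteq> {D}"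
  then consider "\<B> = {}" | "\<B> = {D}" by blast
  then show "generate G (\<Union>\<B>) \<inter> generate G (\<Union>({D} - \<B>)) \<subseteq> {\<one>}"
    using generate_empty_subset by cases auto
qed

lemma (in comm_group) interchange:
  assumes "a \<in> carrier G" "b \<in> carrier G" "c \<in> carrier G" "d \<in> carrier G"
  shows "(a \<otimes> b) \<otimes> (c \<otimes> d) = (a \<otimes> c) \<otimes> (b \<otimes> d)"
  using assms by (simp add: m_ac)

text \<open>
  Kaplansky's theorem for countable summands. Let \<open>e\<close> be the projection of \<open>A\<close> onto \<open>B\<close> along \<open>C\<close>.
  It maps a countable summand \<open>D\<close> into the sum of countably many summands, so closing up under this
  dependence attaches to \<open>D\<close> a countable set \<open>cl D\<close> of summands whose span is invariant under \<open>e\<close>.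
  Running through the summands along a well-order and collecting these sets gives increasing
  families \<open>J c\<close> with \<open>e\<close>-invariant spans, in which \<open>J c\<close> exceeds the union \<open>I c\<close> of its
  predecessors by a countable set only. Intersecting the spans with \<open>B\<close> filters \<open>B\<close>, and the
  invariance makes every step of this filtration split off a countable subgroup \<open>E c\<close>.
\<close>

lemma (in comm_group) countably_decomposable_summand:
  assumes dec: "countably_decomposable G A"
    and B: "subgroup B G" "B \<subseteq> A" and C: "subgroup C G" "B \<inter> C \<subseteq> {\<one>}"
    and BC: "\<And>a. a \<in> A \<Longrightarrow> \<exists>b\<in>B. \<exists>c\<in>C. a = b \<otimes> c"
  shows "countably_decomposable G B"
proof -
  obtain \<D> where sgD: "\<And>D. D \<in> \<D> \<Longrightarrow> subgroup D G" and cD: "\<And>D. D \<in> \<D> \<Longrightarrow> countable D"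
    and ind: "independent_family G \<D>" and A: "A = generate G (\<Union>\<D>)"
    using dec unfolding countably_decomposable_def by blast
  define S where "S = (\<lambda>J. generate G (\<Union>J))"
  have Ucar: "\<Union>J \<subseteq> carrier G" if "J \<subseteq> \<D>" for J
    using sgD that subgroup.subset by fastforce
  have sgS: "subgroup (S J) G" if "J \<subseteq> \<D>" for J
    unfolding S_def by (rule generate_is_subgroup[OF Ucar[OF that]])
  have Smono: "S J \<subseteq> S K" if "J \<subseteq> K" for J K
    unfolding S_def using that by (intro mono_generate Union_mono)
  have SA: "S J \<subseteq> A" if "J \<subseteq> \<D>" for J using Smono[OF that] by (simp add: A S_def)
  have sgA: "subgroup A G" using sgS[of \<D>] by (simp add: A S_def)
  have Acar: "x \<in> carrier G" if "x \<in> A" for x using sgA that subgroup.mem_carrier by metis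
  have Ssplit: "\<exists>y\<in>S J. \<exists>z\<in>S K. x = y \<otimes> z" if "J \<subseteq> \<D>" "K \<subseteq> \<D>" "x \<in> S (J \<union> K)" for x J K
    using that(3) generate_Un[OF Ucar[OF that(1)] Ucar[OF that(2)]] by (simp add: S_def)
  have Sdisj: "S J \<inter> S (\<D> - J) \<subseteq> {\<one>}" if "J \<subseteq> \<D>" for J
    using ind that unfolding independent_family_def S_def by blast
  define e where "e = (\<lambda>x. SOME b. b \<in> B \<and> (\<exists>c\<in>C. x = b \<otimes> c))"
  have e: "e x \<in> B \<and> (\<exists>c\<in>C. x = e x \<otimes> c)" if "x \<in> A" for x
    unfolding e_def by (rule someI_ex) (use BC[OF that] in blast)
  have eB: "e x \<in> B" if "x \<in> A" for x using e[OF that] by blast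
  have eA: "e x \<in> A" if "x \<in> A" for x using eB[OF that] B by blast
  have eU: "e x = b" if "x \<in> A" "b \<in> B" "c \<in> C" "x = b \<otimes> c" for x b c
  proof -
    from e[OF that(1)] obtain c' where "e x \<in> B" "c' \<in> C" "x = e x \<otimes> c'" by blast
    then show ?thesis
      using mult_cancel_split(1)[OF B(1) C(1,2) _ that(2) _ that(3)] that(4) by metis
  qed
  have e_id: "e x = x" if "x \<in> B" for x
    using eU[of x x \<one>] that B C(1) subgroup.one_closed subgroup.mem_carrier[OF B(1)] by (metis r_one subsetD)
  have e_mult: "e (x \<otimes> y) = e x \<otimes> e y" if "x \<in> A" "y \<in> A" for x y
  proof -
    from e[OF that(1)] obtain c where c: "e x \<in> B" "c \<in> C" "x = e x \<otimes> c" by blast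
    from e[OF that(2)] obtain d where d: "e y \<in> B" "d \<in> C" "y = e y \<otimes> d" by blast
    have car: "e x \<in> carrier G" "e y \<in> carrier G" "c \<in> carrier G" "d \<in> carrier G"
      using c d B C subgroup.mem_carrier by metis+
    have "(e x \<otimes> c) \<otimes> (e y \<otimes> d) = (e x \<otimes> e y) \<otimes> (c \<otimes> d)" using car by (simp add: m_ac)
    then have "x \<otimes> y = (e x \<otimes> e y) \<otimes> (c \<otimes> d)" using c(3) d(3) by simp
    then show ?thesis
      by (rule eU[rotated 3])
        (use c d that B C sgA in \<open>auto intro: subgroup.m_closed\<close>)
  qed
  have e_one: "e \<one> = \<one>" using e_id B(1) subgroup.one_closed by metis
  have e_inv: "e (inv x) = inv (e x)" if "x \<in> A" for x
  proof -
    have x: "inv x \<in> A" using that sgA by (rule subgroup.m_inv_closed[rotated])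
    have "e (inv x) \<otimes> e x = \<one>"
      using e_mult[OF x that] e_one Acar[OF that] by simp
    then show ?thesis using Acar[OF eA[OF that]] Acar[OF eA[OF x]] by (metis inv_equality)
  qed

  have "\<exists>Q\<subseteq>\<D>. countable Q \<and> e ` D \<subseteq> S Q" if D: "D \<in> \<D>" for D
  proof -
    have "\<exists>F\<subseteq>\<D>. finite F \<and> e x \<in> S F" if "x \<in> D" for x
    proof -
      have "x \<in> A" unfolding A using that D by (auto intro: generate.incl)
      from eA[OF this] show ?thesis using generate_Union_finite unfolding A S_def by blast
    qed
    then obtain F where F: "\<And>x. x \<in> D \<Longrightarrow> F x \<subseteq> \<D> \<and> finite (F x) \<and> e x \<in> S (F x)" by metis
    show ?thesis
    proof (intro exI[of _ "\<Union>x\<in>D. F x"] conjI)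
      show "countable (\<Union>x\<in>D. F x)" using cD[OF D] F by (auto intro: countable_finite)
      show "e ` D \<subseteq> S (\<Union>x\<in>D. F x)"
      proof (rule image_subsetI)
        fix x assume x: "x \<in> D"
        have "S (F x) \<subseteq> S (\<Union>x\<in>D. F x)" by (rule Smono) (use x in blast)
        then show "e x \<in> S (\<Union>x\<in>D. F x)" using F[OF x] by blast
      qed
    qed (use F in blast)
  qed
  then obtain Q where Q: "\<And>D. D \<in> \<D> \<Longrightarrow> Q D \<subseteq> \<D>" "\<And>D. D \<in> \<D> \<Longrightarrow> countable (Q D)"
    "\<And>D. D \<in> \<D> \<Longrightarrow> e ` D \<subseteq> S (Q D)" by metis
  define r where "r = {(D, D'). D \<in> \<D> \<and> D' \<in> Q D}"
  define cl where "cl = (\<lambda>D. r\<^sup>* `` {D})"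
  have cl_sub: "cl D \<subseteq> \<D>" if "D \<in> \<D>" for D
  proof
    fix D' assume "D' \<in> cl D"
    then have "(D, D') \<in> r\<^sup>*" by (simp add: cl_def)
    then show "D' \<in> \<D>" using that by induction (use Q(1) in \<open>auto simp: r_def\<close>)
  qed
  have cl_self: "D \<in> cl D" for D by (simp add: cl_def)
  have cl_step: "Q E \<subseteq> cl D" if "E \<in> cl D" "E \<in> \<D>" for D E
    using that by (auto simp: cl_def r_def intro: rtrancl_into_rtrancl)
  have cl_count: "countable (cl D)" for D
    unfolding cl_def
  proof (rule countable_rtrancl)
    fix Y :: "'a set set" assume "countable Y"
    moreover have "r `` Y \<subseteq> (\<Union>D\<in>Y \<inter> \<D>. Q D)" by (auto simp: r_def)
    ultimately show "countable (r `` Y)" using Q(2)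
      by (meson IntE countable_Int1 countable_UN countable_subset)
  qed simp

  obtain s where s: "well_order_on \<D> s" using well_order_on by blast
  have Fs: "Field s = \<D>" using well_order_on_Field[OF s] by simp
  have wo: "Well_order s" using s Fs by simp
  then have wo': "wo_rel s" by (simp add: wo_rel_def)
  note REFL = wo_rel.REFL[OF wo'] and TRANS = wo_rel.TRANS[OF wo'] and TOTALS = wo_rel.TOTALS[OF wo']
    and ANTISYM = wo_rel.ANTISYM[OF wo']
  define J where "J = (\<lambda>c. \<Union>a\<in>under s c. cl a)"
  define I where "I = (\<lambda>c. \<Union>a\<in>underS s c. cl a)"
  have under_sub: "under s c \<subseteq> \<D>" "underS s c \<subseteq> \<D>" for c
    using Fs by (auto simp: under_def underS_def Field_def)
  have Jsub: "J c \<subseteq> \<D>" and Isub: "I c \<subseteq> \<D>" for c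
    unfolding J_def I_def using cl_sub under_sub by blast+
  have under_mono: "under s a \<subseteq> under s b" if "(a, b) \<in> s" for a b
    using that transD[OF TRANS] unfolding under_def by blast
  have Jmono: "J a \<subseteq> J b" if "(a, b) \<in> s" for a b
    unfolding J_def using under_mono[OF that] by (rule UN_mono) simp
  have chain: "J a \<subseteq> J b \<or> J b \<subseteq> J a" if "a \<in> \<D>" "b \<in> \<D>" for a b
    using that TOTALS Jmono Fs by metis
  have J_I: "J c = I c \<union> cl c" if "c \<in> \<D>" for c
  proof -
    have "under s c = insert c (underS s c)"
      using refl_onD[OF REFL, of c] that Fs by (auto simp: under_def underS_def)
    then show ?thesis by (auto simp: J_def I_def)
  qed
  have JI: "J a \<subseteq> I c" if "a \<in> underS s c" for a c
  proof -
    have "under s a \<subseteq> underS s c"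
      using that transD[OF TRANS] antisymD[OF ANTISYM] unfolding under_def underS_def by blast
    then show ?thesis unfolding J_def I_def by (rule UN_mono) simp
  qed
  have closed: "e x \<in> S (\<Union>a\<in>U. cl a)" if U: "U \<subseteq> \<D>" and x: "x \<in> S (\<Union>a\<in>U. cl a)" for U x
  proof -
    let ?K = "\<Union>a\<in>U. cl a"
    have K: "?K \<subseteq> \<D>" using U cl_sub by blast
    have base: "e h \<in> S ?K" if "h \<in> D" "D \<in> ?K" for h D
    proof -
      have "Q D \<subseteq> ?K" using cl_step that(2) K by blast
      then have "S (Q D) \<subseteq> S ?K" by (rule Smono)
      moreover have "e h \<in> S (Q D)" using Q(3)[of D] that K by blast
      ultimately show ?thesis by blast
    qed
    from x[unfolded S_def] show ?thesis
    proof induction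
      case one
      then show ?case using e_one by (simp add: S_def generate.one)
    next
      case (incl h)
      then show ?case using base by blast
    next
      case (inv h)
      then obtain D where D: "h \<in> D" "D \<in> ?K" by blast
      then have "inv h \<in> D" using sgD K subgroup.m_inv_closed by (metis subsetD)
      then show ?case using base D(2) by blast
    next
      case (eng h1 h2)
      then have "h1 \<in> A" "h2 \<in> A" using SA[OF K] by (auto simp: S_def)
      then show ?case
        using e_mult eng.IH subgroup.m_closed[OF sgS[OF K]] by simp
    qed
  qed
  have closedI: "e x \<in> S (I c)" if "x \<in> S (I c)" for x c
    using closed[OF under_sub(2)] that by (simp add: I_def)
  have closedJ: "e x \<in> S (J c)" if "x \<in> S (J c)" for x c
    using closed[OF under_sub(1)] that by (simp add: J_def)

  \<comment> \<open>Splitting \<open>x \<in> B\<close> as \<open>y \<otimes> z\<close> along \<open>I c\<close> and its complement, the map sending \<open>x\<close> to \<open>e y\<close>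
    retracts \<open>B\<close> onto \<open>B \<inter> S (I c)\<close>; the complement \<open>E c\<close> is the kernel of this retraction.\<close>
  define E where "E = (\<lambda>c. {x \<in> B \<inter> S (J c). \<exists>y\<in>S (I c). \<exists>z\<in>S (\<D> - I c). x = y \<otimes> z \<and> e y = \<one>})"
  have Icar: "x \<in> carrier G" if "x \<in> S (I c) \<or> x \<in> S (\<D> - I c)" for x c
    using that Acar SA[OF Isub] SA[of "\<D> - I c"] by blast
  have IA: "x \<in> A" if "x \<in> S (I c) \<or> x \<in> S (\<D> - I c)" for x c
    using that SA[OF Isub] SA[of "\<D> - I c"] by blast
  have EB: "E c \<subseteq> B" for c by (auto simp: E_def)
  have sgE: "subgroup (E c) G" for c
  proof (rule subgroupI)
    show "E c \<subseteq> carrier G" using EB B(1) subgroup.subset by blast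
    have "\<one> \<in> E c"
      unfolding E_def using e_one B(1) sgS[OF Jsub] sgS[OF Isub] sgS[of "\<D> - I c"]
      by (auto simp: subgroup.one_closed intro!: bexI[of _ \<one>])
    then show "E c \<noteq> {}" by blast
  next
    fix x assume "x \<in> E c"
    then obtain y z where x: "x \<in> B" "x \<in> S (J c)" "y \<in> S (I c)" "z \<in> S (\<D> - I c)" "x = y \<otimes> z" "e y = \<one>"
      by (auto simp: E_def)
    have "y \<in> carrier G" "z \<in> carrier G" using x Icar by blast+
    then have "inv x = inv y \<otimes> inv z" using x(5) inv_mult by simp
    moreover have "e (inv y) = \<one>" using e_inv[OF IA[OF disjI1[OF x(3)]]] x(6) by simp
    moreover have "inv y \<in> S (I c)" "inv z \<in> S (\<D> - I c)" "inv x \<in> B" "inv x \<in> S (J c)"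
      using x(1-4) B(1) sgS[OF Jsub] sgS[OF Isub] sgS[of "\<D> - I c"]
      by (auto intro!: subgroup.m_inv_closed)
    ultimately show "inv x \<in> E c" unfolding E_def by blast
  next
    fix x x' assume "x \<in> E c" "x' \<in> E c"
    then obtain y z y' z' where x: "x \<in> B" "x \<in> S (J c)" "y \<in> S (I c)" "z \<in> S (\<D> - I c)" "x = y \<otimes> z" "e y = \<one>"
      and x': "x' \<in> B" "x' \<in> S (J c)" "y' \<in> S (I c)" "z' \<in> S (\<D> - I c)" "x' = y' \<otimes> z'" "e y' = \<one>"
      by (auto simp: E_def)
    have car: "y \<in> carrier G" "z \<in> carrier G" "y' \<in> carrier G" "z' \<in> carrier G"
      using x x' Icar by blast+
    have "x \<otimes> x' = (y \<otimes> y') \<otimes> (z \<otimes> z')" using x(5) x'(5) car by (simp add: m_ac)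
    moreover have "e (y \<otimes> y') = \<one>" using e_mult[OF IA[OF disjI1[OF x(3)]] IA[OF disjI1[OF x'(3)]]] x(6) x'(6) by simp
    moreover have "y \<otimes> y' \<in> S (I c)" "z \<otimes> z' \<in> S (\<D> - I c)" "x \<otimes> x' \<in> B" "x \<otimes> x' \<in> S (J c)"
      using x(1-4) x'(1-4) B(1) sgS[OF Jsub] sgS[OF Isub] sgS[of "\<D> - I c"]
      by (auto intro!: subgroup.m_closed)
    ultimately show "x \<otimes> x' \<in> E c" unfolding E_def by blast
  qed
  have cancel: "y = y' \<and> z = z'"
    if "y \<in> S (I c)" "y' \<in> S (I c)" "z \<in> S (\<D> - I c)" "z' \<in> S (\<D> - I c)" "y \<otimes> z = y' \<otimes> z'" for y y' z z' c
    using mult_cancel_split[OF sgS[OF Isub] sgS[OF Diff_subset] Sdisj[OF Isub] that] by blast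
  \<comment> \<open>On \<open>E c\<close> one has \<open>x = e z\<close>, and \<open>z\<close> ranges over the span of the countable set \<open>J c - I c\<close>.\<close>
  have countE: "countable (E c)" if c: "c \<in> \<D>" for c
  proof -
    let ?K = "J c - I c"
    have K: "?K \<subseteq> \<D>" "?K \<subseteq> \<D> - I c" using Jsub by blast+
    have "countable ?K" using J_I[OF c] cl_count by (auto intro: countable_subset[OF _ cl_count[of c]])
    then have "countable (\<Union>?K)" using cD K(1) by (intro countable_UN[of _ "\<lambda>x. x", simplified]) auto
    then have "countable (S ?K)" unfolding S_def by (rule generate_countable[OF Ucar[OF K(1)]])
    moreover have "E c \<subseteq> e ` S ?K"
    proof
      fix x assume "x \<in> E c"
      then obtain y z where x: "x \<in> B" "x \<in> S (J c)" "y \<in> S (I c)" "z \<in> S (\<D> - I c)" "x = y \<otimes> z" "e y = \<one>"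
        by (auto simp: E_def)
      have "I c \<union> ?K = J c" using J_I[OF c] by blast
      with x Ssplit[OF Isub K(1)] obtain u v where uv: "u \<in> S (I c)" "v \<in> S ?K" "x = u \<otimes> v" by metis
      have "v \<in> S (\<D> - I c)" using uv(2) Smono[OF K(2)] by blast
      with cancel[OF x(3) uv(1) x(4)] x(5) uv(3) have "z = v" by simp
      have zA: "y \<in> A" "z \<in> A" using IA x(3,4) by blast+
      have "x = e y \<otimes> e z" using e_id[OF x(1)] e_mult[OF zA] x(5) by simp
      also have "\<dots> = e v" using x(6) \<open>z = v\<close> Acar[OF eA[OF zA(2)]] by simp
      finally show "x \<in> e ` S ?K" using uv(2) by blast
    qed
    ultimately show ?thesis by (meson countable_image countable_subset)
  qed
  define P where "P = (\<lambda>c. \<Union>a\<in>underS s c. B \<inter> S (J a))"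
  have sgBI: "subgroup (B \<inter> S (I c)) G" for c by (rule subgroups_Inter_pair[OF B(1) sgS[OF Isub]])
  have P1: "generate G (P c) \<subseteq> B \<inter> S (I c)" for c
    by (rule generate_subgroup_incl[OF _ sgBI]) (use Smono[OF JI] in \<open>auto simp: P_def\<close>)
  have P2: "x \<in> generate G (P c)" if x: "x \<in> B" "x \<in> S (I c)" for x c
  proof -
    have "\<Union>(I c) \<subseteq> (\<Union>a\<in>underS s c. \<Union>(J a))"
    proof -
      have "cl a \<subseteq> J a" if "a \<in> underS s c" for a using J_I[of a] under_sub that by blast
      then show ?thesis unfolding I_def by blast
    qed
    from mono_generate[OF this] have "x \<in> generate G (\<Union>a\<in>underS s c. \<Union>(J a))"
      using x(2) by (auto simp: S_def)
    then have "x = \<one> \<or> (\<exists>a\<in>underS s c. x \<in> generate G (\<Union>(J a)))"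
    proof (rule generate_Union_chain)
      fix a b assume "a \<in> underS s c" "b \<in> underS s c"
      then show "\<Union>(J a) \<subseteq> \<Union>(J b) \<or> \<Union>(J b) \<subseteq> \<Union>(J a)"
        using chain[of a b] under_sub(2) by (meson Union_mono subsetD)
    qed
    then show ?thesis
    proof
      assume "\<exists>a\<in>underS s c. x \<in> generate G (\<Union>(J a))"
      then have "x \<in> P c" using x(1) by (auto simp: P_def S_def)
      then show ?thesis by (rule generate.incl)
    qed (simp add: generate.one)
  qed
  have h1: "subgroup (B \<inter> S (J c)) G" for c by (rule subgroups_Inter_pair[OF B(1) sgS[OF Jsub]])
  have h2: "B \<inter> S (J a) \<subseteq> B \<inter> S (J b)" if "(a, b) \<in> s" for a b using Smono[OF Jmono[OF that]] by blast
  have h3: "\<Union>{E c} \<subseteq> B \<inter> S (J c)" for c by (auto simp: E_def)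
  have h5: "generate G (\<Union>a\<in>underS s c. B \<inter> S (J a)) \<inter> generate G (\<Union>{E c}) \<subseteq> {\<one>}" for c
    proof
      fix x assume "x \<in> generate G (\<Union>a\<in>underS s c. B \<inter> S (J a)) \<inter> generate G (\<Union>{E c})"
      then have "x \<in> B" "x \<in> S (I c)" "x \<in> E c"
        using P1[of c] generate_subgroup_incl[OF subset_refl sgE, of c] by (auto simp: P_def)
      then obtain y z where x: "x \<in> B" "x \<in> S (I c)" "y \<in> S (I c)" "z \<in> S (\<D> - I c)" "x = y \<otimes> z" "e y = \<one>"
        by (auto simp: E_def)
      have "x \<in> carrier G" using Icar x(2) by blast
      then have "x \<otimes> \<one> = y \<otimes> z" using x(5) by simp
      then have "x = y" using cancel[OF x(2,3) _ x(4)] subgroup.one_closed[OF sgS[OF Diff_subset]] by blast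
      then show "x \<in> {\<one>}" using e_id[OF x(1)] x(6) by simp
    qed
  have h6: "B \<inter> S (J c) \<subseteq> generate G ((\<Union>a\<in>underS s c. B \<inter> S (J a)) \<union> \<Union>{E c})"
    if "c \<in> Field s" for c
    proof
      fix x assume x: "x \<in> B \<inter> S (J c)"
      have c: "c \<in> \<D>" using that Fs by simp
      have JD: "I c \<union> (\<D> - I c) = \<D>" using Isub by blast
      have "x \<in> S \<D>" using x Smono[OF Jsub] by blast
      with Ssplit[OF Isub Diff_subset] JD obtain y z where
        x': "y \<in> S (I c)" "z \<in> S (\<D> - I c)" "x = y \<otimes> z" by metis
      have yz: "y \<in> A" "z \<in> A" using IA x'(1,2) by blast+
      have ez: "e z \<in> S \<D>" using eA[OF yz(2)] by (simp add: A S_def)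
      with Ssplit[OF Isub Diff_subset] JD obtain u v where
        uv: "u \<in> S (I c)" "v \<in> S (\<D> - I c)" "e z = u \<otimes> v" by metis
      have uA: "u \<in> A" "v \<in> A" using IA uv(1,2) by blast+
      have car: "e y \<in> carrier G" "e z \<in> carrier G" "u \<in> carrier G" "v \<in> carrier G" "e u \<in> carrier G"
        using eA[OF yz(1)] eA[OF yz(2)] uA eA[OF uA(1)] Acar by blast+
      have y: "e y \<in> B \<inter> S (I c)" using closedI[OF x'(1)] eB[OF yz(1)] by blast
      have u: "e u \<in> B \<inter> S (I c)" using closedI[OF uv(1)] eB[OF uA(1)] by blast
      \<comment> \<open>The component of \<open>x\<close> in \<open>I c\<close> is not \<open>e y\<close> alone: \<open>e z\<close> contributes the part \<open>u\<close>, and its image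
        \<open>e u\<close> has to be moved from the second factor to the first.\<close>
      have xe: "x = e y \<otimes> e z" using e_id[of x] x e_mult[OF yz] x'(3) by simp
      also have "\<dots> = (e y \<otimes> e z) \<otimes> (e u \<otimes> inv (e u))" using car by simp
      also have "\<dots> = (e y \<otimes> e u) \<otimes> (e z \<otimes> inv (e u))"
        by (rule interchange) (use car in auto)
      finally have x_eq: "x = (e y \<otimes> e u) \<otimes> (e z \<otimes> inv (e u))" .
      have 1: "e y \<otimes> e u \<in> B \<inter> S (I c)" using subgroup.m_closed[OF sgBI y u] .
      have eS: "e z \<otimes> inv (e u) = (u \<otimes> inv (e u)) \<otimes> v" using uv(3) car by (simp add: m_ac)
      have uu: "u \<otimes> inv (e u) \<in> S (I c)"
        using uv u sgS[OF Isub] by (auto intro: subgroup.m_closed subgroup.m_inv_closed)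
      have "e (u \<otimes> inv (e u)) = e u \<otimes> inv (e u)"
        using e_mult[OF uA(1) subgroup.m_inv_closed[OF sgA eA[OF uA(1)]]]
          e_inv[OF eA[OF uA(1)]] e_id[of "e u"] u by simp
      then have 2: "e (u \<otimes> inv (e u)) = \<one>" using car by simp
      have 3: "e z \<otimes> inv (e u) \<in> B"
        using eB[OF yz(2)] u B(1) by (auto intro: subgroup.m_closed subgroup.m_inv_closed)
      have IJ: "S (I c) \<subseteq> S (J c)" using Smono[of "I c" "J c"] J_I[OF c] by blast
      have "e z = inv (e y) \<otimes> x" using xe car by (simp add: m_assoc[symmetric])
      then have "e z \<in> S (J c)"
        using x y IJ subgroup.m_closed[OF sgS[OF Jsub]] subgroup.m_inv_closed[OF sgS[OF Jsub]] by auto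
      then have 4: "e z \<otimes> inv (e u) \<in> S (J c)"
        using u IJ subgroup.m_closed[OF sgS[OF Jsub]] subgroup.m_inv_closed[OF sgS[OF Jsub]] by auto
      have 5: "e z \<otimes> inv (e u) \<in> E c"
        unfolding E_def using 2 3 4 eS uu uv(2) by blast
      have "e y \<otimes> e u \<in> generate G (P c)" using P2 1 by blast
      moreover have "e z \<otimes> inv (e u) \<in> generate G (\<Union>{E c})" using 5 by (auto intro: generate.incl)
      moreover have "P c \<subseteq> carrier G" "\<Union>{E c} \<subseteq> carrier G"
        using B(1) sgE subgroup.subset by (fastforce simp: P_def)+
      ultimately show "x \<in> generate G ((\<Union>a\<in>underS s c. B \<inter> S (J a)) \<union> \<Union>{E c})"
        using generate_Un[of "P c" "\<Union>{E c}" x] x_eq unfolding P_def by blast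
    qed
  note main = filtration_decomposition[OF wo h1 h2 h3 independent_family_singleton h5 h6]
  have "generate G (\<Union>c\<in>Field s. B \<inter> S (J c)) = B"
  proof
    show "generate G (\<Union>c\<in>Field s. B \<inter> S (J c)) \<subseteq> B"
      by (rule generate_subgroup_incl[OF _ B(1)]) blast
    show "B \<subseteq> generate G (\<Union>c\<in>Field s. B \<inter> S (J c))"
    proof
      fix x assume x: "x \<in> B"
      have "\<Union>\<D> \<subseteq> (\<Union>c\<in>\<D>. \<Union>(J c))"
      proof -
        have "c \<in> J c" if "c \<in> \<D>" for c using J_I[OF that] cl_self by blast
        then show ?thesis by blast
      qed
      from mono_generate[OF this] have "x \<in> generate G (\<Union>c\<in>\<D>. \<Union>(J c))"
        using x B(2) A by blast
      then have "x = \<one> \<or> (\<exists>c\<in>\<D>. x \<in> generate G (\<Union>(J c)))"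
      proof (rule generate_Union_chain)
        fix a b assume "a \<in> \<D>" "b \<in> \<D>"
        then show "\<Union>(J a) \<subseteq> \<Union>(J b) \<or> \<Union>(J b) \<subseteq> \<Union>(J a)"
          using chain[of a b] by (meson Union_mono)
      qed
      then show "x \<in> generate G (\<Union>c\<in>Field s. B \<inter> S (J c))"
      proof
        assume "\<exists>c\<in>\<D>. x \<in> generate G (\<Union>(J c))"
        then have "x \<in> (\<Union>c\<in>Field s. B \<inter> S (J c))" using x Fs by (auto simp: S_def)
        then show ?thesis by (rule generate.incl)
      qed (simp add: generate.one)
    qed
  qed
  with main have "independent_family G (E ` \<D>)" "B = generate G (\<Union>(E ` \<D>))"
    by (simp_all add: Fs UNION_singleton_eq_range)
  then show ?thesis
    unfolding countably_decomposable_def using sgE countE by (intro exI[of _ "E ` \<D>"]) auto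
qed

text \<open>
  If the kernel of \<open>\<alpha>\<close> lies in the kernel of \<open>\<beta>\<close>, then \<open>\<beta>\<close> factors through the image of \<open>\<alpha>\<close>. Working
  with elements of \<open>C\<close> instead of the induced map avoids choosing preimages.
\<close>

lemma generate_transfer:
  assumes C: "group C" and A: "group A" and B: "group B"
    and \<alpha>: "\<alpha> \<in> hom C A" and \<beta>: "\<beta> \<in> hom C B"
    and ker: "\<And>x. x \<in> carrier C \<Longrightarrow> \<alpha> x = \<one>\<^bsub>A\<^esub> \<Longrightarrow> \<beta> x = \<one>\<^bsub>B\<^esub>"
    and S: "S \<subseteq> \<alpha> ` carrier C" and x: "x \<in> carrier C" "\<alpha> x \<in> generate A S"
  shows "\<beta> x \<in> generate B (\<beta> ` {x \<in> carrier C. \<alpha> x \<in> S})"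
proof -
  interpret C: group C by fact
  interpret A: group A by fact
  interpret B: group B by fact
  interpret \<alpha>: group_hom C A \<alpha> using C A \<alpha> by (simp add: group_hom_def group_hom_axioms_def)
  interpret \<beta>: group_hom C B \<beta> using C B \<beta> by (simp add: group_hom_def group_hom_axioms_def)
  let ?S = "\<beta> ` {x \<in> carrier C. \<alpha> x \<in> S}"
  have gen_sub: "generate A S \<subseteq> \<alpha> ` carrier C"
    using S by (rule A.generate_subgroup_incl) (rule \<alpha>.img_is_subgroup)
  have "x \<in> carrier C \<longrightarrow> \<alpha> x = y \<longrightarrow> \<beta> x \<in> generate B ?S" if "y \<in> generate A S" for x y
    using that
  proof (induction arbitrary: x)
    case one
    then show ?case using ker by (auto simp: generate.one)
  next
    case (incl h)
    then show ?case by (auto intro!: generate.incl)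
  next
    case (inv h)
    show ?case
    proof (intro impI)
      assume x: "x \<in> carrier C" "\<alpha> x = inv\<^bsub>A\<^esub> h"
      have "h \<in> carrier A" using inv S by auto
      then have "\<alpha> (inv\<^bsub>C\<^esub> x) = h" using x by simp
      then have "inv\<^bsub>B\<^esub> (\<beta> (inv\<^bsub>C\<^esub> x)) \<in> generate B ?S"
        using x inv by (intro generate.inv imageI) simp
      then show "\<beta> x \<in> generate B ?S" using x by simp
    qed
  next
    case (eng h1 h2)
    show ?case
    proof (intro impI)
      assume x: "x \<in> carrier C" "\<alpha> x = h1 \<otimes>\<^bsub>A\<^esub> h2"
      from eng.hyps(1) gen_sub obtain x1 where x1: "x1 \<in> carrier C" "h1 = \<alpha> x1" by blast
      let ?x2 = "inv\<^bsub>C\<^esub> x1 \<otimes>\<^bsub>C\<^esub> x"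
      have "h2 \<in> carrier A" using eng.hyps(2) gen_sub by auto
      then have "\<alpha> ?x2 = h2" using x x1 by (simp add: A.m_assoc[symmetric])
      then have "\<beta> x1 \<in> generate B ?S" "\<beta> ?x2 \<in> generate B ?S"
        using eng.IH(1)[of x1] eng.IH(2)[of ?x2] x x1 by auto
      then have "\<beta> x1 \<otimes>\<^bsub>B\<^esub> \<beta> ?x2 \<in> generate B ?S" by (rule generate.eng)
      then show "\<beta> x \<in> generate B ?S" using x x1 by (simp add: B.m_assoc[symmetric])
    qed
  qed
  with x show ?thesis by blast
qed

text \<open>
  Homomorphisms with the same kernel have isomorphic images. The statement in terms of two
  homomorphisms suits the applications, where both images arise from the same circle-valued maps.
\<close>

lemma countably_decomposable_transfer:
  assumes C: "group C" and A: "group A" and B: "group B"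
    and \<alpha>: "\<alpha> \<in> hom C A" and \<beta>: "\<beta> \<in> hom C B"
    and ker: "\<And>x. x \<in> carrier C \<Longrightarrow> \<alpha> x = \<one>\<^bsub>A\<^esub> \<longleftrightarrow> \<beta> x = \<one>\<^bsub>B\<^esub>"
    and dec: "countably_decomposable A (\<alpha> ` carrier C)"
  shows "countably_decomposable B (\<beta> ` carrier C)"
proof -
  interpret C: group C by fact
  interpret A: group A by fact
  interpret B: group B by fact
  interpret \<alpha>: group_hom C A \<alpha> using C A \<alpha> by (simp add: group_hom_def group_hom_axioms_def)
  interpret \<beta>: group_hom C B \<beta> using C B \<beta> by (simp add: group_hom_def group_hom_axioms_def)
  from dec[unfolded countably_decomposable_def] obtain \<D> where
    dec': "(\<forall>D\<in>\<D>. subgroup D A \<and> countable D) \<and> independent_family A \<D> \<and>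
      \<alpha> ` carrier C = generate A (\<Union>\<D>)" by (rule exE)
  then have D: "\<And>D. D \<in> \<D> \<Longrightarrow> subgroup D A" "\<And>D. D \<in> \<D> \<Longrightarrow> countable D"
    and ind: "independent_family A \<D>" and gen: "\<alpha> ` carrier C = generate A (\<Union>\<D>)"
    by simp_all
  have same: "\<alpha> x = \<alpha> y \<longleftrightarrow> \<beta> x = \<beta> y" if "x \<in> carrier C" "y \<in> carrier C" for x y
  proof -
    have "\<alpha> x = \<alpha> y \<longleftrightarrow> \<alpha> (x \<otimes>\<^bsub>C\<^esub> inv\<^bsub>C\<^esub> y) = \<one>\<^bsub>A\<^esub>"
      using that by (simp add: A.inv_solve_right')
    also have "\<dots> \<longleftrightarrow> \<beta> (x \<otimes>\<^bsub>C\<^esub> inv\<^bsub>C\<^esub> y) = \<one>\<^bsub>B\<^esub>" using that by (intro ker) simp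
    also have "\<dots> \<longleftrightarrow> \<beta> x = \<beta> y" using that by (simp add: B.inv_solve_right')
    finally show ?thesis .
  qed
  define \<phi> where "\<phi> = (\<lambda>S. \<beta> ` {x \<in> carrier C. \<alpha> x \<in> S})"
  have Dsub: "D \<subseteq> \<alpha> ` carrier C" if "D \<in> \<D>" for D
    unfolding gen using that by (auto intro: generate.incl)
  have iff: "\<beta> x \<in> generate B (\<phi> S) \<longleftrightarrow> \<alpha> x \<in> generate A S"
    if S: "S \<subseteq> \<alpha> ` carrier C" and x: "x \<in> carrier C" for S x
  proof
    assume "\<alpha> x \<in> generate A S"
    then show "\<beta> x \<in> generate B (\<phi> S)"
      unfolding \<phi>_def by - (rule generate_transfer[OF C A B \<alpha> \<beta> _ S x], use ker in auto)
  next
    assume "\<beta> x \<in> generate B (\<phi> S)"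
    moreover have "\<phi> S \<subseteq> \<beta> ` carrier C" by (auto simp: \<phi>_def)
    ultimately have "\<alpha> x \<in> generate A (\<alpha> ` {x \<in> carrier C. \<beta> x \<in> \<phi> S})"
      by - (rule generate_transfer[OF C B A \<beta> \<alpha> _ _ x], use ker in auto)
    moreover have "\<alpha> ` {x \<in> carrier C. \<beta> x \<in> \<phi> S} \<subseteq> S"
    proof (rule image_subsetI)
      fix y assume "y \<in> {x \<in> carrier C. \<beta> x \<in> \<phi> S}"
      then obtain z where "y \<in> carrier C" "z \<in> carrier C" "\<alpha> z \<in> S" "\<beta> y = \<beta> z"
        by (auto simp: \<phi>_def)
      then show "\<alpha> y \<in> S" using same[of y z] by simp
    qed
    ultimately show "\<alpha> x \<in> generate A S" using A.mono_generate by blast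
  qed
  have \<phi>Un: "\<Union>(\<phi> ` \<B>) = \<phi> (\<Union>\<B>)" for \<B> by (auto simp: \<phi>_def)
  have \<phi>sub: "\<phi> S \<subseteq> \<beta> ` carrier C" for S by (auto simp: \<phi>_def)
  show ?thesis
    unfolding countably_decomposable_def
  proof (intro exI[of _ "\<phi> ` \<D>"] conjI ballI)
    fix E assume "E \<in> \<phi> ` \<D>"
    then obtain D' where D': "D' \<in> \<D>" "E = \<phi> D'" by blast
    have "subgroup {x \<in> carrier C. \<alpha> x \<in> D'} C"
    proof (rule C.subgroupI)
      have "\<one>\<^bsub>C\<^esub> \<in> {x \<in> carrier C. \<alpha> x \<in> D'}"
        using subgroup.one_closed[OF D(1)[OF D'(1)]] by simp
      then show "{x \<in> carrier C. \<alpha> x \<in> D'} \<noteq> {}" by blast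
    qed (use D(1)[OF D'(1)] in \<open>auto simp: subgroup.m_closed subgroup.m_inv_closed\<close>)
    then show "subgroup E B" unfolding D'(2) \<phi>_def by (rule \<beta>.subgroup_img_is_subgroup)
    obtain g where g: "\<And>d. d \<in> D' \<Longrightarrow> g d \<in> carrier C \<and> \<alpha> (g d) = d"
      using Dsub[OF D'(1)] by (metis image_iff subsetD)
    have "E \<subseteq> (\<lambda>d. \<beta> (g d)) ` D'"
    proof
      fix y assume "y \<in> E"
      then obtain x where x: "x \<in> carrier C" "\<alpha> x \<in> D'" "y = \<beta> x" by (auto simp: D' \<phi>_def)
      then have "\<beta> (g (\<alpha> x)) = \<beta> x" using g[OF x(2)] same by metis
      with x show "y \<in> (\<lambda>d. \<beta> (g d)) ` D'" by (metis imageI)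
    qed
    then show "countable E" using D(2)[OF D'(1)] by (meson countable_image countable_subset)
  next
    show "independent_family B (\<phi> ` \<D>)"
      unfolding independent_family_def
    proof (intro allI impI subsetI)
      fix \<B>' y assume B': "\<B>' \<subseteq> \<phi> ` \<D>"
        and y: "y \<in> generate B (\<Union>\<B>') \<inter> generate B (\<Union>(\<phi> ` \<D> - \<B>'))"
      define \<B> where "\<B> = {D \<in> \<D>. \<phi> D \<in> \<B>'}"
      have eq: "\<B>' = \<phi> ` \<B>" "\<phi> ` \<D> - \<B>' = \<phi> ` (\<D> - \<B>)" using B' by (auto simp: \<B>_def)
      have sub: "\<Union>\<B> \<subseteq> \<alpha> ` carrier C" "\<Union>(\<D> - \<B>) \<subseteq> \<alpha> ` carrier C" using Dsub by (auto simp: \<B>_def)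
      have y': "y \<in> generate B (\<phi> (\<Union>\<B>))" "y \<in> generate B (\<phi> (\<Union>(\<D> - \<B>)))"
        using IntD1[OF y, unfolded eq(1) \<phi>Un] IntD2[OF y, unfolded eq(2) \<phi>Un] by simp_all
      have "generate B (\<phi> (\<Union>\<B>)) \<subseteq> \<beta> ` carrier C"
        by (rule B.generate_subgroup_incl[OF \<phi>sub \<beta>.img_is_subgroup])
      then have "y \<in> \<beta> ` carrier C" using y'(1) by (rule subsetD)
      then obtain x where x: "x \<in> carrier C" "y = \<beta> x" by (rule imageE)
      then have "\<alpha> x \<in> generate A (\<Union>\<B>) \<inter> generate A (\<Union>(\<D> - \<B>))"
        using y' iff[OF sub(1) x(1)] iff[OF sub(2) x(1)] by simp
      moreover have "\<B> \<subseteq> \<D>" by (auto simp: \<B>_def)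
      ultimately have "\<alpha> x = \<one>\<^bsub>A\<^esub>" using ind unfolding independent_family_def by blast
      then show "y \<in> {\<one>\<^bsub>B\<^esub>}" using ker x by simp
    qed
  next
    have U: "\<Union>\<D> \<subseteq> \<alpha> ` carrier C" using Dsub by blast
    show "\<beta> ` carrier C = generate B (\<Union>(\<phi> ` \<D>))"
    proof
      show "generate B (\<Union>(\<phi> ` \<D>)) \<subseteq> \<beta> ` carrier C"
        unfolding \<phi>Un by (rule B.generate_subgroup_incl[OF \<phi>sub \<beta>.img_is_subgroup])
      show "\<beta> ` carrier C \<subseteq> generate B (\<Union>(\<phi> ` \<D>))"
      proof (rule image_subsetI)
        fix x assume x: "x \<in> carrier C"
        then have "\<alpha> x \<in> generate A (\<Union>\<D>)" using gen by (metis imageI)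
        then show "\<beta> x \<in> generate B (\<Union>(\<phi> ` \<D>))" unfolding \<phi>Un using iff[OF U x] by simp
      qed
    qed
  qed
qed

section \<open>Means on compact abelian groups\<close>

lemma continuous_map_euclidean_tendsto:
  "continuous_map X euclidean f \<longleftrightarrow> (\<forall>x\<in>topspace X. (f \<longlongrightarrow> f x) (atin X x))"
  by (simp add: continuous_map_atin)

lemma continuous_map_tendsto_compose:
  assumes "continuous_map X euclidean f" "continuous_on UNIV h"
  shows "continuous_map X euclidean (\<lambda>x. h (f x))"
  using assms by (simp add: continuous_map_euclidean_tendsto continuous_on_tendsto_compose[of UNIV])

lemma continuous_map_times:
  fixes f g :: "'a \<Rightarrow> 'c::real_normed_algebra"
  assumes "continuous_map X euclidean f" "continuous_map X euclidean g"
  shows "continuous_map X euclidean (\<lambda>x. f x * g x)"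
  using assms by (simp add: continuous_map_euclidean_tendsto tendsto_mult)

lemma bounded_of_continuous_map_compact:
  fixes f :: "'a \<Rightarrow> 'c::real_normed_vector"
  assumes "compact_space X" "continuous_map X euclidean f"
  obtains B where "B > 0" "\<And>x. x \<in> topspace X \<Longrightarrow> norm (f x) \<le> B"
proof -
  have "compact (f ` topspace X)"
    using image_compactin[OF _ assms(2), of "topspace X"] assms(1) by (simp add: compact_space_def)
  then have "bounded (f ` topspace X)" by (rule compact_imp_bounded)
  then show ?thesis using that unfolding bounded_pos by auto
qed

locale compact_abelian_group = comm_group G + topological_group G T for G (structure) and T +
  assumes compact: "compact_space T"
begin

lemma topspace_T [simp]: "topspace T = carrier G"
  by (rule topspace_eq_carrier)

lemma continuous_map_mult:
  assumes "continuous_map X T f" "continuous_map X T g"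
  shows "continuous_map X T (\<lambda>x. f x \<otimes> g x)"
proof -
  have "continuous_map X (prod_topology T T) (\<lambda>x. (f x, g x))"
    using assms by (simp add: continuous_map_pairwise o_def)
  from continuous_map_compose[OF this continuous_mult] show ?thesis by (simp add: o_def)
qed

lemma continuous_map_inverse:
  assumes "continuous_map X T f"
  shows "continuous_map X T (\<lambda>x. inv (f x))"
  using continuous_map_compose[OF assms continuous_inv] by (simp add: o_def)

lemma continuous_map_translate:
  assumes "continuous_map T Y f" "a \<in> carrier G"
  shows "continuous_map T Y (\<lambda>x. f (x \<otimes> a))" "continuous_map T Y (\<lambda>x. f (a \<otimes> x))"
proof -
  have "continuous_map T T (\<lambda>x. x \<otimes> a)" "continuous_map T T (\<lambda>x. a \<otimes> x)"
    by (rule continuous_map_mult; use assms(2) in simp)+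
  from this[THEN continuous_map_compose, OF assms(1)]
  show "continuous_map T Y (\<lambda>x. f (x \<otimes> a))" "continuous_map T Y (\<lambda>x. f (a \<otimes> x))"
    by (simp_all add: o_def)
qed

lemma uniformly_continuous:
  fixes f :: "'a \<Rightarrow> 'c::metric_space"
  assumes "continuous_map T euclidean f" "e > 0"
  obtains V where "openin T V" "\<one> \<in> V" "\<And>v x. v \<in> V \<Longrightarrow> x \<in> carrier G \<Longrightarrow> dist (f (x \<otimes> v)) (f x) < e"
proof -
  let ?F = "\<lambda>p. dist (f (snd p \<otimes> fst p)) (f (snd p))"
  have "continuous_map (prod_topology T T) T (\<lambda>p. snd p \<otimes> fst p)"
    by (rule continuous_map_mult) (simp_all add: continuous_map_fst continuous_map_snd)
  from continuous_map_compose[OF this assms(1)]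
  have "continuous_map (prod_topology T T) euclidean (\<lambda>p. f (snd p \<otimes> fst p))" by (simp add: o_def)
  moreover have "continuous_map (prod_topology T T) euclidean (\<lambda>p. f (snd p))"
    using continuous_map_compose[OF continuous_map_snd assms(1), of T] by (simp add: o_def)
  ultimately have "continuous_map (prod_topology T T) euclideanreal ?F"
    by (simp add: continuous_map_euclidean_tendsto tendsto_dist)
  then have "openin (prod_topology T T) {p \<in> topspace (prod_topology T T). ?F p \<in> {..<e}}"
    by (rule openin_continuous_map_preimage) (auto simp: open_lessThan)
  then obtain V U where "openin T V" "openin T U" "{\<one>} \<subseteq> V" "topspace T \<subseteq> U"
    "V \<times> U \<subseteq> {p \<in> topspace (prod_topology T T). ?F p \<in> {..<e}}"
    by (rule Wallace_theorem_prod_topology[rotated 2, of _ _ _ "{\<one>}" "topspace T"])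
      (use assms(2) compact in \<open>auto simp: compact_space_def\<close>)
  then have "dist (f (x \<otimes> v)) (f x) < e" if "v \<in> V" "x \<in> carrier G" for v x
    using that by fastforce
  with \<open>openin T V\<close> \<open>{\<one>} \<subseteq> V\<close> show ?thesis using that by blast
qed

lemma translates_cover:
  assumes "openin T V" "V \<noteq> {}"
  obtains ys where "ys \<noteq> []" "set ys \<subseteq> carrier G" "\<And>x. x \<in> carrier G \<Longrightarrow> \<exists>y\<in>set ys. x \<otimes> y \<in> V"
proof -
  obtain v where v: "v \<in> V" "v \<in> carrier G" using assms openin_subset by fastforce
  let ?U = "\<lambda>a. {x \<in> topspace T. x \<otimes> a \<in> V}"
  have "openin T (?U a)" if "a \<in> carrier G" for a
  proof -
    have "continuous_map T T (\<lambda>x. x \<otimes> a)" using continuous_map_translate(1)[of T id a] that by simp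
    then show ?thesis using assms(1) by (rule openin_continuous_map_preimage)
  qed
  moreover have "topspace T \<subseteq> (\<Union>a\<in>carrier G. ?U a)"
  proof
    fix x assume x: "x \<in> topspace T"
    then have "x \<otimes> (inv x \<otimes> v) = v" using v by (simp add: m_assoc[symmetric])
    with x v show "x \<in> (\<Union>a\<in>carrier G. ?U a)" by (intro UN_I[of "inv x \<otimes> v"]) auto
  qed
  ultimately obtain \<F> where F: "finite \<F>" "\<F> \<subseteq> ?U ` carrier G" "topspace T \<subseteq> \<Union>\<F>"
    using compact[unfolded compact_space_alt, rule_format, of "?U ` carrier G"] by auto
  then obtain A where A: "finite A" "A \<subseteq> carrier G" "\<F> = ?U ` A" by (meson finite_subset_image)
  obtain ys where ys: "set ys = A" using finite_list[OF A(1)] by blast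
  have *: "\<exists>y\<in>set ys. x \<otimes> y \<in> V" if "x \<in> carrier G" for x
    using F(3) that unfolding A(3) ys by auto
  have "ys \<noteq> []" using *[of \<one>] by auto
  with * show ?thesis using that A(2) ys by blast
qed

text \<open>
  By continuity of \<open>x \<otimes> inv y\<close>, the support can be confined to a neighbourhood of \<open>\<one>\<close> whose
  quotients lie in \<open>V\<close>; such a function exists because a compact Hausdorff space is completely
  regular.
\<close>

lemma bump_function:
  assumes "openin T V" "\<one> \<in> V"
  obtains b :: "'a \<Rightarrow> real" where "continuous_map T euclidean b" "b \<one> = 1"
    "\<And>x. x \<in> carrier G \<Longrightarrow> 0 \<le> b x"
    "\<And>x y. x \<in> carrier G \<Longrightarrow> y \<in> carrier G \<Longrightarrow> b x \<noteq> 0 \<Longrightarrow> b y \<noteq> 0 \<Longrightarrow> x \<otimes> inv y \<in> V"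
proof -
  have "continuous_map (prod_topology T T) T (\<lambda>p. fst p \<otimes> inv (snd p))"
    by (intro continuous_map_mult continuous_map_inverse continuous_map_fst continuous_map_snd)
  then have W: "openin (prod_topology T T) {p \<in> topspace (prod_topology T T). fst p \<otimes> inv (snd p) \<in> V}"
    (is "openin _ ?W") using assms(1) by (rule openin_continuous_map_preimage)
  moreover have "(\<one>, \<one>) \<in> ?W" using assms(2) by simp
  ultimately obtain A B where AB: "openin T A" "openin T B" "\<one> \<in> A" "\<one> \<in> B" "A \<times> B \<subseteq> ?W"
    unfolding openin_prod_topology_alt by meson
  have op: "openin T (A \<inter> B)" using AB by blast
  have "normal_space T" using compact Hausdorff compact_Hausdorff_or_regular_imp_normal_space by blast
  then have "completely_regular_space T" using Hausdorff normal_imp_completely_regular_space by blast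
  then obtain g :: "'a \<Rightarrow> real" where g: "continuous_map T (top_of_set {0..1}) g" "g \<one> = 0"
    "g ` (topspace T - A \<inter> B) \<subseteq> {1}"
  proof -
    have "closedin T (topspace T - A \<inter> B)" by (rule closedin_diff[OF closedin_topspace op])
    moreover have "\<one> \<in> topspace T - (topspace T - A \<inter> B)" using AB by auto
    moreover note \<open>completely_regular_space T\<close>
    ultimately show ?thesis
      unfolding completely_regular_space_def using that by blast
  qed
  have g1: "continuous_map T euclidean g" "\<And>x. x \<in> carrier G \<Longrightarrow> g x \<le> 1"
    using g(1) by (auto simp: continuous_map_in_subtopology)
  show ?thesis
  proof
    show "continuous_map T euclidean (\<lambda>x. 1 - g x)"
      using g1(1) by (intro continuous_intros) auto
    show "x \<otimes> inv y \<in> V" if "x \<in> carrier G" "y \<in> carrier G" "1 - g x \<noteq> 0" "1 - g y \<noteq> 0" for x y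
    proof -
      have "x \<in> A" "y \<in> B" using g(3) that by fastforce+
      then show ?thesis using AB(5) by auto
    qed
  qed (use g1 g(2) in auto)
qed

definition avg :: "'a list \<Rightarrow> ('a \<Rightarrow> 'c::real_normed_vector) \<Rightarrow> 'a \<Rightarrow> 'c" where
  "avg ys f x = (\<Sum>y\<leftarrow>ys. f (x \<otimes> y)) /\<^sub>R length ys"

text \<open>
  The constant is the value of the invariant integral of \<open>f\<close>, obtained by averaging translates in
  place of a measure. Since the group is abelian, averages over different lists can be
  combined, which gives uniqueness and additivity.
\<close>

definition has_mean :: "('a \<Rightarrow> 'c::real_normed_vector) \<Rightarrow> 'c \<Rightarrow> bool" where
  "has_mean f c \<longleftrightarrow> (\<forall>e>0. \<exists>ys. ys \<noteq> [] \<and> set ys \<subseteq> carrier G \<and>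
     (\<forall>x\<in>carrier G. norm (avg ys f x - c) \<le> e))"

definition mean :: "('a \<Rightarrow> 'c::real_normed_vector) \<Rightarrow> 'c" where
  "mean f = (THE c. has_mean f c)"

lemma sum_list_swap:
  fixes F :: "'x \<Rightarrow> 'y \<Rightarrow> 'c::comm_monoid_add"
  shows "(\<Sum>x\<leftarrow>xs. \<Sum>y\<leftarrow>ys. F x y) = (\<Sum>y\<leftarrow>ys. \<Sum>x\<leftarrow>xs. F x y)"
  by (induction xs) (simp_all add: sum_list_addf)

lemma sum_list_scaleR:
  fixes F :: "'x \<Rightarrow> 'c::real_vector"
  shows "(\<Sum>x\<leftarrow>xs. r *\<^sub>R F x) = r *\<^sub>R (\<Sum>x\<leftarrow>xs. F x)"
  by (induction xs) (simp_all add: scaleR_add_right)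

text \<open>
  Commutativity of the group is used here: two averaging operations can be interchanged, so
  averages over two lists have a common refinement.
\<close>

lemma avg_commute:
  assumes "x \<in> carrier G" "set ys \<subseteq> carrier G" "set zs \<subseteq> carrier G"
  shows "avg ys (avg zs f) x = avg zs (avg ys f) x"
proof -
  have "(\<Sum>y\<leftarrow>ys. \<Sum>z\<leftarrow>zs. f (x \<otimes> y \<otimes> z)) = (\<Sum>y\<leftarrow>ys. \<Sum>z\<leftarrow>zs. f (x \<otimes> z \<otimes> y))"
    using assms by (intro arg_cong[of _ _ sum_list] map_cong refl) (auto simp: m_ac subset_iff)
  also have "\<dots> = (\<Sum>z\<leftarrow>zs. \<Sum>y\<leftarrow>ys. f (x \<otimes> z \<otimes> y))" by (rule sum_list_swap)
  finally show ?thesis by (simp add: avg_def sum_list_scaleR mult.commute)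
qed

lemma avg_avg:
  assumes "set ys \<subseteq> carrier G" "set zs \<subseteq> carrier G" "ys \<noteq> []" "zs \<noteq> []"
  obtains ws where "ws \<noteq> []" "set ws \<subseteq> carrier G"
    "\<And>(f :: 'a \<Rightarrow> 'c::real_normed_vector) x. x \<in> carrier G \<Longrightarrow> avg ws f x = avg ys (avg zs f) x"
proof
  let ?ws = "concat (map (\<lambda>y. map (\<lambda>z. y \<otimes> z) zs) ys)"
  show "?ws \<noteq> []" using assms by (cases ys; cases zs) auto
  show "set ?ws \<subseteq> carrier G" using assms by auto
  have len: "length ?ws = length ys * length zs" by (induction ys) auto
  fix f :: "'a \<Rightarrow> 'c" and x assume x: "x \<in> carrier G"
  have "(\<Sum>w\<leftarrow>?ws. f (x \<otimes> w)) = (\<Sum>y\<leftarrow>ys. \<Sum>z\<leftarrow>zs. f (x \<otimes> y \<otimes> z))"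
    using assms(1) 
  proof (induction ys)
    case (Cons a ys)
    have "(\<Sum>z\<leftarrow>zs. f (x \<otimes> (a \<otimes> z))) = (\<Sum>z\<leftarrow>zs. f (x \<otimes> a \<otimes> z))"
      using Cons.prems assms(2) x
      by (intro arg_cong[of _ _ sum_list] map_cong refl) (auto simp: m_assoc subset_iff)
    with Cons show ?case by (simp add: o_def)
  qed simp
  then show "avg ?ws f x = avg ys (avg zs f) x"
    unfolding avg_def len by (simp add: sum_list_scaleR)
qed

lemma norm_avg_le:
  assumes "ys \<noteq> []" "set ys \<subseteq> carrier G" "x \<in> carrier G"
    and "\<And>x. x \<in> carrier G \<Longrightarrow> norm (f x - c) \<le> e"
  shows "norm (avg ys f x - c) \<le> e"
proof -
  have "norm ((\<Sum>y\<leftarrow>ys. f (x \<otimes> y)) - length ys *\<^sub>R c) \<le> length ys * e"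
    using assms(2)
  proof (induction ys)
    case (Cons a ys)
    have eq: "(\<Sum>y\<leftarrow>a # ys. f (x \<otimes> y)) - length (a # ys) *\<^sub>R c
      = (f (x \<otimes> a) - c) + ((\<Sum>y\<leftarrow>ys. f (x \<otimes> y)) - length ys *\<^sub>R c)"
      by (simp add: algebra_simps)
    have "norm (f (x \<otimes> a) - c) \<le> e" using assms(3,4) Cons.prems by simp
    moreover have "norm ((\<Sum>y\<leftarrow>ys. f (x \<otimes> y)) - length ys *\<^sub>R c) \<le> length ys * e"
      using Cons by simp
    ultimately have "norm ((\<Sum>y\<leftarrow>a # ys. f (x \<otimes> y)) - length (a # ys) *\<^sub>R c) \<le> e + length ys * e"
      unfolding eq by (meson norm_triangle_mono)
    then show ?case by (simp add: algebra_simps)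
  qed simp
  moreover have eq: "avg ys f x - c = ((\<Sum>y\<leftarrow>ys. f (x \<otimes> y)) - length ys *\<^sub>R c) /\<^sub>R length ys"
    using assms(1) by (simp add: avg_def scaleR_diff_right)
  ultimately show ?thesis using assms(1) unfolding eq norm_scaleR by (simp add: divide_simps mult.commute)
qed

lemma avg_cong:
  "(\<And>x. x \<in> carrier G \<Longrightarrow> f x = g x) \<Longrightarrow> set ys \<subseteq> carrier G \<Longrightarrow> x \<in> carrier G \<Longrightarrow> avg ys f x = avg ys g x"
  unfolding avg_def by (intro arg_cong[of _ _ "\<lambda>s. s /\<^sub>R _"] arg_cong[of _ _ sum_list] map_cong refl)
    (auto simp: subset_iff)

lemma avg_add: "avg ys (\<lambda>x. f x + g x) x = avg ys f x + avg ys g x"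
  by (simp add: avg_def sum_list_addf scaleR_add_right)

lemma avg_fun_add: "avg ys (\<lambda>x. f x + g x) = (\<lambda>x. avg ys f x + avg ys g x)"
  by (rule ext) (rule avg_add)

lemma avg_linear:
  assumes "bounded_linear h"
  shows "avg ys (\<lambda>x. h (f x)) x = h (avg ys f x)"
proof -
  interpret h: bounded_linear h by fact
  have "(\<Sum>y\<leftarrow>ys. h (f (x \<otimes> y))) = h (\<Sum>y\<leftarrow>ys. f (x \<otimes> y))"
    by (induction ys) (simp_all add: h.zero h.add)
  then show ?thesis by (simp add: avg_def h.scaleR)
qed

lemma has_mean_add:
  fixes f g :: "'a \<Rightarrow> 'c::real_normed_vector"
  assumes "has_mean f c" "has_mean g d"
  shows "has_mean (\<lambda>x. f x + g x) (c + d)"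
  unfolding has_mean_def
proof (intro allI impI)
  fix e :: real assume "e > 0"
  then have "e / 2 > 0" by simp
  then obtain ys zs where ys: "ys \<noteq> []" "set ys \<subseteq> carrier G" "\<And>x. x \<in> carrier G \<Longrightarrow> norm (avg ys f x - c) \<le> e/2"
    and zs: "zs \<noteq> []" "set zs \<subseteq> carrier G" "\<And>x. x \<in> carrier G \<Longrightarrow> norm (avg zs g x - d) \<le> e/2"
    using assms unfolding has_mean_def by metis
  obtain ws where ws: "ws \<noteq> []" "set ws \<subseteq> carrier G"
    "\<And>(f :: 'a \<Rightarrow> 'c) x. x \<in> carrier G \<Longrightarrow> avg ws f x = avg ys (avg zs f) x"
    using avg_avg[OF ys(2) zs(2) ys(1) zs(1)] by blast
  have "norm (avg ws (\<lambda>x. f x + g x) x - (c + d)) \<le> e" if x: "x \<in> carrier G" for x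
  proof -
    have "avg ws (\<lambda>x. f x + g x) x = avg zs (avg ys f) x + avg ys (avg zs g) x"
      using ws(3)[OF x] avg_commute[OF x ys(2) zs(2), of f] by (simp add: avg_add avg_fun_add)
    then have eq: "avg ws (\<lambda>x. f x + g x) x - (c + d) = (avg zs (avg ys f) x - c) + (avg ys (avg zs g) x - d)"
      by simp
    have "norm (avg zs (avg ys f) x - c) \<le> e/2" by (rule norm_avg_le[OF zs(1,2) x ys(3)])
    moreover have "norm (avg ys (avg zs g) x - d) \<le> e/2" by (rule norm_avg_le[OF ys(1,2) x zs(3)])
    ultimately have "norm ((avg zs (avg ys f) x - c) + (avg ys (avg zs g) x - d)) \<le> e/2 + e/2"
      by (intro norm_triangle_mono)
    then show ?thesis unfolding eq by simp
  qed
  with ws show "\<exists>ys. ys \<noteq> [] \<and> set ys \<subseteq> carrier G \<and>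
      (\<forall>x\<in>carrier G. norm (avg ys (\<lambda>x. f x + g x) x - (c + d)) \<le> e)" by blast
qed

lemma has_mean_linear:
  assumes "has_mean f c" "bounded_linear h"
  shows "has_mean (\<lambda>x. h (f x)) (h c)"
  unfolding has_mean_def
proof (intro allI impI)
  interpret h: bounded_linear h by fact
  fix e :: real assume "e > 0"
  obtain K where K: "K > 0" "\<And>x. norm (h x) \<le> norm x * K" using h.pos_bounded by blast
  from \<open>e > 0\<close> K have "e / K > 0" by simp
  then obtain ys where ys: "ys \<noteq> []" "set ys \<subseteq> carrier G" "\<And>x. x \<in> carrier G \<Longrightarrow> norm (avg ys f x - c) \<le> e/K"
    using assms(1) unfolding has_mean_def by metis
  have "norm (avg ys (\<lambda>x. h (f x)) x - h c) \<le> e" if "x \<in> carrier G" for x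
  proof -
    have "norm (h (avg ys f x - c)) \<le> norm (avg ys f x - c) * K" by (rule K)
    also have "\<dots> \<le> e" using ys(3)[OF that] K(1) by (simp add: field_simps)
    finally show ?thesis by (simp add: avg_linear[OF assms(2)] h.diff)
  qed
  with ys show "\<exists>ys. ys \<noteq> [] \<and> set ys \<subseteq> carrier G \<and>
      (\<forall>x\<in>carrier G. norm (avg ys (\<lambda>x. h (f x)) x - h c) \<le> e)" by blast
qed

lemma has_mean_const: "has_mean (\<lambda>x. c) c"
  unfolding has_mean_def
  by (intro allI impI exI[of _ "[\<one>]"]) (simp add: avg_def)

lemma has_mean_cong:
  assumes "has_mean f c" "\<And>x. x \<in> carrier G \<Longrightarrow> f x = g x"
  shows "has_mean g c"
  using assms(1) unfolding has_mean_def by (metis (no_types, lifting) avg_cong assms(2))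

lemma has_mean_translate:
  assumes "has_mean f c" "a \<in> carrier G"
  shows "has_mean (\<lambda>x. f (x \<otimes> a)) c"
  unfolding has_mean_def
proof (intro allI impI)
  fix e :: real assume "e > 0"
  then obtain ys where ys: "ys \<noteq> []" "set ys \<subseteq> carrier G" "\<And>x. x \<in> carrier G \<Longrightarrow> norm (avg ys f x - c) \<le> e"
    using assms unfolding has_mean_def by metis
  have "avg ys (\<lambda>x. f (x \<otimes> a)) x = avg ys f (x \<otimes> a)" if "x \<in> carrier G" for x
    unfolding avg_def using ys(2) that assms(2)
    by (intro arg_cong[of _ _ "\<lambda>s. s /\<^sub>R _"] arg_cong[of _ _ sum_list] map_cong refl)
      (auto simp: m_ac subset_iff)
  then show "\<exists>ys. ys \<noteq> [] \<and> set ys \<subseteq> carrier G \<and>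
      (\<forall>x\<in>carrier G. norm (avg ys (\<lambda>x. f (x \<otimes> a)) x - c) \<le> e)"
    using ys assms(2) by (intro exI[of _ ys]) auto
qed

text \<open>
  Averaging once more preserves the approximation by a constant, and the two averages of averages
  agree; thus both constants are close to the same value.
\<close>

lemma avg_centres_close:
  assumes "ys \<noteq> []" "set ys \<subseteq> carrier G" "\<And>x. x \<in> carrier G \<Longrightarrow> norm (avg ys f x - c) \<le> d"
    and "zs \<noteq> []" "set zs \<subseteq> carrier G" "\<And>x. x \<in> carrier G \<Longrightarrow> norm (avg zs f x - c') \<le> d'"
  shows "norm (c - c') \<le> d + d'"
proof -
  have "norm (avg zs (avg ys f) \<one> - c) \<le> d" by (rule norm_avg_le[OF assms(4,5) one_closed assms(3)])
  moreover have "norm (avg ys (avg zs f) \<one> - c') \<le> d'" by (rule norm_avg_le[OF assms(1,2) one_closed assms(6)])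
  moreover have "avg zs (avg ys f) \<one> = avg ys (avg zs f) \<one>" by (rule avg_commute) (use assms in auto)
  ultimately have "norm ((avg zs (avg ys f) \<one> - c') - (avg zs (avg ys f) \<one> - c)) \<le> d' + d"
    by (intro order_trans[OF norm_triangle_ineq4]) simp
  then show ?thesis by simp
qed

lemma has_mean_bound:
  assumes "has_mean f c" "zs \<noteq> []" "set zs \<subseteq> carrier G"
    and "\<And>x. x \<in> carrier G \<Longrightarrow> norm (avg zs f x - d) \<le> e"
  shows "norm (c - d) \<le> e"
proof (rule field_le_epsilon)
  fix e' :: real assume "e' > 0"
  then obtain ys where ys: "ys \<noteq> []" "set ys \<subseteq> carrier G" "\<And>x. x \<in> carrier G \<Longrightarrow> norm (avg ys f x - c) \<le> e'"
    using assms unfolding has_mean_def by metis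
  from avg_centres_close[OF ys assms(2-4)] show "norm (c - d) \<le> e + e'" by simp
qed

lemma has_mean_bound':
  assumes "has_mean f c" "\<And>x. x \<in> carrier G \<Longrightarrow> norm (f x - d) \<le> e"
  shows "norm (c - d) \<le> e"
  by (rule has_mean_bound[OF assms(1), of "[\<one>]"]) (simp_all add: avg_def assms(2))

lemma has_mean_unique: "has_mean f c \<Longrightarrow> has_mean f d \<Longrightarrow> c = d"
proof -
  assume *: "has_mean f c" "has_mean f d"
  have "norm (c - d) \<le> e" if e: "e > 0" for e
  proof -
    from *(2) e obtain zs where "zs \<noteq> []" "set zs \<subseteq> carrier G" "\<forall>x\<in>carrier G. norm (avg zs f x - d) \<le> e"
      unfolding has_mean_def by blast
    then show ?thesis by (intro has_mean_bound[OF *(1)]) auto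
  qed
  then have "norm (c - d) \<le> 0" by (metis add_0 field_le_epsilon)
  then show ?thesis by simp
qed

lemma mean_eq: "has_mean f c \<Longrightarrow> mean f = c"
  unfolding mean_def by (blast intro: has_mean_unique)


lemma sum_list_gap:
  fixes F :: "'x \<Rightarrow> real" and U L :: real
  assumes "\<And>z. z \<in> set zs \<Longrightarrow> F z \<le> U" "z \<in> set zs" "F z \<le> L"
  shows "(\<Sum>z\<leftarrow>zs. F z) \<le> length zs * U - (U - L)"
  using assms
proof (induction zs)
  case (Cons a zs)
  have tot: "(\<Sum>z\<leftarrow>zs. F z) \<le> length zs * U"
    using sum_list_mono[of zs F "\<lambda>_. U"] Cons.prems(1) by (simp add: sum_list_triv)
  show ?case
  proof (cases "z = a")
    case True
    with tot Cons.prems(3) show ?thesis by (simp add: algebra_simps)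
  next
    case False
    then have "(\<Sum>z\<leftarrow>zs. F z) \<le> length zs * U - (U - L)" using Cons by simp
    moreover have "F a \<le> U" using Cons.prems(1) by simp
    ultimately show ?thesis by (simp add: algebra_simps)
  qed
qed simp

text \<open>
  If all values of an average \<open>g\<close> lie within \<open>d\<close> of \<open>c\<close>, then \<open>g\<close> is, on a whole neighbourhood
  \<open>V\<close> of \<open>\<one>\<close>, at most slightly above \<open>c\<close>, or at least slightly below it, depending on the side of
  \<open>g \<one>\<close>. Every point has one of finitely many translates in \<open>V\<close>, so averaging over these
  translates moves one end of the range towards the other by a fixed fraction. The neighbourhood
  depends on the modulus of continuity of \<open>f\<close> alone, which all averages of \<open>f\<close> inherit;
  therefore one factor \<open>q\<close> serves for all of them.
\<close>

lemma avg_oscillation_shrinks: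
  fixes f :: "'a \<Rightarrow> real"
  assumes f: "continuous_map T euclidean f" and e: "e > 0"
  obtains q where "0 \<le> q" "q < 1" "\<And>ys c d. \<lbrakk>ys \<noteq> []; set ys \<subseteq> carrier G; d \<ge> 2 * e;
      \<forall>x\<in>carrier G. \<bar>avg ys f x - c\<bar> \<le> d\<rbrakk> \<Longrightarrow>
      \<exists>ws c'. ws \<noteq> [] \<and> set ws \<subseteq> carrier G \<and> (\<forall>x\<in>carrier G. \<bar>avg ws f x - c'\<bar> \<le> q * d)"
proof -
  obtain V where V: "openin T V" "\<one> \<in> V"
    "\<And>v x. v \<in> V \<Longrightarrow> x \<in> carrier G \<Longrightarrow> dist (f (x \<otimes> v)) (f x) < e"
    using uniformly_continuous[OF f e] by blast
  obtain zs where zs: "zs \<noteq> []" "set zs \<subseteq> carrier G" "\<And>x. x \<in> carrier G \<Longrightarrow> \<exists>z\<in>set zs. x \<otimes> z \<in> V"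
    using translates_cover[OF V(1)] V(2) by blast
  define N where "N = real (length zs)"
  have N: "N \<ge> 1" using zs(1) by (cases zs) (auto simp: N_def)
  show ?thesis
  proof (rule that[of "1 - 1 / (4 * N)"])
    show "0 \<le> 1 - 1 / (4 * N)" "1 - 1 / (4 * N) < 1" using N by (auto simp: field_simps)
    fix ys c d assume ys: "ys \<noteq> []" "set ys \<subseteq> carrier G" and d: "d \<ge> 2 * e"
      and b: "\<forall>x\<in>carrier G. \<bar>avg ys f x - c\<bar> \<le> d"
    let ?g = "avg ys f"
    have near: "\<bar>?g v - ?g \<one>\<bar> \<le> e" if v: "v \<in> V" for v
    proof -
      have vc: "v \<in> carrier G" using v V(1) openin_subset by fastforce
      have "\<bar>avg ys (\<lambda>x. f (x \<otimes> v) - f x) \<one> - 0\<bar> \<le> e"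
        unfolding real_norm_def[symmetric]
        by (rule norm_avg_le[OF ys one_closed]) (use V(3)[OF v] in \<open>force simp: dist_real_def\<close>)
      moreover have "avg ys (\<lambda>x. f (x \<otimes> v) - f x) \<one> = ?g v - ?g \<one>"
      proof -
        have "(\<Sum>y\<leftarrow>ys. f (\<one> \<otimes> y \<otimes> v) - f (\<one> \<otimes> y)) = (\<Sum>y\<leftarrow>ys. f (v \<otimes> y) - f (\<one> \<otimes> y))"
          using ys(2) vc by (intro arg_cong[of _ _ sum_list] map_cong refl) (auto simp: m_comm subset_iff)
        then show ?thesis by (simp add: avg_def sum_list_subtractf right_diff_distrib)
      qed
      ultimately show ?thesis by simp
    qed
    obtain ws where ws: "ws \<noteq> []" "set ws \<subseteq> carrier G"
      "\<And>(f :: 'a \<Rightarrow> real) x. x \<in> carrier G \<Longrightarrow> avg ws f x = avg zs (avg ys f) x"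
      using avg_avg[OF zs(2) ys(2) zs(1) ys(1)] by blast
    have bd: "\<bar>?g (x \<otimes> z) - c\<bar> \<le> d" if "x \<in> carrier G" "z \<in> set zs" for x z
      using b that zs(2) by (meson m_closed subsetD)
    have low: "c - d \<le> avg zs ?g x" and up: "avg zs ?g x \<le> c + d" if "x \<in> carrier G" for x
      using norm_avg_le[OF zs(1,2) that, of ?g c d] b by (auto simp: abs_le_iff)
    have Nz: "avg zs h x = (\<Sum>z\<leftarrow>zs. h (x \<otimes> z)) / N" for h :: "'a \<Rightarrow> real" and x
      by (simp add: avg_def N_def divide_inverse mult.commute)
    show "\<exists>ws c'. ws \<noteq> [] \<and> set ws \<subseteq> carrier G \<and>
        (\<forall>x\<in>carrier G. \<bar>avg ws f x - c'\<bar> \<le> (1 - 1 / (4 * N)) * d)"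
    proof (cases "?g \<one> \<le> c")
      case True
      have up': "avg zs ?g x \<le> c + d - (d - e) / N" if x: "x \<in> carrier G" for x
      proof -
        obtain z where z: "z \<in> set zs" "x \<otimes> z \<in> V" using zs(3)[OF x] by blast
        have "(\<Sum>z\<leftarrow>zs. ?g (x \<otimes> z)) \<le> length zs * (c + d) - ((c + d) - (c + e))"
        proof (rule sum_list_gap[OF _ z(1)])
          show "?g (x \<otimes> z) \<le> c + e" using near[OF z(2)] True by linarith
          fix z' assume "z' \<in> set zs"
          from bd[OF x this] show "?g (x \<otimes> z') \<le> c + d" by linarith
        qed
        then show ?thesis using N unfolding Nz N_def[symmetric] by (simp add: field_simps)
      qed
      have "\<bar>avg ws f x - (c - (d - e) / (2 * N))\<bar> \<le> (1 - 1 / (4 * N)) * d" if x: "x \<in> carrier G" for x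
      proof -
        have "(d - e) / (2 * N) \<ge> d / (4 * N)" using d N by (simp add: field_simps)
        moreover have "(d - e) / N = (d - e) / (2 * N) + (d - e) / (2 * N)" by simp
        moreover have "(1 - 1 / (4 * N)) * d = d - d / (4 * N)" by (simp add: algebra_simps)
        ultimately show ?thesis using up'[OF x] low[OF x] unfolding ws(3)[OF x] abs_le_iff by linarith
      qed
      with ws(1,2) show ?thesis by blast
    next
      case False
      have low': "avg zs ?g x \<ge> c - d + (d - e) / N" if x: "x \<in> carrier G" for x
      proof -
        obtain z where z: "z \<in> set zs" "x \<otimes> z \<in> V" using zs(3)[OF x] by blast
        have "(\<Sum>z\<leftarrow>zs. - ?g (x \<otimes> z)) \<le> length zs * (d - c) - ((d - c) - (e - c))"
        proof (rule sum_list_gap[OF _ z(1)])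
          show "- ?g (x \<otimes> z) \<le> e - c" using near[OF z(2)] False by linarith
          fix z' assume "z' \<in> set zs"
          from bd[OF x this] show "- ?g (x \<otimes> z') \<le> d - c" by linarith
        qed
        moreover have "(\<Sum>z\<leftarrow>zs. - ?g (x \<otimes> z)) = - (\<Sum>z\<leftarrow>zs. ?g (x \<otimes> z))" by (simp add: uminus_sum_list_map o_def)
        ultimately have "N * (c - d) + (d - e) \<le> (\<Sum>z\<leftarrow>zs. ?g (x \<otimes> z))"
          unfolding N_def[symmetric] by (simp add: algebra_simps)
        then have "(N * (c - d) + (d - e)) / N \<le> (\<Sum>z\<leftarrow>zs. ?g (x \<otimes> z)) / N"
          using N by (intro divide_right_mono) auto
        then show ?thesis using N unfolding Nz by (simp add: add_divide_distrib)
      qed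
      have "\<bar>avg ws f x - (c + (d - e) / (2 * N))\<bar> \<le> (1 - 1 / (4 * N)) * d" if x: "x \<in> carrier G" for x
      proof -
        have "(d - e) / (2 * N) \<ge> d / (4 * N)" using d N by (simp add: field_simps)
        moreover have "(d - e) / N = (d - e) / (2 * N) + (d - e) / (2 * N)" by simp
        moreover have "(1 - 1 / (4 * N)) * d = d - d / (4 * N)" by (simp add: algebra_simps)
        ultimately show ?thesis using low'[OF x] up[OF x] unfolding ws(3)[OF x] abs_le_iff by linarith
      qed
      with ws(1,2) show ?thesis by blast
    qed
  qed
qed

text \<open>
  Iterating the contraction of the range produces averages that are arbitrarily close to
  constants. These constants form a Cauchy sequence because averages of averages commute.
\<close>

lemma ex_mean_real:
  fixes f :: "'a \<Rightarrow> real"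
  assumes f: "continuous_map T euclidean f"
  shows "\<exists>c. has_mean f c"
proof -
  define R where "R = (\<lambda>d. \<exists>ys c. ys \<noteq> [] \<and> set ys \<subseteq> carrier G \<and> (\<forall>x\<in>carrier G. \<bar>avg ys f x - c\<bar> \<le> d))"
  obtain B where B: "B > 0" "\<And>x. x \<in> carrier G \<Longrightarrow> norm (f x) \<le> B"
    using bounded_of_continuous_map_compact[OF compact f] by auto
  have RB: "R B" unfolding R_def
    by (rule exI[of _ "[\<one>]"], rule exI[of _ 0]) (use B(2) in \<open>simp add: avg_def\<close>)
  have small: "\<exists>d<2 * e. R d" if e: "e > 0" for e
  proof (rule ccontr)
    assume no: "\<not> (\<exists>d<2 * e. R d)"
    obtain q where q: "0 \<le> q" "q < 1" and step: "\<And>d. d \<ge> 2 * e \<Longrightarrow> R d \<Longrightarrow> R (q * d)"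
      using avg_oscillation_shrinks[OF f e] unfolding R_def by metis
    have all: "R (q ^ n * B)" for n
    proof (induction n)
      case (Suc n)
      then have "R (q * (q ^ n * B))" using no by (intro step) force+
      then show ?case by (simp add: mult.assoc)
    qed (simp add: RB)
    have "(\<lambda>n. q ^ n * B) \<longlonglongrightarrow> 0 * B"
      using q by (intro tendsto_mult LIMSEQ_power_zero tendsto_const) auto
    then have "eventually (\<lambda>n. q ^ n * B < 2 * e) sequentially"
      using e by (intro order_tendstoD) auto
    then show False using all no by (auto simp: eventually_sequentially)
  qed
  have "\<exists>ys c. ys \<noteq> [] \<and> set ys \<subseteq> carrier G \<and> (\<forall>x\<in>carrier G. norm (avg ys f x - c) \<le> inverse (real (Suc n)))" for n
  proof -
    obtain d ys c where "d < 2 * (inverse (Suc n) / 2)" "ys \<noteq> []" "set ys \<subseteq> carrier G"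
      "\<forall>x\<in>carrier G. \<bar>avg ys f x - c\<bar> \<le> d"
      using small[of "inverse (Suc n) / 2"] unfolding R_def by auto
    then show ?thesis by (intro exI[of _ ys] exI[of _ c]) fastforce
  qed
  then obtain ys c where yc: "\<And>n. ys n \<noteq> []" "\<And>n. set (ys n) \<subseteq> carrier G"
    "\<And>n x. x \<in> carrier G \<Longrightarrow> norm (avg (ys n) f x - c n) \<le> inverse (real (Suc n))" by metis
  have dist: "norm (c m - c n) \<le> inverse (real (Suc m)) + inverse (real (Suc n))" for m n
    by (rule avg_centres_close[OF yc(1,2,3) yc(1,2,3)])
  have "Cauchy c"
  proof (rule metric_CauchyI)
    fix e :: real assume "e > 0"
    then obtain M where M: "inverse (real (Suc M)) < e / 2" using reals_Archimedean[of "e/2"] by auto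
    have "dist (c m) (c n) < e" if "m \<ge> M" "n \<ge> M" for m n
    proof -
      have "inverse (real (Suc m)) \<le> inverse (real (Suc M))" "inverse (real (Suc n)) \<le> inverse (real (Suc M))"
        using that by (simp_all add: le_imp_inverse_le)
      then show ?thesis using dist[of m n] M unfolding dist_norm by linarith
    qed
    then show "\<exists>M. \<forall>m\<ge>M. \<forall>n\<ge>M. dist (c m) (c n) < e" by blast
  qed
  then obtain l where l: "c \<longlonglongrightarrow> l" using Cauchy_convergent convergent_def by blast
  have cl: "norm (c n - l) \<le> inverse (real (Suc n))" for n
  proof (rule LIMSEQ_le)
    show "(\<lambda>m. norm (c n - c m)) \<longlonglongrightarrow> norm (c n - l)" using l by (intro tendsto_intros)
    show "(\<lambda>m. inverse (real (Suc n)) + inverse (real (Suc m))) \<longlonglongrightarrow> inverse (real (Suc n))"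
      using tendsto_add[OF tendsto_const LIMSEQ_inverse_real_of_nat] by simp
  qed (use dist in blast)
  show ?thesis
  proof (rule exI[of _ l], unfold has_mean_def, intro allI impI)
    fix e :: real assume "e > 0"
    then obtain n where n: "inverse (real (Suc n)) < e / 2" using reals_Archimedean[of "e/2"] by auto
    have "norm (avg (ys n) f x - l) \<le> e" if "x \<in> carrier G" for x
      using yc(3)[OF that, of n] cl[of n] n by (simp add: abs_le_iff)
    then show "\<exists>ys. ys \<noteq> [] \<and> set ys \<subseteq> carrier G \<and> (\<forall>x\<in>carrier G. norm (avg ys f x - l) \<le> e)"
      using yc by blast
  qed
qed

lemma has_mean_real:
  fixes f :: "'a \<Rightarrow> real"
  assumes "continuous_map T euclidean f"
  shows "has_mean f (mean f)"
  using ex_mean_real[OF assms] mean_eq by blast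

lemma has_mean_complex:
  fixes f :: "'a \<Rightarrow> complex"
  assumes "continuous_map T euclidean f"
  shows "has_mean f (mean f)"
proof -
  have "continuous_map T euclidean (\<lambda>x. Re (f x))" "continuous_map T euclidean (\<lambda>x. Im (f x))"
    using assms by (simp_all add: continuous_map_euclidean_tendsto tendsto_Re tendsto_Im)
  then obtain a b where "has_mean (\<lambda>x. Re (f x)) a" "has_mean (\<lambda>x. Im (f x)) b" using ex_mean_real by blast
  then have "has_mean (\<lambda>x. complex_of_real (Re (f x)) + \<i> * complex_of_real (Im (f x))) (of_real a + \<i> * of_real b)"
    by (intro has_mean_add has_mean_linear[of _ _ of_real] has_mean_linear[of _ _ "\<lambda>x. \<i> * of_real x"])
      (auto intro!: bounded_linear_of_real bounded_linear_mult_right[THEN bounded_linear_compose, unfolded o_def])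
  then have "has_mean f (of_real a + \<i> * of_real b)" by (simp add: complex_eq[symmetric])
  from this mean_eq[OF this] show ?thesis by simp
qed

lemma has_mean_mono:
  fixes f g :: "'a \<Rightarrow> real"
  assumes "has_mean f c" "has_mean g d" "\<And>x. x \<in> carrier G \<Longrightarrow> f x \<le> g x"
  shows "c \<le> d"
proof (rule field_le_epsilon)
  fix e :: real assume e: "e > 0"
  have "has_mean (\<lambda>x. g x + - f x) (d + - c)"
    by (rule has_mean_add[OF assms(2) has_mean_linear[OF assms(1)]]) (rule bounded_linear_minus[OF bounded_linear_ident])
  with e obtain ys where ys: "ys \<noteq> []" "set ys \<subseteq> carrier G"
    "\<forall>x\<in>carrier G. norm (avg ys (\<lambda>x. g x + - f x) x - (d + - c)) \<le> e"
    unfolding has_mean_def by blast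
  have "avg ys (\<lambda>x. g x + - f x) \<one> \<ge> 0"
    using assms(3) ys(2) by (auto simp: avg_def subset_iff intro!: sum_list_nonneg mult_nonneg_nonneg)
  moreover have "norm (avg ys (\<lambda>x. g x + - f x) \<one> - (d + - c)) \<le> e" using ys(3) by blast
  ultimately show "c \<le> d + e" by (simp add: abs_le_iff)
qed

text \<open>
  A function that is positive at one point is bounded below by a positive constant on some open
  set, finitely many translates of which cover the group; so some average of it is bounded below
  by a positive constant.
\<close>

lemma has_mean_pos:
  fixes f :: "'a \<Rightarrow> real"
  assumes "has_mean f c" "continuous_map T euclidean f" "\<And>x. x \<in> carrier G \<Longrightarrow> 0 \<le> f x"
    and a: "a \<in> carrier G" "0 < f a"
  shows "0 < c"
proof -
  let ?V = "{x \<in> topspace T. f x \<in> {f a / 2<..}}"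
  have V: "openin T ?V" using assms(2) by (rule openin_continuous_map_preimage) (auto simp: open_greaterThan)
  have "a \<in> ?V" using a by auto
  then obtain zs where zs: "zs \<noteq> []" "set zs \<subseteq> carrier G" "\<And>x. x \<in> carrier G \<Longrightarrow> \<exists>z\<in>set zs. x \<otimes> z \<in> ?V"
    using translates_cover[OF V] by blast
  define m where "m = f a / 2 / length zs"
  have m: "m > 0" using zs(1) a(2) by (simp add: m_def)
  obtain ys where ys: "ys \<noteq> []" "set ys \<subseteq> carrier G" "\<And>x. x \<in> carrier G \<Longrightarrow> norm (avg ys f x - c) \<le> m / 2"
    using assms(1) m unfolding has_mean_def by (metis half_gt_zero)
  have low: "m \<le> avg zs f x" if x: "x \<in> carrier G" for x
  proof -
    obtain z where z: "z \<in> set zs" "x \<otimes> z \<in> ?V" using zs(3)[OF x] by blast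
    have "f a / 2 \<le> f (x \<otimes> z)" using z by simp
    also have "\<dots> \<le> (\<Sum>z\<leftarrow>zs. f (x \<otimes> z))"
      by (rule member_le_sum_list) (use z x zs(2) assms(3) in \<open>auto simp: subset_iff\<close>)
    finally show ?thesis using zs(1) by (simp add: avg_def m_def field_simps)
  qed
  have "m \<le> avg ys (avg zs f) \<one>"
  proof -
    have "(\<Sum>y\<leftarrow>ys. m) \<le> (\<Sum>y\<leftarrow>ys. avg zs f (\<one> \<otimes> y))"
      by (rule sum_list_mono) (use low ys(2) in auto)
    then show ?thesis using ys(1) by (simp add: avg_def[of ys] sum_list_triv field_simps)
  qed
  moreover have "avg ys (avg zs f) \<one> = avg zs (avg ys f) \<one>" by (rule avg_commute) (use zs ys in auto)
  moreover have "norm (avg zs (avg ys f) \<one> - c) \<le> m / 2" by (rule norm_avg_le[OF zs(1,2) one_closed ys(3)])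
  ultimately show ?thesis using m unfolding real_norm_def abs_le_iff by linarith
qed

end

section \<open>Positive definite functions and characters\<close>

definition pd_form :: "('a, 'm) monoid_scheme \<Rightarrow> ('a \<Rightarrow> complex) \<Rightarrow> (complex \<times> 'a) list \<Rightarrow> (complex \<times> 'a) list \<Rightarrow> complex" where
  "pd_form G \<phi> ps qs = (\<Sum>p\<leftarrow>ps. \<Sum>q\<leftarrow>qs. fst p * cnj (fst q) * \<phi> (snd p \<otimes>\<^bsub>G\<^esub> inv\<^bsub>G\<^esub> (snd q)))"

definition pos_def :: "('a, 'm) monoid_scheme \<Rightarrow> ('a \<Rightarrow> complex) \<Rightarrow> bool" where
  "pos_def G \<phi> \<longleftrightarrow> (\<forall>ps. snd ` set ps \<subseteq> carrier G \<longrightarrow>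
     0 \<le> Re (pd_form G \<phi> ps ps) \<and> Im (pd_form G \<phi> ps ps) = 0)"

text \<open>
  The functions vanish off the carrier so that the set is compact in the topology of pointwise
  convergence on the whole type.
\<close>

definition states :: "('a, 'm) monoid_scheme \<Rightarrow> ('a \<Rightarrow> complex) set" where
  "states G = {\<phi>. pos_def G \<phi> \<and> \<phi> \<one>\<^bsub>G\<^esub> = 1 \<and> (\<forall>x. x \<notin> carrier G \<longrightarrow> \<phi> x = 0)}"

definition abstract_characters :: "('a, 'm) monoid_scheme \<Rightarrow> ('a \<Rightarrow> complex) set" where
  "abstract_characters G = {\<xi>. (\<forall>x\<in>carrier G. \<forall>y\<in>carrier G. \<xi> (x \<otimes>\<^bsub>G\<^esub> y) = \<xi> x * \<xi> y) \<and>
     (\<forall>x\<in>carrier G. cmod (\<xi> x) = 1) \<and> (\<forall>x. x \<notin> carrier G \<longrightarrow> \<xi> x = 0)}"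

lemma pd_form_append:
  "pd_form G \<phi> (ps @ qs) (ps @ qs) =
    pd_form G \<phi> ps ps + pd_form G \<phi> ps qs + pd_form G \<phi> qs ps + pd_form G \<phi> qs qs"
  by (simp add: pd_form_def sum_list_addf)

lemma pd_form_linear:
  fixes G :: "('a, 'm) monoid_scheme"
  shows
  "pd_form G (\<lambda>x. a * \<phi> x + b * \<psi> x) ps qs = a * pd_form G \<phi> ps qs + b * pd_form G \<psi> ps qs"
proof -
  have 1: "(\<Sum>q\<leftarrow>qs. fst p * cnj (fst q) * (a * \<phi> (snd p \<otimes>\<^bsub>G\<^esub> inv\<^bsub>G\<^esub> (snd q)) + b * \<psi> (snd p \<otimes>\<^bsub>G\<^esub> inv\<^bsub>G\<^esub> (snd q))))
     = a * (\<Sum>q\<leftarrow>qs. fst p * cnj (fst q) * \<phi> (snd p \<otimes>\<^bsub>G\<^esub> inv\<^bsub>G\<^esub> (snd q)))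
     + b * (\<Sum>q\<leftarrow>qs. fst p * cnj (fst q) * \<psi> (snd p \<otimes>\<^bsub>G\<^esub> inv\<^bsub>G\<^esub> (snd q)))" for p
    by (induction qs) (simp_all add: algebra_simps)
  show ?thesis
    unfolding pd_form_def 1 by (simp only: sum_list_addf sum_list_const_mult)
qed

lemma continuous_on_pd_form:
  fixes G :: "('a, 'm) monoid_scheme"
  shows
  "continuous_on UNIV (\<lambda>\<phi>::'a \<Rightarrow> complex. pd_form G \<phi> ps qs)"
proof -
  have 1: "continuous_on UNIV (\<lambda>\<phi>::'a \<Rightarrow> complex. \<Sum>q\<leftarrow>qs. fst p * cnj (fst q) * \<phi> (f p q))" for p f
    by (induction qs) (auto intro!: continuous_intros)
  show ?thesis
    unfolding pd_form_def by (induction ps) (auto intro!: continuous_intros 1)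
qed

context comm_group
begin

lemma pos_def_ge: "pos_def G \<phi> \<Longrightarrow> snd ` set ps \<subseteq> carrier G \<Longrightarrow> 0 \<le> Re (pd_form G \<phi> ps ps)"
  and pos_def_real: "pos_def G \<phi> \<Longrightarrow> snd ` set ps \<subseteq> carrier G \<Longrightarrow> Im (pd_form G \<phi> ps ps) = 0"
  by (auto simp: pos_def_def)

lemma pos_def_one: "pos_def G \<phi> \<Longrightarrow> 0 \<le> Re (\<phi> \<one>) \<and> Im (\<phi> \<one>) = 0"
  using pos_def_ge[of \<phi> "[(1, \<one>)]"] pos_def_real[of \<phi> "[(1, \<one>)]"] by (simp add: pd_form_def)

lemma pos_def_pair:
  assumes "pos_def G \<phi>" "x \<in> carrier G"
  shows "0 \<le> Re (\<phi> \<one> + cnj c * \<phi> x + c * \<phi> (inv x) + c * cnj c * \<phi> \<one>)"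
    and "Im (\<phi> \<one> + cnj c * \<phi> x + c * \<phi> (inv x) + c * cnj c * \<phi> \<one>) = 0"
  using pos_def_ge[OF assms(1), of "[(1, x), (c, \<one>)]"] pos_def_real[OF assms(1), of "[(1, x), (c, \<one>)]"] assms(2)
  by (simp_all add: pd_form_def algebra_simps)

lemma pos_def_inv:
  assumes "pos_def G \<phi>" "x \<in> carrier G"
  shows "\<phi> (inv x) = cnj (\<phi> x)"
  using pos_def_pair(2)[OF assms, of 1] pos_def_pair(2)[OF assms, of \<i>] pos_def_one[OF assms(1)]
  by (simp add: complex_eq_iff)

lemma pos_def_bound:
  assumes "pos_def G \<phi>" "x \<in> carrier G"
  shows "cmod (\<phi> x) \<le> Re (\<phi> \<one>)"
proof (cases "\<phi> x = 0")
  case True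
  then show ?thesis using pos_def_one[OF assms(1)] by simp
next
  case False
  define c where "c = - (\<phi> x / cmod (\<phi> x))"
  have z: "\<phi> x * cnj (\<phi> x) = of_real (cmod (\<phi> x)) * of_real (cmod (\<phi> x))"
    using complex_norm_square[of "\<phi> x"] by (simp add: power2_eq_square)
  have c: "c * cnj c = 1" using False z by (simp add: c_def)
  have 1: "cnj c * \<phi> x = - of_real (cmod (\<phi> x))"
    using False z by (simp add: c_def mult.commute[of "cnj _"])
  have 2: "c * \<phi> (inv x) = - of_real (cmod (\<phi> x))"
    using False z pos_def_inv[OF assms] by (simp add: c_def)
  show ?thesis using pos_def_pair(1)[OF assms, of c] unfolding 1 2 c by simp
qed

text \<open>
  The form of the twisted function at \<open>ps\<close> is the form of \<open>\<phi>\<close> at the sum of \<open>ps\<close> and its translate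
  by \<open>y\<close> with coefficients multiplied by a unimodular constant.
\<close>

lemma twist_pos_def:
  assumes "pos_def G \<phi>" and y: "y \<in> carrier G" and c: "c * cnj c = 1"
  shows "pos_def G (\<lambda>x. if x \<in> carrier G then 2 * \<phi> x + (c * \<phi> (x \<otimes> y) + cnj c * \<phi> (x \<otimes> inv y)) else 0)"
    (is "pos_def G ?\<psi>")
  unfolding pos_def_def
proof (intro allI impI)
  fix ps :: "(complex \<times> 'a) list" assume ps: "snd ` set ps \<subseteq> carrier G"
  define qs where "qs = map (\<lambda>p. (c * fst p, snd p \<otimes> y)) ps"
  have qs: "snd ` set qs \<subseteq> carrier G" using ps y by (auto simp: qs_def)
  have e: "x \<otimes> inv (z \<otimes> y) = x \<otimes> inv z \<otimes> inv y" "x \<otimes> y \<otimes> inv z = x \<otimes> inv z \<otimes> y"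
    "x \<otimes> y \<otimes> inv (z \<otimes> y) = x \<otimes> inv z"
    if "x \<in> carrier G" "z \<in> carrier G" for x z
  proof -
    show "x \<otimes> inv (z \<otimes> y) = x \<otimes> inv z \<otimes> inv y" "x \<otimes> y \<otimes> inv z = x \<otimes> inv z \<otimes> y"
      using that y by (simp_all add: inv_mult m_ac)
    have "(x \<otimes> y) \<otimes> (inv z \<otimes> inv y) = (x \<otimes> inv z) \<otimes> (y \<otimes> inv y)"
      using that y by (simp only: m_ac m_closed inv_closed)
    then have "x \<otimes> y \<otimes> inv (z \<otimes> y) = (x \<otimes> inv z) \<otimes> (y \<otimes> inv y)"
      using that y by (simp add: inv_mult)
    then show "x \<otimes> y \<otimes> inv (z \<otimes> y) = x \<otimes> inv z" using that y by simp
  qed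
  have "pd_form G ?\<psi> ps ps = (\<Sum>p\<leftarrow>ps. \<Sum>q\<leftarrow>ps.
      fst p * cnj (fst q) * \<phi> (snd p \<otimes> inv (snd q))
    + fst p * cnj (c * fst q) * \<phi> (snd p \<otimes> inv (snd q \<otimes> y))
    + c * fst p * cnj (fst q) * \<phi> (snd p \<otimes> y \<otimes> inv (snd q))
    + c * fst p * cnj (c * fst q) * \<phi> (snd p \<otimes> y \<otimes> inv (snd q \<otimes> y)))"
    unfolding pd_form_def
  proof (intro arg_cong[of _ _ sum_list] map_cong refl)
    fix p q assume "p \<in> set ps" "q \<in> set ps"
    then have pq: "snd p \<in> carrier G" "snd q \<in> carrier G" using ps by auto
    have "c * fst p * cnj (c * fst q) = (c * cnj c) * (fst p * cnj (fst q))" by simp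
    then have cc: "c * fst p * cnj (c * fst q) = fst p * cnj (fst q)" unfolding c by simp
    show "fst p * cnj (fst q) * ?\<psi> (snd p \<otimes> inv (snd q)) =
      fst p * cnj (fst q) * \<phi> (snd p \<otimes> inv (snd q))
    + fst p * cnj (c * fst q) * \<phi> (snd p \<otimes> inv (snd q \<otimes> y))
    + c * fst p * cnj (fst q) * \<phi> (snd p \<otimes> y \<otimes> inv (snd q))
    + c * fst p * cnj (c * fst q) * \<phi> (snd p \<otimes> y \<otimes> inv (snd q \<otimes> y))"
      unfolding e[OF pq] cc using pq by (simp add: algebra_simps)
  qed
  also have "\<dots> = pd_form G \<phi> (ps @ qs) (ps @ qs)"
    unfolding pd_form_append unfolding pd_form_def qs_def
    by (simp add: o_def sum_list_addf)
  finally show "0 \<le> Re (pd_form G ?\<psi> ps ps) \<and> Im (pd_form G ?\<psi> ps ps) = 0"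
    using pos_def_ge[OF assms(1), of "ps @ qs"] pos_def_real[OF assms(1), of "ps @ qs"] ps qs
    by (simp add: image_Un)
qed

lemma pos_def_scale:
  assumes "pos_def G \<phi>" "0 \<le> r"
  shows "pos_def G (\<lambda>x. of_real r * \<phi> x)"
  using assms pd_form_linear[of G "of_real r" \<phi> 0 \<phi>] by (simp add: pos_def_def)

lemma states_compact: "compact (states G)" and states_closed: "closed (states G)"
proof -
  let ?K = "{\<phi> :: 'a \<Rightarrow> complex. \<forall>x. \<phi> x \<in> cball 0 1}"
  have "compactin (product_topology (\<lambda>i. euclidean) UNIV) (PiE UNIV (\<lambda>_::'a. cball (0::complex) 1))"
    by (simp add: compactin_PiE)
  then have K: "compact ?K"
    by (simp add: euclidean_product_topology PiE_UNIV_domain Pi_def)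
  have "closed {\<phi>. 0 \<le> Re (pd_form G \<phi> ps ps) \<and> Im (pd_form G \<phi> ps ps) = 0}" for ps
    by (intro closed_Collect_conj closed_Collect_le closed_Collect_eq continuous_intros continuous_on_pd_form)
  then have 1: "closed {\<phi>. pos_def G \<phi>}"
    unfolding pos_def_def by (intro closed_Collect_all closed_Collect_imp) auto
  have 2: "closed {\<phi> :: 'a \<Rightarrow> complex. \<phi> \<one> = 1}"
    by (intro closed_Collect_eq continuous_intros) auto
  have 3: "closed {\<phi> :: 'a \<Rightarrow> complex. \<forall>x. x \<notin> carrier G \<longrightarrow> \<phi> x = 0}"
    by (intro closed_Collect_all closed_Collect_imp closed_Collect_eq continuous_intros) auto
  show cl: "closed (states G)" unfolding states_def using 1 2 3 by (auto intro!: closed_Collect_conj)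
  have "states G \<subseteq> ?K"
  proof
    fix \<phi> assume "\<phi> \<in> states G"
    then have p: "pos_def G \<phi>" "\<phi> \<one> = 1" "\<And>x. x \<notin> carrier G \<Longrightarrow> \<phi> x = 0" by (auto simp: states_def)
    have "cmod (\<phi> x) \<le> 1" for x
      using pos_def_bound[OF p(1), of x] p(2,3) by (cases "x \<in> carrier G") auto
    then show "\<phi> \<in> ?K" by simp
  qed
  then show "compact (states G)" using K cl by (metis compact_Int_closed inf.absorb_iff2)
qed

definition face :: "('a \<Rightarrow> complex) set \<Rightarrow> bool" where
  "face F \<longleftrightarrow> F \<subseteq> states G \<and> (\<forall>\<phi>\<in>states G. \<forall>\<psi>\<in>states G. \<forall>t. 0 < (t::real) \<longrightarrow> t < (1::real) \<longrightarrow>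
     (\<lambda>x. of_real t * \<phi> x + of_real (1 - t) * \<psi> x) \<in> F \<longrightarrow> \<phi> \<in> F \<and> \<psi> \<in> F)"

lemma face_maximum:
  fixes L :: "('a \<Rightarrow> complex) \<Rightarrow> real"
  assumes F: "face F" "closed F" "F \<noteq> {}"
    and L: "continuous_on UNIV L"
    and aff: "\<And>\<phi> \<psi> (t::real). L (\<lambda>x. of_real t * \<phi> x + of_real (1 - t) * \<psi> x) = t * L \<phi> + (1 - t) * L \<psi>"
  defines "F' \<equiv> {\<phi>\<in>F. \<forall>\<psi>\<in>F. L \<psi> \<le> L \<phi>}"
  shows "face F'" "closed F'" "F' \<noteq> {}"
proof -
  have sub: "F \<subseteq> states G" using F(1) by (simp add: face_def)
  then have "compact F" using F(2) states_compact by (metis compact_Int_closed inf.absorb_iff2)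
  then obtain m where m: "m \<in> F" "\<And>\<psi>. \<psi> \<in> F \<Longrightarrow> L \<psi> \<le> L m"
    using continuous_attains_sup[of F L] F(3) continuous_on_subset[OF L] by auto
  have eq: "F' = {\<phi>\<in>F. L m \<le> L \<phi>}" unfolding F'_def using m by (auto intro: order_trans)
  show "F' \<noteq> {}" using m by (auto simp: eq)
  have "closed {\<phi>. L m \<le> L \<phi>}" by (intro closed_Collect_le continuous_intros L)
  then show "closed F'" using F(2) unfolding eq by (simp add: closed_Int Collect_conj_eq)
  show "face F'"
    unfolding face_def
  proof (intro conjI ballI allI impI)
    show "F' \<subseteq> states G" using sub by (auto simp: eq)
    fix \<phi> \<psi> and t :: real
    assume *: "\<phi> \<in> states G" "\<psi> \<in> states G" "0 < t" "t < 1" "(\<lambda>x. of_real t * \<phi> x + of_real (1 - t) * \<psi> x) \<in> F'"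
    then have "\<phi> \<in> F" "\<psi> \<in> F" using F(1) unfolding face_def eq by blast+
    have ge: "L m \<le> t * L \<phi> + (1 - t) * L \<psi>" using *(5) unfolding eq aff[symmetric] by blast
    have le: "L \<phi> \<le> L m" "L \<psi> \<le> L m" using m \<open>\<phi> \<in> F\<close> \<open>\<psi> \<in> F\<close> by blast+
    have "t * (L m - L \<phi>) + (1 - t) * (L m - L \<psi>) \<le> 0" using ge by (simp add: algebra_simps)
    moreover have "0 \<le> t * (L m - L \<phi>)" "0 \<le> (1 - t) * (L m - L \<psi>)" using le *(3,4) by auto
    ultimately have "t * (L m - L \<phi>) = 0" "(1 - t) * (L m - L \<psi>) = 0" by linarith+
    then have "L \<phi> = L m" "L \<psi> = L m" using *(3,4) by auto
    then show "\<phi> \<in> F'" "\<psi> \<in> F'" using \<open>\<phi> \<in> F\<close> \<open>\<psi> \<in> F\<close> by (auto simp: eq)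
  qed
qed

text \<open>
  Zorn's lemma applies since a chain of nonempty closed faces has a nonempty intersection by
  compactness of the set of states.
\<close>

lemma minimal_face_exists:
  assumes F: "face F" "closed F" "F \<noteq> {}"
  obtains E where "face E" "closed E" "E \<noteq> {}" "E \<subseteq> F"
    "\<And>E'. face E' \<Longrightarrow> closed E' \<Longrightarrow> E' \<noteq> {} \<Longrightarrow> E' \<subseteq> E \<Longrightarrow> E' = E"
proof -
  define \<A> where "\<A> = {- E |E. face E \<and> closed E \<and> E \<noteq> {} \<and> E \<subseteq> F}"
  have A: "A \<in> \<A> \<longleftrightarrow> face (- A) \<and> closed (- A) \<and> - A \<noteq> {} \<and> - A \<subseteq> F" for A
    unfolding \<A>_def by (auto intro!: exI[of _ "- A"])
  note AD = A[THEN iffD1]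
  have fs: "E \<subseteq> states G" if "face E" for E using that by (simp add: face_def)
  have "\<exists>M\<in>\<A>. \<forall>X\<in>\<A>. M \<subseteq> X \<longrightarrow> X = M"
  proof (rule subset_Zorn_nonempty)
    show "\<A> \<noteq> {}" using F unfolding \<A>_def by blast
    fix \<C> assume C: "\<C> \<noteq> {}" "subset.chain \<A> \<C>"
    then have mem: "A \<in> \<A>" if "A \<in> \<C>" for A using that by (auto simp: subset.chain_def)
    obtain A0 where A0: "A0 \<in> \<C>" using C(1) by blast
    let ?I = "\<Inter>(uminus ` \<C>)"
    have "states G \<inter> ?I \<noteq> {}"
    proof (rule compact_imp_fip[OF states_compact])
      fix E assume "E \<in> uminus ` \<C>"
      then obtain B where "B \<in> \<C>" "E = - B" by blast
      then show "closed E" using AD[OF mem] by blast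
    next
      fix \<F> assume "finite \<F>" "\<F> \<subseteq> uminus ` \<C>"
      then obtain \<B> where B: "finite \<B>" "\<B> \<subseteq> \<C>" "\<F> = uminus ` \<B>" by (meson finite_subset_image)
      show "states G \<inter> \<Inter>\<F> \<noteq> {}"
      proof (cases "\<B> = {}")
        case True
        then have "\<F> = {}" using B(3) by simp
        moreover have "- A0 \<subseteq> states G" "- A0 \<noteq> {}" using AD[OF mem[OF A0]] fs by blast+
        ultimately show ?thesis by blast
      next
        case False
        have UB: "\<Union>\<B> \<in> \<B>"
        proof (rule Union_in_chain[OF B(1) False])
          show "subset.chain \<A> \<B>" using C(2) B(2) unfolding subset_chain_def by (meson subsetD order_trans)
        qed
        have "\<Union>\<B> \<in> \<A>" by (rule mem) (rule subsetD[OF B(2) UB])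
        note ad = AD[OF this]
        have "- \<Union>\<B> \<subseteq> states G" by (rule fs[OF conjunct1[OF ad]])
        moreover have "- \<Union>\<B> \<noteq> {}" by (rule conjunct1[OF conjunct2[OF conjunct2[OF ad]]])
        ultimately have "states G \<inter> - \<Union>\<B> \<noteq> {}" by (metis Int_absorb1)
        moreover have "\<Inter>\<F> = - \<Union>\<B>" using B(3) by auto
        ultimately show ?thesis by (simp only: not_False_eq_True)
      qed
    qed
    then have ne: "- \<Union>\<C> \<noteq> {}" by auto
    have "face (- \<Union>\<C>)"
      unfolding face_def
    proof (intro conjI ballI allI impI)
      have "- A0 \<subseteq> states G" using AD[OF mem[OF A0]] fs by blast
      then show "- \<Union>\<C> \<subseteq> states G" using A0 by blast
      fix \<phi> \<psi> and t :: real
      assume *: "\<phi> \<in> states G" "\<psi> \<in> states G" "0 < t" "t < 1" "(\<lambda>x. of_real t * \<phi> x + of_real (1 - t) * \<psi> x) \<in> - \<Union>\<C>"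
      have "\<phi> \<in> - B \<and> \<psi> \<in> - B" if "B \<in> \<C>" for B
      proof -
        have "face (- B)" using AD[OF mem[OF that]] by blast
        moreover have "(\<lambda>x. of_real t * \<phi> x + of_real (1 - t) * \<psi> x) \<in> - B" using *(5) that by blast
        ultimately show ?thesis using *(1-4) unfolding face_def by blast
      qed
      then show "\<phi> \<in> - \<Union>\<C>" "\<psi> \<in> - \<Union>\<C>" by blast+
    qed
    note f1 = this
    have "open B" if "B \<in> \<C>" for B using AD[OF mem[OF that]] by (simp add: closed_def)
    then have f2: "closed (- \<Union>\<C>)" by (simp add: closed_def open_Union)
    have f3: "- \<Union>\<C> \<subseteq> F" using AD[OF mem[OF A0]] A0 by blast
    show "\<Union>\<C> \<in> \<A>" by (rule A[THEN iffD2]) (intro conjI f1 f2 ne f3)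
  qed
  then obtain M where M: "M \<in> \<A>" "\<And>X. X \<in> \<A> \<Longrightarrow> M \<subseteq> X \<Longrightarrow> X = M" by blast
  show ?thesis
  proof (rule that[of "- M"])
    fix E' assume E': "face E'" "closed E'" "E' \<noteq> {}" "E' \<subseteq> - M"
    moreover have "E' \<subseteq> F" using AD[OF M(1)] E'(4) by blast
    ultimately have "- E' \<in> \<A>" unfolding A by simp
    then have "- E' = M" using M(2) E'(4) by blast
    then show "E' = - M" by blast
  qed (use AD[OF M(1)] in simp_all)
qed

text \<open>
  Twisting \<open>\<xi>\<close> by \<open>c\<close> and by \<open>- c\<close> gives two positive definite functions with sum \<open>4 \<xi>\<close>. Since \<open>\<xi>\<close> is
  extreme, each of them is a multiple of \<open>\<xi>\<close>, and comparing values for \<open>c = 1\<close> and \<open>c = \<i>\<close> yields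
  \<open>\<xi> (x \<otimes> y) = \<xi> x * \<xi> y\<close>.
\<close>

lemma extreme_state_is_character:
  assumes \<xi>: "face {\<xi>}"
  shows "\<xi> \<in> abstract_characters G"
proof -
  have st: "\<xi> \<in> states G" using \<xi> by (auto simp: face_def)
  then have pd: "pos_def G \<xi>" and one: "\<xi> \<one> = 1" and off: "\<And>x. x \<notin> carrier G \<Longrightarrow> \<xi> x = 0"
    by (auto simp: states_def)
  have twist: "c * \<xi> (x \<otimes> y) + cnj c * \<xi> (x \<otimes> inv y) = 2 * Re (c * \<xi> y) * \<xi> x"
    if x: "x \<in> carrier G" and y: "y \<in> carrier G" and c: "c * cnj c = 1" for c x y
  proof -
    define \<psi> where "\<psi> = (\<lambda>c x. if x \<in> carrier G then 2 * \<xi> x + (c * \<xi> (x \<otimes> y) + cnj c * \<xi> (x \<otimes> inv y)) else 0)"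
    have pos: "pos_def G (\<psi> c)" "pos_def G (\<psi> (- c))"
      unfolding \<psi>_def using twist_pos_def[OF pd y] c by simp_all
    define m where "m = 2 + 2 * Re (c * \<xi> y)"
    have \<psi>1: "\<psi> c \<one> = of_real m" "\<psi> (- c) \<one> = of_real (4 - m)"
      using y one pos_def_inv[OF pd y] by (auto simp: \<psi>_def m_def complex_eq_iff)
    have m: "0 \<le> m" "m \<le> 4" using pos_def_one[OF pos(1)] pos_def_one[OF pos(2)] by (simp_all add: \<psi>1)
    have sum: "\<psi> c x + \<psi> (- c) x = 4 * \<xi> x" for x using off by (simp add: \<psi>_def algebra_simps)
    have \<psi>off: "\<psi> d x = 0" if "x \<notin> carrier G" for d x using that by (simp add: \<psi>_def)
    have zero: "\<psi> d x = 0" if "pos_def G (\<psi> d)" "\<psi> d \<one> = 0" for d x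
      using pos_def_bound[OF that(1), of x] that(2) \<psi>off by (cases "x \<in> carrier G") simp_all
    have ext: "\<phi> \<in> {\<xi>}" if "\<phi> \<in> states G" "\<psi>' \<in> states G" "0 < t" "t < 1"
      "(\<lambda>x. of_real t * \<phi> x + of_real (1 - t) * \<psi>' x) \<in> {\<xi>}" for \<phi> \<psi>' and t :: real
      using \<xi> that unfolding face_def by blast
    have "\<psi> c x = m * \<xi> x"
    proof -
      consider "m = 0" | "m = 4" | "0 < m" "m < 4" using m by linarith
      then show ?thesis
      proof cases
        case 1
        then show ?thesis using zero[OF pos(1)] \<psi>1 by simp
      next
        case 2
        then have "\<psi> (- c) x = 0" using zero[OF pos(2)] \<psi>1 by simp
        then show ?thesis using sum[of x] 2 by simp
      next
        case 3
        let ?a = "\<lambda>x. of_real (1 / m) * \<psi> c x" and ?b = "\<lambda>x. of_real (1 / (4 - m)) * \<psi> (- c) x"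
        have inv1: "complex_of_real (1 / m) * of_real m = 1"
          "complex_of_real (1 / (4 - m)) * of_real (4 - m) = 1"
          unfolding of_real_mult[symmetric] using 3 by simp_all
        have st: "?a \<in> states G" "?b \<in> states G"
          unfolding states_def
          by (intro CollectI conjI pos_def_scale pos; use 3 \<psi>off inv1 in \<open>simp add: \<psi>1 del: of_real_divide of_real_diff\<close>)+
        have eq: "(\<lambda>x. of_real (m / 4) * ?a x + of_real (1 - m / 4) * ?b x) = \<xi>"
        proof
          fix x
          have key: "complex_of_real (1 - m / 4) * of_real (1 / (4 - m)) = of_real (1 / 4)"
            "complex_of_real (m / 4) * of_real (1 / m) = of_real (1 / 4)"
            unfolding of_real_mult[symmetric] of_real_eq_iff using 3 by (simp_all add: field_simps)
          have "of_real (m / 4) * ?a x + of_real (1 - m / 4) * ?b x = of_real (1 / 4) * (\<psi> c x + \<psi> (- c) x)"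
            by (simp only: mult.assoc[symmetric] key distrib_left)
          then show "of_real (m / 4) * ?a x + of_real (1 - m / 4) * ?b x = \<xi> x" unfolding sum by simp
        qed
        have "?a \<in> {\<xi>}" by (rule ext[OF st, of "m / 4"]) (use 3 eq in simp_all)
        then have "?a x = \<xi> x" by (simp add: fun_eq_iff)
        then show ?thesis using 3 by (simp add: field_simps)
      qed
    qed
    then show ?thesis using x by (simp add: \<psi>_def m_def algebra_simps)
  qed
  have mult: "\<xi> (x \<otimes> y) = \<xi> x * \<xi> y" if "x \<in> carrier G" "y \<in> carrier G" for x y
  proof -
    have "\<xi> (x \<otimes> y) + \<xi> (x \<otimes> inv y) = 2 * Re (\<xi> y) * \<xi> x" using twist[OF that, of 1] by simp
    moreover have "\<i> * \<xi> (x \<otimes> y) - \<i> * \<xi> (x \<otimes> inv y) = - 2 * Im (\<xi> y) * \<xi> x"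
      using twist[OF that, of \<i>] by simp
    then have "\<i> * (\<i> * \<xi> (x \<otimes> y) - \<i> * \<xi> (x \<otimes> inv y)) = \<i> * (- 2 * Im (\<xi> y) * \<xi> x)" by simp
    then have "\<xi> (x \<otimes> y) - \<xi> (x \<otimes> inv y) = 2 * (\<i> * Im (\<xi> y)) * \<xi> x"
      by (simp add: algebra_simps complex_eq_iff)
    ultimately have "2 * \<xi> (x \<otimes> y) = 2 * (Re (\<xi> y) + \<i> * Im (\<xi> y)) * \<xi> x"
      by (simp add: algebra_simps)
    then show ?thesis using complex_eq[of "\<xi> y"] by (simp add: mult.commute)
  qed
  have "cmod (\<xi> x) = 1" if x: "x \<in> carrier G" for x
  proof -
    have "\<xi> x * cnj (\<xi> x) = 1"
      using mult[OF x inv_closed[OF x]] pos_def_inv[OF pd x] one x by simp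
    then have "complex_of_real ((cmod (\<xi> x))\<^sup>2) = 1" by (metis complex_norm_square)
    then have "(cmod (\<xi> x))\<^sup>2 = 1" by (metis of_real_eq_1_iff)
    then show ?thesis by (simp add: power2_eq_1_iff) (metis norm_ge_zero not_one_le_zero neg_0_le_iff_le)
  qed
  with mult off show ?thesis by (simp add: abstract_characters_def)
qed

text \<open>
  A continuous affine functional attains its maximum over the compact convex set of states on a
  closed face. A minimal closed face inside it is a single point, because the coordinate functionals
  are constant on it, and a one-point face consists of a multiplicative state.
\<close>

lemma character_dominates_state:
  fixes L :: "('a \<Rightarrow> complex) \<Rightarrow> real"
  assumes \<phi>: "\<phi> \<in> states G"
    and L: "continuous_on UNIV L"
      "\<And>\<phi> \<psi> (t::real). L (\<lambda>x. of_real t * \<phi> x + of_real (1 - t) * \<psi> x) = t * L \<phi> + (1 - t) * L \<psi>"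
  obtains \<xi> where "\<xi> \<in> abstract_characters G" "L \<phi> \<le> L \<xi>"
proof -
  have st: "face (states G)" "closed (states G)" "states G \<noteq> {}"
    using \<phi> states_closed by (auto simp: face_def)
  note F = face_maximum[OF st L]
  obtain E where E: "face E" "closed E" "E \<noteq> {}" "E \<subseteq> {\<phi>\<in>states G. \<forall>\<psi>\<in>states G. L \<psi> \<le> L \<phi>}"
    and min: "\<And>E'. face E' \<Longrightarrow> closed E' \<Longrightarrow> E' \<noteq> {} \<Longrightarrow> E' \<subseteq> E \<Longrightarrow> E' = E"
    by (rule minimal_face_exists[OF F]) blast
  obtain \<xi> where \<xi>: "\<xi> \<in> E" using E(3) by blast
  have coord: "h (\<psi> x) = h (\<psi>' x)" if "\<psi> \<in> E" "\<psi>' \<in> E" "h = Re \<or> h = Im" for \<psi> \<psi>' x h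
  proof -
    let ?L = "\<lambda>\<phi>. h (\<phi> x)"
    have "continuous_on UNIV ?L" using that(3) by (auto intro!: continuous_intros)
    moreover have "?L (\<lambda>x. of_real t * \<phi> x + of_real (1 - t) * \<psi> x) = t * ?L \<phi> + (1 - t) * ?L \<psi>" for \<phi> \<psi> and t :: real
      using that(3) by auto
    ultimately have "{\<phi>\<in>E. \<forall>\<psi>\<in>E. ?L \<psi> \<le> ?L \<phi>} = E"
      by (intro min face_maximum[OF E(1-3)]) auto
    then have "?L \<psi> \<le> ?L \<psi>'" "?L \<psi>' \<le> ?L \<psi>" using that(1,2) by blast+
    then show ?thesis by simp
  qed
  have "\<psi> = \<xi>" if "\<psi> \<in> E" for \<psi>
    by (rule ext) (use coord[OF that \<xi>] in \<open>simp add: complex_eq_iff\<close>)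
  with \<xi> have "E = {\<xi>}" by blast
  then show ?thesis using that[of \<xi>] extreme_state_is_character E(1,4) \<phi> by auto
qed

end

section \<open>Characters of positive energy\<close>

context compact_abelian_group
begin

text \<open>
  Off the carrier a character has the value \<open>1\<close>, so that characters form a group under pointwise
  multiplication of functions on the whole type.
\<close>

definition characters :: "('a \<Rightarrow> complex) set" where
  "characters = {\<xi>. continuous_map T euclidean \<xi> \<and>
     (\<forall>x\<in>carrier G. \<forall>y\<in>carrier G. \<xi> (x \<otimes> y) = \<xi> x * \<xi> y) \<and>
     (\<forall>x. cmod (\<xi> x) = 1) \<and> (\<forall>x. x \<notin> carrier G \<longrightarrow> \<xi> x = 1)}"

definition correlation :: "('a \<Rightarrow> real) \<Rightarrow> 'a \<Rightarrow> real" where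
  "correlation u z = mean (\<lambda>t. u (z \<otimes> t) * u t)"

lemma has_mean_sum_list:
  assumes "\<And>x. x \<in> set xs \<Longrightarrow> has_mean (f x) (c x)"
  shows "has_mean (\<lambda>t. \<Sum>x\<leftarrow>xs. f x t) (\<Sum>x\<leftarrow>xs. c x)"
  using assms by (induction xs) (auto intro: has_mean_const has_mean_add)

lemma has_mean_cmult:
  fixes f :: "'a \<Rightarrow> real"
  assumes "has_mean f c"
  shows "has_mean (\<lambda>t. r * f t) (r * c)"
  using has_mean_linear[OF assms bounded_linear_mult_right[of r]] .

lemma has_mean_correlation:
  assumes u: "continuous_map T euclideanreal u" and x: "x \<in> carrier G" and y: "y \<in> carrier G"
  shows "has_mean (\<lambda>t. u (x \<otimes> t) * u (y \<otimes> t)) (correlation u (x \<otimes> inv y))"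
proof -
  have "has_mean (\<lambda>t. u ((x \<otimes> inv y) \<otimes> t) * u t) (correlation u (x \<otimes> inv y))"
    unfolding correlation_def
    by (intro has_mean_real continuous_map_times continuous_map_translate u m_closed inv_closed x y)
  from has_mean_translate[OF this y] show ?thesis
  proof (rule has_mean_cong)
    fix t assume t: "t \<in> carrier G"
    have "(x \<otimes> inv y) \<otimes> (t \<otimes> y) = (x \<otimes> t) \<otimes> (inv y \<otimes> y)"
      using x y t by (simp only: m_ac m_closed inv_closed)
    then show "u (x \<otimes> inv y \<otimes> (t \<otimes> y)) * u (t \<otimes> y) = u (x \<otimes> t) * u (y \<otimes> t)"
      using x y t by (simp add: m_comm)
  qed
qed

lemma continuous_map_sum_list:
  fixes f :: "'x \<Rightarrow> 'a \<Rightarrow> 'c::real_normed_vector"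
  assumes "\<And>x. x \<in> set xs \<Longrightarrow> continuous_map X euclidean (f x)"
  shows "continuous_map X euclidean (\<lambda>t. \<Sum>x\<leftarrow>xs. f x t)"
  using assms
proof (induction xs)
  case (Cons a xs)
  then show ?case by (simp add: continuous_map_add)
qed simp

text \<open>
  The form of the autocorrelation of \<open>u\<close> is the mean of the squared modulus of a combination of
  translates of \<open>u\<close>. Hence autocorrelations are positive definite.
\<close>

lemma pd_form_correlation:
  assumes u: "continuous_map T euclideanreal u" and ps: "snd ` set ps \<subseteq> carrier G"
  shows "\<exists>c. has_mean (\<lambda>t. (cmod (\<Sum>p\<leftarrow>ps. fst p * of_real (u (snd p \<otimes> t))))\<^sup>2) c \<and>
    pd_form G (\<lambda>x. of_real (correlation u x)) ps ps = of_real c"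
proof -
  have "has_mean (\<lambda>t. \<Sum>p\<leftarrow>ps. \<Sum>q\<leftarrow>ps. fst p * cnj (fst q) * of_real (u (snd p \<otimes> t) * u (snd q \<otimes> t)))
     (\<Sum>p\<leftarrow>ps. \<Sum>q\<leftarrow>ps. fst p * cnj (fst q) * of_real (correlation u (snd p \<otimes> inv (snd q))))"
  proof (intro has_mean_sum_list)
    fix p q assume "p \<in> set ps" "q \<in> set ps"
    then have "snd p \<in> carrier G" "snd q \<in> carrier G" using ps by auto
    from has_mean_linear[OF has_mean_correlation[OF u this] bounded_linear_compose[OF bounded_linear_mult_right bounded_linear_of_real]]
    show "has_mean (\<lambda>t. fst p * cnj (fst q) * of_real (u (snd p \<otimes> t) * u (snd q \<otimes> t)))
       (fst p * cnj (fst q) * of_real (correlation u (snd p \<otimes> inv (snd q))))" .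
  qed
  moreover have "(\<Sum>p\<leftarrow>ps. \<Sum>q\<leftarrow>ps. fst p * cnj (fst q) * of_real (u (snd p \<otimes> t) * u (snd q \<otimes> t)))
    = of_real ((cmod (\<Sum>p\<leftarrow>ps. fst p * of_real (u (snd p \<otimes> t))))\<^sup>2)" for t
  proof -
    have cn: "cnj (\<Sum>p\<leftarrow>ps. fst p * of_real (u (snd p \<otimes> t))) = (\<Sum>p\<leftarrow>ps. cnj (fst p) * of_real (u (snd p \<otimes> t)))"
      by (induction ps) simp_all
    have "of_real ((cmod (\<Sum>p\<leftarrow>ps. fst p * of_real (u (snd p \<otimes> t))))\<^sup>2)
      = (\<Sum>p\<leftarrow>ps. fst p * of_real (u (snd p \<otimes> t))) * (\<Sum>q\<leftarrow>ps. cnj (fst q) * of_real (u (snd q \<otimes> t)))"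
      unfolding complex_norm_square cn ..
    also have "\<dots> = (\<Sum>p\<leftarrow>ps. (fst p * of_real (u (snd p \<otimes> t))) * (\<Sum>q\<leftarrow>ps. cnj (fst q) * of_real (u (snd q \<otimes> t))))"
      by (rule sum_list_mult_const[symmetric])
    also have "\<dots> = (\<Sum>p\<leftarrow>ps. \<Sum>q\<leftarrow>ps. fst p * of_real (u (snd p \<otimes> t)) * (cnj (fst q) * of_real (u (snd q \<otimes> t))))"
      by (simp only: sum_list_const_mult)
    also have "\<dots> = (\<Sum>p\<leftarrow>ps. \<Sum>q\<leftarrow>ps. fst p * cnj (fst q) * of_real (u (snd p \<otimes> t) * u (snd q \<otimes> t)))"
      by (intro arg_cong[of _ _ sum_list] map_cong refl) simp
    finally show ?thesis ..
  qed
  ultimately have 1: "has_mean (\<lambda>t. complex_of_real ((cmod (\<Sum>p\<leftarrow>ps. fst p * of_real (u (snd p \<otimes> t))))\<^sup>2))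
     (pd_form G (\<lambda>x. of_real (correlation u x)) ps ps)"
    by (simp only: pd_form_def)
  have cont: "continuous_map T euclidean (\<lambda>t. (cmod (\<Sum>p\<leftarrow>ps. fst p * of_real (u (snd p \<otimes> t))))\<^sup>2)"
  proof -
    have "continuous_map T euclidean (\<lambda>t. \<Sum>p\<leftarrow>ps. fst p * complex_of_real (u (snd p \<otimes> t)))"
    proof (rule continuous_map_sum_list)
      fix p assume "p \<in> set ps"
      then have "continuous_map T euclidean (\<lambda>t. u (snd p \<otimes> t))"
        using ps by (intro continuous_map_translate u) auto
      then show "continuous_map T euclidean (\<lambda>t. fst p * complex_of_real (u (snd p \<otimes> t)))"
        by (rule continuous_map_tendsto_compose) (intro continuous_intros)
    qed
    then show ?thesis by (rule continuous_map_tendsto_compose) (intro continuous_intros)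
  qed
  from has_mean_real[OF cont] have 2: "has_mean (\<lambda>t. complex_of_real ((cmod (\<Sum>p\<leftarrow>ps. fst p * of_real (u (snd p \<otimes> t))))\<^sup>2))
     (of_real (mean (\<lambda>t. (cmod (\<Sum>p\<leftarrow>ps. fst p * of_real (u (snd p \<otimes> t))))\<^sup>2)))"
    by (rule has_mean_linear[OF _ bounded_linear_of_real])
  from has_mean_unique[OF 1 2] has_mean_real[OF cont] show ?thesis by blast
qed

lemma square_avg_le:
  fixes h :: "'a \<Rightarrow> complex"
  assumes "ys \<noteq> []"
  shows "(cmod (avg ys h x))\<^sup>2 \<le> avg ys (\<lambda>x. (cmod (h x))\<^sup>2) x"
proof -
  define n where "n = real (length ys)"
  have n: "n > 0" using assms by (simp add: n_def)
  define a where "a = avg ys h x"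
  have "0 \<le> (\<Sum>y\<leftarrow>ys. (cmod (h (x \<otimes> y) - a))\<^sup>2)" by (intro sum_list_nonneg) auto
  also have "(\<Sum>y\<leftarrow>ys. (cmod (h (x \<otimes> y) - a))\<^sup>2)
      = (\<Sum>y\<leftarrow>ys. (cmod (h (x \<otimes> y)))\<^sup>2) - 2 * Re (cnj a * (\<Sum>y\<leftarrow>ys. h (x \<otimes> y))) + n * (cmod a)\<^sup>2"
    unfolding n_def
  proof (induction ys)
    case (Cons y ys)
    have "(cmod (h (x \<otimes> y) - a))\<^sup>2 = (cmod (h (x \<otimes> y)))\<^sup>2 - 2 * Re (cnj a * h (x \<otimes> y)) + (cmod a)\<^sup>2"
      unfolding cmod_power2 by (simp add: power2_eq_square algebra_simps)
    with Cons show ?case by (simp add: algebra_simps)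
  qed simp
  also have "(\<Sum>y\<leftarrow>ys. h (x \<otimes> y)) = of_real n * a"
    using n by (simp add: a_def avg_def n_def scaleR_conv_of_real)
  also have "Re (cnj a * (of_real n * a)) = n * (cmod a)\<^sup>2"
    unfolding cmod_power2 by (simp add: power2_eq_square algebra_simps)
  finally have "n * (cmod a)\<^sup>2 \<le> (\<Sum>y\<leftarrow>ys. (cmod (h (x \<otimes> y)))\<^sup>2)" by simp
  moreover have "avg ys (\<lambda>x. (cmod (h x))\<^sup>2) x = (\<Sum>y\<leftarrow>ys. (cmod (h (x \<otimes> y)))\<^sup>2) / n"
    by (simp add: avg_def n_def divide_inverse mult.commute)
  ultimately have "n * (cmod a)\<^sup>2 \<le> n * avg ys (\<lambda>x. (cmod (h x))\<^sup>2) x" using n by simp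
  then show ?thesis using n by (simp add: a_def)
qed

lemma has_mean_avg:
  assumes "has_mean g c" "ys \<noteq> []" "set ys \<subseteq> carrier G"
  shows "has_mean (avg ys g) c"
proof -
  have "has_mean (\<lambda>t. \<Sum>y\<leftarrow>ys. g (t \<otimes> y)) (\<Sum>y\<leftarrow>ys. c)"
    by (rule has_mean_sum_list) (use assms in \<open>auto intro: has_mean_translate\<close>)
  note m = has_mean_linear[OF this bounded_linear_scaleR_right[of "inverse (real (length ys))"]]
  have "(\<Sum>y\<leftarrow>ys. c) = real (length ys) *\<^sub>R c"
    by (induction ys) (simp_all add: scaleR_add_left)
  then show ?thesis using m assms(2) by (simp add: avg_def[abs_def])
qed

definition twisted :: "('a \<Rightarrow> real) \<Rightarrow> ('a \<Rightarrow> complex) \<Rightarrow> 'a \<Rightarrow> complex" where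
  "twisted u \<xi> x = of_real (u x) * cnj (\<xi> x)"

text \<open>
  For a continuous character the infimum over all lists is the squared modulus of the Fourier
  coefficient, the mean of \<open>twisted u \<xi>\<close>. The averages make sense for a character that
  is not known to be continuous.
\<close>

definition energy :: "('a \<Rightarrow> real) \<Rightarrow> ('a \<Rightarrow> complex) \<Rightarrow> 'a list \<Rightarrow> real" where
  "energy u \<xi> ys = mean (\<lambda>t. (cmod (avg ys (twisted u \<xi>) t))\<^sup>2)"

lemma abstract_character_one:
  assumes "\<xi> \<in> abstract_characters G"
  shows "\<xi> \<one> = 1"
proof -
  have "\<xi> \<one> * \<xi> \<one> = \<xi> \<one>" "cmod (\<xi> \<one>) = 1"
    using assms one_closed r_one unfolding abstract_characters_def by force+
  then show ?thesis by (metis mult_cancel_left1 mult.commute norm_zero zero_neq_one)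
qed

lemma abstract_character_inv:
  assumes "\<xi> \<in> abstract_characters G" "x \<in> carrier G"
  shows "\<xi> (inv x) = cnj (\<xi> x)"
proof -
  have unit: "cmod (\<xi> x) = 1" using assms by (simp add: abstract_characters_def)
  then have ne: "\<xi> x \<noteq> 0" by auto
  have "\<xi> (x \<otimes> inv x) = \<xi> x * \<xi> (inv x)"
    using assms inv_closed[OF assms(2)] unfolding abstract_characters_def by blast
  then have "\<xi> x * \<xi> (inv x) = 1" using assms(2) abstract_character_one[OF assms(1)] by simp
  also have "1 = \<xi> x * cnj (\<xi> x)" using unit by (simp add: complex_norm_square[symmetric])
  finally show ?thesis using ne by simp
qed

lemma cmod_avg_twisted:
  assumes \<xi>: "\<xi> \<in> abstract_characters G" and ys: "set ys \<subseteq> carrier G" and t: "t \<in> carrier G"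
  shows "cmod (avg ys (twisted u \<xi>) t)
    = cmod (\<Sum>p\<leftarrow>map (\<lambda>y. (cnj (\<xi> y) / length ys, y)) ys. fst p * of_real (u (snd p \<otimes> t)))"
proof -
  define S where "S = (\<Sum>y\<leftarrow>ys. cnj (\<xi> y) * complex_of_real (u (y \<otimes> t)))"
  have "(\<Sum>y\<leftarrow>ys. twisted u \<xi> (t \<otimes> y)) = (\<Sum>y\<leftarrow>ys. cnj (\<xi> t) * (cnj (\<xi> y) * of_real (u (y \<otimes> t))))"
    using \<xi> ys t unfolding abstract_characters_def twisted_def
    by (intro arg_cong[of _ _ sum_list] map_cong refl) (auto simp: m_comm subset_iff)
  also have "\<dots> = cnj (\<xi> t) * S" unfolding S_def by (rule sum_list_const_mult)
  finally have "avg ys (twisted u \<xi>) t = cnj (\<xi> t) * (inverse (of_nat (length ys)) * S)"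
    by (simp add: avg_def scaleR_conv_of_real of_real_inverse)
  moreover have "(\<Sum>p\<leftarrow>map (\<lambda>y. (cnj (\<xi> y) / length ys, y)) ys. fst p * of_real (u (snd p \<otimes> t)))
     = inverse (of_nat (length ys)) * S"
  proof -
    have "(\<Sum>p\<leftarrow>map (\<lambda>y. (cnj (\<xi> y) / length ys, y)) ys. fst p * of_real (u (snd p \<otimes> t)))
      = (\<Sum>y\<leftarrow>ys. inverse (of_nat (length ys)) * (cnj (\<xi> y) * of_real (u (y \<otimes> t))))"
      unfolding map_map o_def fst_conv snd_conv
      by (intro arg_cong[of _ _ sum_list] map_cong refl) (simp add: divide_inverse mult_ac)
    then show ?thesis unfolding S_def sum_list_const_mult .
  qed
  moreover have "cmod (\<xi> t) = 1" using \<xi> t by (simp add: abstract_characters_def)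
  ultimately show ?thesis by (simp only: norm_mult complex_mod_cnj mult_1_left)
qed

text \<open>
  Expanding the square gives an expression that is affine in \<open>\<xi>\<close> and depends on \<open>\<xi>\<close> through
  finitely many values only, so it makes sense for arbitrary states.
\<close>

lemma energy:
  assumes u: "continuous_map T euclideanreal u" and \<xi>: "\<xi> \<in> abstract_characters G" and ys: "set ys \<subseteq> carrier G"
  shows has_mean_energy: "has_mean (\<lambda>t. (cmod (avg ys (twisted u \<xi>) t))\<^sup>2) (energy u \<xi> ys)"
    and energy_eq: "energy u \<xi> ys = (\<Sum>x\<leftarrow>ys. \<Sum>y\<leftarrow>ys. correlation u (x \<otimes> inv y) * Re (\<xi> (x \<otimes> inv y))) / (length ys)\<^sup>2"
proof -
  let ?ps = "map (\<lambda>y. (cnj (\<xi> y) / length ys, y)) ys"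
  have ps: "snd ` set ?ps \<subseteq> carrier G" using ys by auto
  obtain c where c: "has_mean (\<lambda>t. (cmod (\<Sum>p\<leftarrow>?ps. fst p * of_real (u (snd p \<otimes> t))))\<^sup>2) c"
    "pd_form G (\<lambda>x. of_real (correlation u x)) ?ps ?ps = of_real c"
    using pd_form_correlation[OF u ps] by blast
  from c(1) have m: "has_mean (\<lambda>t. (cmod (avg ys (twisted u \<xi>) t))\<^sup>2) c"
    by (rule has_mean_cong) (simp only: cmod_avg_twisted[OF \<xi> ys])
  then have e: "energy u \<xi> ys = c" unfolding energy_def by (rule mean_eq)
  show "has_mean (\<lambda>t. (cmod (avg ys (twisted u \<xi>) t))\<^sup>2) (energy u \<xi> ys)" using m e by simp
  have "of_real c = (\<Sum>x\<leftarrow>ys. \<Sum>y\<leftarrow>ys. (cnj (\<xi> x) / length ys) * cnj (cnj (\<xi> y) / length ys) * of_real (correlation u (x \<otimes> inv y)))"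
    unfolding c(2)[symmetric] pd_form_def by (simp add: o_def)
  then have "c = Re \<dots>" by (metis Re_complex_of_real)
  also have "\<dots> = (\<Sum>x\<leftarrow>ys. \<Sum>y\<leftarrow>ys. correlation u (x \<otimes> inv y) * Re (\<xi> (x \<otimes> inv y)) / (length ys)\<^sup>2)"
  proof -
    have Re_sum: "Re (\<Sum>x\<leftarrow>xs. f x) = (\<Sum>x\<leftarrow>xs. Re (f x))" for xs :: "'a list" and f
      by (induction xs) simp_all
    show ?thesis
      unfolding Re_sum
    proof (intro arg_cong[of _ _ sum_list] map_cong refl)
      fix x y assume "x \<in> set ys" "y \<in> set ys"
      then have xy: "x \<in> carrier G" "y \<in> carrier G" using ys by auto
      then have "\<xi> (x \<otimes> inv y) = \<xi> x * cnj (\<xi> y)"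
        using \<xi> abstract_character_inv[OF \<xi>] by (simp add: abstract_characters_def)
      then show "Re ((cnj (\<xi> x) / length ys) * cnj (cnj (\<xi> y) / length ys) * of_real (correlation u (x \<otimes> inv y)))
        = correlation u (x \<otimes> inv y) * Re (\<xi> (x \<otimes> inv y)) / (length ys)\<^sup>2"
        by (simp add: power2_eq_square field_simps)
    qed
  qed
  also have "\<dots> = (\<Sum>x\<leftarrow>ys. \<Sum>y\<leftarrow>ys. correlation u (x \<otimes> inv y) * Re (\<xi> (x \<otimes> inv y))) / (length ys)\<^sup>2"
    by (simp only: divide_inverse sum_list_mult_const)
  finally show "energy u \<xi> ys = (\<Sum>x\<leftarrow>ys. \<Sum>y\<leftarrow>ys. correlation u (x \<otimes> inv y) * Re (\<xi> (x \<otimes> inv y))) / (length ys)\<^sup>2"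
    using e by simp
qed

lemma correlation_near_one:
  assumes u: "continuous_map T euclideanreal u" and e: "e > 0"
  obtains V where "openin T V" "\<one> \<in> V" "\<And>v. v \<in> V \<Longrightarrow> correlation u \<one> - e \<le> correlation u v"
proof -
  obtain B where B: "B > 0" "\<And>x. x \<in> carrier G \<Longrightarrow> norm (u x) \<le> B"
    using bounded_of_continuous_map_compact[OF compact u] by auto
  have "e / B > 0" using e B by simp
  then obtain V where V: "openin T V" "\<one> \<in> V" "\<And>v x. v \<in> V \<Longrightarrow> x \<in> carrier G \<Longrightarrow> dist (u (x \<otimes> v)) (u x) < e / B"
    using uniformly_continuous[OF u] by blast
  show ?thesis
  proof (rule that[OF V(1,2)])
    fix v assume v: "v \<in> V"
    then have vc: "v \<in> carrier G" using V(1) openin_subset by fastforce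
    have m1: "has_mean (\<lambda>t. u (\<one> \<otimes> t) * u t) (correlation u \<one>)"
      unfolding correlation_def by (intro has_mean_real continuous_map_times continuous_map_translate u one_closed)
    have m2: "has_mean (\<lambda>t. u (v \<otimes> t) * u t) (correlation u v)"
      unfolding correlation_def by (intro has_mean_real continuous_map_times continuous_map_translate u vc)
    have "has_mean (\<lambda>t. u (\<one> \<otimes> t) * u t + - e) (correlation u \<one> + - e)"
      by (intro has_mean_add m1 has_mean_const)
    then have "correlation u \<one> + - e \<le> correlation u v"
    proof (rule has_mean_mono[OF _ m2])
      fix t assume t: "t \<in> carrier G"
      have "\<bar>u (v \<otimes> t) - u t\<bar> \<le> e / B" using V(3)[OF v t] t vc by (simp add: dist_real_def m_comm)
      then have "\<bar>u (v \<otimes> t) - u t\<bar> * \<bar>u t\<bar> \<le> e / B * B"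
        using B(2)[OF t] B(1) e by (intro mult_mono) auto
      then have "\<bar>(u (v \<otimes> t) - u t) * u t\<bar> \<le> e" using B(1) by (simp add: abs_mult)
      then show "u (\<one> \<otimes> t) * u t + - e \<le> u (v \<otimes> t) * u t" using t by (simp add: algebra_simps abs_le_iff)
    qed
    then show "correlation u \<one> - e \<le> correlation u v" by simp
  qed
qed

text \<open>
  For a fixed list the energy extends to a continuous affine functional \<open>L\<close> on states, so it is
  enough to bound \<open>L\<close> at one state: some character does at least as well. The state is the normalized
  autocorrelation \<open>\<phi>\<close> of a bump function \<open>b\<close> supported so close to \<open>\<one>\<close> that the autocorrelation of
  \<open>u\<close> is at least half its value at \<open>\<one>\<close> wherever \<open>\<phi>\<close> is nonzero. The resulting bound
  involves only \<open>u\<close> and \<open>b\<close>, and so is uniform in the list.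
\<close>

lemma ex_character_energy_ge:
  assumes u: "continuous_map T euclideanreal u" and pos: "correlation u \<one> > 0"
  obtains c where "c > 0" "\<And>ys. ys \<noteq> [] \<Longrightarrow> set ys \<subseteq> carrier G \<Longrightarrow> \<exists>\<xi>\<in>abstract_characters G. c \<le> energy u \<xi> ys"
proof -
  define w0 where "w0 = correlation u \<one> / 2"
  have w0: "w0 > 0" using pos by (simp add: w0_def)
  obtain V where V: "openin T V" "\<one> \<in> V" "\<And>v. v \<in> V \<Longrightarrow> correlation u \<one> - w0 \<le> correlation u v"
    using correlation_near_one[OF u w0] by blast
  have Vw: "w0 \<le> correlation u v" if "v \<in> V" for v using V(3)[OF that] by (simp add: w0_def)
  obtain b :: "'a \<Rightarrow> real" where b: "continuous_map T euclidean b" "b \<one> = 1" "\<And>x. x \<in> carrier G \<Longrightarrow> 0 \<le> b x"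
    "\<And>x y. x \<in> carrier G \<Longrightarrow> y \<in> carrier G \<Longrightarrow> b x \<noteq> 0 \<Longrightarrow> b y \<noteq> 0 \<Longrightarrow> x \<otimes> inv y \<in> V"
    using bump_function[OF V(1,2)] by blast
  define B where "B = mean b"
  have hB: "has_mean b B" unfolding B_def by (rule has_mean_real[OF b(1)])
  have B: "B > 0" by (rule has_mean_pos[OF hB b(1,3)]) (use b(2) in auto)
  have hbb: "has_mean (\<lambda>t. b (z \<otimes> t) * b t) (correlation b z)" if "z \<in> carrier G" for z
    unfolding correlation_def by (intro has_mean_real continuous_map_times continuous_map_translate b(1) that)
  define r where "r = correlation b \<one>"
  have r: "r > 0"
    unfolding r_def by (rule has_mean_pos[OF hbb[OF one_closed], of \<one>])
      (auto simp: b intro!: continuous_map_times continuous_map_translate b(1))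
  have cb0: "0 \<le> correlation b z" if "z \<in> carrier G" for z
    by (rule has_mean_mono[OF has_mean_const hbb[OF that]]) (use b(3) that in auto)
  have supp: "z \<in> V" if z: "z \<in> carrier G" "correlation b z \<noteq> 0" for z
  proof (rule ccontr)
    assume "z \<notin> V"
    have "b (z \<otimes> t) * b t = 0" if "t \<in> carrier G" for t
    proof (rule ccontr)
      assume "b (z \<otimes> t) * b t \<noteq> 0"
      then have "z \<otimes> t \<otimes> inv t \<in> V" using b(4)[of "z \<otimes> t" t] z(1) that by simp
      then show False using \<open>z \<notin> V\<close> z(1) that by (simp add: m_assoc)
    qed
    then have "has_mean (\<lambda>t. 0) (correlation b z)" using has_mean_cong[OF hbb[OF z(1)]] by simp
    then show False using has_mean_unique[OF _ has_mean_const] z(2) by blast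
  qed
  define \<phi> where "\<phi> = (\<lambda>x. if x \<in> carrier G then complex_of_real (1 / r) * of_real (correlation b x) else 0)"
  have pdf: "pd_form G \<phi> ps ps = of_real (1 / r) * pd_form G (\<lambda>x. of_real (correlation b x)) ps ps"
    if "snd ` set ps \<subseteq> carrier G" for ps
  proof -
    have "pd_form G \<phi> ps ps = pd_form G (\<lambda>x. of_real (1 / r) * of_real (correlation b x) + 0 * 0) ps ps"
      unfolding pd_form_def using that
      by (intro arg_cong[of _ _ sum_list] map_cong refl) (auto simp: \<phi>_def subset_iff image_iff)
    also have "\<dots> = of_real (1 / r) * pd_form G (\<lambda>x. of_real (correlation b x)) ps ps"
      by (subst pd_form_linear) simp
    finally show ?thesis .
  qed
  have "pos_def G \<phi>"
    unfolding pos_def_def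
  proof (intro allI impI)
    fix ps :: "(complex \<times> 'a) list" assume ps: "snd ` set ps \<subseteq> carrier G"
    from pd_form_correlation[OF b(1) ps] obtain c where
      c: "has_mean (\<lambda>t. (cmod (\<Sum>p\<leftarrow>ps. fst p * of_real (b (snd p \<otimes> t))))\<^sup>2) c"
        "pd_form G (\<lambda>x. of_real (correlation b x)) ps ps = of_real c" by blast
    have "0 \<le> c" by (rule has_mean_mono[OF has_mean_const c(1)]) simp
    then show "0 \<le> Re (pd_form G \<phi> ps ps) \<and> Im (pd_form G \<phi> ps ps) = 0"
      unfolding pdf[OF ps] c(2) using r by simp
  qed
  then have \<phi>: "\<phi> \<in> states G" using r by (simp add: states_def \<phi>_def r_def)
  \<comment> \<open>The mean of the squared average of \<open>b\<close> is at least the square \<open>B\<^sup>2\<close> of its mean.\<close>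
  define c where "c = w0 * B\<^sup>2 / r"
  show ?thesis
  proof (rule that[of c])
    show "c > 0" using w0 B r by (simp add: c_def)
    fix ys assume ys: "ys \<noteq> []" "set ys \<subseteq> carrier G"
    define n where "n = real (length ys)"
    have n: "n > 0" using ys by (simp add: n_def)
    define L where "L = (\<lambda>\<phi> :: 'a \<Rightarrow> complex. (\<Sum>x\<leftarrow>ys. \<Sum>y\<leftarrow>ys. correlation u (x \<otimes> inv y) * Re (\<phi> (x \<otimes> inv y))) / n\<^sup>2)"
    have "continuous_on UNIV L"
    proof -
      have "continuous_on UNIV (\<lambda>\<phi> :: 'a \<Rightarrow> complex. \<Sum>x\<leftarrow>xs. \<Sum>y\<leftarrow>zs. g x y * Re (\<phi> (f x y)))"
        for g :: "'a \<Rightarrow> 'a \<Rightarrow> real" and f xs zs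
      proof -
        have "continuous_on UNIV (\<lambda>\<phi> :: 'a \<Rightarrow> complex. \<Sum>y\<leftarrow>zs. g x y * Re (\<phi> (f x y)))" for x
          by (induction zs) (auto intro!: continuous_intros)
        then show ?thesis by (induction xs) (auto intro!: continuous_intros)
      qed
      then show ?thesis unfolding L_def using n by (intro continuous_intros) auto
    qed
    moreover have "L (\<lambda>x. of_real t * \<phi> x + of_real (1 - t) * \<psi> x) = t * L \<phi> + (1 - t) * L \<psi>"
      for \<phi> \<psi> and t :: real
    proof -
      have 1: "(\<Sum>y\<leftarrow>ys. correlation u (x \<otimes> inv y) * Re (of_real t * \<phi> (x \<otimes> inv y) + of_real (1 - t) * \<psi> (x \<otimes> inv y)))
        = t * (\<Sum>y\<leftarrow>ys. correlation u (x \<otimes> inv y) * Re (\<phi> (x \<otimes> inv y))) +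
         (1 - t) * (\<Sum>y\<leftarrow>ys. correlation u (x \<otimes> inv y) * Re (\<psi> (x \<otimes> inv y)))" for x
        by (induction ys) (simp_all add: algebra_simps)
      show ?thesis
        unfolding L_def 1 by (simp only: sum_list_addf sum_list_const_mult add_divide_distrib times_divide_eq_right)
    qed
    ultimately obtain \<xi> where \<xi>: "\<xi> \<in> abstract_characters G" "L \<phi> \<le> L \<xi>"
      using character_dominates_state[OF \<phi>] by blast
    have "c \<le> L \<phi>"
    proof -
      define ps where "ps = map (\<lambda>y. (complex_of_real (1 / n), y)) ys"
      have ps: "snd ` set ps \<subseteq> carrier G" using ys by (auto simp: ps_def)
      obtain d where d: "has_mean (\<lambda>t. (cmod (\<Sum>p\<leftarrow>ps. fst p * of_real (b (snd p \<otimes> t))))\<^sup>2) d"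
        "pd_form G (\<lambda>x. of_real (correlation b x)) ps ps = of_real d"
        using pd_form_correlation[OF b(1) ps] by blast
      have "B\<^sup>2 \<le> d"
      proof -
        have avg: "(cmod (\<Sum>p\<leftarrow>ps. fst p * of_real (b (snd p \<otimes> t))))\<^sup>2 = (avg ys b t)\<^sup>2" if "t \<in> carrier G" for t
        proof -
          have "(\<Sum>p\<leftarrow>ps. fst p * of_real (b (snd p \<otimes> t))) = (\<Sum>y\<leftarrow>ys. of_real (1 / n) * of_real (b (t \<otimes> y)))"
            unfolding ps_def using that ys(2) unfolding map_map o_def fst_conv snd_conv
            by (intro arg_cong[of _ _ sum_list] map_cong refl) (auto simp: m_comm subset_iff)
          also have "\<dots> = complex_of_real (1 / n) * (\<Sum>y\<leftarrow>ys. of_real (b (t \<otimes> y)))" by (rule sum_list_const_mult)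
          also have "(\<Sum>y\<leftarrow>ys. complex_of_real (b (t \<otimes> y))) = of_real (\<Sum>y\<leftarrow>ys. b (t \<otimes> y))"
            by (induction ys) simp_all
          also have "complex_of_real (1 / n) * of_real (\<Sum>y\<leftarrow>ys. b (t \<otimes> y)) = of_real (avg ys b t)"
            by (simp add: avg_def n_def divide_inverse)
          finally show ?thesis by (simp add: power2_eq_square flip: abs_mult)
        qed
        have "has_mean (\<lambda>t. 2 * B * avg ys b t + - (B\<^sup>2)) (2 * B * B + - (B\<^sup>2))"
          by (intro has_mean_add has_mean_cmult has_mean_avg hB ys has_mean_const)
        then have "2 * B * B + - (B\<^sup>2) \<le> d"
        proof (rule has_mean_mono[OF _ d(1)])
          fix t assume t: "t \<in> carrier G"
          have "0 \<le> (avg ys b t - B)\<^sup>2" by simp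
          then show "2 * B * avg ys b t + - (B\<^sup>2) \<le> (cmod (\<Sum>p\<leftarrow>ps. fst p * of_real (b (snd p \<otimes> t))))\<^sup>2"
            unfolding avg[OF t] by (simp add: power2_diff algebra_simps)
        qed
        then show ?thesis by (simp add: power2_eq_square)
      qed
      have "of_real (d / r) = pd_form G \<phi> ps ps" unfolding pdf[OF ps] d(2) by simp
      also have "\<dots> = (\<Sum>x\<leftarrow>ys. \<Sum>y\<leftarrow>ys. of_real (1 / n) * cnj (of_real (1 / n)) * \<phi> (x \<otimes> inv y))"
        unfolding pd_form_def ps_def by (simp add: o_def)
      also have "\<dots> = (\<Sum>x\<leftarrow>ys. \<Sum>y\<leftarrow>ys. of_real (1 / n\<^sup>2 * Re (\<phi> (x \<otimes> inv y))))"
        using ys(2) by (intro arg_cong[of _ _ sum_list] map_cong refl) (auto simp: \<phi>_def power2_eq_square subset_iff)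
      also have "\<dots> = of_real (\<Sum>x\<leftarrow>ys. \<Sum>y\<leftarrow>ys. 1 / n\<^sup>2 * Re (\<phi> (x \<otimes> inv y)))"
      proof -
        have o: "(\<Sum>x\<leftarrow>xs. of_real (f x)) = complex_of_real (\<Sum>x\<leftarrow>xs. f x)" for xs :: "'a list" and f
          by (induction xs) simp_all
        show ?thesis by (simp only: o)
      qed
      finally have eq: "d / r = (\<Sum>x\<leftarrow>ys. \<Sum>y\<leftarrow>ys. 1 / n\<^sup>2 * Re (\<phi> (x \<otimes> inv y)))" by (simp only: of_real_eq_iff)
      have "c \<le> w0 * (d / r)" using \<open>B\<^sup>2 \<le> d\<close> w0 r by (simp add: c_def divide_right_mono)
      also have "\<dots> = (\<Sum>x\<leftarrow>ys. \<Sum>y\<leftarrow>ys. w0 * (1 / n\<^sup>2 * Re (\<phi> (x \<otimes> inv y))))"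
        unfolding eq by (simp only: sum_list_const_mult)
      also have "\<dots> \<le> (\<Sum>x\<leftarrow>ys. \<Sum>y\<leftarrow>ys. correlation u (x \<otimes> inv y) * Re (\<phi> (x \<otimes> inv y)) * (1 / n\<^sup>2))"
      proof (intro sum_list_mono)
        fix x y assume "x \<in> set ys" "y \<in> set ys"
        then have z: "x \<otimes> inv y \<in> carrier G" using ys by auto
        have "w0 * Re (\<phi> (x \<otimes> inv y)) \<le> correlation u (x \<otimes> inv y) * Re (\<phi> (x \<otimes> inv y))"
        proof (cases "correlation b (x \<otimes> inv y) = 0")
          case False
          then show ?thesis using Vw[OF supp[OF z]] cb0[OF z] r z
            by (intro mult_right_mono) (auto simp: \<phi>_def)
        qed (simp add: \<phi>_def)
        then have "w0 * Re (\<phi> (x \<otimes> inv y)) * (1 / n\<^sup>2) \<le> correlation u (x \<otimes> inv y) * Re (\<phi> (x \<otimes> inv y)) * (1 / n\<^sup>2)"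
          by (rule mult_right_mono) simp
        then show "w0 * (1 / n\<^sup>2 * Re (\<phi> (x \<otimes> inv y))) \<le> correlation u (x \<otimes> inv y) * Re (\<phi> (x \<otimes> inv y)) * (1 / n\<^sup>2)"
          by (simp add: mult_ac)
      qed
      also have "\<dots> = L \<phi>" unfolding L_def by (simp only: sum_list_mult_const divide_inverse mult_1_left)
      finally show ?thesis .
    qed
    also note \<xi>(2)
    also have "L \<xi> = energy u \<xi> ys" unfolding L_def n_def energy_eq[OF u \<xi>(1) ys(2)] by simp
    finally show "\<exists>\<xi>\<in>abstract_characters G. c \<le> energy u \<xi> ys" using \<xi>(1) by blast
  qed
qed

lemma energy_mono:
  assumes u: "continuous_map T euclideanreal u" and \<xi>: "\<xi> \<in> abstract_characters G"
    and ys: "set ys \<subseteq> carrier G" "ys \<noteq> []" and zs: "set zs \<subseteq> carrier G" "zs \<noteq> []" and ws: "set ws \<subseteq> carrier G"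
    and eq: "\<And>x. x \<in> carrier G \<Longrightarrow> avg ws (twisted u \<xi>) x = avg zs (avg ys (twisted u \<xi>)) x"
  shows "energy u \<xi> ws \<le> energy u \<xi> ys"
proof (rule has_mean_mono)
  show "has_mean (\<lambda>t. (cmod (avg ws (twisted u \<xi>) t))\<^sup>2) (energy u \<xi> ws)" by (rule has_mean_energy[OF u \<xi> ws])
  show "has_mean (avg zs (\<lambda>t. (cmod (avg ys (twisted u \<xi>) t))\<^sup>2)) (energy u \<xi> ys)"
    by (rule has_mean_avg[OF has_mean_energy[OF u \<xi> ys(1)] zs(2,1)])
  fix x assume "x \<in> carrier G"
  show "(cmod (avg ws (twisted u \<xi>) x))\<^sup>2 \<le> avg zs (\<lambda>t. (cmod (avg ys (twisted u \<xi>) t))\<^sup>2) x"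
    unfolding eq[OF \<open>x \<in> carrier G\<close>] by (rule square_avg_le[OF zs(2)])
qed

lemma compact_abstract_characters: "compact (abstract_characters G)"
proof -
  have "compactin (product_topology (\<lambda>i. euclidean) UNIV) (PiE UNIV (\<lambda>_::'a. cball (0::complex) 1))"
    by (simp add: compactin_PiE)
  then have K: "compact {\<phi> :: 'a \<Rightarrow> complex. \<forall>x. \<phi> x \<in> cball 0 1}"
    by (simp add: euclidean_product_topology PiE_UNIV_domain Pi_def)
  have c: "continuous_on UNIV (\<lambda>\<xi> :: 'a \<Rightarrow> complex. \<xi> x)" for x by (rule continuous_on_product_coordinates)
  have 1: "closed {\<xi> :: 'a \<Rightarrow> complex. \<forall>x. x \<in> carrier G \<longrightarrow> (\<forall>y. y \<in> carrier G \<longrightarrow> \<xi> (x \<otimes> y) = \<xi> x * \<xi> y)}"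
    by (intro closed_Collect_all closed_Collect_imp closed_Collect_eq continuous_intros c) auto
  have 2: "closed {\<xi> :: 'a \<Rightarrow> complex. \<forall>x. x \<in> carrier G \<longrightarrow> cmod (\<xi> x) = 1}"
    by (intro closed_Collect_all closed_Collect_imp closed_Collect_eq continuous_intros c) auto
  have 3: "closed {\<xi> :: 'a \<Rightarrow> complex. \<forall>x. x \<notin> carrier G \<longrightarrow> \<xi> x = 0}"
    by (intro closed_Collect_all closed_Collect_imp closed_Collect_eq continuous_intros c) auto
  have "closed (abstract_characters G)"
    unfolding abstract_characters_def Ball_def by (intro closed_Collect_conj 1 2 3)
  moreover have "abstract_characters G \<subseteq> {\<phi>. \<forall>x. \<phi> x \<in> cball 0 1}"
  proof
    fix \<xi> assume \<xi>: "\<xi> \<in> abstract_characters G"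
    have "cmod (\<xi> x) \<le> 1" for x using \<xi> by (cases "x \<in> carrier G") (auto simp: abstract_characters_def)
    then show "\<xi> \<in> {\<phi>. \<forall>x. \<phi> x \<in> cball 0 1}" by simp
  qed
  ultimately show ?thesis using K by (metis compact_Int_closed inf.absorb_iff2)
qed

text \<open>
  The bound for single lists becomes a simultaneous one by compactness of the set of all
  multiplicative characters: refining a list does not increase the energy, so the conditions belonging to
  finitely many lists follow from the condition of one common refinement.
\<close>

lemma ex_energetic_character:
  assumes u: "continuous_map T euclideanreal u" and pos: "correlation u \<one> > 0"
  obtains c \<xi> where "c > 0" "\<xi> \<in> abstract_characters G"
    "\<And>ys. ys \<noteq> [] \<Longrightarrow> set ys \<subseteq> carrier G \<Longrightarrow> c \<le> energy u \<xi> ys"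
proof -
  obtain c where c: "c > 0" and ex: "\<And>ys. ys \<noteq> [] \<Longrightarrow> set ys \<subseteq> carrier G \<Longrightarrow> \<exists>\<xi>\<in>abstract_characters G. c \<le> energy u \<xi> ys"
    using ex_character_energy_ge[OF u pos] by blast
  define E where "E = (\<lambda>ys (\<xi> :: 'a \<Rightarrow> complex).
    (\<Sum>x\<leftarrow>ys. \<Sum>y\<leftarrow>ys. correlation u (x \<otimes> inv y) * Re (\<xi> (x \<otimes> inv y))) / (length ys)\<^sup>2)"
  have contE: "continuous_on UNIV (E ys)" for ys
  proof -
    have "continuous_on UNIV (\<lambda>\<xi> :: 'a \<Rightarrow> complex. \<Sum>x\<leftarrow>xs. \<Sum>y\<leftarrow>zs. g x y * Re (\<xi> (f x y)))"
      for g :: "'a \<Rightarrow> 'a \<Rightarrow> real" and f xs zs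
    proof -
      have "continuous_on UNIV (\<lambda>\<xi> :: 'a \<Rightarrow> complex. \<Sum>y\<leftarrow>zs. g x y * Re (\<xi> (f x y)))" for x
        by (induction zs) (auto intro!: continuous_intros)
      then show ?thesis by (induction xs) (auto intro!: continuous_intros)
    qed
    then show ?thesis unfolding E_def divide_inverse by (intro continuous_on_mult_right)
  qed
  define I where "I = {ys. ys \<noteq> [] \<and> set ys \<subseteq> carrier G}"
  define K where "K = (\<lambda>ys. {\<xi>. c \<le> E ys \<xi>})"
  have EE: "E ys \<xi> = energy u \<xi> ys" if "ys \<in> I" "\<xi> \<in> abstract_characters G" for ys \<xi>
    using energy_eq[OF u that(2)] that(1) by (simp add: E_def I_def)
  have dir: "\<exists>ws\<in>I. abstract_characters G \<inter> K ws \<subseteq> (\<Inter>ys\<in>F. K ys)" if "finite F" "F \<subseteq> I" for F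
    using that
  proof (induction F)
    case empty
    show ?case by (rule bexI[of _ "[\<one>]"]) (auto simp: I_def)
  next
    case (insert ys F)
    then obtain zs where zs: "zs \<in> I" "abstract_characters G \<inter> K zs \<subseteq> (\<Inter>ys\<in>F. K ys)" by auto
    have ys: "ys \<in> I" using insert by simp
    obtain ws where ws: "ws \<noteq> []" "set ws \<subseteq> carrier G"
      "\<And>(f :: 'a \<Rightarrow> complex) x. x \<in> carrier G \<Longrightarrow> avg ws f x = avg zs (avg ys f) x"
      using avg_avg[of zs ys] zs(1) ys unfolding I_def by blast
    have wI: "ws \<in> I" using ws by (simp add: I_def)
    have "energy u \<xi> ws \<le> energy u \<xi> ys" "energy u \<xi> ws \<le> energy u \<xi> zs" if \<xi>: "\<xi> \<in> abstract_characters G" for \<xi>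
    proof -
      show "energy u \<xi> ws \<le> energy u \<xi> ys"
        by (rule energy_mono[OF u \<xi> _ _ _ _ ws(2) ws(3)]) (use ys zs(1) in \<open>auto simp: I_def\<close>)
      show "energy u \<xi> ws \<le> energy u \<xi> zs"
      proof (rule energy_mono[OF u \<xi> _ _ _ _ ws(2)])
        fix x assume x: "x \<in> carrier G"
        show "avg ws (twisted u \<xi>) x = avg ys (avg zs (twisted u \<xi>)) x"
          unfolding ws(3)[OF x] by (rule avg_commute[OF x]) (use ys zs(1) in \<open>auto simp: I_def\<close>)
      qed (use ys zs(1) in \<open>auto simp: I_def\<close>)
    qed
    then have "abstract_characters G \<inter> K ws \<subseteq> K ys \<inter> K zs"
      using EE[OF ys] EE[OF zs(1)] EE[OF wI] by (fastforce simp: K_def)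
    then have "abstract_characters G \<inter> K ws \<subseteq> (\<Inter>ys\<in>insert ys F. K ys)" using zs(2) by auto
    then show ?case using wI by blast
  qed
  have "abstract_characters G \<inter> \<Inter>(K ` I) \<noteq> {}"
  proof (rule compact_imp_fip[OF compact_abstract_characters])
    fix S assume "S \<in> K ` I"
    then show "closed S" unfolding K_def by (auto intro!: closed_Collect_le continuous_intros contE)
  next
    fix \<F> assume "finite \<F>" "\<F> \<subseteq> K ` I"
    then obtain F where F: "finite F" "F \<subseteq> I" "\<F> = K ` F" by (meson finite_subset_image)
    obtain ws where ws: "ws \<in> I" "abstract_characters G \<inter> K ws \<subseteq> (\<Inter>ys\<in>F. K ys)" using dir[OF F(1,2)] by blast
    obtain \<xi> where \<xi>: "\<xi> \<in> abstract_characters G" "c \<le> energy u \<xi> ws" using ex[of ws] ws(1) unfolding I_def by auto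
    then have "\<xi> \<in> abstract_characters G \<inter> K ws" using EE[OF ws(1)] by (simp add: K_def)
    then show "abstract_characters G \<inter> \<Inter>\<F> \<noteq> {}" using ws(2) unfolding F(3) by blast
  qed
  then obtain \<xi> where \<xi>: "\<xi> \<in> abstract_characters G" "\<And>ys. ys \<in> I \<Longrightarrow> \<xi> \<in> K ys" by blast
  show ?thesis
    by (rule that[OF c \<xi>(1)]) (use \<xi>(2) EE[OF _ \<xi>(1)] in \<open>auto simp: I_def K_def\<close>)
qed

end

section \<open>Separation of points and evaluation homomorphisms\<close>

context compact_abelian_group
begin

lemma continuous_map_if_near_translates:
  fixes f :: "'a \<Rightarrow> 'c::metric_space"
  assumes near: "\<And>x e. x \<in> carrier G \<Longrightarrow> e > 0 \<Longrightarrow>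
    \<exists>V. openin T V \<and> \<one> \<in> V \<and> (\<forall>v\<in>V. dist (f (x \<otimes> v)) (f x) < e)"
  shows "continuous_map T euclidean f"
  unfolding continuous_map_euclidean_tendsto
proof (intro ballI tendstoI)
  fix x and e :: real assume "x \<in> topspace T" and e: "e > 0"
  then have x: "x \<in> carrier G" by simp
  obtain V where V: "openin T V" "\<one> \<in> V" "\<forall>v\<in>V. dist (f (x \<otimes> v)) (f x) < e" using near[OF x e] by blast
  let ?U = "{y \<in> topspace T. inv x \<otimes> y \<in> V}"
  have "continuous_map T T (\<lambda>y. inv x \<otimes> y)"
    using continuous_map_translate(2)[of T id "inv x"] x by simp
  then have U: "openin T ?U" using V(1) by (rule openin_continuous_map_preimage)
  have "dist (f y) (f x) < e" if "y \<in> ?U" for y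
    using V(3)[rule_format, of "inv x \<otimes> y"] that x by (simp add: m_assoc[symmetric])
  moreover have "x \<in> ?U" using x V(2) by simp
  ultimately show "\<forall>\<^sub>F y in atin T x. dist (f y) (f x) < e"
    unfolding eventually_atin using U by blast
qed

text \<open>
  Let \<open>l > 0\<close> be the infimum of the energies and \<open>h\<close> an average of \<open>twisted u \<xi>\<close> whose energy is
  almost \<open>l\<close>. Averaging \<open>h\<close> with its translate by \<open>v\<close> cannot bring the energy below \<open>l\<close>, so by
  the parallelogram law \<open>h\<close> and its translate are close in mean square. For small \<open>v\<close> uniform
  continuity of \<open>u\<close> makes \<open>h t\<close> uniformly close to \<open>\<xi> v * h (t \<otimes> v)\<close>. Together
  these force \<open>(cmod (1 - \<xi> v))\<^sup>2 * l\<close> to be small.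
\<close>

lemma energetic_character_continuous:
  assumes u: "continuous_map T euclideanreal u" and \<xi>: "\<xi> \<in> abstract_characters G" and c: "c > 0"
    and en: "\<And>ys. ys \<noteq> [] \<Longrightarrow> set ys \<subseteq> carrier G \<Longrightarrow> c \<le> energy u \<xi> ys"
  shows "continuous_map T euclidean \<xi>"
proof -
  have mult: "\<xi> (x \<otimes> y) = \<xi> x * \<xi> y" if "x \<in> carrier G" "y \<in> carrier G" for x y
    using \<xi> that by (simp add: abstract_characters_def)
  have unit: "cmod (\<xi> x) = 1" if "x \<in> carrier G" for x
    using \<xi> that by (simp add: abstract_characters_def)
  define I where "I = {ys. ys \<noteq> [] \<and> set ys \<subseteq> carrier G}"
  define l where "l = Inf (energy u \<xi> ` I)"
  have I_ne: "[\<one>] \<in> I" by (simp add: I_def)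
  have bdd: "bdd_below (energy u \<xi> ` I)" using en by (intro bdd_belowI[of _ c]) (auto simp: I_def)
  have l_le: "l \<le> energy u \<xi> ys" if "ys \<in> I" for ys
    unfolding l_def using bdd that by (intro cInf_lower) auto
  have "c \<le> l" unfolding l_def
  proof (rule cInf_greatest)
    show "energy u \<xi> ` I \<noteq> {}" using I_ne by blast
  qed (use en in \<open>auto simp: I_def\<close>)
  with c have l: "l > 0" by simp
  have near: "\<exists>V. openin T V \<and> \<one> \<in> V \<and> (\<forall>v\<in>V. cmod (\<xi> v - 1) < e)" if e: "e > 0" for e
  proof -
    define e' where "e' = e * sqrt l / 2"
    have e': "e' > 0" using e l by (simp add: e'_def)
    obtain V where V: "openin T V" "\<one> \<in> V" "\<And>v x. v \<in> V \<Longrightarrow> x \<in> carrier G \<Longrightarrow> dist (u (x \<otimes> v)) (u x) < e'"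
      using uniformly_continuous[OF u e'] by blast
    have "cmod (\<xi> v - 1) < e" if v: "v \<in> V" for v
    proof -
      have vc: "v \<in> carrier G" using v V(1) openin_subset by fastforce
      define k where "k = cmod (1 - \<xi> v)"
      have bound: "k\<^sup>2 * l \<le> 8 * d + 2 * e'\<^sup>2" if d: "d > 0" for d
      proof -
        have "Inf (energy u \<xi> ` I) < l + d" using d by (simp add: l_def)
        then obtain ys where ys: "ys \<in> I" "energy u \<xi> ys < l + d"
          using cInf_lessD[of "energy u \<xi> ` I" "l + d"] I_ne by blast
        have ys': "ys \<noteq> []" "set ys \<subseteq> carrier G" using ys(1) by (auto simp: I_def)
        let ?h = "avg ys (twisted u \<xi>)"
        define zs where "zs = map (\<lambda>y. y \<otimes> v) ys"
        have zs: "zs \<noteq> []" "set zs \<subseteq> carrier G" "length zs = length ys" using ys' vc by (auto simp: zs_def)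
        have hz: "avg zs (twisted u \<xi>) t = ?h (t \<otimes> v)" if t: "t \<in> carrier G" for t
        proof -
          have "(\<Sum>z\<leftarrow>zs. twisted u \<xi> (t \<otimes> z)) = (\<Sum>y\<leftarrow>ys. twisted u \<xi> (t \<otimes> v \<otimes> y))"
            unfolding zs_def map_map o_def using ys'(2) vc t
            by (intro arg_cong[of _ _ sum_list] map_cong refl) (auto simp: m_ac subset_iff)
          then show ?thesis by (simp add: avg_def zs(3))
        qed
        have both: "avg (ys @ zs) (twisted u \<xi>) t = (?h t + ?h (t \<otimes> v)) / 2" if t: "t \<in> carrier G" for t
        proof -
          have inv: "inverse (real (length (ys @ zs))) = (1 / 2) * inverse (real (length ys))"
            using zs(3) by simp
          have "avg (ys @ zs) (twisted u \<xi>) t = (1 / 2) *\<^sub>R (?h t + avg zs (twisted u \<xi>) t)"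
            unfolding avg_def inv by (simp add: zs(3) scaleR_add_right)
          then show ?thesis unfolding hz[OF t] by (simp add: scaleR_conv_of_real)
        qed
        have m1: "has_mean (\<lambda>t. (cmod (?h t))\<^sup>2) (energy u \<xi> ys)" by (rule has_mean_energy[OF u \<xi> ys'(2)])
        have m2: "has_mean (\<lambda>t. (cmod (?h (t \<otimes> v)))\<^sup>2) (energy u \<xi> ys)" by (rule has_mean_translate[OF m1 vc])
        have m3: "has_mean (\<lambda>t. (cmod ((?h t + ?h (t \<otimes> v)) / 2))\<^sup>2) (energy u \<xi> (ys @ zs))"
        proof (rule has_mean_cong[OF has_mean_energy[OF u \<xi>]])
          show "set (ys @ zs) \<subseteq> carrier G" using ys' zs by simp
        qed (simp only: both)
        have l3: "l \<le> energy u \<xi> (ys @ zs)" using ys' zs by (intro l_le) (simp add: I_def)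
        let ?E = "energy u \<xi> ys"
        have M4: "has_mean (\<lambda>t. (4 * (cmod (?h t))\<^sup>2 + 4 * (cmod (?h (t \<otimes> v)))\<^sup>2) + ((-8) * (cmod ((?h t + ?h (t \<otimes> v)) / 2))\<^sup>2 + 2 * e'\<^sup>2))
          ((4 * ?E + 4 * ?E) + ((-8) * energy u \<xi> (ys @ zs) + 2 * e'\<^sup>2))"
          by (intro has_mean_add has_mean_cmult m1 m2 m3 has_mean_const)
        have M5: "has_mean (\<lambda>t. k\<^sup>2 * (cmod (?h (t \<otimes> v)))\<^sup>2) (k\<^sup>2 * ?E)" by (intro has_mean_cmult m2)
        have "k\<^sup>2 * ?E \<le> (4 * ?E + 4 * ?E) + ((-8) * energy u \<xi> (ys @ zs) + 2 * e'\<^sup>2)"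
        proof (rule has_mean_mono[OF M5 M4])
          fix t assume t: "t \<in> carrier G"
          define a where "a = ?h t"
          define b where "b = ?h (t \<otimes> v)"
          have ab: "cmod (a - \<xi> v * b) \<le> e'"
          proof -
            have "norm (avg ys (\<lambda>x. of_real (u x - u (x \<otimes> v)) * cnj (\<xi> x)) t - 0) \<le> e'"
            proof (rule norm_avg_le[OF ys' t])
              fix x assume x: "x \<in> carrier G"
              have "\<bar>u x - u (x \<otimes> v)\<bar> \<le> e'" using V(3)[OF v x] by (simp add: dist_real_def abs_minus_commute)
              then show "norm (of_real (u x - u (x \<otimes> v)) * cnj (\<xi> x) - 0) \<le> e'"
                using unit[OF x] by (simp add: norm_mult del: of_real_diff)
            qed
            moreover have "avg ys (\<lambda>x. of_real (u x - u (x \<otimes> v)) * cnj (\<xi> x)) t = a - \<xi> v * b"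
            proof -
              have vv: "\<xi> v * cnj (\<xi> v) = 1" using unit[OF vc] by (simp add: complex_norm_square[symmetric])
              have "(\<Sum>y\<leftarrow>ys. of_real (u (t \<otimes> y) - u (t \<otimes> y \<otimes> v)) * cnj (\<xi> (t \<otimes> y)))
                = (\<Sum>y\<leftarrow>ys. twisted u \<xi> (t \<otimes> y) - \<xi> v * twisted u \<xi> (t \<otimes> v \<otimes> y))"
              proof (intro arg_cong[of _ _ sum_list] map_cong refl)
                fix y assume "y \<in> set ys"
                then have y: "y \<in> carrier G" using ys' by auto
                have e1: "t \<otimes> v \<otimes> y = t \<otimes> y \<otimes> v" using t vc y by (simp add: m_ac)
                have "\<xi> v * (of_real (u (t \<otimes> y \<otimes> v)) * cnj (\<xi> (t \<otimes> y \<otimes> v)))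
                  = (\<xi> v * cnj (\<xi> v)) * (of_real (u (t \<otimes> y \<otimes> v)) * cnj (\<xi> (t \<otimes> y)))"
                  using mult[of "t \<otimes> y" v] t y vc by simp
                then show "of_real (u (t \<otimes> y) - u (t \<otimes> y \<otimes> v)) * cnj (\<xi> (t \<otimes> y)) = twisted u \<xi> (t \<otimes> y) - \<xi> v * twisted u \<xi> (t \<otimes> v \<otimes> y)"
                  unfolding vv e1 twisted_def by (simp add: algebra_simps)
              qed
              also have "\<dots> = (\<Sum>y\<leftarrow>ys. twisted u \<xi> (t \<otimes> y)) - \<xi> v * (\<Sum>y\<leftarrow>ys. twisted u \<xi> (t \<otimes> v \<otimes> y))"
                by (simp only: sum_list_subtractf sum_list_const_mult)
              finally show ?thesis
                unfolding a_def b_def avg_def by (simp add: scaleR_diff_right)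
            qed
            ultimately show ?thesis by simp
          qed
          have "k * cmod b = cmod ((1 - \<xi> v) * b)" by (simp add: k_def norm_mult)
          also have "(1 - \<xi> v) * b = (b - a) + (a - \<xi> v * b)" by (simp add: algebra_simps)
          also have "cmod \<dots> \<le> cmod (b - a) + e'" using ab norm_triangle_ineq[of "b - a" "a - \<xi> v * b"] by linarith
          finally have "(k * cmod b)\<^sup>2 \<le> (cmod (b - a) + e')\<^sup>2"
            by (intro power_mono) (auto simp: k_def)
          also have "\<dots> \<le> 2 * (cmod (b - a))\<^sup>2 + 2 * e'\<^sup>2"
            using sum_squares_bound[of "cmod (b - a)" e'] by (simp add: power2_sum)
          also have "(cmod (b - a))\<^sup>2 = 2 * (cmod a)\<^sup>2 + 2 * (cmod b)\<^sup>2 - 4 * (cmod ((a + b) / 2))\<^sup>2"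
            unfolding cmod_power2 by (simp add: power2_eq_square field_simps)
          finally show "k\<^sup>2 * (cmod (?h (t \<otimes> v)))\<^sup>2 \<le> (4 * (cmod (?h t))\<^sup>2 + 4 * (cmod (?h (t \<otimes> v)))\<^sup>2) + ((-8) * (cmod ((?h t + ?h (t \<otimes> v)) / 2))\<^sup>2 + 2 * e'\<^sup>2)"
            unfolding a_def[symmetric] b_def[symmetric] by (simp add: power_mult_distrib)
        qed
        also have "\<dots> \<le> 8 * d + 2 * e'\<^sup>2" using ys(2) l3 by simp
        finally have "k\<^sup>2 * ?E \<le> 8 * d + 2 * e'\<^sup>2" .
        moreover have "k\<^sup>2 * l \<le> k\<^sup>2 * ?E" using l_le[OF ys(1)] by (intro mult_left_mono) auto
        ultimately show ?thesis by simp
      qed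
      have "k\<^sup>2 * l \<le> 2 * e'\<^sup>2"
      proof (rule field_le_epsilon)
        fix d :: real assume "d > 0"
        then show "k\<^sup>2 * l \<le> 2 * e'\<^sup>2 + d" using bound[of "d / 8"] by simp
      qed
      also have "2 * e'\<^sup>2 = (e\<^sup>2 / 2) * l" using l by (simp add: e'_def power_mult_distrib power_divide)
      finally have "k\<^sup>2 \<le> e\<^sup>2 / 2" using l by simp
      also have "\<dots> < e\<^sup>2" using e by simp
      finally have "k < e" using e by (simp add: power_less_imp_less_base)
      then show ?thesis by (simp add: k_def norm_minus_commute)
    qed
    with V show ?thesis by blast
  qed
  show ?thesis
  proof (rule continuous_map_if_near_translates)
    fix x and e :: real assume x: "x \<in> carrier G" and e: "e > 0"
    obtain V where V: "openin T V" "\<one> \<in> V" "\<forall>v\<in>V. cmod (\<xi> v - 1) < e" using near[OF e] by blast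
    have "dist (\<xi> (x \<otimes> v)) (\<xi> x) < e" if v: "v \<in> V" for v
    proof -
      have vc: "v \<in> carrier G" using v V(1) openin_subset by fastforce
      have "\<xi> (x \<otimes> v) - \<xi> x = \<xi> x * (\<xi> v - 1)" using mult[OF x vc] by (simp add: algebra_simps)
      then show ?thesis using V(3) v unit[OF x] by (simp add: dist_norm norm_mult)
    qed
    with V show "\<exists>V. openin T V \<and> \<one> \<in> V \<and> (\<forall>v\<in>V. dist (\<xi> (x \<otimes> v)) (\<xi> x) < e)" by blast
  qed
qed

text \<open>
  Take \<open>u x = k x - k (x \<otimes> a)\<close> for a bump function \<open>k\<close> that vanishes at \<open>a\<close>. If a character \<open>\<xi>\<close>
  satisfies \<open>\<xi> a = 1\<close>, then \<open>twisted u \<xi>\<close> is a difference of a function and its translate and has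
  mean zero, so its averages become small and its energies are not bounded below. A character with
  energies bounded below therefore separates \<open>a\<close> from \<open>\<one>\<close>.
\<close>

theorem characters_separate:
  assumes a: "a \<in> carrier G" "a \<noteq> \<one>"
  obtains \<xi> where "\<xi> \<in> characters" "\<xi> a \<noteq> 1"
proof -
  have "closedin T {a}" using Hausdorff a by (simp add: closedin_Hausdorff_sing_eq)
  then have "openin T (topspace T - {a})" by (rule openin_diff[OF openin_topspace])
  moreover define V where "V = carrier G - {a}"
  ultimately have V: "openin T V" by simp
  have one: "\<one> \<in> V" using a by (auto simp: V_def)
  obtain k :: "'a \<Rightarrow> real" where k: "continuous_map T euclidean k" "k \<one> = 1"
    "\<And>x. x \<in> carrier G \<Longrightarrow> 0 \<le> k x"
    "\<And>x y. x \<in> carrier G \<Longrightarrow> y \<in> carrier G \<Longrightarrow> k x \<noteq> 0 \<Longrightarrow> k y \<noteq> 0 \<Longrightarrow> x \<otimes> inv y \<in> V"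
    using bump_function[OF V one] by blast
  have ka: "k a = 0" using k(4)[of a \<one>] k(2) a by (auto simp: V_def)
  define u where "u = (\<lambda>x. k x - k (x \<otimes> a))"
  have u: "continuous_map T euclideanreal u"
    unfolding u_def by (intro continuous_map_diff k(1) continuous_map_translate(1)[OF k(1) a(1)])
  have u1: "u \<one> = 1" using k(2) ka a by (simp add: u_def)
  have uu: "has_mean (\<lambda>t. u (\<one> \<otimes> t) * u t) (correlation u \<one>)"
    unfolding correlation_def by (intro has_mean_real continuous_map_times continuous_map_translate u one_closed)
  have pos: "correlation u \<one> > 0"
    by (rule has_mean_pos[OF uu _ _ one_closed])
      (auto simp: u1 intro!: continuous_map_times continuous_map_translate u)
  obtain c \<xi> where c: "c > 0" and \<xi>: "\<xi> \<in> abstract_characters G"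
    and en: "\<And>ys. ys \<noteq> [] \<Longrightarrow> set ys \<subseteq> carrier G \<Longrightarrow> c \<le> energy u \<xi> ys"
    using ex_energetic_character[OF u pos] by blast
  have cont: "continuous_map T euclidean \<xi>" by (rule energetic_character_continuous[OF u \<xi> c en])
  have mult: "\<xi> (x \<otimes> y) = \<xi> x * \<xi> y" if "x \<in> carrier G" "y \<in> carrier G" for x y
    using \<xi> that by (simp add: abstract_characters_def)
  have "\<xi> a \<noteq> 1"
  proof
    assume "\<xi> a = 1"
    define f where "f = (\<lambda>x. complex_of_real (k x) * cnj (\<xi> x))"
    have "continuous_map T euclidean f"
      unfolding f_def
      by (intro continuous_map_times continuous_map_tendsto_compose[OF k(1)] continuous_map_tendsto_compose[OF cont] continuous_intros)
    then have f: "has_mean f (mean f)" by (rule has_mean_complex)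
    have "has_mean (\<lambda>x. f x + - f (x \<otimes> a)) (mean f + - mean f)"
      by (intro has_mean_add f has_mean_linear[OF has_mean_translate[OF f a(1)]] bounded_linear_minus bounded_linear_ident)
    then have "has_mean (\<lambda>x. f x + - f (x \<otimes> a)) 0" by simp
    then have m0: "has_mean (twisted u \<xi>) 0"
      by (rule has_mean_cong) (use \<open>\<xi> a = 1\<close> mult a in \<open>simp add: f_def twisted_def u_def algebra_simps\<close>)
    have "sqrt c / 2 > 0" using c by simp
    then obtain ys where ys: "ys \<noteq> []" "set ys \<subseteq> carrier G"
      "\<And>x. x \<in> carrier G \<Longrightarrow> norm (avg ys (twisted u \<xi>) x - 0) \<le> sqrt c / 2"
      using m0 unfolding has_mean_def by metis
    have "energy u \<xi> ys \<le> (sqrt c / 2)\<^sup>2"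
    proof (rule has_mean_mono[OF has_mean_energy[OF u \<xi> ys(2)] has_mean_const])
      fix x assume "x \<in> carrier G"
      then show "(cmod (avg ys (twisted u \<xi>) x))\<^sup>2 \<le> (sqrt c / 2)\<^sup>2" using ys(3) by (intro power_mono) auto
    qed
    also have "\<dots> = c / 4" using c by (simp add: power_divide)
    finally show False using en[OF ys(1,2)] c by simp
  qed
  define \<zeta> where "\<zeta> = (\<lambda>x. if x \<in> carrier G then \<xi> x else 1)"
  have "continuous_map T euclidean \<zeta>"
    by (rule continuous_map_eq[OF cont]) (simp add: \<zeta>_def)
  moreover have "cmod (\<zeta> x) = 1" for x using \<xi> by (simp add: \<zeta>_def abstract_characters_def)
  ultimately have "\<zeta> \<in> characters" using mult by (simp add: characters_def \<zeta>_def)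
  moreover have "\<zeta> a \<noteq> 1" using \<open>\<xi> a \<noteq> 1\<close> a by (simp add: \<zeta>_def)
  ultimately show ?thesis using that by blast
qed

lemma character_mult: "\<xi> \<in> characters \<Longrightarrow> x \<in> carrier G \<Longrightarrow> y \<in> carrier G \<Longrightarrow> \<xi> (x \<otimes> y) = \<xi> x * \<xi> y"
  and character_norm: "\<xi> \<in> characters \<Longrightarrow> cmod (\<xi> x) = 1"
  and character_off: "\<xi> \<in> characters \<Longrightarrow> x \<notin> carrier G \<Longrightarrow> \<xi> x = 1"
  and character_continuous: "\<xi> \<in> characters \<Longrightarrow> continuous_map T euclidean \<xi>"
  by (auto simp: characters_def)

lemma characters_closed_mult: "\<xi> \<in> characters \<Longrightarrow> \<zeta> \<in> characters \<Longrightarrow> (\<lambda>x. \<xi> x * \<zeta> x) \<in> characters"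
  by (auto simp: characters_def norm_mult intro!: continuous_map_times)

lemma characters_closed_cnj: "\<xi> \<in> characters \<Longrightarrow> (\<lambda>x. cnj (\<xi> x)) \<in> characters"
  by (auto simp: characters_def intro!: continuous_map_tendsto_compose[of _ _ cnj] continuous_intros)

lemma characters_one: "(\<lambda>x. 1) \<in> characters"
  by (simp add: characters_def)

text \<open>
  Translating by a point multiplies a character, and hence its mean, by the value at that point.
\<close>

lemma mean_character:
  assumes "\<xi> \<in> characters"
  shows "has_mean \<xi> (if \<xi> = (\<lambda>x. 1) then 1 else 0)"
proof (cases "\<xi> = (\<lambda>x. 1)")
  case True
  then show ?thesis using has_mean_const[of 1] by simp
next
  case False
  then obtain a where "\<xi> a \<noteq> 1" by auto
  then have a: "a \<in> carrier G" using character_off[OF assms] by blast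
  have m: "has_mean \<xi> (mean \<xi>)" by (rule has_mean_complex[OF character_continuous[OF assms]])
  have "has_mean (\<lambda>x. \<xi> (x \<otimes> a)) (mean \<xi>)" by (rule has_mean_translate[OF m a])
  then have "has_mean (\<lambda>x. \<xi> a * \<xi> x) (mean \<xi>)"
    by (rule has_mean_cong) (simp add: character_mult[OF assms] a mult.commute)
  moreover have "has_mean (\<lambda>x. \<xi> a * \<xi> x) (\<xi> a * mean \<xi>)"
    by (rule has_mean_linear[OF m bounded_linear_mult_right])
  ultimately have "\<xi> a * mean \<xi> = mean \<xi>" by (rule has_mean_unique[rotated])
  then have "mean \<xi> = 0" using \<open>\<xi> a \<noteq> 1\<close> by (metis mult_cancel_right1)
  then show ?thesis using m False by simp
qed

text \<open>
  Pairs of trigonometric polynomials in which the coefficient of each \<open>\<xi>\<close> differs by the factor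
  \<open>cnj (\<omega> \<xi>)\<close>. If \<open>\<omega>\<close> is the evaluation at a point, the first function is a translate of the second;
  for an arbitrary homomorphism \<open>\<omega>\<close> the two functions still have the same mean.
\<close>

inductive_set matched :: "(('a \<Rightarrow> complex) \<Rightarrow> complex) \<Rightarrow> (('a \<Rightarrow> complex) \<times> ('a \<Rightarrow> complex)) set"
  for \<omega> where
  matched_char: "\<xi> \<in> characters \<Longrightarrow> ((\<lambda>x. c * (cnj (\<omega> \<xi>) * \<xi> x)), (\<lambda>x. c * \<xi> x)) \<in> matched \<omega>"
| matched_add: "(f, g) \<in> matched \<omega> \<Longrightarrow> (f', g') \<in> matched \<omega> \<Longrightarrow> ((\<lambda>x. f x + f' x), (\<lambda>x. g x + g' x)) \<in> matched \<omega>"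

lemma matched_mult:
  assumes \<omega>: "\<And>\<xi> \<zeta>. \<xi> \<in> characters \<Longrightarrow> \<zeta> \<in> characters \<Longrightarrow> \<omega> (\<lambda>x. \<xi> x * \<zeta> x) = \<omega> \<xi> * \<omega> \<zeta>"
    and "(f, g) \<in> matched \<omega>" "(f', g') \<in> matched \<omega>"
  shows "((\<lambda>x. f x * f' x), (\<lambda>x. g x * g' x)) \<in> matched \<omega>"
  using assms(2)
proof induction
  case (matched_char \<xi> c)
  note \<xi> = this
  from assms(3) show ?case
  proof induction
    case (matched_char \<zeta> d)
    have "((\<lambda>x. (c * d) * (cnj (\<omega> (\<lambda>x. \<xi> x * \<zeta> x)) * (\<xi> x * \<zeta> x))), (\<lambda>x. (c * d) * (\<xi> x * \<zeta> x))) \<in> matched \<omega>"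
      by (rule matched.matched_char[OF characters_closed_mult[OF \<xi> matched_char]])
    then show ?case by (simp add: \<omega>[OF \<xi> matched_char] mult_ac)
  next
    case (matched_add f g f' g')
    from matched.matched_add[OF matched_add.IH] show ?case by (simp add: distrib_left)
  qed
next
  case (matched_add f g f'' g'')
  from matched.matched_add[OF matched_add.IH] show ?case by (simp add: distrib_right)
qed

lemma matched_means:
  assumes "\<omega> (\<lambda>x. 1) = 1" "(f, g) \<in> matched \<omega>"
  shows "\<exists>m. has_mean f m \<and> has_mean g m"
  using assms(2)
proof induction
  case (matched_char \<xi> c)
  let ?m = "if \<xi> = (\<lambda>x. 1) then 1 else 0 :: complex"
  have m: "has_mean \<xi> ?m" by (rule mean_character[OF matched_char])
  have "has_mean (\<lambda>x. c * \<xi> x) (c * ?m)" by (rule has_mean_linear[OF m bounded_linear_mult_right])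
  moreover have "has_mean (\<lambda>x. (c * cnj (\<omega> \<xi>)) * \<xi> x) ((c * cnj (\<omega> \<xi>)) * ?m)"
    by (rule has_mean_linear[OF m bounded_linear_mult_right])
  moreover have "(c * cnj (\<omega> \<xi>)) * ?m = c * ?m" using assms(1) by simp
  ultimately show ?case by (auto simp: mult.assoc)
next
  case (matched_add f g f' g')
  then show ?case using has_mean_add by blast
qed

text \<open>
  Suppose that no point approximates \<open>\<omega>\<close> on \<open>F\<close>. The trigonometric polynomial \<open>q\<close> is a product of
  factors in the unit interval and peaks at \<open>\<one>\<close> with value \<open>1\<close>; its matched companion \<open>p\<close> would peak
  at a point with character values \<open>\<omega>\<close>, so it stays below some \<open>\<theta> < 1\<close>. The powers \<open>p ^ n\<close> and
  \<open>q ^ n\<close> are matched and have equal means. But the means of \<open>p ^ n\<close> are at most \<open>\<theta> ^ n\<close>, whereas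
  those of \<open>q ^ n\<close> are at least a constant times \<open>\<theta>' ^ n\<close> for some \<open>\<theta>' > \<theta>\<close>.
\<close>

lemma character_values_approximable:
  assumes \<omega>: "\<And>\<xi> \<zeta>. \<xi> \<in> characters \<Longrightarrow> \<zeta> \<in> characters \<Longrightarrow> \<omega> (\<lambda>x. \<xi> x * \<zeta> x) = \<omega> \<xi> * \<omega> \<zeta>"
    and norm: "\<And>\<xi>. \<xi> \<in> characters \<Longrightarrow> cmod (\<omega> \<xi>) = 1"
    and F: "finite F" "F \<subseteq> characters" and e: "e > 0"
  shows "\<exists>x\<in>carrier G. \<forall>\<xi>\<in>F. cmod (\<xi> x - \<omega> \<xi>) \<le> e"
proof (rule ccontr)
  assume no: "\<not> (\<exists>x\<in>carrier G. \<forall>\<xi>\<in>F. cmod (\<xi> x - \<omega> \<xi>) \<le> e)"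
  have \<omega>1: "\<omega> (\<lambda>x. 1) = 1"
  proof -
    have "\<omega> (\<lambda>x. 1) * \<omega> (\<lambda>x. 1) = \<omega> (\<lambda>x. 1)" using \<omega>[OF characters_one characters_one] by simp
    moreover have "\<omega> (\<lambda>x. 1) \<noteq> 0" using norm[OF characters_one] by auto
    ultimately show ?thesis by simp
  qed
  have inv\<omega>: "\<omega> (\<lambda>x. cnj (\<xi> x)) = cnj (\<omega> \<xi>)" if \<xi>: "\<xi> \<in> characters" for \<xi>
  proof -
    have "(\<lambda>x. \<xi> x * cnj (\<xi> x)) = (\<lambda>x. 1)"
      using character_norm[OF \<xi>] by (simp add: complex_norm_square[symmetric])
    then have "\<omega> \<xi> * \<omega> (\<lambda>x. cnj (\<xi> x)) = 1" using \<omega>[OF \<xi> characters_closed_cnj[OF \<xi>]] \<omega>1 by simp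
    moreover have "\<omega> \<xi> * cnj (\<omega> \<xi>) = 1" using norm[OF \<xi>] by (simp add: complex_norm_square[symmetric])
    ultimately show ?thesis by (metis mult_cancel_left mult_zero_left zero_neq_one)
  qed
  define p where "p = (\<lambda>x. \<Prod>\<xi>\<in>F. (2 + 2 * Re (cnj (\<omega> \<xi>) * \<xi> x)) / 4)"
  define q where "q = (\<lambda>x. \<Prod>\<xi>\<in>F. (2 + 2 * Re (\<xi> x)) / 4)"
  have factor: "0 \<le> (2 + 2 * Re z) / 4 \<and> (2 + 2 * Re z) / 4 \<le> 1" if "cmod z = 1" for z
    using abs_Re_le_cmod[of z] that by (simp add: abs_le_iff)
  have unit: "cmod (cnj (\<omega> \<xi>) * \<xi> x) = 1" if "\<xi> \<in> F" for \<xi> x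
    using norm character_norm F(2) that by (auto simp: norm_mult subset_iff)
  have unit': "cmod (\<xi> x) = 1" if "\<xi> \<in> F" for \<xi> x
    using character_norm F(2) that by auto
  have matched1: "((\<lambda>x. complex_of_real ((2 + 2 * Re (cnj (\<omega> \<xi>) * \<xi> x)) / 4)), (\<lambda>x. complex_of_real ((2 + 2 * Re (\<xi> x)) / 4))) \<in> matched \<omega>"
    if \<xi>: "\<xi> \<in> characters" for \<xi>
  proof -
    have "((\<lambda>x. (1/2) * (cnj (\<omega> (\<lambda>x. 1)) * 1) + ((1/4) * (cnj (\<omega> \<xi>) * \<xi> x) + (1/4) * (cnj (\<omega> (\<lambda>x. cnj (\<xi> x))) * cnj (\<xi> x)))),
        (\<lambda>x. (1/2) * 1 + ((1/4) * \<xi> x + (1/4) * cnj (\<xi> x)))) \<in> matched \<omega>"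
      by (intro matched.intros characters_one \<xi> characters_closed_cnj)
    moreover have "(1/2) * (cnj (\<omega> (\<lambda>x. 1)) * 1) + ((1/4) * (cnj (\<omega> \<xi>) * \<xi> x) + (1/4) * (cnj (\<omega> (\<lambda>x. cnj (\<xi> x))) * cnj (\<xi> x)))
      = complex_of_real ((2 + 2 * Re (cnj (\<omega> \<xi>) * \<xi> x)) / 4)" for x
      unfolding inv\<omega>[OF \<xi>] \<omega>1 by (simp add: complex_eq_iff) (simp add: field_simps)
    moreover have "(1/2) * 1 + ((1/4) * \<xi> x + (1/4) * cnj (\<xi> x)) = complex_of_real ((2 + 2 * Re (\<xi> x)) / 4)" for x
      by (simp add: complex_eq_iff)
    ultimately show ?thesis by (simp only:)
  qed
  have one_matched: "((\<lambda>x. 1), (\<lambda>x. 1)) \<in> matched \<omega>"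
    using matched.matched_char[OF characters_one, of 1 \<omega>] \<omega>1 by simp
  have base: "((\<lambda>x. complex_of_real (p x)), (\<lambda>x. complex_of_real (q x))) \<in> matched \<omega>"
    using F unfolding p_def q_def
  proof (induction F)
    case empty
    then show ?case using one_matched by simp
  next
    case (insert \<xi> F)
    then have \<xi>: "\<xi> \<in> characters" and "F \<subseteq> characters" by auto
    from matched_mult[OF \<omega> matched1[OF \<xi>] insert.IH[OF this(2)]]
    show ?case unfolding prod.insert[OF insert.hyps(1,2)] of_real_mult .
  qed
  have powers: "((\<lambda>x. complex_of_real (p x ^ n)), (\<lambda>x. complex_of_real (q x ^ n))) \<in> matched \<omega>" for n
  proof (induction n)
    case 0
    then show ?case using one_matched by simp
  next
    case (Suc n)
    from matched_mult[OF \<omega> base Suc] show ?case unfolding power_Suc of_real_mult .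
  qed
  have pq0: "0 \<le> p x" "0 \<le> q x" for x
    unfolding p_def q_def by (intro prod_nonneg conjunct1[OF factor] unit unit'; assumption)+
  define e' where "e' = min e 1"
  have e': "0 < e'" "e' \<le> e" "e' \<le> 1" using e by (auto simp: e'_def)
  define \<theta> where "\<theta> = 1 - e'\<^sup>2 / 4"
  have "e'\<^sup>2 \<le> 1" using e' by (simp add: power_le_one)
  then have \<theta>: "0 < \<theta>" "\<theta> < 1" using e' by (auto simp: \<theta>_def)
  have p_le: "p x \<le> \<theta>" if x: "x \<in> carrier G" for x
  proof -
    obtain \<xi> where \<xi>: "\<xi> \<in> F" "cmod (\<xi> x - \<omega> \<xi>) > e" using no x by force
    then have \<xi>c: "\<xi> \<in> characters" using F by blast
    define z where "z = cnj (\<omega> \<xi>) * \<xi> x"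
    have z: "cmod z = 1" using unit[OF \<xi>(1)] by (simp add: z_def)
    have w: "cnj (\<omega> \<xi>) * \<omega> \<xi> = 1" using norm[OF \<xi>c] by (simp add: mult.commute[of "cnj _"] complex_norm_square[symmetric])
    have "cmod (z - 1) = cmod (cnj (\<omega> \<xi>) * (\<xi> x - \<omega> \<xi>))" by (simp add: z_def right_diff_distrib w)
    also have "\<dots> = cmod (\<xi> x - \<omega> \<xi>)" using norm[OF \<xi>c] by (simp add: norm_mult)
    finally have "e' < cmod (z - 1)" using \<xi>(2) e'(2) by simp
    then have "e'\<^sup>2 < (cmod (z - 1))\<^sup>2" using e' by (intro power_strict_mono) auto
    also have "(cmod (z - 1))\<^sup>2 = (cmod z)\<^sup>2 + 1 - 2 * Re z"
      unfolding cmod_power2 by (simp add: power2_eq_square algebra_simps)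
    finally have A: "(2 + 2 * Re z) / 4 \<le> \<theta>" using z by (simp add: \<theta>_def)
    have p: "p x = (2 + 2 * Re z) / 4 * (\<Prod>\<zeta>\<in>F - {\<xi>}. (2 + 2 * Re (cnj (\<omega> \<zeta>) * \<zeta> x)) / 4)"
      unfolding p_def z_def using F(1) \<xi>(1) by (rule prod.remove)
    have B: "(\<Prod>\<zeta>\<in>F - {\<xi>}. (2 + 2 * Re (cnj (\<omega> \<zeta>) * \<zeta> x)) / 4) \<le> 1"
    proof (rule prod_le_1)
      fix \<zeta> assume "\<zeta> \<in> F - {\<xi>}"
      then have "\<zeta> \<in> F" by blast
      from factor[OF unit[OF this]]
      show "0 \<le> (2 + 2 * Re (cnj (\<omega> \<zeta>) * \<zeta> x)) / 4 \<and> (2 + 2 * Re (cnj (\<omega> \<zeta>) * \<zeta> x)) / 4 \<le> 1" .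
    qed
    have "p x \<le> (2 + 2 * Re z) / 4 * 1"
      unfolding p by (rule mult_left_mono[OF B conjunct1[OF factor[OF z]]])
    then show ?thesis using A by simp
  qed
  have q1: "q \<one> = 1"
  proof -
    have one: "\<xi> \<one> = 1" if "\<xi> \<in> F" for \<xi>
    proof -
      have "\<xi> \<one> * \<xi> \<one> = \<xi> \<one>" using character_mult[of \<xi> \<one> \<one>] F(2) that by auto
      then show ?thesis using unit'[OF that, of \<one>] by auto
    qed
    show ?thesis unfolding q_def
    proof (intro prod.neutral ballI)
      fix \<xi> assume "\<xi> \<in> F"
      from one[OF this] show "(2 + 2 * Re (\<xi> \<one>)) / 4 = 1" by simp
    qed
  qed
  have q_cont: "continuous_map T euclideanreal q"
    unfolding q_def
  proof (rule continuous_map_prod[OF F(1)])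
    fix \<xi> assume "\<xi> \<in> F"
    then have "continuous_map T euclidean \<xi>" using F(2) character_continuous by blast
    then show "continuous_map T euclideanreal (\<lambda>x. (2 + 2 * Re (\<xi> x)) / 4)"
      by (rule continuous_map_tendsto_compose) (intro continuous_intros, simp)
  qed
  define \<theta>' where "\<theta>' = (1 + \<theta>) / 2"
  have \<theta>': "\<theta> < \<theta>'" "\<theta>' < 1" "0 < \<theta>'" using \<theta> by (auto simp: \<theta>'_def)
  \<comment> \<open>The function \<open>b\<close> is a continuous substitute for the indicator of the region where \<open>q\<close> exceeds \<open>\<theta>'\<close>.\<close>
  define b where "b = (\<lambda>x. max 0 ((q x - \<theta>') / (1 - \<theta>')))"
  have b_cont: "continuous_map T euclideanreal b"
    unfolding b_def by (rule continuous_map_tendsto_compose[OF q_cont]) (intro continuous_intros, use \<theta>' in simp)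
  have bm: "has_mean b (mean b)" by (rule has_mean_real[OF b_cont])
  have b_pos: "mean b > 0"
    by (rule has_mean_pos[OF bm b_cont _ one_closed]) (use \<theta>' q1 in \<open>auto simp: b_def\<close>)
  have q_le: "q x \<le> 1" for x
    unfolding q_def by (intro prod_le_1 factor unit')
  have bq: "\<theta>' ^ n * b x \<le> q x ^ n" for n x
  proof (cases "q x \<le> \<theta>'")
    case True
    then have "(q x - \<theta>') / (1 - \<theta>') \<le> 0" using \<theta>' by (intro divide_nonpos_pos) auto
    then have "b x = 0" by (simp add: b_def)
    then show ?thesis using pq0 by simp
  next
    case False
    then have "b x \<le> 1" using q_le[of x] \<theta>' by (simp add: b_def)
    then have "\<theta>' ^ n * b x \<le> \<theta>' ^ n * 1" using \<theta>' by (intro mult_left_mono) auto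
    also have "\<dots> \<le> q x ^ n" using False \<theta>' by (simp add: power_mono)
    finally show ?thesis .
  qed
  have ineq: "\<theta>' ^ n * mean b \<le> \<theta> ^ n" for n
  proof -
    obtain m where m: "has_mean (\<lambda>x. complex_of_real (p x ^ n)) m" "has_mean (\<lambda>x. complex_of_real (q x ^ n)) m"
      using matched_means[OF \<omega>1 powers] by blast
    have "has_mean (\<lambda>x. p x ^ n) (Re m)" "has_mean (\<lambda>x. q x ^ n) (Re m)"
      using has_mean_linear[OF m(1) bounded_linear_Re] has_mean_linear[OF m(2) bounded_linear_Re] by simp_all
    then have "\<theta>' ^ n * mean b \<le> Re m" "Re m \<le> \<theta> ^ n"
      using has_mean_mono[OF has_mean_cmult[OF bm, of "\<theta>' ^ n"] _ bq]
        has_mean_mono[OF _ has_mean_const[of "\<theta> ^ n"], of "\<lambda>x. p x ^ n" "Re m"] p_le pq0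
      by (auto intro!: power_mono)
    then show ?thesis by simp
  qed
  have "(\<lambda>n. (\<theta> / \<theta>') ^ n) \<longlonglongrightarrow> 0"
    using \<theta> \<theta>' by (intro LIMSEQ_power_zero) simp
  then have "eventually (\<lambda>n. (\<theta> / \<theta>') ^ n < mean b) sequentially"
    using b_pos by (rule order_tendstoD)
  then obtain n where "(\<theta> / \<theta>') ^ n < mean b" by (auto simp: eventually_sequentially)
  then show False using ineq[of n] \<theta>' by (simp add: power_divide field_simps)
qed

theorem character_values_attained:
  assumes \<omega>: "\<And>\<xi> \<zeta>. \<xi> \<in> characters \<Longrightarrow> \<zeta> \<in> characters \<Longrightarrow> \<omega> (\<lambda>x. \<xi> x * \<zeta> x) = \<omega> \<xi> * \<omega> \<zeta>"
    and norm: "\<And>\<xi>. \<xi> \<in> characters \<Longrightarrow> cmod (\<omega> \<xi>) = 1"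
  obtains x where "x \<in> carrier G" "\<And>\<xi>. \<xi> \<in> characters \<Longrightarrow> \<xi> x = \<omega> \<xi>"
proof -
  define K where "K = (\<lambda>(\<xi>, n). {x \<in> topspace T. \<xi> x \<in> cball (\<omega> \<xi>) (inverse (real (Suc n)))})"
  let ?I = "characters \<times> UNIV"
  have "topspace T \<inter> \<Inter>(K ` ?I) \<noteq> {}"
  proof (rule compact[unfolded compact_space_def compactin_fip, THEN conjunct2, rule_format], intro conjI)
    show "\<forall>C\<in>K ` ?I. closedin T C"
    proof (rule ballI, elim imageE SigmaE)
      fix C j \<xi> and n :: nat assume "C = K j" "j = (\<xi>, n)" "\<xi> \<in> characters"
      then show "closedin T C"
        unfolding K_def by (auto intro!: closedin_continuous_map_preimage[OF character_continuous] simp del: mem_cball topspace_T)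
    qed
    show "\<forall>\<F>. finite \<F> \<and> \<F> \<subseteq> K ` ?I \<longrightarrow> topspace T \<inter> \<Inter>\<F> \<noteq> {}"
    proof (intro allI impI)
      fix \<F> assume "finite \<F> \<and> \<F> \<subseteq> K ` ?I"
      then obtain J where J: "finite J" "J \<subseteq> ?I" "\<F> = K ` J" by (meson finite_subset_image)
      define e where "e = Min (insert 1 ((\<lambda>(\<xi>, n). inverse (real (Suc n))) ` J))"
      have "e > 0" unfolding e_def using J(1) by (subst Min_gr_iff) auto
      moreover have "finite (fst ` J)" "fst ` J \<subseteq> characters" using J by auto
      ultimately obtain x where x: "x \<in> carrier G" "\<forall>\<xi>\<in>fst ` J. cmod (\<xi> x - \<omega> \<xi>) \<le> e"
        using character_values_approximable[of \<omega> "fst ` J" e, OF \<omega> norm] by blast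
      have "x \<in> K j" if j: "j \<in> J" for j
      proof -
        obtain \<xi> n where jn: "j = (\<xi>, n)" by fastforce
        have "e \<le> inverse (real (Suc n))" unfolding e_def using J(1) j jn by (intro Min_le) force+
        moreover have "cmod (\<xi> x - \<omega> \<xi>) \<le> e" using x(2) j jn by force
        ultimately show ?thesis using x(1) by (simp add: jn K_def dist_norm norm_minus_commute)
      qed
      then show "topspace T \<inter> \<Inter>\<F> \<noteq> {}" using x(1) unfolding J(3) by auto
    qed
  qed
  then obtain x where x: "x \<in> carrier G" "\<And>j. j \<in> ?I \<Longrightarrow> x \<in> K j" by auto
  have "\<xi> x = \<omega> \<xi>" if \<xi>: "\<xi> \<in> characters" for \<xi>
  proof -
    have "cmod (\<omega> \<xi> - \<xi> x) \<le> inverse (real (Suc n))" for n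
      using x(2)[of "(\<xi>, n)"] \<xi> by (simp add: K_def dist_norm)
    then have "cmod (\<omega> \<xi> - \<xi> x) \<le> 0"
      by (intro LIMSEQ_le_const[OF LIMSEQ_inverse_real_of_nat]) auto
    then show ?thesis by simp
  qed
  with x(1) show ?thesis using that by blast
qed

end

section \<open>Circle-valued maps up to homotopy\<close>

text \<open>
  For maps of compact Hausdorff spaces to the circle, having a real logarithm is equivalent to being
  homotopic to a constant. Values off the space are ignored.
\<close>

definition nullhomotopic :: "'x topology \<Rightarrow> ('x \<Rightarrow> complex) \<Rightarrow> bool" where
  "nullhomotopic X f \<longleftrightarrow> (\<exists>h. continuous_map X euclideanreal h \<and> (\<forall>x\<in>topspace X. f x = cis (h x)))"

lemma nullhomotopic_one: "nullhomotopic X (\<lambda>x. 1)"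
  unfolding nullhomotopic_def by (rule exI[of _ "\<lambda>x. 0"]) simp

lemma nullhomotopic_mult:
  "nullhomotopic X f \<Longrightarrow> nullhomotopic X g \<Longrightarrow> nullhomotopic X (\<lambda>x. f x * g x)"
proof -
  assume "nullhomotopic X f" "nullhomotopic X g"
  then obtain h k where "continuous_map X euclideanreal h" "\<forall>x\<in>topspace X. f x = cis (h x)"
    "continuous_map X euclideanreal k" "\<forall>x\<in>topspace X. g x = cis (k x)"
    unfolding nullhomotopic_def by blast
  then show ?thesis
    unfolding nullhomotopic_def
    by (intro exI[of _ "\<lambda>x. h x + k x"]) (simp add: cis_mult continuous_map_add)
qed

lemma nullhomotopic_cnj: "nullhomotopic X f \<Longrightarrow> nullhomotopic X (\<lambda>x. cnj (f x))"
proof -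
  assume "nullhomotopic X f"
  then obtain h where "continuous_map X euclideanreal h" "\<forall>x\<in>topspace X. f x = cis (h x)"
    unfolding nullhomotopic_def by blast
  then show ?thesis
    unfolding nullhomotopic_def
    by (intro exI[of _ "\<lambda>x. - h x"]) (simp add: cis_cnj continuous_map_minus)
qed

lemma nullhomotopic_cong:
  "nullhomotopic X f \<Longrightarrow> (\<And>x. x \<in> topspace X \<Longrightarrow> f x = g x) \<Longrightarrow> nullhomotopic X g"
  unfolding nullhomotopic_def by metis

lemma nullhomotopic_compose:
  assumes "nullhomotopic Y f" "continuous_map X Y r"
  shows "nullhomotopic X (\<lambda>x. f (r x))"
proof -
  obtain h where "continuous_map Y euclideanreal h" "\<forall>y\<in>topspace Y. f y = cis (h y)"
    using assms(1) unfolding nullhomotopic_def by blast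
  moreover from this have "continuous_map X euclideanreal (\<lambda>x. h (r x))"
    using continuous_map_compose[OF assms(2)] by (simp add: o_def)
  moreover have "r x \<in> topspace Y" if "x \<in> topspace X" for x
    using assms(2) that by (auto simp: continuous_map_def)
  ultimately show ?thesis unfolding nullhomotopic_def by blast
qed

lemma cis_Im_Ln: "cmod z = 1 \<Longrightarrow> cis (Im (Ln z)) = z"
proof -
  assume z: "cmod z = 1"
  then have "z \<noteq> 0" by auto
  then have "z = exp (Ln z)" by simp
  also have "\<dots> = cis (Im (Ln z))" using z \<open>z \<noteq> 0\<close> by (simp add: exp_eq_polar)
  finally show ?thesis ..
qed

lemma continuous_map_Im_Ln:
  assumes f: "continuous_map X euclidean f"
    and unit: "\<And>x. x \<in> topspace X \<Longrightarrow> cmod (f x) = 1" and ne: "\<And>x. x \<in> topspace X \<Longrightarrow> f x \<noteq> - 1"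
  shows "continuous_map X euclideanreal (\<lambda>x. Im (Ln (f x)))"
  unfolding continuous_map_euclidean_tendsto
proof
  fix x assume x: "x \<in> topspace X"
  have "f x \<notin> \<real>\<^sub>\<le>\<^sub>0"
  proof
    assume n: "f x \<in> \<real>\<^sub>\<le>\<^sub>0"
    then obtain r where "f x = of_real r" "r \<le> 0" by (auto elim: nonpos_Reals_cases)
    with unit[OF x] ne[OF x] show False by simp
  qed
  moreover have "(f \<longlongrightarrow> f x) (atin X x)" using f x by (simp add: continuous_map_euclidean_tendsto)
  ultimately show "((\<lambda>x. Im (Ln (f x))) \<longlongrightarrow> Im (Ln (f x))) (atin X x)"
    by (intro tendsto_Im tendsto_Ln)
qed

text \<open>
  Circle-valued maps that are never antipodal have a quotient that avoids \<open>- 1\<close>, where the principal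
  logarithm is continuous.
\<close>

lemma nullhomotopic_if_close:
  assumes f: "continuous_map X euclidean f" and g: "continuous_map X euclidean g"
    and fu: "\<And>x. x \<in> topspace X \<Longrightarrow> cmod (f x) = 1" and gu: "\<And>x. x \<in> topspace X \<Longrightarrow> cmod (g x) = 1"
    and close: "\<And>x. x \<in> topspace X \<Longrightarrow> cmod (f x - g x) < 2"
  shows "nullhomotopic X (\<lambda>x. f x * cnj (g x))"
  unfolding nullhomotopic_def
proof (intro exI conjI ballI)
  have c: "continuous_map X euclidean (\<lambda>x. f x * cnj (g x))"
    by (intro continuous_map_times f continuous_map_tendsto_compose[OF g] continuous_intros)
  have u: "cmod (f x * cnj (g x)) = 1" if "x \<in> topspace X" for x using fu gu that by (simp add: norm_mult)
  have "f x * cnj (g x) \<noteq> - 1" if x: "x \<in> topspace X" for x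
  proof
    assume "f x * cnj (g x) = - 1"
    then have "f x * (cnj (g x) * g x) = - g x" by (simp add: mult.assoc[symmetric])
    moreover have "cnj (g x) * g x = 1"
      using gu[OF x] complex_norm_square[of "g x"] by (simp add: mult.commute)
    ultimately have "f x = - g x" by simp
    then have eq: "f x - g x = - 2 * g x" by simp
    have "cmod (f x - g x) = 2" unfolding eq norm_mult using gu[OF x] by simp
    then show False using close[OF x] by simp
  qed
  then show "continuous_map X euclideanreal (\<lambda>x. Im (Ln (f x * cnj (g x))))"
    by (intro continuous_map_Im_Ln c u)
  fix x assume "x \<in> topspace X"
  then show "f x * cnj (g x) = cis (Im (Ln (f x * cnj (g x))))" using cis_Im_Ln u by simp
qed

lemma lift_of_one_constant:
  assumes conn: "connected_space X" and h: "continuous_map X euclideanreal h"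
    and one: "\<And>x. x \<in> topspace X \<Longrightarrow> cis (h x) = 1" and xy: "x \<in> topspace X" "y \<in> topspace X"
  shows "h x = h y"
proof -
  have "connectedin euclideanreal (h ` topspace X)"
    using connectedin_continuous_map_image[OF h] conn by (simp add: connectedin_topspace)
  then have int: "connected (h ` topspace X)" by simp
  have False if ab: "a \<in> topspace X" "b \<in> topspace X" "h a < h b" for a b
  proof (cases "h b - h a < pi")
    case True
    have "cis (h b - h a) = cis (h b) / cis (h a)" by (simp add: cis_divide)
    then have "cis (h b - h a) = 1" using one ab by simp
    then have "sin (h b - h a) = 0" by (metis cis.simps(2) one_complex.simps(2))
    moreover have "sin (h b - h a) > 0" using True ab by (intro sin_gt_zero) auto
    ultimately show False by simp
  next
    case False
    have "h a + pi \<in> h ` topspace X"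
      using int[unfolded connected_iff_interval, rule_format, of "h a" "h b" "h a + pi"] ab False by force
    then obtain c where "c \<in> topspace X" "h c = h a + pi" by auto
    then have "cis (h a + pi) = 1" using one by metis
    moreover have "cis (h a + pi) = - cis (h a)" by (simp add: complex_eq_iff)
    ultimately show False using one[OF ab(1)] by simp
  qed
  then show ?thesis using xy by (meson linorder_neqE_linordered_idom)
qed

lemma lifts_differ_by_constant:
  assumes conn: "connected_space X"
    and h: "continuous_map X euclideanreal h" and k: "continuous_map X euclideanreal k"
    and same: "\<And>x. x \<in> topspace X \<Longrightarrow> cis (h x) = cis (k x)" and xy: "x \<in> topspace X" "y \<in> topspace X"
  shows "h x - k x = h y - k y"
proof (rule lift_of_one_constant[OF conn _ _ xy])
  show "continuous_map X euclideanreal (\<lambda>x. h x - k x)" by (intro continuous_map_diff h k)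
  show "cis (h x - k x) = 1" if "x \<in> topspace X" for x
    using same[OF that] by (simp add: cis_divide[symmetric])
qed

lemma Im_Ln_small:
  assumes "e > 0"
  obtains d where "d > 0" "d \<le> 1" "\<And>z. cmod (z - 1) < d \<Longrightarrow> \<bar>Im (Ln z)\<bar> < e"
proof -
  have "isCont Ln 1" by (rule continuous_at_Ln) simp
  then have "isCont (\<lambda>z. Im (Ln z)) 1" by (rule continuous_Im)
  then obtain d where "d > 0" "\<And>z. dist z 1 < d \<Longrightarrow> dist (Im (Ln z)) (Im (Ln 1)) < e"
    using assms unfolding continuous_at_eps_delta by blast
  then show ?thesis by (intro that[of "min d 1"]) (auto simp: dist_norm)
qed

lemma cis_small:
  assumes "e > 0"
  obtains d where "d > 0" "\<And>t. \<bar>t\<bar> < d \<Longrightarrow> cmod (cis t - 1) < e"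
proof -
  have "isCont cis 0" using continuous_on_cis[OF continuous_on_id, of "UNIV :: real set"]
    by (simp add: continuous_on_eq_continuous_at)
  then obtain d where "d > 0" "\<And>t. dist t 0 < d \<Longrightarrow> dist (cis t) (cis 0) < e"
    using assms unfolding continuous_at_eps_delta by blast
  then show ?thesis by (intro that[of d]) (auto simp: dist_norm)
qed

context compact_abelian_group
begin

text \<open>
  By connectedness the logarithm \<open>h\<close> of \<open>\<xi>\<close> satisfies \<open>h (x \<otimes> y) = h x + k\<close> with \<open>k\<close> independent
  of \<open>x\<close>. Translation preserves the mean, so \<open>k = 0\<close> and \<open>h\<close> is constant.
\<close>

lemma nullhomotopic_character:
  assumes conn: "connected_space T" and \<xi>: "\<xi> \<in> characters" and null: "nullhomotopic T \<xi>"
  shows "\<xi> = (\<lambda>x. 1)"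
proof -
  obtain h where h: "continuous_map T euclideanreal h" "\<And>x. x \<in> carrier G \<Longrightarrow> \<xi> x = cis (h x)"
    using null unfolding nullhomotopic_def by auto
  have hm: "has_mean h (mean h)" by (rule has_mean_real[OF h(1)])
  have const: "h y = h \<one>" if y: "y \<in> carrier G" for y
  proof -
    define k where "k = h y - h \<one>"
    have hy: "continuous_map T euclideanreal (\<lambda>x. h (x \<otimes> y))" by (rule continuous_map_translate(1)[OF h(1) y])
    have h2: "continuous_map T euclideanreal (\<lambda>x. h x + h y)" by (intro continuous_map_add h(1)) simp
    have eq: "h (x \<otimes> y) = h x + k" if x: "x \<in> carrier G" for x
    proof -
      have "h (x \<otimes> y) - (h x + h y) = h (\<one> \<otimes> y) - (h \<one> + h y)"
      proof (rule lifts_differ_by_constant[OF conn hy h2])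
        fix z assume "z \<in> topspace T"
        then have z: "z \<in> carrier G" by simp
        have "cis (h (z \<otimes> y)) = \<xi> z * \<xi> y" using character_mult[OF \<xi> z y] h(2)[of "z \<otimes> y"] z y by simp
        then show "cis (h (z \<otimes> y)) = cis (h z + h y)" using h(2) z y by (simp add: cis_mult)
      qed (use x in auto)
      then show ?thesis using y by (simp add: k_def)
    qed
    have "has_mean (\<lambda>x. h x + k) (mean h + k)" by (intro has_mean_add hm has_mean_const)
    moreover have "has_mean (\<lambda>x. h x + k) (mean h)"
      by (rule has_mean_cong[OF has_mean_translate[OF hm y] eq])
    ultimately have "mean h + k = mean h" by (rule has_mean_unique)
    then show ?thesis by (simp add: k_def)
  qed
  have "\<xi> \<one> = 1"
  proof -
    have "\<xi> \<one> * \<xi> \<one> = \<xi> \<one>" using character_mult[OF \<xi>, of \<one> \<one>] by simp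
    then show ?thesis using character_norm[OF \<xi>, of \<one>] by auto
  qed
  then have "\<xi> y = 1" for y
    using h(2) const character_off[OF \<xi>] by (cases "y \<in> carrier G") (metis one_closed)+
  then show ?thesis by blast
qed

text \<open>
  Points \<open>y\<close> and \<open>y \<otimes> v\<close> with \<open>v\<close> small give translates that are nowhere antipodal, so
  the set of all \<open>y\<close> with the asserted property is open and closed, and it contains \<open>\<one>\<close>.
\<close>

lemma translate_quotient_nullhomotopic:
  assumes conn: "connected_space T" and f: "continuous_map T euclidean f"
    and unit: "\<And>x. x \<in> carrier G \<Longrightarrow> cmod (f x) = 1" and y: "y \<in> carrier G"
  shows "nullhomotopic T (\<lambda>x. f (x \<otimes> y) * cnj (f x))"
proof -
  define Y where "Y = {y \<in> carrier G. nullhomotopic T (\<lambda>x. f (x \<otimes> y) * cnj (f x))}"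
  obtain V where V: "openin T V" "\<one> \<in> V" "\<And>v x. v \<in> V \<Longrightarrow> x \<in> carrier G \<Longrightarrow> dist (f (x \<otimes> v)) (f x) < 2"
    using uniformly_continuous[OF f, of 2] by auto
  have step: "y \<otimes> v \<in> Y \<longleftrightarrow> y \<in> Y" if y: "y \<in> carrier G" and v: "v \<in> V" for y v
  proof -
    have vc: "v \<in> carrier G" using v V(1) openin_subset by fastforce
    have q: "nullhomotopic T (\<lambda>x. f (x \<otimes> (y \<otimes> v)) * cnj (f (x \<otimes> y)))"
    proof (rule nullhomotopic_if_close)
      show "continuous_map T euclidean (\<lambda>x. f (x \<otimes> (y \<otimes> v)))" "continuous_map T euclidean (\<lambda>x. f (x \<otimes> y))"
        using y vc by (auto intro!: continuous_map_translate(1) f)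
      show "cmod (f (x \<otimes> (y \<otimes> v)) - f (x \<otimes> y)) < 2" if "x \<in> topspace T" for x
        using V(3)[OF v, of "x \<otimes> y"] that y vc by (simp add: dist_norm m_assoc)
    qed (use unit y vc in auto)
    have u: "cnj (f x) * f x = 1" if "x \<in> carrier G" for x
      using unit[OF that] complex_norm_square[of "f x"] by (simp add: mult.commute)
    have yv: "y \<otimes> v \<in> carrier G" using y vc by simp
    show ?thesis
    proof
      assume "y \<in> Y"
      then have "nullhomotopic T (\<lambda>x. f (x \<otimes> y) * cnj (f x))" by (simp add: Y_def)
      from nullhomotopic_mult[OF q this] have "nullhomotopic T (\<lambda>x. f (x \<otimes> (y \<otimes> v)) * cnj (f x))"
      proof (rule nullhomotopic_cong)
        fix x assume "x \<in> topspace T"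
        then have "cnj (f (x \<otimes> y)) * f (x \<otimes> y) = 1" using u y by simp
        then show "f (x \<otimes> (y \<otimes> v)) * cnj (f (x \<otimes> y)) * (f (x \<otimes> y) * cnj (f x)) = f (x \<otimes> (y \<otimes> v)) * cnj (f x)"
          by (metis mult.assoc mult.left_neutral)
      qed
      then show "y \<otimes> v \<in> Y" using yv by (simp add: Y_def)
    next
      assume "y \<otimes> v \<in> Y"
      then have "nullhomotopic T (\<lambda>x. f (x \<otimes> (y \<otimes> v)) * cnj (f x))" by (simp add: Y_def)
      from nullhomotopic_mult[OF nullhomotopic_cnj[OF q] this] have "nullhomotopic T (\<lambda>x. f (x \<otimes> y) * cnj (f x))"
      proof (rule nullhomotopic_cong)
        fix x assume "x \<in> topspace T"
        then have "cnj (f (x \<otimes> (y \<otimes> v))) * f (x \<otimes> (y \<otimes> v)) = 1" using u yv by simp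
        then show "cnj (f (x \<otimes> (y \<otimes> v)) * cnj (f (x \<otimes> y))) * (f (x \<otimes> (y \<otimes> v)) * cnj (f x)) = f (x \<otimes> y) * cnj (f x)"
          by (simp add: mult_ac)
      qed
      then show "y \<in> Y" using y by (simp add: Y_def)
    qed
  qed
  have nb: "\<exists>U. openin T U \<and> y \<in> U \<and> (\<forall>z\<in>U. z \<in> Y \<longleftrightarrow> y \<in> Y)" if y: "y \<in> carrier G" for y
  proof -
    let ?U = "{z \<in> topspace T. inv y \<otimes> z \<in> V}"
    have "continuous_map T T (\<lambda>z. inv y \<otimes> z)"
      using continuous_map_translate(2)[of T id "inv y"] y by simp
    then have "openin T ?U" using V(1) by (rule openin_continuous_map_preimage)
    moreover have "y \<in> ?U" using y V(2) by simp
    moreover have "z \<in> Y \<longleftrightarrow> y \<in> Y" if "z \<in> ?U" for z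
      using step[OF y, of "inv y \<otimes> z"] that y by (simp add: m_assoc[symmetric])
    ultimately show ?thesis by blast
  qed
  have sub: "Y \<subseteq> carrier G" by (auto simp: Y_def)
  have "openin T Y"
  proof (subst openin_subopen, intro ballI)
    fix y assume y: "y \<in> Y"
    then obtain U where U: "openin T U" "y \<in> U" "\<forall>z\<in>U. z \<in> Y \<longleftrightarrow> y \<in> Y" using nb[of y] sub by blast
    have "U \<subseteq> Y" using U(3) y by (simp add: subset_iff)
    with U(1,2) show "\<exists>U. openin T U \<and> y \<in> U \<and> U \<subseteq> Y" by blast
  qed
  moreover have "openin T (carrier G - Y)"
  proof (subst openin_subopen, intro ballI)
    fix y assume y: "y \<in> carrier G - Y"
    then obtain U where U: "openin T U" "y \<in> U" "\<forall>z\<in>U. z \<in> Y \<longleftrightarrow> y \<in> Y" using nb[of y] by blast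
    have "U \<subseteq> carrier G - Y" using openin_subset[OF U(1)] U(3) y by (simp add: subset_iff)
    with U(1,2) show "\<exists>U. openin T U \<and> y \<in> U \<and> U \<subseteq> carrier G - Y" by blast
  qed
  then have "closedin T Y" using sub by (simp add: closedin_def)
  ultimately have "Y = {} \<or> Y = topspace T" using conn by (simp add: connected_space_clopen_in)
  moreover have "\<one> \<in> Y"
  proof -
    have "nullhomotopic T (\<lambda>x. f (x \<otimes> \<one>) * cnj (f x))"
      by (rule nullhomotopic_cong[OF nullhomotopic_one])
        (use unit in \<open>simp add: complex_norm_square[symmetric]\<close>)
    then show ?thesis by (simp add: Y_def)
  qed
  ultimately show ?thesis using y by (auto simp: Y_def)
qed

text \<open>
  For each \<open>y\<close> the quotient of a translate of \<open>f\<close> by \<open>f\<close> has a logarithm \<open>g y\<close>, unique up to a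
  constant multiple of \<open>2 * pi\<close>. Its mean \<open>m y\<close> changes by the same constant, so \<open>cis (m y)\<close> and
  \<open>D y = g y \<one> - m y\<close> do not depend on the choice. The function \<open>cis (m y)\<close> is multiplicative in
  \<open>y\<close> because logarithms add under composition of translations and means are translation
  invariant; it is the required character, and \<open>D\<close> is a logarithm of the quotient up to the constant
  \<open>f \<one>\<close>.
\<close>

theorem homotopic_to_character:
  assumes conn: "connected_space T" and f: "continuous_map T euclidean f"
    and unit: "\<And>x. x \<in> carrier G \<Longrightarrow> cmod (f x) = 1"
  obtains \<xi> where "\<xi> \<in> characters" "nullhomotopic T (\<lambda>x. f x * cnj (\<xi> x))"
proof -
  have uf: "f x * cnj (f x) = 1" if "x \<in> carrier G" for x
    using unit[OF that] by (simp add: complex_norm_square[symmetric])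
  have "\<exists>g. continuous_map T euclideanreal g \<and> (\<forall>x\<in>carrier G. f (x \<otimes> y) = f x * cis (g x))" if y: "y \<in> carrier G" for y
  proof -
    obtain g where g: "continuous_map T euclideanreal g" "\<And>x. x \<in> carrier G \<Longrightarrow> f (x \<otimes> y) * cnj (f x) = cis (g x)"
      using translate_quotient_nullhomotopic[OF conn f unit y] unfolding nullhomotopic_def by auto
    have "f (x \<otimes> y) = f x * cis (g x)" if "x \<in> carrier G" for x
    proof -
      have "f x * (f (x \<otimes> y) * cnj (f x)) = f (x \<otimes> y) * (f x * cnj (f x))" by (simp add: mult_ac)
      then show ?thesis using g(2)[OF that] uf[OF that] by simp
    qed
    with g(1) show ?thesis by blast
  qed
  then obtain g where g: "\<And>y. y \<in> carrier G \<Longrightarrow> continuous_map T euclideanreal (g y)"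
    "\<And>x y. y \<in> carrier G \<Longrightarrow> x \<in> carrier G \<Longrightarrow> f (x \<otimes> y) = f x * cis (g y x)" by metis
  define m where "m = (\<lambda>y. mean (g y))"
  have m: "has_mean (g y) (m y)" if "y \<in> carrier G" for y
    unfolding m_def by (rule has_mean_real[OF g(1)[OF that]])
  define D where "D = (\<lambda>y. g y \<one> - m y)"
  have indep: "D y = h \<one> - r \<and> cis (m y) = cis r"
    if y: "y \<in> carrier G" and h: "continuous_map T euclideanreal h"
      "\<And>x. x \<in> carrier G \<Longrightarrow> f (x \<otimes> y) = f x * cis (h x)" and r: "has_mean h r" for y h r
  proof -
    have ci: "cis (g y x) = cis (h x)" if x: "x \<in> carrier G" for x
    proof -
      have "f x * cis (g y x) = f x * cis (h x)" by (rule trans[OF g(2)[OF y x, symmetric] h(2)[OF x]])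
      moreover have "f x \<noteq> 0" using unit[OF x] by auto
      ultimately show ?thesis using mult_left_cancel by blast
    qed
    define k where "k = g y \<one> - h \<one>"
    have eq: "g y x = h x + k" if "x \<in> carrier G" for x
      using lifts_differ_by_constant[OF conn g(1)[OF y] h(1), of x \<one>] ci that by (simp add: k_def)
    have "has_mean (\<lambda>x. h x + k) (r + k)" by (intro has_mean_add r has_mean_const)
    then have "has_mean (g y) (r + k)" by (rule has_mean_cong) (simp add: eq)
    then have "m y = r + k" using m[OF y] has_mean_unique by blast
    moreover have "cis k = 1"
      using ci[OF one_closed] by (simp add: k_def cis_divide[symmetric])
    ultimately show ?thesis by (simp add: D_def k_def cis_mult[symmetric])
  qed
  have add: "D (y \<otimes> z) = g y z + g z \<one> - (m y + m z)" "cis (m (y \<otimes> z)) = cis (m y) * cis (m z)"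
    if y: "y \<in> carrier G" and z: "z \<in> carrier G" for y z
  proof -
    let ?h = "\<lambda>x. g y (x \<otimes> z) + g z x"
    have "continuous_map T euclideanreal ?h"
      by (intro continuous_map_add continuous_map_translate(1) g y z)
    moreover have "f (x \<otimes> (y \<otimes> z)) = f x * cis (?h x)" if x: "x \<in> carrier G" for x
    proof -
      have "x \<otimes> (y \<otimes> z) = (x \<otimes> z) \<otimes> y" using x y z by (simp add: m_ac)
      then have "f (x \<otimes> (y \<otimes> z)) = f x * cis (g z x) * cis (g y (x \<otimes> z))" using g(2) x y z by simp
      then show ?thesis by (simp add: cis_mult[symmetric] mult_ac)
    qed
    moreover have "has_mean ?h (m y + m z)" by (intro has_mean_add has_mean_translate m y z)
    ultimately have "D (y \<otimes> z) = ?h \<one> - (m y + m z) \<and> cis (m (y \<otimes> z)) = cis (m y + m z)"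
      using indep[of "y \<otimes> z" ?h "m y + m z"] y z by simp
    then show "D (y \<otimes> z) = g y z + g z \<one> - (m y + m z)" "cis (m (y \<otimes> z)) = cis (m y) * cis (m z)"
      using z by (simp_all add: cis_mult)
  qed
  \<comment> \<open>For \<open>v\<close> near \<open>\<one>\<close> the principal logarithm is an admissible and uniformly small choice of \<open>g v\<close>;
    continuity of the character and of \<open>D\<close> at \<open>\<one>\<close> follow.\<close>
  have small: "\<exists>V. openin T V \<and> \<one> \<in> V \<and> (\<forall>v\<in>V. \<exists>r. \<bar>r\<bar> \<le> e \<and> \<bar>D v\<bar> \<le> 2 * e \<and> cis (m v) = cis r)" if e: "e > 0" for e
  proof -
    obtain d where d: "d > 0" "d \<le> 1" "\<And>z. cmod (z - 1) < d \<Longrightarrow> \<bar>Im (Ln z)\<bar> < e" using Im_Ln_small[OF e] by blast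
    obtain V where V: "openin T V" "\<one> \<in> V" "\<And>v x. v \<in> V \<Longrightarrow> x \<in> carrier G \<Longrightarrow> dist (f (x \<otimes> v)) (f x) < d"
      using uniformly_continuous[OF f d(1)] by blast
    have "\<exists>r. \<bar>r\<bar> \<le> e \<and> \<bar>D v\<bar> \<le> 2 * e \<and> cis (m v) = cis r" if v: "v \<in> V" for v
    proof -
      have vc: "v \<in> carrier G" using v V(1) openin_subset by fastforce
      define q where "q = (\<lambda>x. f (x \<otimes> v) * cnj (f x))"
      have q_close: "cmod (q x - 1) < d" and q_unit: "cmod (q x) = 1" if x: "x \<in> carrier G" for x
      proof -
        have "q x - 1 = (f (x \<otimes> v) - f x) * cnj (f x)" by (simp add: q_def left_diff_distrib uf[OF x])
        then show "cmod (q x - 1) < d" using V(3)[OF v x] unit[OF x] by (simp add: dist_norm norm_mult)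
        show "cmod (q x) = 1" using unit x vc by (simp add: q_def norm_mult)
      qed
      let ?h = "\<lambda>x. Im (Ln (q x))"
      have qc: "continuous_map T euclidean q"
        unfolding q_def by (intro continuous_map_times continuous_map_translate(1) f vc continuous_map_tendsto_compose[OF f] continuous_intros)
      have h: "continuous_map T euclideanreal ?h"
      proof (rule continuous_map_Im_Ln[OF qc])
        fix x assume "x \<in> topspace T"
        then have x: "x \<in> carrier G" by simp
        show "cmod (q x) = 1" by (rule q_unit[OF x])
        show "q x \<noteq> - 1" using q_close[OF x] d(2) by auto
      qed
      have hb: "\<bar>?h x\<bar> \<le> e" if "x \<in> carrier G" for x using d(3)[OF q_close[OF that]] by simp
      have hm: "has_mean ?h (mean ?h)" by (rule has_mean_real[OF h])
      have mb: "\<bar>mean ?h\<bar> \<le> e" using has_mean_bound'[OF hm, of 0 e] hb by simp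
      have "f (x \<otimes> v) = f x * cis (?h x)" if x: "x \<in> carrier G" for x
      proof -
        have "f x * q x = f (x \<otimes> v) * (f x * cnj (f x))" by (simp add: q_def mult_ac)
        then show ?thesis using cis_Im_Ln[OF q_unit[OF x]] uf[OF x] by simp
      qed
      from indep[OF vc h this hm] show ?thesis using hb[OF one_closed] mb
        by (intro exI[of _ "mean ?h"]) (auto simp: abs_le_iff)
    qed
    with V show ?thesis by blast
  qed
  define \<xi> where "\<xi> = (\<lambda>x. if x \<in> carrier G then cis (m x) else 1)"
  have "continuous_map T euclidean \<xi>"
  proof (rule continuous_map_if_near_translates)
    fix y and e :: real assume y: "y \<in> carrier G" and e: "e > 0"
    obtain d where d: "d > 0" "\<And>t. \<bar>t\<bar> < d \<Longrightarrow> cmod (cis t - 1) < e" using cis_small[OF e] by blast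
    obtain V where V: "openin T V" "\<one> \<in> V" "\<forall>v\<in>V. \<exists>r. \<bar>r\<bar> \<le> d / 2 \<and> \<bar>D v\<bar> \<le> 2 * (d / 2) \<and> cis (m v) = cis r"
      using small[of "d / 2"] d(1) by auto
    have "dist (\<xi> (y \<otimes> v)) (\<xi> y) < e" if v: "v \<in> V" for v
    proof -
      have vc: "v \<in> carrier G" using v V(1) openin_subset by fastforce
      obtain r where "\<bar>r\<bar> \<le> d / 2" "cis (m v) = cis r" using V(3) v by blast
      then have "cmod (cis (m v) - 1) < e" using d by auto
      moreover have "\<xi> (y \<otimes> v) - \<xi> y = cis (m y) * (cis (m v) - 1)"
        using y vc add(2) by (simp add: \<xi>_def algebra_simps)
      ultimately show ?thesis by (simp add: dist_norm norm_mult)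
    qed
    then show "\<exists>V. openin T V \<and> \<one> \<in> V \<and> (\<forall>v\<in>V. dist (\<xi> (y \<otimes> v)) (\<xi> y) < e)" using V by blast
  qed
  then have \<xi>: "\<xi> \<in> characters" using add(2) by (auto simp: characters_def \<xi>_def)
  have Dcont: "continuous_map T euclideanreal D"
  proof (rule continuous_map_if_near_translates)
    fix y and e :: real assume y: "y \<in> carrier G" and e: "e > 0"
    obtain V where V: "openin T V" "\<one> \<in> V" "\<forall>v\<in>V. \<exists>r. \<bar>r\<bar> \<le> e / 4 \<and> \<bar>D v\<bar> \<le> 2 * (e / 4) \<and> cis (m v) = cis r"
      using small[of "e / 4"] e by auto
    obtain W where W: "openin T W" "\<one> \<in> W" "\<And>v x. v \<in> W \<Longrightarrow> x \<in> carrier G \<Longrightarrow> dist (g y (x \<otimes> v)) (g y x) < e / 2"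
      using uniformly_continuous[OF g(1)[OF y], of "e / 2"] e by auto
    have "dist (D (y \<otimes> v)) (D y) < e" if v: "v \<in> V \<inter> W" for v
    proof -
      have vc: "v \<in> carrier G" using v V(1) openin_subset by fastforce
      have "\<bar>D v\<bar> \<le> e / 2" using V(3) v by auto
      moreover have "\<bar>g y v - g y \<one>\<bar> < e / 2" using W(3)[of v \<one>] v vc by (simp add: dist_real_def)
      moreover have "D (y \<otimes> v) - D y = (g y v - g y \<one>) + D v" using add(1)[OF y vc] by (simp add: D_def)
      ultimately show ?thesis unfolding dist_real_def by linarith
    qed
    then show "\<exists>V. openin T V \<and> \<one> \<in> V \<and> (\<forall>v\<in>V. dist (D (y \<otimes> v)) (D y) < e)"
      using V(1,2) W(1,2) by (intro exI[of _ "V \<inter> W"]) auto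
  qed
  have "nullhomotopic T (\<lambda>x. f x * cnj (\<xi> x))"
    unfolding nullhomotopic_def
  proof (intro exI conjI ballI)
    show "continuous_map T euclideanreal (\<lambda>x. D x + Im (Ln (f \<one>)))"
      by (intro continuous_map_add Dcont) simp
    fix x assume "x \<in> topspace T"
    then have x: "x \<in> carrier G" by simp
    have "f x = f \<one> * cis (g x \<one>)" using g(2)[OF x one_closed] x by simp
    then have "f x * cnj (\<xi> x) = f \<one> * (cis (g x \<one>) * cis (- m x))" using x by (simp add: \<xi>_def cis_cnj)
    also have "\<dots> = cis (D x) * f \<one>" by (simp add: D_def cis_mult)
    also have "f \<one> = cis (Im (Ln (f \<one>)))" using cis_Im_Ln[OF unit[OF one_closed]] ..
    finally show "f x * cnj (\<xi> x) = cis (D x + Im (Ln (f \<one>)))" by (simp add: cis_mult)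
  qed
  with \<xi> show ?thesis using that by blast
qed

end

section \<open>The Bruschlinsky group\<close>

text \<open>
  The modulus is one on the whole type, which makes pointwise conjugation the inverse. Functions
  that agree on the space represent the same class, because a quotient that is \<open>1\<close> on
  the space is nullhomotopic.
\<close>

definition circle_group :: "'x topology \<Rightarrow> ('x \<Rightarrow> complex) monoid" where
  "circle_group X = \<lparr>carrier = {f. continuous_map X euclidean f \<and> (\<forall>x. cmod (f x) = 1)},
     mult = (\<lambda>f g x. f x * g x), one = (\<lambda>x. 1)\<rparr>"

definition null_group :: "'x topology \<Rightarrow> ('x \<Rightarrow> complex) set" where
  "null_group X = {f \<in> carrier (circle_group X). nullhomotopic X f}"

definition bruschlinsky :: "'x topology \<Rightarrow> ('x \<Rightarrow> complex) set monoid" where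
  "bruschlinsky X = circle_group X Mod null_group X"

definition homotopy_class :: "'x topology \<Rightarrow> ('x \<Rightarrow> complex) \<Rightarrow> ('x \<Rightarrow> complex) set" where
  "homotopy_class X f = null_group X #>\<^bsub>circle_group X\<^esub> f"

lemma carrier_circle_group:
  "f \<in> carrier (circle_group X) \<longleftrightarrow> continuous_map X euclidean f \<and> (\<forall>x. cmod (f x) = 1)"
  by (simp add: circle_group_def)

lemma mult_circle_group [simp]: "f \<otimes>\<^bsub>circle_group X\<^esub> g = (\<lambda>x. f x * g x)"
  by (simp add: circle_group_def)

lemma one_circle_group [simp]: "\<one>\<^bsub>circle_group X\<^esub> = (\<lambda>x. 1)"
  by (simp add: circle_group_def)

lemma circle_group_mult_closed:
  "f \<in> carrier (circle_group X) \<Longrightarrow> g \<in> carrier (circle_group X) \<Longrightarrow> (\<lambda>x. f x * g x) \<in> carrier (circle_group X)"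
  by (auto simp: carrier_circle_group norm_mult intro: continuous_map_times)

lemma circle_group_cnj_closed:
  "f \<in> carrier (circle_group X) \<Longrightarrow> (\<lambda>x. cnj (f x)) \<in> carrier (circle_group X)"
  by (auto simp: carrier_circle_group intro!: continuous_map_tendsto_compose[of _ _ cnj] continuous_intros)

lemma circle_group_cnj_mult:
  "f \<in> carrier (circle_group X) \<Longrightarrow> cnj (f x) * f x = 1"
  using complex_norm_square[of "f x"] by (simp add: carrier_circle_group mult.commute)

lemma circle_group_compose:
  assumes "f \<in> carrier (circle_group Y)" "continuous_map X Y r"
  shows "(\<lambda>x. f (r x)) \<in> carrier (circle_group X)"
  using assms continuous_map_compose[OF assms(2), of euclidean f] by (simp add: carrier_circle_group o_def)

lemma comm_group_circle_group: "comm_group (circle_group X)"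
proof (rule comm_groupI)
  show "\<one>\<^bsub>circle_group X\<^esub> \<in> carrier (circle_group X)" by (simp add: carrier_circle_group)
  fix f assume f: "f \<in> carrier (circle_group X)"
  show "\<exists>g\<in>carrier (circle_group X). g \<otimes>\<^bsub>circle_group X\<^esub> f = \<one>\<^bsub>circle_group X\<^esub>"
    by (rule bexI[OF _ circle_group_cnj_closed[OF f]]) (simp add: circle_group_cnj_mult[OF f])
qed (auto intro: circle_group_mult_closed simp: mult_ac)

lemma inv_circle_group:
  assumes "f \<in> carrier (circle_group X)"
  shows "inv\<^bsub>circle_group X\<^esub> f = (\<lambda>x. cnj (f x))"
proof -
  interpret comm_group "circle_group X" by (rule comm_group_circle_group)
  show ?thesis
    by (rule inv_equality) (use assms circle_group_cnj_closed[OF assms] circle_group_cnj_mult[OF assms] in auto)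
qed

lemma subgroup_null_group: "subgroup (null_group X) (circle_group X)"
proof -
  interpret comm_group "circle_group X" by (rule comm_group_circle_group)
  show ?thesis
  proof (rule subgroupI)
    have "(\<lambda>x. 1) \<in> null_group X"
      by (simp add: null_group_def nullhomotopic_one carrier_circle_group)
    then show "null_group X \<noteq> {}" by blast
  qed (auto simp: null_group_def inv_circle_group nullhomotopic_cnj nullhomotopic_mult circle_group_cnj_closed circle_group_mult_closed)
qed

lemma comm_group_bruschlinsky: "comm_group (bruschlinsky X)"
  unfolding bruschlinsky_def
  by (rule comm_group.abelian_FactGroup[OF comm_group_circle_group subgroup_null_group])

lemma homotopy_class_hom: "homotopy_class X \<in> hom (circle_group X) (bruschlinsky X)"
proof -
  interpret comm_group "circle_group X" by (rule comm_group_circle_group)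
  interpret normal "null_group X" "circle_group X"
    by (rule subgroup_imp_normal[OF subgroup_null_group])
  show ?thesis
    using r_coset_hom_Mod unfolding bruschlinsky_def homotopy_class_def[abs_def] .
qed

lemma carrier_bruschlinsky: "carrier (bruschlinsky X) = homotopy_class X ` carrier (circle_group X)"
  by (auto simp: bruschlinsky_def FactGroup_def RCOSETS_def homotopy_class_def)

lemma homotopy_class_one_iff:
  assumes "f \<in> carrier (circle_group X)"
  shows "homotopy_class X f = \<one>\<^bsub>bruschlinsky X\<^esub> \<longleftrightarrow> nullhomotopic X f"
proof -
  interpret comm_group "circle_group X" by (rule comm_group_circle_group)
  have "homotopy_class X f = null_group X \<longleftrightarrow> f \<in> null_group X"
    unfolding homotopy_class_def using coset_join1[OF _ assms subgroup_null_group] coset_join2[OF assms subgroup_null_group]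
      subgroup.subset[OF subgroup_null_group] by blast
  then show ?thesis using assms by (simp add: bruschlinsky_def FactGroup_def null_group_def)
qed

lemma homotopy_class_mult:
  assumes "f \<in> carrier (circle_group X)" "g \<in> carrier (circle_group X)"
  shows "homotopy_class X (\<lambda>x. f x * g x) = homotopy_class X f \<otimes>\<^bsub>bruschlinsky X\<^esub> homotopy_class X g"
  using hom_mult[OF homotopy_class_hom assms] by simp

lemma homotopy_class_eq_iff:
  assumes f: "f \<in> carrier (circle_group X)" and g: "g \<in> carrier (circle_group X)"
  shows "homotopy_class X f = homotopy_class X g \<longleftrightarrow> nullhomotopic X (\<lambda>x. f x * cnj (g x))"
proof -
  interpret B: comm_group "bruschlinsky X" by (rule comm_group_bruschlinsky)
  have cl: "homotopy_class X h \<in> carrier (bruschlinsky X)" if "h \<in> carrier (circle_group X)" for h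
    using that by (simp add: carrier_bruschlinsky)
  note g' = circle_group_cnj_closed[OF g]
  have "(\<lambda>x. cnj (g x) * g x) = (\<lambda>x. 1)" using circle_group_cnj_mult[OF g] by blast
  then have "homotopy_class X (\<lambda>x. cnj (g x)) \<otimes>\<^bsub>bruschlinsky X\<^esub> homotopy_class X g = \<one>\<^bsub>bruschlinsky X\<^esub>"
    using homotopy_class_mult[OF g' g] homotopy_class_one_iff[of "\<lambda>x. 1" X] nullhomotopic_one
    by (simp add: carrier_circle_group)
  then have "homotopy_class X (\<lambda>x. cnj (g x)) = inv\<^bsub>bruschlinsky X\<^esub> homotopy_class X g"
    using B.inv_equality cl[OF g] cl[OF g'] by simp
  then have "homotopy_class X (\<lambda>x. f x * cnj (g x)) = homotopy_class X f \<otimes>\<^bsub>bruschlinsky X\<^esub> inv\<^bsub>bruschlinsky X\<^esub> homotopy_class X g"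
    using homotopy_class_mult[OF f g'] by simp
  moreover have "homotopy_class X f \<otimes>\<^bsub>bruschlinsky X\<^esub> inv\<^bsub>bruschlinsky X\<^esub> homotopy_class X g = \<one>\<^bsub>bruschlinsky X\<^esub>
      \<longleftrightarrow> homotopy_class X f = homotopy_class X g"
    using cl[OF f] cl[OF g] by (simp add: B.inv_solve_right')
  ultimately show ?thesis
    using homotopy_class_one_iff[OF circle_group_mult_closed[OF f g']] by simp
qed

text \<open>
  A map to the circle is determined up to homotopy by a finite code: a finite cover by members of a
  countable base, each labelled with one of the four points \<open>1\<close>, \<open>- 1\<close>, \<open>\<i>\<close>, \<open>- \<i>\<close> from which the values
  on that member have distance less than \<open>1\<close>. Maps with a common code are nowhere antipodal.
\<close>

lemma countable_bruschlinsky_metrizable: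
  assumes "compact_space X" "metrizable_space X"
  shows "countable (carrier (bruschlinsky X))"
proof -
  obtain M d where M: "Metric_space M d" "X = Metric_space.mtopology M d"
    using assms(2) unfolding metrizable_space_def by blast
  interpret Metric_space M d by fact
  have top: "topspace X = M" by (simp add: M(2))
  have comp: "compactin mtopology M" using assms(1) by (simp add: M(2) compact_space_def)
  have "\<exists>F. finite F \<and> F \<subseteq> M \<and> M \<subseteq> (\<Union>x\<in>F. mball x (inverse (real (Suc n))))" for n
    using compactin_imp_mtotally_bounded[OF comp] unfolding mtotally_bounded_def by simp
  then obtain F where F: "\<And>n. finite (F n)" "\<And>n. F n \<subseteq> M" "\<And>n. M \<subseteq> (\<Union>x\<in>F n. mball x (inverse (real (Suc n))))"
    by metis
  define B where "B = (\<Union>n. (\<lambda>x. mball x (inverse (real (Suc n)))) ` F n)"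
  have countB: "countable B" unfolding B_def using F(1) by (intro countable_UN countable_image) (auto intro: countable_finite)
  have baseB: "\<exists>b\<in>B. x \<in> b \<and> b \<subseteq> U" if "openin X U" "x \<in> U" for x U
  proof -
    have xM: "x \<in> M" using that openin_subset top by blast
    have "openin mtopology U" using that(1) by (simp only: M(2))
    then have "\<exists>r>0. mball x r \<subseteq> U" using that(2) by (simp add: openin_mtopology)
    then obtain r where r: "r > 0" "mball x r \<subseteq> U" by blast
    obtain n where n: "inverse (real (Suc n)) < r / 2" using reals_Archimedean[of "r/2"] r(1) by auto
    obtain y where y: "y \<in> F n" "x \<in> mball y (inverse (real (Suc n)))" using F(3)[of n] xM by blast
    have "mball y (inverse (real (Suc n))) \<subseteq> mball x r"
    proof
      fix z assume z: "z \<in> mball y (inverse (real (Suc n)))"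
      then have "d x z \<le> d x y + d y z" using y xM by (intro triangle) auto
      also have "\<dots> < r" using z y n by (auto simp: commute)
      finally show "z \<in> mball x r" using z xM by auto
    qed
    with r y show ?thesis by (intro bexI[of _ "mball y (inverse (real (Suc n)))"]) (auto simp: B_def)
  qed
  have openB: "openin X b" if "b \<in> B" for b using that by (auto simp: B_def M(2))
  \<comment> \<open>Every point of the circle has distance less than one from a fourth root of unity.\<close>
  define Q :: "complex set" where "Q = {1, - 1, \<i>, - \<i>}"
  have nearQ: "\<exists>q\<in>Q. cmod (z - q) < 1" if "cmod z = 1" for z
  proof -
    have sq: "(Re z)\<^sup>2 + (Im z)\<^sup>2 = 1" using that by (simp add: cmod_def)
    have key: "cmod (z - q) < 1" if "cmod q = 1" "Re (z * cnj q) > 1/2" for q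
    proof -
      have "(cmod (z - q))\<^sup>2 = (cmod z)\<^sup>2 + (cmod q)\<^sup>2 - 2 * Re (z * cnj q)"
        unfolding cmod_power2 by (simp add: power2_eq_square algebra_simps)
      then have "(cmod (z - q))\<^sup>2 < 1\<^sup>2" using that \<open>cmod z = 1\<close> by simp
      then show ?thesis by (rule power_less_imp_less_base) simp
    qed
    have "\<bar>Re z\<bar> > 1/2 \<or> \<bar>Im z\<bar> > 1/2"
    proof (rule ccontr)
      assume "\<not> ?thesis"
      then have "\<bar>Re z\<bar> \<le> 1/2" "\<bar>Im z\<bar> \<le> 1/2" by auto
      from this[THEN power_mono, of 2] have "(Re z)\<^sup>2 \<le> 1/4" "(Im z)\<^sup>2 \<le> 1/4"
        by (simp_all add: power_divide)
      then show False using sq by simp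
    qed
    then consider "Re z > 1/2" | "Re z < - 1/2" | "Im z > 1/2" | "Im z < - 1/2" by linarith
    then show ?thesis
    proof cases
      case 1 then show ?thesis using key[of 1] by (auto simp: Q_def)
    next
      case 2 then show ?thesis using key[of "- 1"] by (auto simp: Q_def)
    next
      case 3 then show ?thesis using key[of \<i>] by (auto simp: Q_def)
    next
      case 4 then show ?thesis using key[of "- \<i>"] by (auto simp: Q_def)
    qed
  qed
  define code where "code = (\<lambda>f S. finite S \<and> S \<subseteq> B \<times> Q \<and> M \<subseteq> \<Union>(fst ` S) \<and> (\<forall>(b, q)\<in>S. \<forall>x\<in>b. cmod (f x - q) < (1::real)))"
  have code_cover: "\<exists>b q. (b, q) \<in> S \<and> x \<in> b" if "code f S" "x \<in> M" for f S x
  proof -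
    have "x \<in> \<Union>(fst ` S)" using that unfolding code_def by blast
    then obtain s where "s \<in> S" "x \<in> fst s" by blast
    then show ?thesis by (intro exI[of _ "fst s"] exI[of _ "snd s"]) simp
  qed
  have code_close: "cmod (f x - q) < 1" if "code f S" "(b, q) \<in> S" "x \<in> b" for f S b q x
    using that unfolding code_def by blast
  have ex_code: "\<exists>S. code f S" if f: "f \<in> carrier (circle_group X)" for f
  proof -
    have fc: "continuous_map X euclidean f" and fu: "\<And>x. cmod (f x) = 1" using f by (auto simp: carrier_circle_group)
    define P where "P = {(b, q). b \<in> B \<and> q \<in> Q \<and> (\<forall>x\<in>b. cmod (f x - q) < 1)}"
    have "topspace X \<subseteq> \<Union>(fst ` P)"
    proof
      fix x assume x: "x \<in> topspace X"
      obtain q where q: "q \<in> Q" "cmod (f x - q) < 1" using nearQ[OF fu] by blast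
      let ?U = "{y \<in> topspace X. f y \<in> ball q 1}"
      have "openin X ?U" by (rule openin_continuous_map_preimage[OF fc]) simp
      moreover have "x \<in> ?U" using x q by (simp add: dist_norm norm_minus_commute)
      ultimately obtain b where b: "b \<in> B" "x \<in> b" "b \<subseteq> ?U" using baseB by blast
      then have "(b, q) \<in> P" using q by (auto simp: P_def dist_norm norm_minus_commute)
      then show "x \<in> \<Union>(fst ` P)" using b(2) by force
    qed
    moreover have "\<forall>U\<in>fst ` P. openin X U" using openB by (auto simp: P_def)
    ultimately obtain \<F> where "finite \<F>" "\<F> \<subseteq> fst ` P" "topspace X \<subseteq> \<Union>\<F>"
      using assms(1)[unfolded compact_space_alt, rule_format, of "fst ` P"] by auto
    then obtain S where "finite S" "S \<subseteq> P" "\<F> = fst ` S" by (meson finite_subset_image)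
    then show ?thesis using \<open>topspace X \<subseteq> \<Union>\<F>\<close> unfolding code_def P_def top by (intro exI[of _ S]) fastforce
  qed
  then obtain c where c: "\<And>f. f \<in> carrier (circle_group X) \<Longrightarrow> code f (c f)" by metis
  have "homotopy_class X f = homotopy_class X g"
    if f: "f \<in> carrier (circle_group X)" and g: "g \<in> carrier (circle_group X)" and eq: "c f = c g" for f g
  proof -
    have "nullhomotopic X (\<lambda>x. f x * cnj (g x))"
    proof (rule nullhomotopic_if_close)
      fix x assume "x \<in> topspace X"
      then obtain b q where bq: "(b, q) \<in> c f" "x \<in> b" using code_cover[OF c[OF f]] top by blast
      then have "(b, q) \<in> c g" using eq by simp
      then have "cmod (f x - q) < 1" "cmod (g x - q) < 1"
        using code_close[OF c[OF f]] code_close[OF c[OF g]] bq by blast+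
      then have "cmod ((f x - q) - (g x - q)) < 1 + 1" by (intro norm_diff_triangle_less[of _ 0] order_le_less_trans[OF norm_triangle_ineq4]) simp_all
      then show "cmod (f x - g x) < 2" by simp
    qed (use f g in \<open>auto simp: carrier_circle_group\<close>)
    then show ?thesis using homotopy_class_eq_iff[OF f g] by simp
  qed
  then have "homotopy_class X ` carrier (circle_group X) \<subseteq> (\<lambda>S. homotopy_class X (SOME f. f \<in> carrier (circle_group X) \<and> c f = S)) ` {S. S \<subseteq> B \<times> Q \<and> finite S}"
  proof (intro image_subsetI)
    fix f assume *: "\<And>f g. f \<in> carrier (circle_group X) \<Longrightarrow> g \<in> carrier (circle_group X) \<Longrightarrow> c f = c g \<Longrightarrow> homotopy_class X f = homotopy_class X g"
      and f: "f \<in> carrier (circle_group X)"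
    let ?g = "SOME g. g \<in> carrier (circle_group X) \<and> c g = c f"
    have "?g \<in> carrier (circle_group X) \<and> c ?g = c f" by (rule someI[of _ f]) (use f in simp)
    then have "homotopy_class X f = homotopy_class X ?g" using *[OF f, of ?g] by simp
    moreover have "c f \<in> {S. S \<subseteq> B \<times> Q \<and> finite S}" using c[OF f] by (simp add: code_def)
    ultimately show "homotopy_class X f \<in> (\<lambda>S. homotopy_class X (SOME f. f \<in> carrier (circle_group X) \<and> c f = S)) ` {S. S \<subseteq> B \<times> Q \<and> finite S}"
      by (rule image_eqI)
  qed
  moreover have "countable {S. S \<subseteq> B \<times> Q \<and> finite S}"
  proof -
    have "countable (B \<times> Q)" using countB by (simp add: Q_def)
    from countable_Collect_finite_subset[OF this] show ?thesis by (simp add: conj_commute)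
  qed
  ultimately show ?thesis unfolding carrier_bruschlinsky by (meson countable_image countable_subset)
qed

section \<open>Circle-valued maps on inverse limits\<close>

text \<open>
  The index set is an initial segment of the well-order, so that the results apply both to the limit
  of a whole sequence and to the spaces at limit stages.
\<close>

locale surjective_inverse_limit =
  fixes s :: "'i rel" and I :: "'i set" and K :: "'i \<Rightarrow> 'u topology" and p :: "'i \<Rightarrow> 'i \<Rightarrow> 'u \<Rightarrow> 'u"
    and X :: "'x topology" and q :: "'i \<Rightarrow> 'x \<Rightarrow> 'u"
  assumes seq: "inverse_sequence s K p"
    and I_sub: "I \<subseteq> Field s" and I_ne: "I \<noteq> {}"
    and down: "\<And>a b. (a, b) \<in> s \<Longrightarrow> b \<in> I \<Longrightarrow> a \<in> I"
    and surj: "\<And>a b. (a, b) \<in> s \<Longrightarrow> p a b ` topspace (K b) = topspace (K a)"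
    and lim: "is_inverse_limit s I K p X q"
begin

lemma wo: "Well_order s" using seq by (simp add: inverse_sequence_def)

lemma rel_refl: "a \<in> I \<Longrightarrow> (a, a) \<in> s"
  using wo I_sub by (auto simp: order_on_defs refl_on_def)

lemma rel_trans: "(a, b) \<in> s \<Longrightarrow> (b, c) \<in> s \<Longrightarrow> (a, c) \<in> s"
  using wo unfolding order_on_defs by (blast dest: transD)

lemma rel_total: "a \<in> I \<Longrightarrow> b \<in> I \<Longrightarrow> (a, b) \<in> s \<or> (b, a) \<in> s"
  using wo rel_refl I_sub unfolding order_on_defs total_on_def by (metis subsetD)

lemma finite_upper_bound: "finite F \<Longrightarrow> F \<subseteq> I \<Longrightarrow> \<exists>c\<in>I. \<forall>a\<in>F. (a, c) \<in> s"
proof (induction rule: finite_induct)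
  case empty
  then show ?case using I_ne by auto
next
  case (insert b F)
  then obtain c where c: "c \<in> I" "\<forall>a\<in>F. (a, c) \<in> s" by auto
  have b: "b \<in> I" using insert by simp
  from rel_total[OF b c(1)] show ?case
  proof
    assume "(b, c) \<in> s"
    with c show ?thesis by (intro bexI[of _ c]) auto
  next
    assume "(c, b) \<in> s"
    with c b show ?thesis by (intro bexI[of _ b]) (auto intro: rel_trans rel_refl)
  qed
qed

lemma space: "a \<in> I \<Longrightarrow> compact_space (K a)" "a \<in> I \<Longrightarrow> Hausdorff_space (K a)"
  using seq I_sub by (auto simp: inverse_sequence_def)

lemma bond: "(a, b) \<in> s \<Longrightarrow> continuous_map (K b) (K a) (p a b)"
  using seq by (simp add: inverse_sequence_def)

lemma bond_comp: "(a, b) \<in> s \<Longrightarrow> (b, c) \<in> s \<Longrightarrow> x \<in> topspace (K c) \<Longrightarrow> p a b (p b c x) = p a c x"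
  using seq by (simp add: inverse_sequence_def)

abbreviation "L \<equiv> inverse_limit s I K p"

lemma topspace_L: "topspace L = {x \<in> (\<Pi>\<^sub>E a\<in>I. topspace (K a)). \<forall>a\<in>I. \<forall>b\<in>I. (a, b) \<in> s \<longrightarrow> p a b (x b) = x a}"
  by (auto simp: inverse_limit_def)

lemma hom: "homeomorphic_map X L (\<lambda>x. \<lambda>a\<in>I. q a x)"
  using lim by (simp add: is_inverse_limit_def)

lemma closedin_coherent:
  assumes "a \<in> I" "b \<in> I" "(a, b) \<in> s"
  shows "closedin (product_topology K I) {x \<in> (\<Pi>\<^sub>E a\<in>I. topspace (K a)). p a b (x b) = x a}"
proof -
  have "continuous_map (product_topology K I) (K a) (\<lambda>x. p a b (x b))"
    using continuous_map_compose[OF continuous_map_product_projection[OF assms(2), of K] bond[OF assms(3)]]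
    by (simp add: o_def)
  moreover have "continuous_map (product_topology K I) (K a) (\<lambda>x. x a)"
    by (rule continuous_map_product_projection[OF assms(1)])
  ultimately have "closedin (product_topology K I) {x \<in> topspace (product_topology K I). p a b (x b) = x a}"
    by (rule closedin_continuous_maps_eq[OF space(2)[OF assms(1)]])
  then show ?thesis by simp
qed

lemma compact_X: "compact_space X"
proof -
  have "topspace L = (\<Inter>c\<in>{(a, b) \<in> I \<times> I. (a, b) \<in> s}. {x \<in> (\<Pi>\<^sub>E a\<in>I. topspace (K a)). p (fst c) (snd c) (x (snd c)) = x (fst c)})"
    using I_ne rel_refl unfolding topspace_L by auto
  also have "closedin (product_topology K I) \<dots>"
    using I_ne rel_refl closedin_coherent by (intro closedin_Inter) auto
  finally have "closedin (product_topology K I) (topspace L)" .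
  moreover have "compact_space (product_topology K I)"
    using space(1) by (simp add: compact_space_product_topology)
  ultimately have "compactin (product_topology K I) (topspace L)" by (rule closedin_compact_space[rotated])
  then have "compactin L (topspace L)"
    unfolding inverse_limit_def compactin_subtopology by auto
  then have "compact_space L" by (simp add: compact_space_def)
  moreover have "X homeomorphic_space L" using hom homeomorphic_map_imp_homeomorphic_space by blast
  ultimately show ?thesis using homeomorphic_compact_space by blast
qed

lemma q_in: "a \<in> I \<Longrightarrow> x \<in> topspace X \<Longrightarrow> q a x \<in> topspace (K a)"
  and q_coherent: "b \<in> I \<Longrightarrow> (a, b) \<in> s \<Longrightarrow> x \<in> topspace X \<Longrightarrow> p a b (q b x) = q a x"
proof -
  have L: "(\<lambda>a\<in>I. q a x) \<in> topspace L" if "x \<in> topspace X" for x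
    using homeomorphic_imp_surjective_map[OF hom] that by blast
  show "a \<in> I \<Longrightarrow> x \<in> topspace X \<Longrightarrow> q a x \<in> topspace (K a)" using L unfolding topspace_L by auto
  show "b \<in> I \<Longrightarrow> (a, b) \<in> s \<Longrightarrow> x \<in> topspace X \<Longrightarrow> p a b (q b x) = q a x"
    using L[of x] down[of a b] unfolding topspace_L by auto
qed

lemma q_cont: 
  assumes a: "a \<in> I"
  shows "continuous_map X (K a) (q a)"
proof -
  have "continuous_map L (K a) (\<lambda>x. x a)"
    unfolding inverse_limit_def by (intro continuous_map_from_subtopology continuous_map_product_projection a)
  from continuous_map_compose[OF homeomorphic_imp_continuous_map[OF hom] this] show ?thesis
    using a by (simp add: o_def)
qed

text \<open>
  A thread through a prescribed point exists by compactness of the product: finitely many coherence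
  conditions can be satisfied by starting from a single sufficiently late coordinate.
\<close>

lemma q_surj:
  assumes a: "a \<in> I" and y: "y \<in> topspace (K a)"
  shows "\<exists>x\<in>topspace X. q a x = y"
proof -
  let ?P = "\<Pi>\<^sub>E a\<in>I. topspace (K a)"
  define C where "C = (\<lambda>(b, c). {x \<in> ?P. p b c (x c) = x b})"
  define J where "J = {(b, c) \<in> I \<times> I. (b, c) \<in> s}"
  define A where "A = {x \<in> topspace (product_topology K I). x a \<in> {y}}"
  have A: "closedin (product_topology K I) A"
    unfolding A_def
    by (rule closedin_continuous_map_preimage[OF continuous_map_product_projection[OF a]])
      (use space(2)[OF a] y in \<open>simp add: closedin_Hausdorff_sing_eq\<close>)
  have ne: "topspace (K b) \<noteq> {}" if b: "b \<in> I" for b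
  proof -
    from rel_total[OF a b] show ?thesis
    proof
      assume "(a, b) \<in> s" then show ?thesis using surj[of a b] y by auto
    next
      assume "(b, a) \<in> s" then show ?thesis using surj[of b a] y by auto
    qed
  qed
  have "topspace (product_topology K I) \<inter> \<Inter>(insert A (C ` J)) \<noteq> {}"
  proof (rule compact_space_product_topology[THEN iffD2, unfolded compact_space_def compactin_fip, THEN conjunct2, rule_format], goal_cases)
    case 1 then show ?case using space(1) by (simp add: compact_space_def compactin_fip)
  next
    case 2
    show ?case
    proof (intro conjI ballI allI impI)
      fix D assume "D \<in> insert A (C ` J)"
      then show "closedin (product_topology K I) D" using A closedin_coherent by (auto simp: C_def J_def)
    next
      fix \<F> assume F: "finite \<F> \<and> \<F> \<subseteq> insert A (C ` J)"
      then have "finite (\<F> - {A})" "\<F> - {A} \<subseteq> C ` J" by auto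
      then obtain J' where J': "finite J'" "J' \<subseteq> J" "\<F> - {A} = C ` J'" by (meson finite_subset_image)
      have "finite (insert a (fst ` J' \<union> snd ` J'))" "insert a (fst ` J' \<union> snd ` J') \<subseteq> I"
        using J' a by (auto simp: J_def)
      then obtain c where c: "c \<in> I" "\<forall>b\<in>insert a (fst ` J' \<union> snd ` J'). (b, c) \<in> s"
        using finite_upper_bound by blast
      have "y \<in> p a c ` topspace (K c)" using surj[of a c] c(2) y by simp
      then obtain z where z: "z \<in> topspace (K c)" "p a c z = y" by blast
      define x where "x = (\<lambda>b\<in>I. if (b, c) \<in> s then p b c z else (SOME w. w \<in> topspace (K b)))"
      have xP: "x \<in> ?P"
      proof (rule PiE_I)
        fix b assume b: "b \<in> I"
        have "(SOME w. w \<in> topspace (K b)) \<in> topspace (K b)" using ne[OF b] by (simp add: some_in_eq)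
        then show "x b \<in> topspace (K b)" using b bond[of b c] z(1) by (auto simp: x_def continuous_map_def)
      qed (simp add: x_def)
      have "x \<in> A" using xP c(2) a z(2) by (simp add: A_def x_def)
      moreover have "x \<in> C j" if j: "j \<in> J'" for j
      proof -
        obtain b b' where jb: "j = (b, b')" by fastforce
        then have "b \<in> I" "b' \<in> I" "(b, b') \<in> s" "(b, c) \<in> s" "(b', c) \<in> s" using j J'(2) c(2) by (force simp: J_def)+
        then show ?thesis using xP bond_comp[of b b' c z] z(1) by (simp add: jb C_def x_def)
      qed
      ultimately have "x \<in> \<Inter>\<F>" using J'(3) by blast
      then show "topspace (product_topology K I) \<inter> \<Inter>\<F> \<noteq> {}" using xP by auto
    qed
  qed
  then obtain x where x: "x \<in> ?P" "x \<in> A" "\<And>j. j \<in> J \<Longrightarrow> x \<in> C j" by auto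
  have "x \<in> topspace L" using x(1) x(3) unfolding topspace_L by (force simp: C_def J_def)
  then obtain w where w: "w \<in> topspace X" "x = (\<lambda>a\<in>I. q a w)" using homeomorphic_imp_surjective_map[OF hom] by blast
  then show ?thesis using x(2) a by (intro bexI[of _ w]) (auto simp: A_def)
qed

lemma basic_open:
  assumes V: "openin X V" "x \<in> V"
  obtains a U where "a \<in> I" "openin (K a) U" "q a x \<in> U" "\<And>y. y \<in> topspace X \<Longrightarrow> q a y \<in> U \<Longrightarrow> y \<in> V"
proof -
  let ?e = "\<lambda>x. \<lambda>a\<in>I. q a x"
  have xX: "x \<in> topspace X" using V openin_subset by blast
  have "openin L (?e ` V)" using homeomorphic_map_openness_eq[OF hom] V(1) openin_subset[OF V(1)] by blast
  then obtain W where W: "openin (product_topology K I) W" "?e ` V = W \<inter> {x. \<forall>a\<in>I. \<forall>b\<in>I. (a, b) \<in> s \<longrightarrow> p a b (x b) = x a}"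
    unfolding inverse_limit_def openin_subtopology by blast
  have eW: "?e x \<in> W" using W(2) V(2) by blast
  have "\<exists>U. finite {i \<in> I. U i \<noteq> topspace (K i)} \<and> (\<forall>i\<in>I. openin (K i) (U i)) \<and> ?e x \<in> PiE I U \<and> PiE I U \<subseteq> W"
    using W(1) eW unfolding openin_product_topology_alt by (rule bspec)
  then obtain U where U: "finite {i \<in> I. U i \<noteq> topspace (K i)}" "\<forall>i\<in>I. openin (K i) (U i)" "?e x \<in> PiE I U" "PiE I U \<subseteq> W"
    by (elim exE conjE)
  let ?F = "{i \<in> I. U i \<noteq> topspace (K i)}"
  obtain a where a: "a \<in> I" "\<forall>i\<in>?F. (i, a) \<in> s" using finite_upper_bound[OF U(1)] by auto
  define U' where "U' = (\<Inter>i\<in>?F. {z \<in> topspace (K a). p i a z \<in> U i}) \<inter> topspace (K a)"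
  have "openin (K a) U'"
    unfolding U'_def
  proof (rule openin_INT[OF U(1)])
    fix i assume "i \<in> ?F"
    then show "openin (K a) {z \<in> topspace (K a). p i a z \<in> U i}"
      using a(2) U(2) by (intro openin_continuous_map_preimage[OF bond]) auto
  qed
  moreover have "q a x \<in> U'"
    using q_in[OF a(1) xX] q_coherent[OF a(1) _ xX] a(2) U(3) by (auto simp: U'_def PiE_iff)
  moreover have "y \<in> V" if y: "y \<in> topspace X" "q a y \<in> U'" for y
  proof -
    have "q i y \<in> U i" if i: "i \<in> I" for i
    proof (cases "i \<in> ?F")
      case True
      then show ?thesis using y a(2) q_coherent[OF a(1) _ y(1), of i] by (auto simp: U'_def)
    next
      case False
      then show ?thesis using i q_in[OF i y(1)] by auto
    qed
    then have "?e y \<in> PiE I U" by auto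
    then have "?e y \<in> W" using U(4) by blast
    moreover have "?e y \<in> topspace L" using homeomorphic_imp_surjective_map[OF hom] y(1) by blast
    ultimately have "?e y \<in> ?e ` V" unfolding W(2) topspace_L by blast
    then obtain v where v: "v \<in> V" "?e y = ?e v" by blast
    then have "y = v"
      using homeomorphic_imp_injective_map[OF hom] y(1) openin_subset[OF V(1)] by (meson inj_onD subsetD)
    then show ?thesis using v(1) by simp
  qed
  ultimately show ?thesis using that a(1) by blast
qed

text \<open>
  Every point has a neighbourhood that is pulled back from a stage and on which \<open>f\<close> varies little;
  by compactness one stage \<open>a\<close> serves for all points. A partition of unity on that stage combines
  the approximate values into the function \<open>g\<close>.
\<close>

lemma approximation:
  fixes f :: "'x \<Rightarrow> complex"
  assumes f: "continuous_map X euclidean f" and e: "e > 0"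
  obtains a g where "a \<in> I" "continuous_map (K a) euclidean g" "\<And>x. x \<in> topspace X \<Longrightarrow> cmod (f x - g (q a x)) < e"
proof -
  define \<P> where "\<P> = {(a, U, z). a \<in> I \<and> openin (K a) U \<and> (\<forall>y\<in>topspace X. q a y \<in> U \<longrightarrow> cmod (f y - z) < e)}"
  define N where "N = (\<lambda>(a, U, z :: complex). {x \<in> topspace X. q a x \<in> U})"
  have "topspace X \<subseteq> \<Union>(N ` \<P>)"
  proof
    fix x assume x: "x \<in> topspace X"
    define V where "V = {y \<in> topspace X. f y \<in> ball (f x) e}"
    have V: "openin X V" unfolding V_def by (rule openin_continuous_map_preimage[OF f]) simp
    have "x \<in> V" using x e by (simp add: V_def)
    then obtain a U where aU: "a \<in> I" "openin (K a) U" "q a x \<in> U" "\<And>y. y \<in> topspace X \<Longrightarrow> q a y \<in> U \<Longrightarrow> y \<in> V"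
      using basic_open[OF V] by blast
    have "cmod (f y - f x) < e" if "y \<in> topspace X" "q a y \<in> U" for y
      using aU(4)[OF that] by (simp add: V_def dist_norm norm_minus_commute)
    then have "(a, U, f x) \<in> \<P>" using aU(1,2) by (simp add: \<P>_def)
    moreover have "x \<in> N (a, U, f x)" using x aU by (simp add: N_def)
    ultimately show "x \<in> \<Union>(N ` \<P>)" by blast
  qed
  moreover have "\<forall>W\<in>N ` \<P>. openin X W"
    by (auto simp: N_def \<P>_def intro!: openin_continuous_map_preimage[OF q_cont])
  ultimately obtain \<F> where FF: "finite \<F>" "\<F> \<subseteq> N ` \<P>" "topspace X \<subseteq> \<Union>\<F>"
    using compact_X[unfolded compact_space_alt, rule_format, of "N ` \<P>"] by auto
  obtain S where S: "finite S" "S \<subseteq> \<P>" "topspace X \<subseteq> \<Union>(N ` S)"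
    using finite_subset_image[OF FF(1,2)] FF(3) by blast
  have "fst ` S \<subseteq> I" using S(2) by (auto simp: \<P>_def)
  then obtain a where a: "a \<in> I" "\<forall>b\<in>fst ` S. (b, a) \<in> s" using finite_upper_bound[of "fst ` S"] S(1) by auto
  define good where "good = (\<lambda>z U. openin (K a) U \<and> (\<forall>y\<in>topspace X. q a y \<in> U \<longrightarrow> cmod (f y - z) < e))"
  have nbhd: "\<exists>U z. w \<in> U \<and> good z U" if w: "w \<in> topspace (K a)" for w
  proof -
    obtain x where x: "x \<in> topspace X" "q a x = w" using q_surj[OF a(1) w] by blast
    have "x \<in> \<Union>(N ` S)" using S(3) x(1) by (rule subsetD)
    then obtain t where t: "t \<in> S" "x \<in> N t" by (rule UN_E)
    obtain b U z where bt: "t = (b, U, z)" by (cases t)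
    with t have bUz: "(b, U, z) \<in> S" "q b x \<in> U" by (simp_all add: N_def)
    have ba: "(b, a) \<in> s" using a(2) bUz(1) by force
    have "b \<in> I" "openin (K b) U" and gd: "\<And>y. y \<in> topspace X \<Longrightarrow> q b y \<in> U \<Longrightarrow> cmod (f y - z) < e"
      using S(2) bUz(1) by (auto simp: \<P>_def)
    let ?U = "{v \<in> topspace (K a). p b a v \<in> U}"
    have g1: "openin (K a) ?U" by (rule openin_continuous_map_preimage[OF bond[OF ba] \<open>openin (K b) U\<close>])
    have g2: "w \<in> ?U" using w x bUz(2) q_coherent[OF a(1) ba x(1)] by simp
    have g3: "cmod (f y - z) < e" if "y \<in> topspace X" "q a y \<in> ?U" for y
      using gd[OF that(1)] that(2) q_coherent[OF a(1) ba that(1)] by simp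
    have "good z ?U" unfolding good_def by (intro conjI g1 ballI impI g3)
    with g2 show ?thesis by (intro exI[of _ ?U] exI[of _ z] conjI)
  qed
  have "\<exists>\<phi> z. continuous_map (K a) euclideanreal \<phi> \<and> \<phi> w > 0 \<and> (\<forall>v\<in>topspace (K a). \<phi> v \<ge> 0) \<and>
      (\<forall>y\<in>topspace X. \<phi> (q a y) \<noteq> 0 \<longrightarrow> cmod (f y - z) < e)" if w: "w \<in> topspace (K a)" for w
  proof -
    obtain U z where U: "w \<in> U" "good z U" using nbhd[OF w] by blast
    have "normal_space (K a)" using space[OF a(1)] compact_Hausdorff_or_regular_imp_normal_space by blast
    then have "completely_regular_space (K a)" using space(2)[OF a(1)] normal_imp_completely_regular_space by blast
    moreover have "openin (K a) U" using U(2) unfolding good_def by (rule conjunct1)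
    then have "closedin (K a) (topspace (K a) - U)" by (rule closedin_diff[OF closedin_topspace])
    moreover have "w \<in> topspace (K a) - (topspace (K a) - U)" using U(1) w by blast
    ultimately obtain \<psi> :: "'u \<Rightarrow> real" where \<psi>: "continuous_map (K a) (top_of_set {0..1}) \<psi>" "\<psi> w = 0" "\<psi> ` (topspace (K a) - U) \<subseteq> {1}"
      unfolding completely_regular_space_def by blast
    then have \<psi>': "continuous_map (K a) euclideanreal \<psi>" "\<And>v. v \<in> topspace (K a) \<Longrightarrow> \<psi> v \<le> 1"
      by (auto simp: continuous_map_in_subtopology)
    have "cmod (f y - z) < e" if y: "y \<in> topspace X" "1 - \<psi> (q a y) \<noteq> 0" for y
    proof -
      have "q a y \<in> U" using \<psi>(3) y q_in[OF a(1) y(1)] by (cases "q a y \<in> U") force+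
      then show ?thesis using U(2) y(1) unfolding good_def by blast
    qed
    moreover have "continuous_map (K a) euclideanreal (\<lambda>v. 1 - \<psi> v)"
      by (intro continuous_map_diff \<psi>'(1)) simp
    ultimately show ?thesis using \<psi>(2) \<psi>'(2) by (intro exI[of _ "\<lambda>v. 1 - \<psi> v"] exI[of _ z]) auto
  qed
  then obtain \<phi> z where \<phi>: "\<And>w. w \<in> topspace (K a) \<Longrightarrow> continuous_map (K a) euclideanreal (\<phi> w)"
    "\<And>w. w \<in> topspace (K a) \<Longrightarrow> \<phi> w w > 0"
    "\<And>w v. w \<in> topspace (K a) \<Longrightarrow> v \<in> topspace (K a) \<Longrightarrow> \<phi> w v \<ge> 0"
    "\<And>w y. w \<in> topspace (K a) \<Longrightarrow> y \<in> topspace X \<Longrightarrow> \<phi> w (q a y) \<noteq> 0 \<Longrightarrow> cmod (f y - z w) < e" by metis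
  define Nb where "Nb = (\<lambda>w. {v \<in> topspace (K a). \<phi> w v \<in> {0<..}})"
  have "openin (K a) (Nb w)" if "w \<in> topspace (K a)" for w
    unfolding Nb_def by (rule openin_continuous_map_preimage[OF \<phi>(1)[OF that]]) simp
  moreover have "topspace (K a) \<subseteq> \<Union>(Nb ` topspace (K a))" using \<phi>(2) by (auto simp: Nb_def)
  ultimately obtain \<F>' where FF': "finite \<F>'" "\<F>' \<subseteq> Nb ` topspace (K a)" "topspace (K a) \<subseteq> \<Union>\<F>'"
    using space(1)[OF a(1), unfolded compact_space_alt, rule_format, of "Nb ` topspace (K a)"] by auto
  obtain W where W: "finite W" "W \<subseteq> topspace (K a)" "topspace (K a) \<subseteq> \<Union>(Nb ` W)"
    using finite_subset_image[OF FF'(1,2)] FF'(3) by blast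
  define \<sigma> where "\<sigma> = (\<lambda>v. \<Sum>w\<in>W. \<phi> w v)"
  have \<sigma>_pos: "\<sigma> v > 0" if v: "v \<in> topspace (K a)" for v
  proof -
    obtain w where "w \<in> W" "\<phi> w v > 0" using W(3) v by (auto simp: Nb_def)
    then show ?thesis unfolding \<sigma>_def using W \<phi>(3) v by (intro sum_pos2[of W w]) auto
  qed
  have \<sigma>_cont: "continuous_map (K a) euclideanreal \<sigma>"
    unfolding \<sigma>_def using W \<phi>(1) by (intro continuous_map_sum) auto
  define g where "g = (\<lambda>v. (\<Sum>w\<in>W. of_real (\<phi> w v) * z w) / of_real (\<sigma> v))"
  have num: "continuous_map (K a) euclidean (\<lambda>v. \<Sum>w\<in>W. complex_of_real (\<phi> w v) * z w)"
  proof (rule continuous_map_sum[OF W(1)])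
    fix w assume "w \<in> W"
    then have "continuous_map (K a) euclidean (\<phi> w)" using W(2) \<phi>(1) by blast
    then show "continuous_map (K a) euclidean (\<lambda>v. complex_of_real (\<phi> w v) * z w)"
      by (rule continuous_map_tendsto_compose) (intro continuous_intros)
  qed
  have "continuous_map (K a) euclidean g"
    unfolding continuous_map_euclidean_tendsto g_def
  proof
    fix v assume v: "v \<in> topspace (K a)"
    show "((\<lambda>v. (\<Sum>w\<in>W. of_real (\<phi> w v) * z w) / complex_of_real (\<sigma> v)) \<longlongrightarrow> (\<Sum>w\<in>W. of_real (\<phi> w v) * z w) / of_real (\<sigma> v)) (atin (K a) v)"
    proof (rule tendsto_divide)
      show "((\<lambda>v. \<Sum>w\<in>W. complex_of_real (\<phi> w v) * z w) \<longlongrightarrow> (\<Sum>w\<in>W. of_real (\<phi> w v) * z w)) (atin (K a) v)"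
        using num v unfolding continuous_map_euclidean_tendsto by blast
      show "((\<lambda>v. complex_of_real (\<sigma> v)) \<longlongrightarrow> of_real (\<sigma> v)) (atin (K a) v)"
        using \<sigma>_cont v unfolding continuous_map_euclidean_tendsto by (intro tendsto_of_real) blast
    qed (use \<sigma>_pos[OF v] in simp)
  qed
  moreover have "cmod (f x - g (q a x)) < e" if x: "x \<in> topspace X" for x
  proof -
    let ?v = "q a x"
    have v: "?v \<in> topspace (K a)" by (rule q_in[OF a(1) x])
    have "of_real (\<sigma> ?v) * g ?v = (\<Sum>w\<in>W. of_real (\<phi> w ?v) * z w)"
      using \<sigma>_pos[OF v] by (simp add: g_def)
    moreover have "of_real (\<sigma> ?v) * f x = (\<Sum>w\<in>W. of_real (\<phi> w ?v) * f x)"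
      by (simp add: \<sigma>_def sum_distrib_right)
    ultimately have "of_real (\<sigma> ?v) * (f x - g ?v) = (\<Sum>w\<in>W. of_real (\<phi> w ?v) * (f x - z w))"
      by (simp only: right_diff_distrib sum_subtractf)
    then have "\<sigma> ?v * cmod (f x - g ?v) = cmod (\<Sum>w\<in>W. of_real (\<phi> w ?v) * (f x - z w))"
      using \<sigma>_pos[OF v] by (metis abs_of_pos norm_mult norm_of_real)
    also have "\<dots> \<le> (\<Sum>w\<in>W. cmod (of_real (\<phi> w ?v) * (f x - z w)))" by (rule norm_sum)
    also have "\<dots> < (\<Sum>w\<in>W. \<phi> w ?v * e)"
    proof (rule sum_strict_mono_ex1[OF W(1)])
      show "\<forall>w\<in>W. cmod (of_real (\<phi> w ?v) * (f x - z w)) \<le> \<phi> w ?v * e"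
      proof
        fix w assume w: "w \<in> W"
        then have "\<phi> w ?v \<ge> 0" using \<phi>(3) W(2) v by blast
        moreover have "\<phi> w ?v \<noteq> 0 \<Longrightarrow> cmod (f x - z w) \<le> e" using \<phi>(4)[of w x] w W(2) x by force
        ultimately show "cmod (of_real (\<phi> w ?v) * (f x - z w)) \<le> \<phi> w ?v * e"
          by (cases "\<phi> w ?v = 0") (auto simp: norm_mult intro!: mult_left_mono)
      qed
      obtain w where w: "w \<in> W" "\<phi> w ?v > 0" using W(3) v by (auto simp: Nb_def)
      moreover have "cmod (f x - z w) < e" using \<phi>(4)[of w x] w W(2) x by force
      ultimately show "\<exists>w\<in>W. cmod (of_real (\<phi> w ?v) * (f x - z w)) < \<phi> w ?v * e"
        by (intro bexI[of _ w]) (auto simp: norm_mult)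
    qed
    also have "\<dots> = \<sigma> ?v * e" by (simp add: \<sigma>_def sum_distrib_right)
    finally show ?thesis using \<sigma>_pos[OF v] by simp
  qed
  ultimately show ?thesis using that a(1) by blast
qed

text \<open>
  Normalizing a good approximation from a stage to modulus one gives a circle-valued map that is
  nowhere antipodal to \<open>f\<close>.
\<close>

lemma class_from_stage:
  assumes f: "f \<in> carrier (circle_group X)"
  obtains a g where "a \<in> I" "g \<in> carrier (circle_group (K a))" "homotopy_class X f = homotopy_class X (\<lambda>x. g (q a x))"
proof -
  have fc: "continuous_map X euclidean f" and fu: "\<And>x. cmod (f x) = 1" using f by (auto simp: carrier_circle_group)
  obtain a g where ag: "a \<in> I" "continuous_map (K a) euclidean g" "\<And>x. x \<in> topspace X \<Longrightarrow> cmod (f x - g (q a x)) < 1/2"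
    by (rule approximation[OF fc, of "1/2"]) auto
  have gpos: "cmod (g v) > 1/2" if v: "v \<in> topspace (K a)" for v
  proof -
    obtain x where x: "x \<in> topspace X" "q a x = v" using q_surj[OF ag(1) v] by blast
    then show ?thesis using ag(3)[OF x(1)] fu[of x] norm_triangle_ineq2[of "f x" "g v"] by auto
  qed
  define g' where "g' = (\<lambda>v. if v \<in> topspace (K a) then g v / of_real (cmod (g v)) else 1)"
  have g'u: "cmod (g' v) = 1" for v using gpos[of v] by (auto simp: g'_def norm_divide)
  have "continuous_map (K a) euclidean (\<lambda>v. g v / of_real (cmod (g v)))"
    unfolding continuous_map_euclidean_tendsto
  proof
    fix v assume v: "v \<in> topspace (K a)"
    then have "(g \<longlongrightarrow> g v) (atin (K a) v)" using ag(2) by (simp add: continuous_map_euclidean_tendsto)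
    then show "((\<lambda>v. g v / of_real (cmod (g v))) \<longlongrightarrow> g v / of_real (cmod (g v))) (atin (K a) v)"
      using gpos[OF v] by (intro tendsto_intros) auto
  qed
  then have "continuous_map (K a) euclidean g'" by (rule continuous_map_eq) (simp add: g'_def)
  then have g': "g' \<in> carrier (circle_group (K a))" using g'u by (simp add: carrier_circle_group)
  have gq: "(\<lambda>x. g' (q a x)) \<in> carrier (circle_group X)" by (rule circle_group_compose[OF g' q_cont[OF ag(1)]])
  have "nullhomotopic X (\<lambda>x. f x * cnj (g' (q a x)))"
  proof (rule nullhomotopic_if_close[OF fc])
    show "continuous_map X euclidean (\<lambda>x. g' (q a x))" using gq by (simp add: carrier_circle_group)
    fix x assume x: "x \<in> topspace X"
    let ?v = "q a x"
    have v: "?v \<in> topspace (K a)" by (rule q_in[OF ag(1) x])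
    have "of_real (cmod (g ?v)) * g' ?v = g ?v"
      using gpos[OF v] v by (simp add: g'_def)
    then have "g ?v - g' ?v = of_real (cmod (g ?v) - 1) * g' ?v"
      by (simp add: left_diff_distrib)
    then have "cmod (g ?v - g' ?v) = \<bar>cmod (g ?v) - 1\<bar>" using g'u by (simp add: norm_mult del: of_real_diff)
    also have "\<dots> \<le> cmod (f x - g ?v)" using norm_triangle_ineq3[of "g ?v" "f x"] fu by (simp add: norm_minus_commute)
    finally have "cmod (g ?v - g' ?v) < 1/2" using ag(3)[OF x] by simp
    moreover have "cmod (f x - g' ?v) \<le> cmod (f x - g ?v) + cmod (g ?v - g' ?v)"
      using norm_triangle_ineq[of "f x - g ?v" "g ?v - g' ?v"] by simp
    ultimately show "cmod (f x - g' ?v) < 2" using ag(3)[OF x] by simp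
  qed (use fu g'u in auto)
  then have "homotopy_class X f = homotopy_class X (\<lambda>x. g' (q a x))" using homotopy_class_eq_iff[OF f gq] by simp
  then show ?thesis using that ag(1) g' by blast
qed

text \<open>
  A logarithm on the limit is approximated by a real function from a later stage \<open>b\<close>. On that stage
  the map differs so little from the exponential of this function that it has a logarithm as well.
\<close>

lemma null_at_stage:
  assumes a: "a \<in> I" and g: "g \<in> carrier (circle_group (K a))" and null: "nullhomotopic X (\<lambda>x. g (q a x))"
  obtains b where "b \<in> I" "(a, b) \<in> s" "nullhomotopic (K b) (\<lambda>x. g (p a b x))"
proof -
  obtain h where h: "continuous_map X euclideanreal h" "\<And>x. x \<in> topspace X \<Longrightarrow> g (q a x) = cis (h x)"
    using null unfolding nullhomotopic_def by blast
  obtain d where d: "d > 0" "\<And>t. \<bar>t\<bar> < d \<Longrightarrow> cmod (cis t - 1) < 2" using cis_small[of 2] by auto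
  have "continuous_map X euclidean (\<lambda>x. complex_of_real (h x))"
    by (rule continuous_map_tendsto_compose[OF h(1)]) (intro continuous_intros)
  then obtain b' k where b': "b' \<in> I" "continuous_map (K b') euclidean k" "\<And>x. x \<in> topspace X \<Longrightarrow> cmod (of_real (h x) - k (q b' x)) < d"
    using approximation[OF _ d(1)] by metis
  obtain b where b: "b \<in> I" "(a, b) \<in> s" "(b', b) \<in> s" using finite_upper_bound[of "{a, b'}"] a b'(1) by auto
  define m where "m = (\<lambda>v. Re (k (p b' b v)))"
  have kc: "continuous_map (K b) euclidean (\<lambda>v. k (p b' b v))"
    using continuous_map_compose[OF bond[OF b(3)] b'(2)] by (simp add: o_def)
  have mc: "continuous_map (K b) euclideanreal m"
    unfolding m_def by (rule continuous_map_tendsto_compose[OF kc]) (intro continuous_intros)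
  have gp: "(\<lambda>v. g (p a b v)) \<in> carrier (circle_group (K b))" by (rule circle_group_compose[OF g bond[OF b(2)]])
  have cm: "continuous_map (K b) euclidean (\<lambda>v. cis (m v))"
    by (rule continuous_map_tendsto_compose[OF mc]) (intro continuous_intros)
  have "nullhomotopic (K b) (\<lambda>v. g (p a b v) * cnj (cis (m v)))"
  proof (rule nullhomotopic_if_close[OF _ cm])
    fix v assume v: "v \<in> topspace (K b)"
    obtain x where x: "x \<in> topspace X" "q b x = v" using q_surj[OF b(1) v] by blast
    have pv: "p a b v = q a x" "p b' b v = q b' x" using q_coherent[OF b(1) b(2) x(1)] q_coherent[OF b(1) b(3) x(1)] x(2) by auto
    have "\<bar>h x - m v\<bar> \<le> cmod (of_real (h x) - k (q b' x))"
      using abs_Re_le_cmod[of "of_real (h x) - k (q b' x)"] by (simp add: m_def pv)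
    then have "cmod (cis (h x - m v) - 1) < 2" using d(2) b'(3)[OF x(1)] by force
    moreover have "cis (h x) - cis (m v) = cis (m v) * (cis (h x - m v) - 1)" by (simp add: right_diff_distrib cis_mult)
    ultimately show "cmod (g (p a b v) - cis (m v)) < 2" using h(2)[OF x(1)] by (simp add: pv norm_mult)
  qed (use gp in \<open>auto simp: carrier_circle_group\<close>)
  moreover have "nullhomotopic (K b) (\<lambda>v. cis (m v))" using mc unfolding nullhomotopic_def by blast
  ultimately have "nullhomotopic (K b) (\<lambda>v. g (p a b v) * cnj (cis (m v)) * cis (m v))" by (rule nullhomotopic_mult)
  then have "nullhomotopic (K b) (\<lambda>x. g (p a b x))"
    by (rule nullhomotopic_cong) (simp add: cis_cnj cis_mult mult.assoc)
  with b(1,2) show ?thesis by (rule that)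
qed

end

section \<open>Decomposition of the Bruschlinsky group on the class R\<close>

lemma homotopy_class_cong:
  assumes "f \<in> carrier (circle_group X)" "g \<in> carrier (circle_group X)"
    "\<And>x. x \<in> topspace X \<Longrightarrow> f x = g x"
  shows "homotopy_class X f = homotopy_class X g"
proof -
  have "nullhomotopic X (\<lambda>x. f x * cnj (g x))"
    by (rule nullhomotopic_cong[OF nullhomotopic_one])
      (use assms circle_group_cnj_mult[OF assms(2)] in \<open>simp add: mult.commute\<close>)
  then show ?thesis using homotopy_class_eq_iff[OF assms(1,2)] by simp
qed

lemma countably_decomposable_countable:
  assumes "group A" "countable (carrier A)"
  shows "countably_decomposable A (carrier A)"
proof -
  interpret group A by fact
  have "generate A (carrier A) = carrier A"
    using generate_incl[of "carrier A"] generate.incl[of _ "carrier A" A] by blast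
  then show ?thesis
    unfolding countably_decomposable_def
    by (intro exI[of _ "{carrier A}"]) (simp add: assms(2) subgroup_self independent_family_singleton)
qed

lemma nullhomotopic_of_section:
  assumes r: "continuous_map Z Y r" and j: "continuous_map Y Z j" and rj: "\<And>y. y \<in> topspace Y \<Longrightarrow> r (j y) = y"
    and null: "nullhomotopic Z (\<lambda>z. g (r z))"
  shows "nullhomotopic Y g"
  by (rule nullhomotopic_cong[OF nullhomotopic_compose[OF null j]]) (simp add: rj)

text \<open>
  A section \<open>j\<close> of \<open>r\<close> makes the classes pulled back along \<open>r\<close> a direct summand: a map \<open>f\<close> is the product
  of the pullback of \<open>f \<circ> j\<close> and a map whose restriction along \<open>j\<close> is trivial. The
  homomorphism \<open>\<phi>\<close> identifies the classes on \<open>Z\<close> with a subgroup of an ambient group \<open>A\<close>, in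
  which the classes of several spaces can be compared.
\<close>

lemma retraction_splits:
  fixes A :: "('b, 'm) monoid_scheme"
  assumes A: "comm_group A" and \<phi>: "\<phi> \<in> hom (circle_group Z) A"
    and ker: "\<And>f. f \<in> carrier (circle_group Z) \<Longrightarrow> \<phi> f = \<one>\<^bsub>A\<^esub> \<longleftrightarrow> nullhomotopic Z f"
    and r: "continuous_map Z Y r" and j: "continuous_map Y Z j" and rj: "\<And>y. y \<in> topspace Y \<Longrightarrow> r (j y) = y"
  defines "B \<equiv> (\<lambda>g. \<phi> (\<lambda>z. g (r z))) ` carrier (circle_group Y)"
    and "D \<equiv> \<phi> ` {f \<in> carrier (circle_group Z). nullhomotopic Y (\<lambda>y. f (j y))}"
  shows "subgroup B A" "subgroup D A" "B \<inter> D \<subseteq> {\<one>\<^bsub>A\<^esub>}"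
    "B \<subseteq> \<phi> ` carrier (circle_group Z)" "D \<subseteq> \<phi> ` carrier (circle_group Z)"
    "\<And>a. a \<in> \<phi> ` carrier (circle_group Z) \<Longrightarrow> \<exists>b\<in>B. \<exists>d\<in>D. a = b \<otimes>\<^bsub>A\<^esub> d"
proof -
  interpret A: comm_group A by fact
  interpret Z: comm_group "circle_group Z" by (rule comm_group_circle_group)
  interpret Y: comm_group "circle_group Y" by (rule comm_group_circle_group)
  interpret \<phi>: group_hom "circle_group Z" A \<phi>
    using \<phi> by (simp add: group_hom_def group_hom_axioms_def Z.group_axioms A.group_axioms)
  note rc = circle_group_compose[OF _ r] and jc = circle_group_compose[OF _ j]
  have "(\<lambda>g. \<phi> (\<lambda>z. g (r z))) \<in> hom (circle_group Y) A"
  proof (rule homI)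
    fix g assume g: "g \<in> carrier (circle_group Y)"
    show "\<phi> (\<lambda>z. g (r z)) \<in> carrier A" using rc[OF g] by simp
    fix g' assume g': "g' \<in> carrier (circle_group Y)"
    show "\<phi> (\<lambda>z. (g \<otimes>\<^bsub>circle_group Y\<^esub> g') (r z)) = \<phi> (\<lambda>z. g (r z)) \<otimes>\<^bsub>A\<^esub> \<phi> (\<lambda>z. g' (r z))"
      using \<phi>.hom_mult[OF rc[OF g] rc[OF g']] by simp
  qed
  then interpret \<rho>: group_hom "circle_group Y" A "\<lambda>g. \<phi> (\<lambda>z. g (r z))"
    by (simp add: group_hom_def group_hom_axioms_def Y.group_axioms A.group_axioms)
  show "subgroup B A" unfolding B_def by (rule \<rho>.img_is_subgroup)
  let ?D = "{f \<in> carrier (circle_group Z). nullhomotopic Y (\<lambda>y. f (j y))}"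
  have "subgroup ?D (circle_group Z)"
  proof (rule Z.subgroupI)
    have "(\<lambda>x. 1) \<in> ?D" by (simp add: carrier_circle_group nullhomotopic_one)
    then show "?D \<noteq> {}" by blast
  qed (auto simp: inv_circle_group nullhomotopic_cnj nullhomotopic_mult circle_group_cnj_closed circle_group_mult_closed)
  then show "subgroup D A" unfolding D_def by (rule \<phi>.subgroup_img_is_subgroup)
  show "B \<subseteq> \<phi> ` carrier (circle_group Z)" unfolding B_def using rc by blast
  show "D \<subseteq> \<phi> ` carrier (circle_group Z)" unfolding D_def by blast
  show "B \<inter> D \<subseteq> {\<one>\<^bsub>A\<^esub>}"
  proof
    fix a assume "a \<in> B \<inter> D"
    then obtain g f where g: "g \<in> carrier (circle_group Y)" "a = \<phi> (\<lambda>z. g (r z))"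
      and f: "f \<in> carrier (circle_group Z)" "nullhomotopic Y (\<lambda>y. f (j y))" "a = \<phi> f"
      by (auto simp: B_def D_def)
    have "\<phi> (\<lambda>z. f z * cnj (g (r z))) = \<phi> f \<otimes>\<^bsub>A\<^esub> inv\<^bsub>A\<^esub> \<phi> (\<lambda>z. g (r z))"
      using \<phi>.hom_mult[OF f(1) circle_group_cnj_closed[OF rc[OF g(1)]]] \<phi>.hom_inv[OF rc[OF g(1)]]
      by (simp add: inv_circle_group[OF rc[OF g(1)]])
    also have "\<dots> = \<one>\<^bsub>A\<^esub>" using f g rc[OF g(1)] by (metis A.r_inv \<phi>.hom_closed)
    finally have "nullhomotopic Z (\<lambda>z. f z * cnj (g (r z)))"
      using ker[OF circle_group_mult_closed[OF f(1) circle_group_cnj_closed[OF rc[OF g(1)]]]] by simp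
    from nullhomotopic_compose[OF this j] have 1: "nullhomotopic Y (\<lambda>y. f (j y) * cnj (g (r (j y))))" .
    have "nullhomotopic Y (\<lambda>y. f (j y) * cnj (f (j y) * cnj (g (r (j y)))))"
      by (rule nullhomotopic_mult[OF f(2) nullhomotopic_cnj[OF 1]])
    then have gn: "nullhomotopic Y g"
    proof (rule nullhomotopic_cong)
      fix y assume y: "y \<in> topspace Y"
      have "f (j y) * cnj (f (j y)) = 1" using circle_group_cnj_mult[OF f(1)] by (simp add: mult.commute)
      then have "f (j y) * (cnj (f (j y)) * g y) = g y" by (simp add: mult.assoc[symmetric])
      then show "f (j y) * cnj (f (j y) * cnj (g (r (j y)))) = g y" using rj[OF y] by simp
    qed
    have "nullhomotopic Z (\<lambda>z. g (r z))" by (rule nullhomotopic_compose[OF gn r])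
    then show "a \<in> {\<one>\<^bsub>A\<^esub>}" using ker[OF rc[OF g(1)]] g(2) by simp
  qed
  fix a assume "a \<in> \<phi> ` carrier (circle_group Z)"
  then obtain f where f: "f \<in> carrier (circle_group Z)" "a = \<phi> f" by blast
  define g where "g = (\<lambda>y. f (j y))"
  have g: "g \<in> carrier (circle_group Y)" unfolding g_def by (rule jc[OF f(1)])
  define d where "d = (\<lambda>z. cnj (g (r z)) * f z)"
  have d: "d \<in> carrier (circle_group Z)"
    unfolding d_def by (rule circle_group_mult_closed[OF circle_group_cnj_closed[OF rc[OF g]] f(1)])
  have "nullhomotopic Y (\<lambda>y. d (j y))"
    by (rule nullhomotopic_cong[OF nullhomotopic_one])
      (use circle_group_cnj_mult[OF f(1)] in \<open>simp add: d_def g_def rj\<close>)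
  then have "\<phi> d \<in> D" using d by (auto simp: D_def)
  moreover have "\<phi> (\<lambda>z. g (r z)) \<in> B" using g by (auto simp: B_def)
  moreover have "a = \<phi> (\<lambda>z. g (r z)) \<otimes>\<^bsub>A\<^esub> \<phi> d"
  proof -
    have "(\<lambda>z. g (r z) * d z) = f"
    proof
      fix z
      have "g (r z) * cnj (g (r z)) = 1" using circle_group_cnj_mult[OF g] by (simp add: mult.commute)
      then show "g (r z) * d z = f z" by (simp add: d_def mult.assoc[symmetric])
    qed
    then show ?thesis using \<phi>.hom_mult[OF rc[OF g] d] f(2) by simp
  qed
  ultimately show "\<exists>b\<in>B. \<exists>d\<in>D. a = b \<otimes>\<^bsub>A\<^esub> d" by blast
qed

text \<open>
  The classes that come from stage \<open>c\<close> form a subgroup \<open>A c\<close> of the group of the limit. It is a copy of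
  the group of \<open>K c\<close>, because a logarithm on the limit yields one on a later stage, which the
  retraction's section brings back to \<open>c\<close>. At limit stages \<open>A c\<close> is the union of its predecessors.
  At a successor of \<open>a\<close>, the retraction splits \<open>A c\<close> into \<open>A a\<close> and a complement, and the
  complement is a summand of a group that is decomposable by hypothesis.
\<close>

lemma bruschlinsky_retractive_limit:
  fixes s :: "'i rel" and X :: "'x topology" and K :: "'i \<Rightarrow> 'u topology"
  assumes retr: "retractive_inverse_sequence s K p"
    and dec: "\<And>a. a \<in> Field s \<Longrightarrow> countably_decomposable (bruschlinsky (K a)) (carrier (bruschlinsky (K a)))"
    and lim: "is_inverse_limit s (Field s) K p X q"
  shows "countably_decomposable (bruschlinsky X) (carrier (bruschlinsky X))"
proof (cases "Field s = {}")
  case True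
  interpret H: comm_group "bruschlinsky X" by (rule comm_group_bruschlinsky)
  \<comment> \<open>The limit of the empty sequence has at most one point, so every map on it has a logarithm.\<close>
  have inj: "inj_on (\<lambda>x. \<lambda>a\<in>Field s. q a x) (topspace X)"
    using lim homeomorphic_imp_injective_map unfolding is_inverse_limit_def by blast
  have single: "x = y" if "x \<in> topspace X" "y \<in> topspace X" for x y
    by (rule inj_onD[OF inj _ that]) (simp add: True restrict_def)
  have "nullhomotopic X f" if f: "f \<in> carrier (circle_group X)" for f
  proof (cases "topspace X = {}")
    case True
    then show ?thesis by (intro nullhomotopic_cong[OF nullhomotopic_one]) simp
  next
    case False
    then obtain x0 where x0: "x0 \<in> topspace X" by blast
    show ?thesis
      unfolding nullhomotopic_def
      using f single[OF _ x0] by (intro exI[of _ "\<lambda>x. Im (Ln (f x0))"]) (auto simp: cis_Im_Ln carrier_circle_group)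
  qed
  then have "carrier (bruschlinsky X) \<subseteq> {\<one>\<^bsub>bruschlinsky X\<^esub>}"
    unfolding carrier_bruschlinsky using homotopy_class_one_iff by blast
  then have "countable (carrier (bruschlinsky X))" by (meson countable_empty countable_insert countable_subset)
  then show ?thesis by (rule countably_decomposable_countable[OF H.group_axioms])
next
  case False
  have cont: "continuous_inverse_sequence s K p" and seq: "inverse_sequence s K p"
    and rm: "\<And>a b. (a, b) \<in> s \<Longrightarrow> retraction_map (K b) (K a) (p a b)"
    using retr by (auto simp: retractive_inverse_sequence_def continuous_inverse_sequence_def)
  have wo: "Well_order s" using seq by (simp add: inverse_sequence_def)
  have section_ex: "\<exists>j. continuous_map (K b) (K a) (p a b) \<and> continuous_map (K a) (K b) j \<and> (\<forall>y\<in>topspace (K a). p a b (j y) = y)"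
    if "(a, b) \<in> s" for a b
    using rm[OF that] unfolding retraction_map_def retraction_maps_def by blast
  have surj: "p a b ` topspace (K b) = topspace (K a)" if "(a, b) \<in> s" for a b
    using rm[OF that] by (rule retraction_imp_surjective_map)
  interpret L: surjective_inverse_limit s "Field s" K p X q
    by unfold_locales (use seq False surj lim in \<open>auto simp: Field_def\<close>)
  interpret H: comm_group "bruschlinsky X" by (rule comm_group_bruschlinsky)
  let ?H = "bruschlinsky X"
  define \<kappa> where "\<kappa> = (\<lambda>c f. homotopy_class X (\<lambda>x. f (q c x)))"
  define A where "A = (\<lambda>c. \<kappa> c ` carrier (circle_group (K c)))"
  have qc: "(\<lambda>x. f (q c x)) \<in> carrier (circle_group X)" if "c \<in> Field s" "f \<in> carrier (circle_group (K c))" for c f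
    by (rule circle_group_compose[OF that(2) L.q_cont[OF that(1)]])
  have \<kappa>hom: "\<kappa> c \<in> hom (circle_group (K c)) ?H" if c: "c \<in> Field s" for c
  proof (rule homI)
    fix f assume f: "f \<in> carrier (circle_group (K c))"
    show "\<kappa> c f \<in> carrier ?H" using qc[OF c f] by (simp add: \<kappa>_def carrier_bruschlinsky)
    fix g assume g: "g \<in> carrier (circle_group (K c))"
    show "\<kappa> c (f \<otimes>\<^bsub>circle_group (K c)\<^esub> g) = \<kappa> c f \<otimes>\<^bsub>?H\<^esub> \<kappa> c g"
      using homotopy_class_mult[OF qc[OF c f] qc[OF c g]] by (simp add: \<kappa>_def)
  qed
  have \<kappa>ker: "\<kappa> c f = \<one>\<^bsub>?H\<^esub> \<longleftrightarrow> nullhomotopic (K c) f" if c: "c \<in> Field s" and f: "f \<in> carrier (circle_group (K c))" for c f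
  proof -
    have "\<kappa> c f = \<one>\<^bsub>?H\<^esub> \<longleftrightarrow> nullhomotopic X (\<lambda>x. f (q c x))"
      unfolding \<kappa>_def by (rule homotopy_class_one_iff[OF qc[OF c f]])
    also have "\<dots> \<longleftrightarrow> nullhomotopic (K c) f"
    proof
      assume "nullhomotopic X (\<lambda>x. f (q c x))"
      then obtain b where b: "b \<in> Field s" "(c, b) \<in> s" "nullhomotopic (K b) (\<lambda>x. f (p c b x))"
        using L.null_at_stage[OF c f] by blast
      obtain j where "continuous_map (K b) (K c) (p c b)" "continuous_map (K c) (K b) j" "\<forall>y\<in>topspace (K c). p c b (j y) = y"
        using section_ex[OF b(2)] by blast
      then show "nullhomotopic (K c) f" using nullhomotopic_of_section[of "K b" "K c" "p c b" j f] b(3) by blast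
    next
      assume "nullhomotopic (K c) f"
      then show "nullhomotopic X (\<lambda>x. f (q c x))" by (rule nullhomotopic_compose[OF _ L.q_cont[OF c]])
    qed
    finally show ?thesis .
  qed
  have grp: "group (circle_group Z)" for Z :: "'z topology"
    using comm_group_circle_group[of Z] by (simp add: comm_group_def)
  have sgA: "subgroup (A c) ?H" if c: "c \<in> Field s" for c
  proof -
    interpret group_hom "circle_group (K c)" ?H "\<kappa> c"
      using \<kappa>hom[OF c] grp[of "K c"] H.group_axioms by (simp add: group_hom_def group_hom_axioms_def)
    show ?thesis unfolding A_def by (rule img_is_subgroup)
  qed
  have decA: "countably_decomposable ?H (A c)" if c: "c \<in> Field s" for c
    unfolding A_def
  proof (rule countably_decomposable_transfer)
    show "group (bruschlinsky (K c))" using comm_group_bruschlinsky[of "K c"] by (simp add: comm_group_def)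
    show "homotopy_class (K c) \<in> hom (circle_group (K c)) (bruschlinsky (K c))" by (rule homotopy_class_hom)
    show "countably_decomposable (bruschlinsky (K c)) (homotopy_class (K c) ` carrier (circle_group (K c)))"
      using dec[OF c] by (simp only: carrier_bruschlinsky)
  qed (use grp H.group_axioms \<kappa>hom[OF c] homotopy_class_one_iff \<kappa>ker[OF c] in auto)
  have pull: "\<kappa> a g = \<kappa> b (\<lambda>x. g (p a b x)) \<and> (\<lambda>x. g (p a b x)) \<in> carrier (circle_group (K b))"
    if ab: "(a, b) \<in> s" and g: "g \<in> carrier (circle_group (K a))" for a b g
  proof -
    have F: "a \<in> Field s" "b \<in> Field s" using ab by (auto simp: Field_def)
    have g': "(\<lambda>x. g (p a b x)) \<in> carrier (circle_group (K b))" by (rule circle_group_compose[OF g L.bond[OF ab]])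
    have "\<kappa> a g = \<kappa> b (\<lambda>x. g (p a b x))"
      unfolding \<kappa>_def
      by (rule homotopy_class_cong[OF qc[OF F(1) g] qc[OF F(2) g']]) (simp add: L.q_coherent[OF F(2) ab])
    with g' show ?thesis by blast
  qed
  have mono: "A a \<subseteq> A b" if "(a, b) \<in> s" for a b
    unfolding A_def using pull[OF that] by blast
  have "\<exists>\<D>. (\<forall>D\<in>\<D>. subgroup D ?H \<and> countable D) \<and> independent_family ?H \<D> \<and> \<Union>\<D> \<subseteq> A c \<and>
      generate ?H (\<Union>a\<in>underS s c. A a) \<inter> generate ?H (\<Union>\<D>) \<subseteq> {\<one>\<^bsub>?H\<^esub>} \<and>
      A c \<subseteq> generate ?H ((\<Union>a\<in>underS s c. A a) \<union> \<Union>\<D>)"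
    if c: "c \<in> Field s" for c
  proof -
    have fldS: "a \<in> Field s" "(a, c) \<in> s" if "a \<in> underS s c" for a using that by (auto simp: underS_def Field_def)
    have union_dec: "\<Union>\<D> \<subseteq> Y" if "Y = generate ?H (\<Union>\<D>)" for \<D> Y
      unfolding that by (rule subsetI) (rule generate.incl)
    consider "underS s c = {}" | "limit_element s c" | a where "a \<in> underS s c" "\<And>b. b \<in> underS s c \<Longrightarrow> (b, a) \<in> s"
    proof (cases "underS s c = {} \<or> limit_element s c")
      case False
      then obtain a where a: "a \<in> underS s c" "\<forall>b\<in>underS s c. a \<notin> underS s b"
        using c unfolding limit_element_def by blast
      have "(b, a) \<in> s" if b: "b \<in> underS s c" for b
      proof (cases "a = b")
        case True
        then show ?thesis using L.rel_refl[OF fldS(1)[OF b]] by simp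
      next
        case False
        then show ?thesis using L.rel_total[OF fldS(1)[OF a(1)] fldS(1)[OF b]] a(2) b by (auto simp: underS_def)
      qed
      with a(1) show ?thesis using that by blast
    qed (use that in blast)
    then show ?thesis
    proof cases
      case 1
      obtain \<D> where D: "\<forall>D\<in>\<D>. subgroup D ?H \<and> countable D" "independent_family ?H \<D>" "A c = generate ?H (\<Union>\<D>)"
        using decA[OF c] unfolding countably_decomposable_def by (elim exE conjE)
      show ?thesis
      proof (intro exI[of _ \<D>] conjI D(1,2))
        show "\<Union>\<D> \<subseteq> A c" by (rule union_dec[OF D(3)])
        show "generate ?H (\<Union>a\<in>underS s c. A a) \<inter> generate ?H (\<Union>\<D>) \<subseteq> {\<one>\<^bsub>?H\<^esub>}"
          using 1 H.generate_empty_subset by auto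
        show "A c \<subseteq> generate ?H ((\<Union>a\<in>underS s c. A a) \<union> \<Union>\<D>)" using 1 D(3) by simp
      qed
    next
      case 2
      then have "is_inverse_limit s (underS s c) K p (K c) (\<lambda>a. p a c)"
        using cont by (simp add: continuous_inverse_sequence_def)
      moreover have "underS s c \<noteq> {}" using 2 by (simp add: limit_element_def)
      moreover have "a \<in> underS s c" if "(a, b) \<in> s" "b \<in> underS s c" for a b
      proof -
        have "antisym s" using wo by (simp add: order_on_defs)
        then show ?thesis using that L.rel_trans[of a b c] by (auto simp: underS_def dest: antisymD)
      qed
      ultimately interpret M: surjective_inverse_limit s "underS s c" K p "K c" "\<lambda>a. p a c"
        by unfold_locales (use seq surj fldS in blast)+
      have "A c \<subseteq> (\<Union>a\<in>underS s c. A a)"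
      proof
        fix y assume "y \<in> A c"
        then obtain f where f: "f \<in> carrier (circle_group (K c))" "y = \<kappa> c f" by (auto simp: A_def)
        obtain a g where ag: "a \<in> underS s c" "g \<in> carrier (circle_group (K a))"
          "homotopy_class (K c) f = homotopy_class (K c) (\<lambda>x. g (p a c x))"
          using M.class_from_stage[OF f(1)] by blast
        note pl = pull[OF fldS(2)[OF ag(1)] ag(2)]
        have nl: "nullhomotopic (K c) (\<lambda>x. f x * cnj (g (p a c x)))"
          using homotopy_class_eq_iff[OF f(1) conjunct2[OF pl]] ag(3) by simp
        have "nullhomotopic X (\<lambda>x. f (q c x) * cnj (g (p a c (q c x))))"
          by (rule nullhomotopic_compose[OF nl L.q_cont[OF c]])
        then have "\<kappa> c f = \<kappa> c (\<lambda>x. g (p a c x))"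
          unfolding \<kappa>_def using homotopy_class_eq_iff[OF qc[OF c f(1)] qc[OF c conjunct2[OF pl]]] by simp
        then have "y = \<kappa> a g" using pl f(2) by simp
        then show "y \<in> (\<Union>a\<in>underS s c. A a)" using ag(1,2) by (auto simp: A_def)
      qed
      then have "A c \<subseteq> generate ?H (\<Union>a\<in>underS s c. A a)" by (meson generate.incl subset_iff)
      then show ?thesis
        using H.generate_empty_subset by (intro exI[of _ "{}"]) (auto simp: independent_family_def)
    next
      case (3 a)
      note ac = fldS(2)[OF 3(1)] and aF = fldS(1)[OF 3(1)]
      obtain j where j: "continuous_map (K c) (K a) (p a c)" "continuous_map (K a) (K c) j" "\<And>y. y \<in> topspace (K a) \<Longrightarrow> p a c (j y) = y"
        using section_ex[OF ac] by blast
      define D where "D = \<kappa> c ` {f \<in> carrier (circle_group (K c)). nullhomotopic (K a) (\<lambda>y. f (j y))}"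
      have Aa: "A a = (\<lambda>g. \<kappa> c (\<lambda>z. g (p a c z))) ` carrier (circle_group (K a))"
        unfolding A_def using pull[OF ac] by (intro image_cong refl) blast
      have Ac: "A c = \<kappa> c ` carrier (circle_group (K c))" by (simp add: A_def)
      have spl: "subgroup (A a) ?H" "subgroup D ?H" "A a \<inter> D \<subseteq> {\<one>\<^bsub>?H\<^esub>}" "D \<subseteq> A c"
        "\<And>x. x \<in> A c \<Longrightarrow> \<exists>b\<in>A a. \<exists>d\<in>D. x = b \<otimes>\<^bsub>?H\<^esub> d"
        using retraction_splits[OF comm_group_bruschlinsky \<kappa>hom[OF c] \<kappa>ker[OF c] j] unfolding Aa[symmetric] D_def[symmetric] Ac[symmetric] by simp_all
      have "countably_decomposable ?H D"
      proof (rule H.countably_decomposable_summand[OF decA[OF c] spl(2,4,1)])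
        show "D \<inter> A a \<subseteq> {\<one>\<^bsub>?H\<^esub>}" using spl(3) by blast
        fix x assume "x \<in> A c"
        then obtain b d where "b \<in> A a" "d \<in> D" "x = b \<otimes>\<^bsub>?H\<^esub> d" using spl(5) by blast
        moreover from this have "b \<otimes>\<^bsub>?H\<^esub> d = d \<otimes>\<^bsub>?H\<^esub> b"
          using spl(1,2) by (intro H.m_comm) (auto dest: subgroup.mem_carrier)
        ultimately show "\<exists>d\<in>D. \<exists>b\<in>A a. x = d \<otimes>\<^bsub>?H\<^esub> b" by metis
      qed
      then obtain \<D> where D: "\<forall>D\<in>\<D>. subgroup D ?H \<and> countable D" "independent_family ?H \<D>" "D = generate ?H (\<Union>\<D>)"
        unfolding countably_decomposable_def by (elim exE conjE)
      have un: "(\<Union>b\<in>underS s c. A b) = A a" using 3 mono by blast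
      have DD: "\<Union>\<D> \<subseteq> D" by (rule union_dec[OF D(3)])
      have gA: "generate ?H (A a) = A a"
        using H.generate_subgroup_incl[OF subset_refl spl(1)] generate.incl[of _ "A a" ?H] by blast
      show ?thesis
      proof (intro exI[of _ \<D>] conjI D(1,2))
        show "\<Union>\<D> \<subseteq> A c" using DD spl(4) by blast
        show "generate ?H (\<Union>a\<in>underS s c. A a) \<inter> generate ?H (\<Union>\<D>) \<subseteq> {\<one>\<^bsub>?H\<^esub>}"
          unfolding un gA D(3)[symmetric] by (rule spl(3))
        show "A c \<subseteq> generate ?H ((\<Union>a\<in>underS s c. A a) \<union> \<Union>\<D>)"
        proof
          fix x assume "x \<in> A c"
          then obtain b d where bd: "b \<in> A a" "d \<in> D" "x = b \<otimes>\<^bsub>?H\<^esub> d" using spl(5) by blast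
          have "b \<in> generate ?H (A a)" using bd(1) by (rule generate.incl)
          moreover have "d \<in> generate ?H (\<Union>\<D>)" using bd(2) D(3) by simp
          moreover have "A a \<subseteq> carrier ?H" by (rule subgroup.subset[OF spl(1)])
          moreover have "\<Union>\<D> \<subseteq> carrier ?H" using DD subgroup.subset[OF spl(2)] by (rule subset_trans)
          ultimately show "x \<in> generate ?H ((\<Union>a\<in>underS s c. A a) \<union> \<Union>\<D>)"
            unfolding un using H.generate_Un[of "A a" "\<Union>\<D>" x] bd(3) by blast
        qed
      qed
    qed
  qed
  then obtain \<D> where D: "\<And>c. c \<in> Field s \<Longrightarrow> (\<forall>D\<in>\<D> c. subgroup D ?H \<and> countable D)"
      "\<And>c. c \<in> Field s \<Longrightarrow> independent_family ?H (\<D> c)"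
      "\<And>c. c \<in> Field s \<Longrightarrow> \<Union>(\<D> c) \<subseteq> A c"
      "\<And>c. c \<in> Field s \<Longrightarrow> generate ?H (\<Union>a\<in>underS s c. A a) \<inter> generate ?H (\<Union>(\<D> c)) \<subseteq> {\<one>\<^bsub>?H\<^esub>}"
      "\<And>c. c \<in> Field s \<Longrightarrow> A c \<subseteq> generate ?H ((\<Union>a\<in>underS s c. A a) \<union> \<Union>(\<D> c))"
    by metis
  note fd = H.filtration_decomposition[OF wo sgA mono D(3,2,4,5)]
  have "generate ?H (\<Union>c\<in>Field s. A c) = carrier ?H"
  proof
    show "generate ?H (\<Union>c\<in>Field s. A c) \<subseteq> carrier ?H"
      by (rule H.generate_incl) (use sgA subgroup.subset in blast)
    show "carrier ?H \<subseteq> generate ?H (\<Union>c\<in>Field s. A c)"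
    proof
      fix y assume "y \<in> carrier ?H"
      then obtain f where f: "f \<in> carrier (circle_group X)" "y = homotopy_class X f" by (auto simp: carrier_bruschlinsky)
      obtain a g where "a \<in> Field s" "g \<in> carrier (circle_group (K a))" "homotopy_class X f = homotopy_class X (\<lambda>x. g (q a x))"
        using L.class_from_stage[OF f(1)] by blast
      then have "y \<in> (\<Union>c\<in>Field s. A c)" using f(2) by (auto simp: A_def \<kappa>_def)
      then show "y \<in> generate ?H (\<Union>c\<in>Field s. A c)" by (rule generate.incl)
    qed
  qed
  with fd show ?thesis
    unfolding countably_decomposable_def using D(1) by (intro exI[of _ "\<Union>c\<in>Field s. \<D> c"]) auto
qed

theorem class_R_bruschlinsky:
  assumes "class_R ty X"
  shows "countably_decomposable (bruschlinsky X) (carrier (bruschlinsky X))"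
  using assms
proof induction
  case (metrizable X)
  have "group (bruschlinsky X)" using comm_group_bruschlinsky[of X] by (simp add: comm_group_def)
  then show ?case
    by (rule countably_decomposable_countable) (rule countable_bruschlinsky_metrizable[OF metrizable])
next
  case (limit s K p X q)
  then show ?case by (intro bruschlinsky_retractive_limit[of s K p X q])
qed

context compact_abelian_group
begin

definition dual :: "('a \<Rightarrow> complex) monoid" where
  "dual = \<lparr>carrier = characters, mult = (\<lambda>\<xi> \<zeta> x. \<xi> x * \<zeta> x), one = (\<lambda>x. 1)\<rparr>"

lemma dual_simps [simp]: "carrier dual = characters" "\<xi> \<otimes>\<^bsub>dual\<^esub> \<zeta> = (\<lambda>x. \<xi> x * \<zeta> x)" "\<one>\<^bsub>dual\<^esub> = (\<lambda>x. 1)"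
  by (simp_all add: dual_def)

lemma character_cnj_mult: "\<xi> \<in> characters \<Longrightarrow> cnj (\<xi> x) * \<xi> x = 1"
  using complex_norm_square[of "\<xi> x"] by (simp add: character_norm mult.commute)

lemma comm_group_dual: "comm_group dual"
proof (rule comm_groupI)
  fix \<xi> assume "\<xi> \<in> carrier dual"
  then show "\<exists>\<zeta>\<in>carrier dual. \<zeta> \<otimes>\<^bsub>dual\<^esub> \<xi> = \<one>\<^bsub>dual\<^esub>"
    by (intro bexI[of _ "\<lambda>x. cnj (\<xi> x)"]) (auto simp: characters_closed_cnj character_cnj_mult)
qed (auto simp: characters_one characters_closed_mult mult_ac)

lemma inv_dual: "\<xi> \<in> characters \<Longrightarrow> inv\<^bsub>dual\<^esub> \<xi> = (\<lambda>x. cnj (\<xi> x))"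
proof -
  interpret D: comm_group dual by (rule comm_group_dual)
  assume "\<xi> \<in> characters"
  then show ?thesis by (intro D.inv_equality) (auto simp: characters_closed_cnj character_cnj_mult)
qed

text \<open>
  Pulling characters back along \<open>r\<close> embeds the dual into the Bruschlinsky group of \<open>X\<close>. The image
  consists of all classes pulled back from \<open>T\<close>, since each is represented by a character, and is
  therefore a direct summand.
\<close>

theorem dual_countably_decomposable:
  assumes conn: "connected_space T" and X: "class_R ty X" and retr: "retraction_map X T r"
  shows "countably_decomposable dual (carrier dual)"
proof -
  interpret H: comm_group "bruschlinsky X" by (rule comm_group_bruschlinsky)
  interpret D: comm_group dual by (rule comm_group_dual)
  obtain j where r: "continuous_map X T r" and j: "continuous_map T X j" and rj: "\<And>y. y \<in> topspace T \<Longrightarrow> r (j y) = y"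
    using retr unfolding retraction_map_def retraction_maps_def by blast
  let ?H = "bruschlinsky X"
  define B where "B = (\<lambda>g. homotopy_class X (\<lambda>z. g (r z))) ` carrier (circle_group T)"
  define E where "E = homotopy_class X ` {f \<in> carrier (circle_group X). nullhomotopic T (\<lambda>y. f (j y))}"
  note sp = retraction_splits[OF comm_group_bruschlinsky homotopy_class_hom homotopy_class_one_iff r j rj, folded B_def E_def carrier_bruschlinsky]
  have decB: "countably_decomposable ?H B"
    by (rule H.countably_decomposable_summand[OF class_R_bruschlinsky[OF X] sp(1,4,2,3,6)])
  have ch: "\<xi> \<in> carrier (circle_group T)" if "\<xi> \<in> characters" for \<xi>
    using that by (simp add: carrier_circle_group character_continuous character_norm)
  define \<beta> where "\<beta> = (\<lambda>\<xi>. homotopy_class X (\<lambda>z. \<xi> (r z)))"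
  have rc: "(\<lambda>z. g (r z)) \<in> carrier (circle_group X)" if "g \<in> carrier (circle_group T)" for g
    by (rule circle_group_compose[OF that r])
  have \<beta>: "\<beta> \<in> hom dual ?H"
  proof (rule homI)
    fix \<xi> assume "\<xi> \<in> carrier dual"
    then have \<xi>: "(\<lambda>z. \<xi> (r z)) \<in> carrier (circle_group X)" using rc ch by simp
    then show "\<beta> \<xi> \<in> carrier ?H" by (simp add: \<beta>_def carrier_bruschlinsky)
    fix \<zeta> assume "\<zeta> \<in> carrier dual"
    then have "(\<lambda>z. \<zeta> (r z)) \<in> carrier (circle_group X)" using rc ch by simp
    then show "\<beta> (\<xi> \<otimes>\<^bsub>dual\<^esub> \<zeta>) = \<beta> \<xi> \<otimes>\<^bsub>?H\<^esub> \<beta> \<zeta>"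
      using homotopy_class_mult[OF \<xi>] by (simp add: \<beta>_def)
  qed
  have img: "\<beta> ` carrier dual = B"
  proof
    show "\<beta> ` carrier dual \<subseteq> B" using ch by (auto simp: \<beta>_def B_def)
    show "B \<subseteq> \<beta> ` carrier dual"
    proof
      fix y assume "y \<in> B"
      then obtain g where g: "g \<in> carrier (circle_group T)" "y = homotopy_class X (\<lambda>z. g (r z))" by (auto simp: B_def)
      then obtain \<xi> where \<xi>: "\<xi> \<in> characters" "nullhomotopic T (\<lambda>x. g x * cnj (\<xi> x))"
        using homotopic_to_character[OF conn, of g] by (auto simp: carrier_circle_group)
      have "nullhomotopic X (\<lambda>z. g (r z) * cnj (\<xi> (r z)))" by (rule nullhomotopic_compose[OF \<xi>(2) r])
      then have "y = \<beta> \<xi>" using homotopy_class_eq_iff[OF rc[OF g(1)] rc[OF ch[OF \<xi>(1)]]] g(2) by (simp add: \<beta>_def)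
      then show "y \<in> \<beta> ` carrier dual" using \<xi>(1) by auto
    qed
  qed
  have "countably_decomposable dual (id ` carrier dual)"
  proof (rule countably_decomposable_transfer[OF D.group_axioms H.group_axioms D.group_axioms \<beta>])
    show "countably_decomposable ?H (\<beta> ` carrier dual)" unfolding img by (rule decB)
    show "id \<in> hom dual dual" by (rule homI) auto
    fix \<xi> assume "\<xi> \<in> carrier dual"
    then have \<xi>: "\<xi> \<in> characters" by simp
    show "\<beta> \<xi> = \<one>\<^bsub>?H\<^esub> \<longleftrightarrow> id \<xi> = \<one>\<^bsub>dual\<^esub>"
    proof
      assume "\<beta> \<xi> = \<one>\<^bsub>?H\<^esub>"
      then have null: "nullhomotopic X (\<lambda>z. \<xi> (r z))" using homotopy_class_one_iff[OF rc[OF ch[OF \<xi>]]] by (simp add: \<beta>_def)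
      have "nullhomotopic T \<xi>"
        by (rule nullhomotopic_of_section[where g = \<xi>, OF r j _ null]) (rule rj)
      then show "id \<xi> = \<one>\<^bsub>dual\<^esub>" using nullhomotopic_character[OF conn \<xi>] by simp
    next
      assume "id \<xi> = \<one>\<^bsub>dual\<^esub>"
      then show "\<beta> \<xi> = \<one>\<^bsub>?H\<^esub>"
        using homotopy_class_one_iff[OF rc[OF ch[OF \<xi>]]] nullhomotopic_one by (simp add: \<beta>_def)
    qed
  qed
  then show ?thesis by simp
qed

end

section \<open>From the dual back to the group\<close>

context compact_abelian_group
begin

lemma topological_group_closed_subgroup:
  assumes N: "subgroup N G" and cl: "closedin T N"
  shows "topological_group (G\<lparr>carrier := N\<rparr>) (subtopology T N)" "compact_space (subtopology T N)"
proof -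
  have sub: "N \<subseteq> carrier G" by (rule subgroup.subset[OF N])
  have top: "topspace (subtopology T N) = N" using sub by (simp add: topspace_subtopology Int_absorb1)
  interpret N: group "G\<lparr>carrier := N\<rparr>" by (rule subgroup_imp_group[OF N])
  have incl: "continuous_map (subtopology T N) T (\<lambda>x. x)"
    by (rule continuous_map_from_subtopology) simp
  show "topological_group (G\<lparr>carrier := N\<rparr>) (subtopology T N)"
  proof
    show "topspace (subtopology T N) = carrier (G\<lparr>carrier := N\<rparr>)" using top by simp
    show "Hausdorff_space (subtopology T N)" by (rule Hausdorff_space_subtopology[OF Hausdorff])
    let ?NN = "prod_topology (subtopology T N) (subtopology T N)"
    have "continuous_map ?NN T (\<lambda>p. fst p \<otimes> snd p)"
      by (intro continuous_map_mult continuous_map_compose[OF continuous_map_fst incl, unfolded o_def]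
          continuous_map_compose[OF continuous_map_snd incl, unfolded o_def])
    then have "continuous_map ?NN (subtopology T N) (\<lambda>p. fst p \<otimes> snd p)"
      using top subgroup.m_closed[OF N] by (auto simp: continuous_map_in_subtopology)
    then show "continuous_map ?NN (subtopology T N) (\<lambda>(x, y). x \<otimes>\<^bsub>G\<lparr>carrier := N\<rparr>\<^esub> y)"
      by (simp add: case_prod_unfold)
    have "continuous_map (subtopology T N) (subtopology T N) (\<lambda>x. inv x)"
      using continuous_map_inverse[OF incl] top subgroup.m_inv_closed[OF N]
      by (auto simp: continuous_map_in_subtopology)
    then show "continuous_map (subtopology T N) (subtopology T N) (\<lambda>x. inv\<^bsub>G\<lparr>carrier := N\<rparr>\<^esub> x)"
      by (rule continuous_map_eq) (simp add: top m_inv_consistent[OF N])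
  qed
  show "compact_space (subtopology T N)"
    using closedin_compact_space[OF compact cl] by (simp add: compact_space_subtopology)
qed

lemma character_one: "\<xi> \<in> characters \<Longrightarrow> \<xi> \<one> = 1"
proof -
  assume \<xi>: "\<xi> \<in> characters"
  have "\<xi> \<one> * \<xi> \<one> = \<xi> \<one>" using character_mult[OF \<xi>, of \<one> \<one>] by simp
  then show ?thesis using character_norm[OF \<xi>, of \<one>] by auto
qed

lemma character_inv: "\<xi> \<in> characters \<Longrightarrow> x \<in> carrier G \<Longrightarrow> \<xi> (inv x) = cnj (\<xi> x)"
proof -
  assume \<xi>: "\<xi> \<in> characters" and x: "x \<in> carrier G"
  have "\<xi> (inv x) * \<xi> x = 1" using character_mult[OF \<xi>, of "inv x" x] x character_one[OF \<xi>] by simp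
  also have "1 = cnj (\<xi> x) * \<xi> x" using character_cnj_mult[OF \<xi>] by simp
  finally have "\<xi> (inv x) * \<xi> x = cnj (\<xi> x) * \<xi> x" .
  moreover have "\<xi> x \<noteq> 0" using character_norm[OF \<xi>, of x] by auto
  ultimately show ?thesis by simp
qed

lemma eq_if_characters_agree:
  assumes x: "x \<in> carrier G" and y: "y \<in> carrier G" and eq: "\<And>\<xi>. \<xi> \<in> characters \<Longrightarrow> \<xi> x = \<xi> y"
  shows "x = y"
proof (rule ccontr)
  assume "x \<noteq> y"
  then have "x \<otimes> inv y \<noteq> \<one>" using x y by (simp add: inv_solve_right')
  then obtain \<xi> where \<xi>: "\<xi> \<in> characters" "\<xi> (x \<otimes> inv y) \<noteq> 1"
    using characters_separate[of "x \<otimes> inv y"] x y by auto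
  then show False
    using character_mult[OF \<xi>(1) x inv_closed[OF y]] character_inv[OF \<xi>(1) y] eq[OF \<xi>(1)]
      character_cnj_mult[OF \<xi>(1), of y] by (simp add: mult.commute)
qed

lemma agree_on_generated:
  assumes x: "x \<in> carrier G" and y: "y \<in> carrier G" and S: "S \<subseteq> characters"
    and eq: "\<And>\<xi>. \<xi> \<in> S \<Longrightarrow> \<xi> x = \<xi> y" and \<zeta>: "\<zeta> \<in> generate dual S"
  shows "\<zeta> x = \<zeta> y"
  using \<zeta>
proof induction
  case (inv \<xi>)
  then show ?case using S eq inv_dual[of \<xi>] by auto
qed (use eq in auto)

definition annihilator :: "('a \<Rightarrow> complex) set \<Rightarrow> 'a set" where
  "annihilator E = {x \<in> carrier G. \<forall>\<xi>\<in>E. \<xi> x = 1}"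

lemma subgroup_annihilator:
  assumes "E \<subseteq> characters"
  shows "subgroup (annihilator E) G"
proof (rule subgroupI)
  have "\<one> \<in> annihilator E" using character_one assms by (auto simp: annihilator_def)
  then show "annihilator E \<noteq> {}" by blast
qed (use assms in \<open>auto simp: annihilator_def character_inv character_mult subset_iff\<close>)

lemma closedin_character_values:
  assumes "E \<subseteq> characters"
  shows "closedin T {x \<in> carrier G. \<forall>\<xi>\<in>E. \<xi> x = c \<xi>}"
proof -
  have "closedin T {x \<in> topspace T. \<xi> x \<in> {c \<xi>}}" if "\<xi> \<in> E" for \<xi>
  proof (rule closedin_continuous_map_preimage)
    show "continuous_map T euclidean \<xi>" using that assms character_continuous by blast
    show "closedin euclidean {c \<xi>}" by (simp add: closed_closedin[symmetric])
  qed
  then have "closedin T (\<Inter>(insert (topspace T) ((\<lambda>\<xi>. {x \<in> topspace T. \<xi> x \<in> {c \<xi>}}) ` E)))"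
    by (intro closedin_Inter) (auto simp del: topspace_eq_carrier)
  moreover have "\<Inter>(insert (topspace T) ((\<lambda>\<xi>. {x \<in> topspace T. \<xi> x \<in> {c \<xi>}}) ` E))
      = {x \<in> carrier G. \<forall>\<xi>\<in>E. \<xi> x = c \<xi>}"
    by (auto simp: topspace_eq_carrier)
  ultimately show ?thesis by simp
qed

lemma closedin_annihilator: "E \<subseteq> characters \<Longrightarrow> closedin T (annihilator E)"
  unfolding annihilator_def by (rule closedin_character_values[of E "\<lambda>_. 1"])

text \<open>
  A splitting of the dual into \<open>D\<close> and \<open>E\<close> dualizes to a projection of the group onto the annihilator
  of \<open>E\<close>. The point \<open>y\<close> realizes the homomorphism that agrees with evaluation at \<open>x\<close> on \<open>D\<close> and is
  trivial on \<open>E\<close>.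
\<close>

lemma dual_split_projection:
  assumes D: "subgroup D dual" and E: "subgroup E dual" and DE: "D \<inter> E \<subseteq> {\<one>\<^bsub>dual\<^esub>}"
    and gen: "\<And>\<xi>. \<xi> \<in> characters \<Longrightarrow> \<exists>\<delta>\<in>D. \<exists>\<epsilon>\<in>E. \<xi> = \<delta> \<otimes>\<^bsub>dual\<^esub> \<epsilon>" and x: "x \<in> carrier G"
  shows "\<exists>!y. y \<in> annihilator E \<and> (\<forall>\<xi>\<in>D. \<xi> y = \<xi> x)"
proof -
  interpret dual: comm_group dual by (rule comm_group_dual)
  have Dc: "D \<subseteq> characters" and Ec: "E \<subseteq> characters" using D E subgroup.subset by force+
  define \<pi> where "\<pi> = (\<lambda>\<xi>. SOME \<delta>. \<delta> \<in> D \<and> (\<exists>\<epsilon>\<in>E. \<xi> = \<delta> \<otimes>\<^bsub>dual\<^esub> \<epsilon>))"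
  have \<pi>: "\<pi> \<xi> \<in> D \<and> (\<exists>\<epsilon>\<in>E. \<xi> = \<pi> \<xi> \<otimes>\<^bsub>dual\<^esub> \<epsilon>)" if "\<xi> \<in> characters" for \<xi>
  proof -
    have "\<exists>\<delta>. \<delta> \<in> D \<and> (\<exists>\<epsilon>\<in>E. \<xi> = \<delta> \<otimes>\<^bsub>dual\<^esub> \<epsilon>)" using gen[OF that] by blast
    then show ?thesis unfolding \<pi>_def by (rule someI_ex)
  qed
  have \<pi>U: "\<pi> \<xi> = \<delta>" if "\<xi> \<in> characters" "\<delta> \<in> D" "\<epsilon> \<in> E" "\<xi> = \<delta> \<otimes>\<^bsub>dual\<^esub> \<epsilon>" for \<xi> \<delta> \<epsilon>
  proof -
    from \<pi>[OF that(1)] obtain \<epsilon>' where "\<pi> \<xi> \<in> D" "\<epsilon>' \<in> E" "\<xi> = \<pi> \<xi> \<otimes>\<^bsub>dual\<^esub> \<epsilon>'" by blast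
    then show ?thesis
      using dual.mult_cancel_split(1)[OF D E DE _ that(2) _ that(3)] that(4) by metis
  qed
  have \<pi>mult: "\<pi> (\<lambda>z. \<xi> z * \<zeta> z) = (\<lambda>z. \<pi> \<xi> z * \<pi> \<zeta> z)" if "\<xi> \<in> characters" "\<zeta> \<in> characters" for \<xi> \<zeta>
  proof -
    from \<pi>[OF that(1)] obtain \<epsilon> where \<epsilon>: "\<pi> \<xi> \<in> D" "\<epsilon> \<in> E" "\<xi> = \<pi> \<xi> \<otimes>\<^bsub>dual\<^esub> \<epsilon>" by blast
    from \<pi>[OF that(2)] obtain \<epsilon>' where \<epsilon>': "\<pi> \<zeta> \<in> D" "\<epsilon>' \<in> E" "\<zeta> = \<pi> \<zeta> \<otimes>\<^bsub>dual\<^esub> \<epsilon>'" by blast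
    have "\<pi> (\<lambda>z. \<xi> z * \<zeta> z) = \<pi> \<xi> \<otimes>\<^bsub>dual\<^esub> \<pi> \<zeta>"
    proof (rule \<pi>U)
      show "(\<lambda>z. \<xi> z * \<zeta> z) \<in> characters" using that by (rule characters_closed_mult)
      show "\<pi> \<xi> \<otimes>\<^bsub>dual\<^esub> \<pi> \<zeta> \<in> D" "\<epsilon> \<otimes>\<^bsub>dual\<^esub> \<epsilon>' \<in> E"
        using \<epsilon> \<epsilon>' D E subgroup.m_closed by metis+
      have "(\<lambda>z. \<xi> z * \<zeta> z) = (\<lambda>z. (\<pi> \<xi> \<otimes>\<^bsub>dual\<^esub> \<epsilon>) z * (\<pi> \<zeta> \<otimes>\<^bsub>dual\<^esub> \<epsilon>') z)"
        using \<epsilon>(3) \<epsilon>'(3) by simp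
      then show "(\<lambda>z. \<xi> z * \<zeta> z) = \<pi> \<xi> \<otimes>\<^bsub>dual\<^esub> \<pi> \<zeta> \<otimes>\<^bsub>dual\<^esub> (\<epsilon> \<otimes>\<^bsub>dual\<^esub> \<epsilon>')"
        by (simp add: mult_ac)
    qed
    then show ?thesis by simp
  qed
  obtain y where y: "y \<in> carrier G" "\<And>\<xi>. \<xi> \<in> characters \<Longrightarrow> \<xi> y = \<pi> \<xi> x"
  proof (rule character_values_attained[of "\<lambda>\<xi>. \<pi> \<xi> x"])
    show "\<pi> (\<lambda>z. \<xi> z * \<zeta> z) x = \<pi> \<xi> x * \<pi> \<zeta> x" if "\<xi> \<in> characters" "\<zeta> \<in> characters" for \<xi> \<zeta>
      using \<pi>mult[OF that] by simp
    show "cmod (\<pi> \<xi> x) = 1" if "\<xi> \<in> characters" for \<xi>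
      using \<pi>[OF that] Dc by (intro character_norm) blast
  qed blast
  have one: "(\<lambda>z. 1) \<in> D" "(\<lambda>z. 1) \<in> E" using subgroup.one_closed[OF D] subgroup.one_closed[OF E] by simp_all
  have \<pi>D: "\<pi> \<xi> = \<xi>" if "\<xi> \<in> D" for \<xi> by (rule \<pi>U[OF _ that one(2)]) (use that Dc in auto)
  have \<pi>E: "\<pi> \<xi> = (\<lambda>z. 1)" if "\<xi> \<in> E" for \<xi> by (rule \<pi>U[OF _ one(1) that]) (use that Ec in auto)
  have "\<xi> y = \<xi> x" if "\<xi> \<in> D" for \<xi> using y(2)[of \<xi>] \<pi>D[OF that] that Dc by auto
  moreover have "\<xi> y = 1" if "\<xi> \<in> E" for \<xi> using y(2)[of \<xi>] \<pi>E[OF that] that Ec by auto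
  ultimately have ex: "y \<in> annihilator E \<and> (\<forall>\<xi>\<in>D. \<xi> y = \<xi> x)"
    using y(1) by (simp add: annihilator_def)
  have uniq: "z = z'" if z: "z \<in> annihilator E \<and> (\<forall>\<xi>\<in>D. \<xi> z = \<xi> x)" and z': "z' \<in> annihilator E \<and> (\<forall>\<xi>\<in>D. \<xi> z' = \<xi> x)" for z z'
  proof (rule eq_if_characters_agree)
    fix \<xi> assume "\<xi> \<in> characters"
    then obtain \<delta> \<epsilon> where \<delta>: "\<delta> \<in> D" and \<epsilon>: "\<epsilon> \<in> E" and "\<xi> = \<delta> \<otimes>\<^bsub>dual\<^esub> \<epsilon>" using gen by blast
    moreover have "\<delta> z = \<delta> z'" using bspec[OF conjunct2[OF z] \<delta>] bspec[OF conjunct2[OF z'] \<delta>] by simp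
    moreover have "\<epsilon> z = 1" "\<epsilon> z' = 1" using z z' \<epsilon> unfolding annihilator_def by blast+
    ultimately show "\<xi> z = \<xi> z'" by simp
  qed (use z z' in \<open>auto simp: annihilator_def\<close>)
  show ?thesis using ex uniq by blast
qed

text \<open>
  The characters in \<open>D\<close> embed the compact annihilator into a countable product of planes. The topology
  being that of the embedding, continuity of a map into the annihilator can be tested by
  composing it with the characters in \<open>D\<close>.
\<close>

lemma annihilator_embedding:
  assumes D: "D \<subseteq> characters" "countable D" and E: "E \<subseteq> characters"
    and sep: "\<And>x y. x \<in> annihilator E \<Longrightarrow> y \<in> annihilator E \<Longrightarrow> (\<forall>\<xi>\<in>D. \<xi> x = \<xi> y) \<Longrightarrow> x = y"
  shows "metrizable_space (subtopology T (annihilator E))"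
    and "\<And>h. (\<And>x. x \<in> carrier G \<Longrightarrow> h x \<in> annihilator E \<and> (\<forall>\<xi>\<in>D. \<xi> (h x) = \<xi> x)) \<Longrightarrow>
      continuous_map T (subtopology T (annihilator E)) h"
proof -
  let ?N = "annihilator E" and ?P = "product_topology (\<lambda>_::'a \<Rightarrow> complex. euclidean :: complex topology) D"
  let ?S = "subtopology T ?N"
  define e where "e = (\<lambda>x. \<lambda>\<xi>\<in>D. \<xi> x)"
  have sub: "?N \<subseteq> carrier G" by (auto simp: annihilator_def)
  have top: "topspace ?S = ?N" using sub by (simp add: topspace_subtopology Int_absorb1)
  have eT: "continuous_map T ?P e"
    unfolding e_def continuous_map_componentwise using D(1) character_continuous
    by (auto intro!: continuous_map_eq[OF character_continuous])
  have hausP: "Hausdorff_space ?P" by (simp add: Hausdorff_space_product_topology)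
  let ?Q = "subtopology ?P (e ` ?N)"
  have topQ: "topspace ?Q = e ` ?N" by (auto simp: e_def)
  have hm: "homeomorphic_map ?S ?Q e"
  proof (rule continuous_imp_homeomorphic_map)
    show "continuous_map ?S ?Q e"
      unfolding continuous_map_in_subtopology using continuous_map_from_subtopology[OF eT] top by auto
    show "compact_space ?S" by (rule topological_group_closed_subgroup(2)[OF subgroup_annihilator[OF E] closedin_annihilator[OF E]])
    show "Hausdorff_space ?Q" by (rule Hausdorff_space_subtopology[OF hausP])
    show "e ` topspace ?S = topspace ?Q" unfolding top topQ ..
    show "inj_on e (topspace ?S)"
      unfolding top
    proof (rule inj_onI)
      fix x y assume xy: "x \<in> ?N" "y \<in> ?N" "e x = e y"
      then have "\<forall>\<xi>\<in>D. \<xi> x = \<xi> y" unfolding e_def by (metis restrict_apply')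
      then show "x = y" using sep xy by blast
    qed
  qed
  have "metrizable_space ?P"
    unfolding metrizable_space_product_topology using D(2)
    by (intro disjI2 conjI) (auto intro: countable_subset[of _ D] metrizable_space_euclidean)
  then have "metrizable_space ?Q" by (rule metrizable_space_subtopology)
  then show "metrizable_space ?S"
    using homeomorphic_metrizable_space homeomorphic_map_imp_homeomorphic_space[OF hm] by blast
  fix h assume h: "\<And>x. x \<in> carrier G \<Longrightarrow> h x \<in> ?N \<and> (\<forall>\<xi>\<in>D. \<xi> (h x) = \<xi> x)"
  obtain g where g: "homeomorphic_maps ?S ?Q e g" using hm homeomorphic_map_maps by blast
  have eh: "e x = e (h x)" if "x \<in> carrier G" for x
    unfolding e_def by (rule restrict_ext) (use h[OF that] in metis)
  have "continuous_map T ?Q e"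
    unfolding continuous_map_in_subtopology using eT eh h by auto
  moreover have "continuous_map ?Q ?S g" using g by (simp add: homeomorphic_maps_def)
  ultimately have "continuous_map T ?S (g \<circ> e)" by (rule continuous_map_compose)
  then show "continuous_map T ?S h"
  proof (rule continuous_map_eq)
    fix x assume "x \<in> topspace T"
    then have x: "x \<in> carrier G" by simp
    have "h x \<in> topspace ?S" unfolding top using h[OF x] by blast
    then have "g (e (h x)) = h x" using g by (simp add: homeomorphic_maps_def)
    then show "(g \<circ> e) x = h x" using eh[OF x] by simp
  qed
qed

text \<open>
  The factors are the annihilators \<open>M D\<close> of the sums of all summands other than \<open>D\<close>, with the
  projections \<open>P D\<close> as coordinates. Injectivity holds since the summands generate the dual and
  characters separate points. For surjectivity, finitely many prescribed coordinates are
  realized by a product of group elements, and compactness takes care of all of them at once.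
\<close>

theorem product_of_metrizable_groups:
  assumes dec: "countably_decomposable dual (carrier dual)"
  shows "\<exists>(I :: 'a set) N f. (\<forall>i\<in>I. subgroup (N i) G \<and> closedin T (N i) \<and> metrizable_space (subtopology T (N i))) \<and>
    topological_group_iso G T (product_group I (\<lambda>i. G\<lparr>carrier := N i\<rparr>)) (product_topology (\<lambda>i. subtopology T (N i)) I) f"
proof -
  interpret dual: comm_group dual by (rule comm_group_dual)
  from dec[unfolded countably_decomposable_def] obtain \<D> where
    D0: "(\<forall>D\<in>\<D>. subgroup D dual \<and> countable D) \<and> independent_family dual \<D> \<and> carrier dual = generate dual (\<Union>\<D>)"
    by (rule exE)
  then have D: "\<And>D. D \<in> \<D> \<Longrightarrow> subgroup D dual" "\<And>D. D \<in> \<D> \<Longrightarrow> countable D"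
    and ind: "independent_family dual \<D>" and gen: "characters = generate dual (\<Union>\<D>)" by simp_all
  have Dc: "D \<subseteq> characters" if "D \<in> \<D>" for D using subgroup.subset[OF D(1)[OF that]] by simp
  then have Uc: "\<Union>\<B> \<subseteq> characters" if "\<B> \<subseteq> \<D>" for \<B> using that by blast
  define E where "E = (\<lambda>D. generate dual (\<Union>(\<D> - {D})))"
  have sgE: "subgroup (E D) dual" for D
    unfolding E_def by (rule dual.generate_is_subgroup) (use Uc[of "\<D> - {D}"] in auto)
  have Ec: "E D \<subseteq> characters" for D using subgroup.subset[OF sgE] by simp
  have split: "D \<inter> E D \<subseteq> {\<one>\<^bsub>dual\<^esub>}" "\<And>\<xi>. \<xi> \<in> characters \<Longrightarrow> \<exists>\<delta>\<in>D. \<exists>\<epsilon>\<in>E D. \<xi> = \<delta> \<otimes>\<^bsub>dual\<^esub> \<epsilon>"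
    if DD: "D \<in> \<D>" for D
  proof -
    have gD: "generate dual D = D"
      using dual.generate_subgroup_incl[OF subset_refl D(1)[OF DD]] generate.incl[of _ D dual] by blast
    have "generate dual (\<Union>{D}) \<inter> generate dual (\<Union>(\<D> - {D})) \<subseteq> {\<one>\<^bsub>dual\<^esub>}"
      using ind DD unfolding independent_family_def by blast
    then show "D \<inter> E D \<subseteq> {\<one>\<^bsub>dual\<^esub>}" by (simp add: gD E_def)
    fix \<xi> assume "\<xi> \<in> characters"
    moreover have "\<Union>\<D> = D \<union> \<Union>(\<D> - {D})" using DD by blast
    ultimately have "\<xi> \<in> generate dual (D \<union> \<Union>(\<D> - {D}))" using gen by simp
    then show "\<exists>\<delta>\<in>D. \<exists>\<epsilon>\<in>E D. \<xi> = \<delta> \<otimes>\<^bsub>dual\<^esub> \<epsilon>"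
      using dual.generate_Un[of D "\<Union>(\<D> - {D})" \<xi>] Dc[OF DD] Uc[of "\<D> - {D}"] by (simp add: gD E_def)
  qed
  define M where "M = (\<lambda>D. annihilator (E D))"
  have sgM: "subgroup (M D) G" and clM: "closedin T (M D)" for D
    unfolding M_def by (rule subgroup_annihilator[OF Ec] closedin_annihilator[OF Ec])+
  have Mc: "M D \<subseteq> carrier G" for D by (auto simp: M_def annihilator_def)
  have ex1: "\<exists>!y. y \<in> M D \<and> (\<forall>\<xi>\<in>D. \<xi> y = \<xi> x)" if "D \<in> \<D>" "x \<in> carrier G" for D x
    unfolding M_def by (rule dual_split_projection[OF D(1)[OF that(1)] sgE split[OF that(1)] that(2)])
  define P where "P = (\<lambda>D x. THE y. y \<in> M D \<and> (\<forall>\<xi>\<in>D. \<xi> y = \<xi> x))"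
  have P: "P D x \<in> M D \<and> (\<forall>\<xi>\<in>D. \<xi> (P D x) = \<xi> x)" if "D \<in> \<D>" "x \<in> carrier G" for D x
    unfolding P_def by (rule theI'[OF ex1[OF that]])
  have PU: "P D x = y" if "D \<in> \<D>" "x \<in> carrier G" "y \<in> M D" "\<And>\<xi>. \<xi> \<in> D \<Longrightarrow> \<xi> y = \<xi> x" for D x y
    unfolding P_def by (rule the1_equality[OF ex1[OF that(1,2)]]) (use that in blast)
  have sepM: "x = y" if "D \<in> \<D>" "x \<in> M D" "y \<in> M D" "\<forall>\<xi>\<in>D. \<xi> x = \<xi> y" for D x y
  proof -
    have x: "x \<in> carrier G" using that(2) Mc by blast
    have "P D x = x" by (rule PU[OF that(1) x that(2)]) simp
    moreover have "P D x = y" by (rule PU[OF that(1) x that(3)]) (rule bspec[OF that(4), symmetric])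
    ultimately show ?thesis by simp
  qed
  have metr: "metrizable_space (subtopology T (M D))"
    and Pcont: "continuous_map T (subtopology T (M D)) (P D)" if DD: "D \<in> \<D>" for D
  proof -
    have s: "\<And>x y. x \<in> annihilator (E D) \<Longrightarrow> y \<in> annihilator (E D) \<Longrightarrow> \<forall>\<xi>\<in>D. \<xi> x = \<xi> y \<Longrightarrow> x = y"
      using sepM[OF DD] unfolding M_def by blast
    show "metrizable_space (subtopology T (M D))"
      unfolding M_def by (rule annihilator_embedding(1)[OF Dc[OF DD] D(2)[OF DD] Ec s])
    show "continuous_map T (subtopology T (M D)) (P D)"
      unfolding M_def
      by (rule annihilator_embedding(2)[OF Dc[OF DD] D(2)[OF DD] Ec]) (erule (2) s, erule P[OF DD, unfolded M_def])
  qed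
  \<comment> \<open>The factors are to be indexed by elements of the group. Trivial summands are dropped; a nontrivial
    summand is represented by a nontrivial element of its factor, and distinct factors meet in \<open>\<one>\<close> only.\<close>
  define \<D>' where "\<D>' = {D \<in> \<D>. \<not> D \<subseteq> {\<one>\<^bsub>dual\<^esub>}}"
  have nontrivial: "\<exists>x. x \<in> M D \<and> x \<noteq> \<one>" if "D \<in> \<D>'" for D
  proof -
    have DD: "D \<in> \<D>" using that by (simp add: \<D>'_def)
    have "\<not> D \<subseteq> {\<lambda>x. 1}" using that by (simp add: \<D>'_def)
    then obtain \<xi> where \<xi>: "\<xi> \<in> D" "\<xi> \<noteq> (\<lambda>x. 1)" by blast
    then have \<xi>c: "\<xi> \<in> characters" using Dc[OF DD] by blast
    obtain x where "\<xi> x \<noteq> 1" using \<xi>(2) by auto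
    then have x: "x \<in> carrier G" "\<xi> x \<noteq> 1" using character_off[OF \<xi>c] by blast+
    then have "\<xi> (P D x) \<noteq> 1" "P D x \<in> M D" using P[OF DD x(1)] \<xi>(1) by auto
    then show ?thesis using character_one[OF \<xi>c] by (intro exI[of _ "P D x"]) auto
  qed
  then obtain \<iota> where \<iota>: "\<And>D. D \<in> \<D>' \<Longrightarrow> \<iota> D \<in> M D" "\<And>D. D \<in> \<D>' \<Longrightarrow> \<iota> D \<noteq> \<one>" by metis
  have other: "\<xi> x = 1" if "x \<in> M D" "D' \<in> \<D>" "D' \<noteq> D" "\<xi> \<in> D'" for x D D' \<xi>
  proof -
    have "\<xi> \<in> E D" unfolding E_def by (rule generate.incl) (use that in blast)
    then show ?thesis using that(1) by (simp add: M_def annihilator_def)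
  qed
  have disjM: "D = D'" if "D \<in> \<D>" "D' \<in> \<D>" "x \<in> M D" "x \<in> M D'" "x \<noteq> \<one>" for D D' x
  proof (rule ccontr)
    assume ne: "D \<noteq> D'"
    have x: "x \<in> carrier G" using that(3) Mc by blast
    have "\<xi> x = \<xi> \<one>" if \<xi>: "\<xi> \<in> D''" "D'' \<in> \<D>" for \<xi> D''
    proof -
      have "\<xi> x = 1" using other[OF \<open>x \<in> M D\<close> \<xi>(2) _ \<xi>(1)] other[OF \<open>x \<in> M D'\<close> \<xi>(2) _ \<xi>(1)] ne by blast
      then show ?thesis using character_one Dc \<xi> by (metis subsetD)
    qed
    then have "\<xi> x = \<xi> \<one>" if "\<xi> \<in> characters" for \<xi>
      using agree_on_generated[OF x one_closed Uc[OF subset_refl]] that gen by blast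
    then show False using eq_if_characters_agree[OF x one_closed] \<open>x \<noteq> \<one>\<close> by blast
  qed
  have inj: "inj_on \<iota> \<D>'"
  proof (rule inj_onI)
    fix D D' assume DD: "D \<in> \<D>'" "D' \<in> \<D>'" "\<iota> D = \<iota> D'"
    have "D \<in> \<D>" "D' \<in> \<D>" using DD by (auto simp: \<D>'_def)
    then show "D = D'" using disjM[of D D' "\<iota> D"] \<iota>(1)[OF DD(1)] \<iota>(1)[OF DD(2)] \<iota>(2)[OF DD(1)] DD(3) by simp
  qed
  define I where "I = \<iota> ` \<D>'"
  define d where "d = inv_into \<D>' \<iota>"
  have d: "d i \<in> \<D>" if "i \<in> I" for i
    using inv_into_into[of i \<iota> \<D>'] that unfolding d_def I_def by (auto simp: \<D>'_def)
  have d_surj: "\<exists>i\<in>I. d i = D" if "D \<in> \<D>'" for D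
    using that inj by (intro bexI[of _ "\<iota> D"]) (auto simp: d_def I_def)
  have d_inj: "i = j" if "i \<in> I" "j \<in> I" "d i = d j" for i j
    using that unfolding d_def I_def by (metis f_inv_into_f)
  define N where "N = (\<lambda>i. M (d i))"
  define f where "f = (\<lambda>x. \<lambda>i\<in>I. P (d i) x)"
  let ?H = "\<lambda>i. G\<lparr>carrier := N i\<rparr>" and ?S = "\<lambda>i. subtopology T (N i)"
  have topS: "topspace (?S i) = N i" for i using Mc[of "d i"] by (simp add: N_def Int_absorb1)
  have f_mem: "f x \<in> (\<Pi>\<^sub>E i\<in>I. N i)" if "x \<in> carrier G" for x
    using P[OF d that] by (auto simp: f_def N_def)
  have agree: "x = y" if x: "x \<in> carrier G" and y: "y \<in> carrier G" and eq: "\<And>i \<xi>. i \<in> I \<Longrightarrow> \<xi> \<in> d i \<Longrightarrow> \<xi> x = \<xi> y" for x y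
  proof (rule eq_if_characters_agree[OF x y])
    fix \<xi> assume "\<xi> \<in> characters"
    then have "\<xi> \<in> generate dual (\<Union>\<D>)" using gen by simp
    then show "\<xi> x = \<xi> y"
    proof (rule agree_on_generated[OF x y Uc[OF subset_refl], rotated])
      fix \<zeta> assume "\<zeta> \<in> \<Union>\<D>"
      then obtain D where DD: "D \<in> \<D>" "\<zeta> \<in> D" by blast
      show "\<zeta> x = \<zeta> y"
      proof (cases "D \<in> \<D>'")
        case True
        then obtain i where "i \<in> I" "d i = D" using d_surj by blast
        then show ?thesis using eq DD(2) by blast
      next
        case False
        then have "\<zeta> = (\<lambda>x. 1)" using DD by (auto simp: \<D>'_def)
        then show ?thesis by simp
      qed
    qed
  qed
  have inj_f: "inj_on f (carrier G)"
  proof (rule inj_onI)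
    fix x y assume xy: "x \<in> carrier G" "y \<in> carrier G" "f x = f y"
    show "x = y"
    proof (rule agree[OF xy(1,2)])
      fix i \<xi> assume i: "i \<in> I" "\<xi> \<in> d i"
      then have "P (d i) x = P (d i) y" using xy(3) unfolding f_def by (metis restrict_apply')
      then show "\<xi> x = \<xi> y" using P[OF d[OF i(1)] xy(1)] P[OF d[OF i(1)] xy(2)] i(2) by metis
    qed
  qed
  have surj_f: "f ` carrier G = (\<Pi>\<^sub>E i\<in>I. N i)"
  proof
    show "f ` carrier G \<subseteq> (\<Pi>\<^sub>E i\<in>I. N i)" using f_mem by blast
    show "(\<Pi>\<^sub>E i\<in>I. N i) \<subseteq> f ` carrier G"
    proof
      fix n assume n: "n \<in> (\<Pi>\<^sub>E i\<in>I. N i)"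
      have nM: "n i \<in> M (d i)" if "i \<in> I" for i using n that by (auto simp: N_def)
      have nc: "n i \<in> carrier G" if "i \<in> I" for i using nM[OF that] Mc by blast
      define C where "C = (\<lambda>i. {x \<in> carrier G. \<forall>\<xi>\<in>d i. \<xi> x = \<xi> (n i)})"
      have clC: "closedin T (C i)" if i: "i \<in> I" for i
        unfolding C_def by (rule closedin_character_values[OF Dc[OF d[OF i]]])
      have fin: "\<exists>x\<in>carrier G. (\<forall>i\<in>F. \<forall>\<xi>\<in>d i. \<xi> x = \<xi> (n i)) \<and> (\<forall>i\<in>I - F. \<forall>\<xi>\<in>d i. \<xi> x = 1)"
        if "finite F" "F \<subseteq> I" for F
        using that
      proof (induction F)
        case empty
        have "\<xi> \<one> = 1" if "i \<in> I" "\<xi> \<in> d i" for i \<xi> using Dc[OF d[OF that(1)]] that(2) character_one by blast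
        then show ?case by (intro bexI[of _ \<one>]) auto
      next
        case (insert j F)
        then obtain x where x: "x \<in> carrier G" "\<And>i \<xi>. i \<in> F \<Longrightarrow> \<xi> \<in> d i \<Longrightarrow> \<xi> x = \<xi> (n i)"
          "\<And>i \<xi>. i \<in> I - F \<Longrightarrow> \<xi> \<in> d i \<Longrightarrow> \<xi> x = 1" by auto
        have j: "j \<in> I" using insert by simp
        have m: "\<xi> (x \<otimes> n j) = \<xi> x * \<xi> (n j)" if "i \<in> I" "\<xi> \<in> d i" for i \<xi>
          using Dc[OF d[OF that(1)]] that(2) by (intro character_mult x(1) nc[OF j]) blast
        have o: "\<xi> (n j) = 1" if "i \<in> I" "\<xi> \<in> d i" "i \<noteq> j" for i \<xi>
          using other[OF nM[OF j] d[OF that(1)] _ that(2)] d_inj[OF that(1) j] that(3) by blast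
        show ?case
        proof (intro bexI[of _ "x \<otimes> n j"] conjI ballI)
          fix i \<xi> assume i: "i \<in> insert j F" "\<xi> \<in> d i"
          then have iI: "i \<in> I" using insert.prems by blast
          show "\<xi> (x \<otimes> n j) = \<xi> (n i)"
          proof (cases "i = j")
            case True
            then have "\<xi> x = 1" using x(3)[of j \<xi>] i(2) insert.hyps(2) j by blast
            then show ?thesis using m[OF iI i(2)] True by simp
          next
            case False
            then show ?thesis using m[OF iI i(2)] o[OF iI i(2)] x(2)[of i \<xi>] i by simp
          qed
        next
          fix i \<xi> assume i: "i \<in> I - insert j F" "\<xi> \<in> d i"
          then show "\<xi> (x \<otimes> n j) = 1" using m[of i \<xi>] o[of i \<xi>] x(3)[of i \<xi>] by simp
        qed (use x(1) nc[OF j] in simp)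
      qed
      have "topspace T \<inter> \<Inter>(C ` I) \<noteq> {}"
      proof (rule compact[unfolded compact_space_def compactin_fip, THEN conjunct2, rule_format], intro conjI)
        show "\<forall>C\<in>C ` I. closedin T C" using clC by blast
        show "\<forall>\<F>. finite \<F> \<and> \<F> \<subseteq> C ` I \<longrightarrow> topspace T \<inter> \<Inter>\<F> \<noteq> {}"
        proof (intro allI impI)
          fix \<F> assume "finite \<F> \<and> \<F> \<subseteq> C ` I"
          then obtain F where F: "finite F" "F \<subseteq> I" "\<F> = C ` F" by (meson finite_subset_image)
          from fin[OF F(1,2)] obtain x where "x \<in> carrier G" "\<forall>i\<in>F. \<forall>\<xi>\<in>d i. \<xi> x = \<xi> (n i)" by blast
          then have "x \<in> topspace T \<inter> \<Inter>\<F>" unfolding F(3) by (auto simp: C_def)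
          then show "topspace T \<inter> \<Inter>\<F> \<noteq> {}" by blast
        qed
      qed
      then obtain x where x: "x \<in> carrier G" "\<And>i. i \<in> I \<Longrightarrow> x \<in> C i" by auto
      have "f x = n"
      proof (rule PiE_ext[OF f_mem[OF x(1)] n])
        fix i assume i: "i \<in> I"
        have same: "\<forall>\<xi>\<in>d i. \<xi> x = \<xi> (n i)" using x(2)[OF i] by (simp add: C_def)
        have "P (d i) x = n i"
          by (rule PU[OF d[OF i] x(1) nM[OF i]]) (rule bspec[OF same, symmetric])
        then show "f x i = n i" using i by (simp add: f_def)
      qed
      then show "n \<in> f ` carrier G" using x(1) by blast
    qed
  qed
  have hom_f: "f \<in> hom G (product_group I ?H)"
  proof (rule homI)
    fix x assume x: "x \<in> carrier G"
    show "f x \<in> carrier (product_group I ?H)" using f_mem[OF x] by simp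
    fix y assume y: "y \<in> carrier G"
    have "P (d i) (x \<otimes> y) = P (d i) x \<otimes> P (d i) y" if i: "i \<in> I" for i
    proof (rule PU[OF d[OF i]])
      note px = P[OF d[OF i] x] and py = P[OF d[OF i] y]
      show "x \<otimes> y \<in> carrier G" using x y by simp
      show "P (d i) x \<otimes> P (d i) y \<in> M (d i)" using px py subgroup.m_closed[OF sgM] by blast
      fix \<xi> assume \<xi>: "\<xi> \<in> d i"
      then have \<xi>c: "\<xi> \<in> characters" using Dc[OF d[OF i]] by blast
      have "P (d i) x \<in> carrier G" "P (d i) y \<in> carrier G" using px py Mc by blast+
      moreover have "\<xi> (P (d i) x) = \<xi> x" "\<xi> (P (d i) y) = \<xi> y" using px py \<xi> by blast+
      ultimately show "\<xi> (P (d i) x \<otimes> P (d i) y) = \<xi> (x \<otimes> y)"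
        using x y by (simp add: character_mult[OF \<xi>c])
    qed
    then show "f (x \<otimes> y) = f x \<otimes>\<^bsub>product_group I ?H\<^esub> f y" by (auto simp: f_def)
  qed
  have iso: "f \<in> iso G (product_group I ?H)"
    using hom_f inj_f surj_f by (simp add: iso_def bij_betw_def)
  have homeo: "homeomorphic_map T (product_topology ?S I) f"
  proof (rule continuous_imp_homeomorphic_map[OF _ compact])
    show "continuous_map T (product_topology ?S I) f"
      unfolding continuous_map_componentwise
    proof (intro conjI ballI)
      show "f ` topspace T \<subseteq> extensional I" by (auto simp: f_def)
      fix i assume i: "i \<in> I"
      show "continuous_map T (?S i) (\<lambda>x. f x i)"
        using Pcont[OF d[OF i]] i by (simp add: f_def N_def)
    qed
    show "Hausdorff_space (product_topology ?S I)"
      using Hausdorff_space_subtopology[OF Hausdorff] by (simp add: Hausdorff_space_product_topology)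
    show "f ` topspace T = topspace (product_topology ?S I)" using surj_f by (simp add: topS del: topspace_subtopology)
    show "inj_on f (topspace T)" using inj_f by simp
  qed
  have "\<forall>i\<in>I. subgroup (N i) G \<and> closedin T (N i) \<and> metrizable_space (subtopology T (N i))"
    unfolding N_def using sgM clM metr[OF d] by blast
  with iso homeo show ?thesis unfolding topological_group_iso_def by blast
qed

end

theorem theorem3p4:
  fixes G :: "'g monoid" and T :: "'g topology" and X :: "'u topology"
  assumes "comm_group G"
    and "topological_group G T"
    and "compact_space T"
    and "connected_space T"
    and "class_R TYPE('i) X"
    and "\<exists>f. retraction_map X T f"
  shows "\<exists>(I :: 'g set) (H :: 'g \<Rightarrow> 'g monoid) S f.
           (\<forall>i\<in>I. topological_group (H i) (S i) \<and> compact_space (S i) \<and> metrizable_space (S i)) \<and>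
           topological_group_iso G T (product_group I H) (product_topology S I) f"
proof -
  interpret compact_abelian_group G T
    using assms(1-3) by (simp add: compact_abelian_group_def compact_abelian_group_axioms_def)
  obtain r where "retraction_map X T r" using assms(6) by blast
  from product_of_metrizable_groups[OF dual_countably_decomposable[OF assms(4,5) this]]
  obtain I :: "'g set" and N f where
    N: "\<forall>i\<in>I. subgroup (N i) G \<and> closedin T (N i) \<and> metrizable_space (subtopology T (N i))"
    and iso: "topological_group_iso G T (product_group I (\<lambda>i. G\<lparr>carrier := N i\<rparr>))
      (product_topology (\<lambda>i. subtopology T (N i)) I) f" by blast
  show ?thesis
  proof (rule exI[of _ I], rule exI[of _ "\<lambda>i. G\<lparr>carrier := N i\<rparr>"],
      rule exI[of _ "\<lambda>i. subtopology T (N i)"], rule exI[of _ f], intro conjI ballI iso)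
    fix i assume "i \<in> I"
    with N have i: "subgroup (N i) G" "closedin T (N i)" "metrizable_space (subtopology T (N i))" by blast+
    show "topological_group (G\<lparr>carrier := N i\<rparr>) (subtopology T (N i))" "compact_space (subtopology T (N i))"
      by (rule topological_group_closed_subgroup[OF i(1,2)])+
    show "metrizable_space (subtopology T (N i))" by (rule i(3))
  qed
qed

end
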